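(* Let $G$ be a Weyl group of exceptional type, i.e. one of $W(E_6),W(E_7),W(E_8),W(F_4),W(G_2)$, and let $\mathfrak{B}(G,r,\overrightarrow\rho,u)$ be a central quantum linear space over $G$ (with $r\neq 0$). Then one of the following holds: (i) $G=W(E_7)$, $r=r_CC$ with $C=\{z\}$, where $z$ is the unique nontrivial central element of $W(E_7)$, and for every $i\in I_C(r,u)$ the character $\chi_C^{(i)}$ is one of the $30$ irreducible characters $\chi$ of $W(E_7)$ with $\chi(z)=-\chi(1)$; (ii) $G=W(E_8)$, $r=r_CC$ with $C=\{z\}$, where $z$ is the unique nontrivial central element of $W(E_8)$, and for every $i\in I_C(r,u)$ the character $\chi_C^{(i)}$ is one of the $45$ irreducible characters $\chi$ of $W(E_8)$ with $\chi(z)=-\chi(1)$; (iii) $G=W(F_4)$, $r=r_CC$ with $C=\{z\}$, where $z$ is the unique nontrivial central element of $W(F_4)$, and for every $i\in I_C(r,u)$ the character $\chi_C^{(i)}$ is one of the $9$ irreducible characters $\chi$ of $W(F_4)$ with $\chi(z)=-\chi(1)$; (iv) $G=W(G_2)$, $r=r_CC$ with $C=\{z\}$, where $z$ is the unique nontrivial central element of $W(G_2)$, and for every $i\in I_C(r,u)$ the character $\chi_C^{(i)}$ is one of the $3$ irreducible characters $\chi$ of $W(G_2)$ with $\chi(z)=-\chi(1)$.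
   Context: $k=\mathbb{C}$; $Z(G)$ is the center of $G$; $G^s$ is the centralizer of $s$; ${\mathcal K}(G)$ is the set of conjugacy classes. A ramification is a formal sum $r=\sum_{C\in{\mathcal K}(G)}r_CC$ with cardinal coefficients; ${\mathcal K}_r(G)=\{C:r_C\ne0\}$. An ${\rm RSR}(G,r,\overrightarrow\rho,u)$ consists of a ramification $r$, a map $u:{\mathcal K}(G)\to G$ with $u(C)\in C$, and for each $C\in{\mathcal K}_r(G)$ a finite nonempty index set $I_C(r,u)$ and irreducible representations $\rho_C^{(i)}$ ($i\in I_C(r,u)$) of $G^{u(C)}$ with characters $\chi_C^{(i)}$, written as right actions on spaces $X_C^{(i)}$ with bases $\{x_C^{(i,j)}\mid j\in J_C(i)\}$, $|J_C(i)|=\deg\rho_C^{(i)}$, $r_C=\sum_i\deg\rho_C^{(i)}$. Fix $G=\bigcup_{\theta\in\Theta_C}G^{u(C)}g_\theta$. The arrow YD module $kQ_1^1$ over $kG$ has basis $a_{x,1}^{(i,j)}$ ($x\in C\in{\mathcal K}_r(G)$, $i\in I_C(r,u)$, $j\in J_C(i)$), coaction $\delta^-(a_{x,1}^{(i,j)})=x\otimes a_{x,1}^{(i,j)}$ and action $h\rhd a_{x,1}^{(i,j)}=\sum_pk_pa_{hxh^{-1},1}^{(i,p)}$, where $x=g_\theta^{-1}u(C)g_\theta$, $g_\theta h^{-1}=\zeta_\theta(h^{-1})g_{\theta'}$, $\zeta_\theta(h^{-1})\in G^{u(C)}$, $x_C^{(i,j)}\cdot\zeta_\theta(h^{-1})=\sum_pk_px_C^{(i,p)}$.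 $\mathfrak{B}(G,r,\overrightarrow\rho,u)$ is its Nichols algebra. For $C\in{\mathcal K}_r(G)$, $i\in I_C(r,u)$, let $M_C^{(i)}$ be the YD submodule spanned by the $a_{x,1}^{(i,j)}$, $x\in C$, $j\in J_C(i)$, and $\mathfrak{B}({\mathcal O}_{u(C)},\rho_C^{(i)})$ its Nichols algebra. Let $\sigma$ be the braiding of ${}^{kG}_{kG}{\mathcal{YD}}$ and $\sigma_{C^{(i)},D^{(j)}}=\sigma_{M_C^{(i)},M_D^{(j)}}$. The RSR is quantum symmetric if $\sigma_{C^{(i)},D^{(j)}}=(\sigma_{D^{(j)},C^{(i)}})^{-1}$ for all $C,D\in{\mathcal K}_r(G)$, $i\in I_C(r,u)$, $j\in I_D(r,u)$. It is of non-essentially infinite type if $\dim\mathfrak{B}({\mathcal O}_{u(C)},\rho_C^{(i)})<\infty$ for all $C\in{\mathcal K}_r(G)$, $i\in I_C(r,u)$. It is of central quantum linear type if it is quantum symmetric, of non-essentially infinite type, and $C\subseteq Z(G)$ for all $C\in{\mathcal K}_r(G)$; in this case $\mathfrak{B}(G,r,\overrightarrow\rho,u)$ is called a central quantum linear space over $G$. (For central $C=\{z\}$ one has $G^{u(C)}=G$.) *)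

theory Defs
  imports
    Complex_Main
    "HOL-Algebra.Generated_Groups"
    "HOL-Algebra.QuotRing"
    "HOL-Library.Function_Algebras"
    "Jordan_Normal_Form.Matrix"
begin

section \<open>Groups\<close>

definition center :: "('g, 'm) monoid_scheme \<Rightarrow> 'g set" where
  "center G = {z \<in> carrier G. \<forall>g \<in> carrier G. z \<otimes>\<^bsub>G\<^esub> g = g \<otimes>\<^bsub>G\<^esub> z}"

definition centralizer :: "('g, 'm) monoid_scheme \<Rightarrow> 'g \<Rightarrow> 'g set" where
  "centralizer G s = {g \<in> carrier G. g \<otimes>\<^bsub>G\<^esub> s = s \<otimes>\<^bsub>G\<^esub> g}"

definition centralizer_group :: "'g monoid \<Rightarrow> 'g \<Rightarrow> 'g monoid" where
  "centralizer_group G s = G\<lparr>carrier := centralizer G s\<rparr>"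

definition conj_class :: "('g, 'm) monoid_scheme \<Rightarrow> 'g \<Rightarrow> 'g set" where
  "conj_class G x = (\<lambda>g. g \<otimes>\<^bsub>G\<^esub> x \<otimes>\<^bsub>G\<^esub> inv\<^bsub>G\<^esub> g) ` carrier G"

definition conj_classes :: "('g, 'm) monoid_scheme \<Rightarrow> 'g set set" where
  "conj_classes G = conj_class G ` carrier G"


section \<open>Weyl groups\<close>

text \<open>For an \<open>n \<times> n\<close> Cartan matrix \<open>A\<close>, the simple reflection \<open>s\<^sub>i\<close> of the root lattice is
  \<open>s\<^sub>i(\<alpha>\<^sub>j) = \<alpha>\<^sub>j - A\<^sub>i\<^sub>j \<alpha>\<^sub>i\<close>; below is its matrix in the basis of simple roots (images in
  columns). The Weyl group is the subgroup of \<open>GL\<^sub>n(\<int>)\<close> generated by the simple reflections.\<close>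

definition simple_reflection :: "int mat \<Rightarrow> nat \<Rightarrow> int mat" where
  "simple_reflection A i =
     mat (dim_row A) (dim_row A) (\<lambda>(k, j). of_bool (k = j) - of_bool (k = i) * A $$ (i, j))"

definition weyl_group :: "int mat \<Rightarrow> int mat monoid" where
  "weyl_group A =
     (let GL = units_of (ring_mat TYPE(int) (dim_row A) ())
      in GL\<lparr>carrier := generate GL (simple_reflection A ` {..<dim_row A})\<rparr>)"

text \<open>Simple roots are numbered as in Bourbaki, shifted to start from \<open>0\<close>: the diagram of type
  \<open>E\<^sub>n\<close> (\<open>n = 6, 7, 8\<close>) is the chain \<open>0, 2, 3, \<dots>, n - 1\<close> with \<open>1\<close> attached to \<open>3\<close>.\<close>

definition cartan_E :: "nat \<Rightarrow> int mat" where
  "cartan_E n = mat n n (\<lambda>(i, j).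
     if i = j then 2
     else if {i, j} \<in> {{0, 2}, {1, 3}, {2, 3}, {3, 4}, {4, 5}, {5, 6}, {6, 7}} then - 1
     else 0)"

definition cartan_F4 :: "int mat" where
  "cartan_F4 = mat_of_rows_list 4
     [[ 2, - 1,   0,   0],
      [- 1,  2, - 2,   0],
      [ 0, - 1,   2, - 1],
      [ 0,   0, - 1,   2]]"

definition cartan_G2 :: "int mat" where
  "cartan_G2 = mat_of_rows_list 2
     [[ 2, - 1],
      [- 3,  2]]"


section \<open>Complex representations, written as right actions\<close>

text \<open>Representation spaces are subspaces of an ambient complex vector space
  (\<open>vector_space scale\<close> is required wherever these notions are used).\<close>

definition right_rep ::
  "(complex \<Rightarrow> 'v::ab_group_add \<Rightarrow> 'v) \<Rightarrow> 'g monoid \<Rightarrow> 'v set \<Rightarrow> ('v \<Rightarrow> 'g \<Rightarrow> 'v) \<Rightarrow> bool" where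
  "right_rep scale H E act \<longleftrightarrow>
     Modules.module.subspace scale E \<and>
     (\<forall>x\<in>E. \<forall>h\<in>carrier H. act x h \<in> E) \<and>
     (\<forall>x\<in>E. \<forall>y\<in>E. \<forall>h\<in>carrier H. act (x + y) h = act x h + act y h) \<and>
     (\<forall>c. \<forall>x\<in>E. \<forall>h\<in>carrier H. act (scale c x) h = scale c (act x h)) \<and>
     (\<forall>x\<in>E. act x \<one>\<^bsub>H\<^esub> = x) \<and>
     (\<forall>x\<in>E. \<forall>g\<in>carrier H. \<forall>h\<in>carrier H. act x (g \<otimes>\<^bsub>H\<^esub> h) = act (act x g) h)"

definition irreducible_rep ::
  "(complex \<Rightarrow> 'v::ab_group_add \<Rightarrow> 'v) \<Rightarrow> 'g monoid \<Rightarrow> 'v set \<Rightarrow> ('v \<Rightarrow> 'g \<Rightarrow> 'v) \<Rightarrow> bool" where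
  "irreducible_rep scale H E act \<longleftrightarrow>
     right_rep scale H E act \<and> E \<noteq> {0} \<and>
     (\<forall>W. Modules.module.subspace scale W \<and> W \<subseteq> E \<and> (\<forall>w\<in>W. \<forall>h\<in>carrier H. act w h \<in> W)
        \<longrightarrow> W = {0} \<or> W = E)"

definition is_basis ::
  "(complex \<Rightarrow> 'v::ab_group_add \<Rightarrow> 'v) \<Rightarrow> 'v set \<Rightarrow> 'v set \<Rightarrow> bool" where
  "is_basis scale E B \<longleftrightarrow>
     finite B \<and> \<not> Modules.module.dependent scale B \<and> Modules.module.span scale B = E"

text \<open>The character of a representation, i.e. its trace, computed in a basis \<open>B\<close>.\<close>

definition rep_character ::
  "(complex \<Rightarrow> 'v::ab_group_add \<Rightarrow> 'v) \<Rightarrow> 'g monoid \<Rightarrow> 'v set \<Rightarrow> ('v \<Rightarrow> 'g \<Rightarrow> 'v)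
     \<Rightarrow> 'g \<Rightarrow> complex" where
  "rep_character scale H B act =
     (\<lambda>h\<in>carrier H. \<Sum>b\<in>B. Modules.module.representation scale B (act b h) b)"

text \<open>The ambient space \<open>\<nat> \<rightarrow> \<complex>\<close> contains a copy of every finite-dimensional complex
  space, so that the following are all irreducible (finite-dimensional) characters of \<open>H\<close>.\<close>

definition irr_chars :: "'g monoid \<Rightarrow> ('g \<Rightarrow> complex) set" where
  "irr_chars H =
     (let scale = (\<lambda>c (v :: nat \<Rightarrow> complex) n. c * v n)
      in {\<chi>. \<exists>E B act. irreducible_rep scale H E act \<and> is_basis scale E B \<and>
            \<chi> = rep_character scale H B act})"

definition odd_irr_chars :: "'g monoid \<Rightarrow> 'g \<Rightarrow> ('g \<Rightarrow> complex) set" where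
  "odd_irr_chars H z = {\<chi> \<in> irr_chars H. \<chi> z = - \<chi> \<one>\<^bsub>H\<^esub>}"


section \<open>Yetter-Drinfeld modules over a group algebra\<close>

text \<open>A finite-dimensional Yetter-Drinfeld module over \<open>kG\<close> is a \<open>G\<close>-graded space, hence has a
  finite homogeneous basis; it is given by such a basis, with coaction \<open>\<delta>(b) = deg b \<otimes> b\<close> and
  action \<open>h \<rhd> b = \<Sum>\<^sub>p coef h b p \<sqdot> p\<close>, the sum being over the basis elements \<open>p\<close>
  (values of \<open>coef\<close> off the basis are irrelevant).\<close>

record ('g, 'b) yd_module =
  bas :: "'b set"
  deg :: "'b \<Rightarrow> 'g"
  coef :: "'g \<Rightarrow> 'b \<Rightarrow> 'b \<Rightarrow> complex"

definition yd_tensor :: "('g, 'b) yd_module \<Rightarrow> ('g, 'b) yd_module \<Rightarrow> ('b \<times> 'b \<Rightarrow> complex) set" where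
  "yd_tensor M N = {t. finite {x. t x \<noteq> 0} \<and> {x. t x \<noteq> 0} \<subseteq> bas M \<times> bas N}"

text \<open>\<open>\<sigma>\<^sub>M\<^sub>,\<^sub>N : M \<otimes> N \<rightarrow> N \<otimes> M\<close>, \<open>a \<otimes> b \<mapsto> (deg a \<rhd> b) \<otimes> a\<close>.\<close>

definition yd_braiding ::
  "('g, 'b) yd_module \<Rightarrow> ('g, 'b) yd_module \<Rightarrow> ('b \<times> 'b \<Rightarrow> complex) \<Rightarrow> ('b \<times> 'b \<Rightarrow> complex)" where
  "yd_braiding M N t = (\<lambda>(q, a).
     if q \<in> bas N \<and> a \<in> bas M then \<Sum>b\<in>bas N. t (a, b) * coef N (deg M a) b q else 0)"


section \<open>Nichols algebras\<close>

text \<open>Elements of \<open>T(V)\<close> are finitely supported functions on words in the basis of \<open>V\<close>.\<close>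

definition tensor_algebra :: "('g, 'b) yd_module \<Rightarrow> ('b list \<Rightarrow> complex) ring" where
  "tensor_algebra V =
     \<lparr>carrier = {t. finite {w. t w \<noteq> 0} \<and> {w. t w \<noteq> 0} \<subseteq> lists (bas V)},
      monoid.mult = (\<lambda>s t w. \<Sum>k\<le>length w. s (take k w) * t (drop k w)),
      one = (\<lambda>w. of_bool (w = [])),
      zero = (\<lambda>w. 0),
      add = (\<lambda>s t w. s w + t w)\<rparr>"

text \<open>The coefficient of the word \<open>u\<close> in \<open>h \<rhd> u'\<close> under the diagonal action on \<open>T(V)\<close>.\<close>

definition word_coef :: "('g, 'b) yd_module \<Rightarrow> 'g \<Rightarrow> 'b list \<Rightarrow> 'b list \<Rightarrow> complex" where
  "word_coef V h u' u =
     (if u \<in> lists (bas V) \<and> length u' = length u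
      then \<Prod>k<length u. coef V h (u' ! k) (u ! k) else 0)"

text \<open>The coproduct is the algebra map \<open>T(V) \<rightarrow> T(V) \<otimes> T(V)\<close> with
  \<open>\<Delta>(b) = b \<otimes> 1 + 1 \<otimes> b\<close>, where the right-hand side carries the braided multiplication
  \<open>(x \<otimes> y)(x' \<otimes> y') = x (deg y \<rhd> x') \<otimes> y y'\<close>. On a word \<open>b w\<close> this amounts to
  \<open>\<Delta>(b w) = \<Sum> (b w\<^sub>1 \<otimes> w\<^sub>2 + (deg b \<rhd> w\<^sub>1) \<otimes> b w\<^sub>2)\<close> where \<open>\<Delta>(w) = \<Sum> w\<^sub>1 \<otimes> w\<^sub>2\<close>.
  The value at \<open>(u, v)\<close> is the coefficient of \<open>u \<otimes> v\<close>.\<close>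

primrec word_coproduct ::
  "('g, 'b) yd_module \<Rightarrow> 'b list \<Rightarrow> 'b list \<times> 'b list \<Rightarrow> complex" where
  "word_coproduct V [] = (\<lambda>(u, v). of_bool (u = [] \<and> v = []))"
| "word_coproduct V (b # w) = (\<lambda>(u, v).
     (case u of [] \<Rightarrow> 0 | a # u' \<Rightarrow> if a = b then word_coproduct V w (u', v) else 0) +
     (case v of [] \<Rightarrow> 0 | a # v' \<Rightarrow>
        if a = b
        then \<Sum>u' \<in> {u' \<in> lists (bas V). length u' = length u}.
               word_coef V (deg V b) u' u * word_coproduct V w (u', v')
        else 0))"

definition coproduct ::
  "('g, 'b) yd_module \<Rightarrow> ('b list \<Rightarrow> complex) \<Rightarrow> 'b list \<times> 'b list \<Rightarrow> complex" where
  "coproduct V t = (\<lambda>x. \<Sum>w | t w \<noteq> 0. t w * word_coproduct V w x)"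

text \<open>\<open>\<Delta>(I) \<subseteq> I \<otimes> T(V) + T(V) \<otimes> I\<close>.\<close>

definition is_coideal :: "('g, 'b) yd_module \<Rightarrow> ('b list \<Rightarrow> complex) set \<Rightarrow> bool" where
  "is_coideal V I \<longleftrightarrow> (\<forall>t\<in>I. \<exists>(n::nat) f g.
     (\<forall>k<n. (f k \<in> I \<and> g k \<in> carrier (tensor_algebra V)) \<or>
            (f k \<in> carrier (tensor_algebra V) \<and> g k \<in> I)) \<and>
     coproduct V t = (\<lambda>(u, v). \<Sum>k<n. f k u * g k v))"

definition is_homogeneous :: "('b list \<Rightarrow> complex) set \<Rightarrow> bool" where
  "is_homogeneous I \<longleftrightarrow> (\<forall>t\<in>I. \<forall>n. (\<lambda>w. if length w = n then t w else 0) \<in> I)"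

text \<open>The Nichols algebra is \<open>T(V) / I(V)\<close>, where \<open>I(V)\<close> is the sum of all homogeneous ideals
  of \<open>T(V)\<close> that are coideals and lie in degrees \<open>\<ge> 2\<close>.\<close>

definition nichols_ideal :: "('g, 'b) yd_module \<Rightarrow> ('b list \<Rightarrow> complex) set" where
  "nichols_ideal V = genideal (tensor_algebra V)
     (\<Union>{I. ideal I (tensor_algebra V) \<and> is_homogeneous I \<and> is_coideal V I \<and>
           (\<forall>t\<in>I. \<forall>w. t w \<noteq> 0 \<longrightarrow> 2 \<le> length w)})"

definition nichols_algebra :: "('g, 'b) yd_module \<Rightarrow> ('b list \<Rightarrow> complex) set ring" where
  "nichols_algebra V = tensor_algebra V Quot nichols_ideal V"

text \<open>\<open>dim \<BB>(V) < \<infinity>\<close>: the classes of finitely many elements of \<open>T(V)\<close> span \<open>\<BB>(V)\<close>.\<close>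

definition finite_dim_nichols :: "('g, 'b) yd_module \<Rightarrow> bool" where
  "finite_dim_nichols V \<longleftrightarrow>
     (\<exists>F. finite F \<and> F \<subseteq> carrier (tensor_algebra V) \<and>
        (\<forall>A \<in> carrier (nichols_algebra V). \<exists>c.
           A = nichols_ideal V +>\<^bsub>tensor_algebra V\<^esub> (\<lambda>w. \<Sum>t\<in>F. c t * t w)))"


section \<open>Ramification systems with irreducible representations\<close>

text \<open>The data of an RSR, together with representatives \<open>g\<^sub>\<theta>\<close> (\<open>\<theta> \<in> \<Theta>\<^sub>C\<close>) of the
  right cosets of \<open>G\<^sup>u\<^sup>(\<^sup>C\<^sup>)\<close>. The group is finite, so degrees of irreducible
  representations, and with them the coefficients \<open>r\<^sub>C = \<Sum>\<^sub>i deg \<rho>\<^sub>C\<^sup>(\<^sup>i\<^sup>)\<close>, are natural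
  numbers.\<close>

record ('g, 'v, 'i, 'j, 't) rsr =
  ram :: "'g set \<Rightarrow> nat"                           \<comment> \<open>\<open>r\<^sub>C\<close>\<close>
  pt :: "'g set \<Rightarrow> 'g"                             \<comment> \<open>\<open>u(C)\<close>\<close>
  idx :: "'g set \<Rightarrow> 'i set"                        \<comment> \<open>\<open>I\<^sub>C(r,u)\<close>\<close>
  spc :: "'g set \<Rightarrow> 'i \<Rightarrow> 'v set"                  \<comment> \<open>\<open>X\<^sub>C\<^sup>(\<^sup>i\<^sup>)\<close>\<close>
  ract :: "'g set \<Rightarrow> 'i \<Rightarrow> 'v \<Rightarrow> 'g \<Rightarrow> 'v"         \<comment> \<open>\<open>\<rho>\<^sub>C\<^sup>(\<^sup>i\<^sup>)\<close>\<close>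
  bidx :: "'g set \<Rightarrow> 'i \<Rightarrow> 'j set"                 \<comment> \<open>\<open>J\<^sub>C(i)\<close>\<close>
  bvec :: "'g set \<Rightarrow> 'i \<Rightarrow> 'j \<Rightarrow> 'v"               \<comment> \<open>\<open>x\<^sub>C\<^sup>(\<^sup>i\<^sup>,\<^sup>j\<^sup>)\<close>\<close>
  cidx :: "'g set \<Rightarrow> 't set"                       \<comment> \<open>\<open>\<Theta>\<^sub>C\<close>\<close>
  crep :: "'g set \<Rightarrow> 't \<Rightarrow> 'g"                     \<comment> \<open>\<open>g\<^sub>\<theta>\<close>\<close>

definition ram_support :: "'g monoid \<Rightarrow> ('g, 'v, 'i, 'j, 't) rsr \<Rightarrow> 'g set set" where
  "ram_support G R = {C \<in> conj_classes G. ram R C \<noteq> 0}"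

definition is_rsr ::
  "'g monoid \<Rightarrow> (complex \<Rightarrow> 'v::ab_group_add \<Rightarrow> 'v) \<Rightarrow> ('g, 'v, 'i, 'j, 't) rsr \<Rightarrow> bool" where
  "is_rsr G scale R \<longleftrightarrow>
     vector_space scale \<and>
     (\<forall>C \<in> conj_classes G. pt R C \<in> C) \<and>
     (\<forall>C \<in> ram_support G R.
        finite (idx R C) \<and> idx R C \<noteq> {} \<and>
        (\<forall>i \<in> idx R C.
           irreducible_rep scale (centralizer_group G (pt R C)) (spc R C i) (ract R C i) \<and>
           inj_on (bvec R C i) (bidx R C i) \<and>
           is_basis scale (spc R C i) (bvec R C i ` bidx R C i)) \<and>
        ram R C = (\<Sum>i\<in>idx R C. vector_space.dim scale (spc R C i)) \<and>
        (\<forall>\<theta> \<in> cidx R C. crep R C \<theta> \<in> carrier G) \<and>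
        (\<forall>g \<in> carrier G.
           \<exists>!\<theta>. \<theta> \<in> cidx R C \<and> g \<in> centralizer G (pt R C) #>\<^bsub>G\<^esub> crep R C \<theta>))"

definition rsr_character ::
  "'g monoid \<Rightarrow> (complex \<Rightarrow> 'v::ab_group_add \<Rightarrow> 'v) \<Rightarrow> ('g, 'v, 'i, 'j, 't) rsr
     \<Rightarrow> 'g set \<Rightarrow> 'i \<Rightarrow> 'g \<Rightarrow> complex" where
  "rsr_character G scale R C i =
     rep_character scale (centralizer_group G (pt R C)) (bvec R C i ` bidx R C i) (ract R C i)"

text \<open>The \<open>\<theta>\<close> with \<open>x = g\<^sub>\<theta>\<^sup>-\<^sup>1 u(C) g\<^sub>\<theta>\<close>, for \<open>x \<in> C\<close>.\<close>

definition rsr_theta :: "'g monoid \<Rightarrow> ('g, 'v, 'i, 'j, 't) rsr \<Rightarrow> 'g set \<Rightarrow> 'g \<Rightarrow> 't" where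
  "rsr_theta G R C x =
     (THE \<theta>. \<theta> \<in> cidx R C \<and> x = inv\<^bsub>G\<^esub> crep R C \<theta> \<otimes>\<^bsub>G\<^esub> pt R C \<otimes>\<^bsub>G\<^esub> crep R C \<theta>)"

text \<open>\<open>\<zeta>\<^sub>\<theta>(g) \<in> G\<^sup>u\<^sup>(\<^sup>C\<^sup>)\<close> with \<open>g\<^sub>\<theta> g = \<zeta>\<^sub>\<theta>(g) g\<^sub>\<theta>\<^sub>'\<close>.\<close>

definition rsr_zeta :: "'g monoid \<Rightarrow> ('g, 'v, 'i, 'j, 't) rsr \<Rightarrow> 'g set \<Rightarrow> 't \<Rightarrow> 'g \<Rightarrow> 'g" where
  "rsr_zeta G R C \<theta> g =
     (THE \<zeta>. \<zeta> \<in> centralizer G (pt R C) \<and>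
        (\<exists>\<theta>'\<in>cidx R C. crep R C \<theta> \<otimes>\<^bsub>G\<^esub> g = \<zeta> \<otimes>\<^bsub>G\<^esub> crep R C \<theta>'))"

text \<open>The arrow module \<open>kQ\<^sub>1\<^sup>1\<close>; the triple \<open>(x, i, j)\<close> stands for the basis element
  \<open>a\<^sub>x\<^sub>,\<^sub>1\<^sup>(\<^sup>i\<^sup>,\<^sup>j\<^sup>)\<close>.\<close>

definition arrow_module ::
  "'g monoid \<Rightarrow> (complex \<Rightarrow> 'v::ab_group_add \<Rightarrow> 'v) \<Rightarrow> ('g, 'v, 'i, 'j, 't) rsr
     \<Rightarrow> ('g, 'g \<times> 'i \<times> 'j) yd_module" where
  "arrow_module G scale R =
     \<lparr>bas = {(x, i, j). \<exists>C \<in> ram_support G R. x \<in> C \<and> i \<in> idx R C \<and> j \<in> bidx R C i},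
      deg = (\<lambda>(x, i, j). x),
      coef = (\<lambda>h (x, i, j) (y, i', p).
        if y = h \<otimes>\<^bsub>G\<^esub> x \<otimes>\<^bsub>G\<^esub> inv\<^bsub>G\<^esub> h \<and> i' = i
        then (let C = conj_class G x; \<theta> = rsr_theta G R C x
              in Modules.module.representation scale (bvec R C i ` bidx R C i)
                   (ract R C i (bvec R C i j) (rsr_zeta G R C \<theta> (inv\<^bsub>G\<^esub> h)))
                   (bvec R C i p))
        else 0)\<rparr>"

definition arrow_submodule ::
  "'g monoid \<Rightarrow> (complex \<Rightarrow> 'v::ab_group_add \<Rightarrow> 'v) \<Rightarrow> ('g, 'v, 'i, 'j, 't) rsr
     \<Rightarrow> 'g set \<Rightarrow> 'i \<Rightarrow> ('g, 'g \<times> 'i \<times> 'j) yd_module" where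
  "arrow_submodule G scale R C i =
     (arrow_module G scale R)\<lparr>bas := {(x, i', j). x \<in> C \<and> i' = i \<and> j \<in> bidx R C i}\<rparr>"

definition quantum_symmetric ::
  "'g monoid \<Rightarrow> (complex \<Rightarrow> 'v::ab_group_add \<Rightarrow> 'v) \<Rightarrow> ('g, 'v, 'i, 'j, 't) rsr \<Rightarrow> bool" where
  "quantum_symmetric G scale R \<longleftrightarrow>
     (\<forall>C \<in> ram_support G R. \<forall>D \<in> ram_support G R. \<forall>i \<in> idx R C. \<forall>j \<in> idx R D.
        let M = arrow_submodule G scale R C i; N = arrow_submodule G scale R D j
        in (\<forall>t \<in> yd_tensor M N. yd_braiding N M (yd_braiding M N t) = t) \<and>
           (\<forall>t \<in> yd_tensor N M. yd_braiding M N (yd_braiding N M t) = t))"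

definition non_essentially_infinite ::
  "'g monoid \<Rightarrow> (complex \<Rightarrow> 'v::ab_group_add \<Rightarrow> 'v) \<Rightarrow> ('g, 'v, 'i, 'j, 't) rsr \<Rightarrow> bool" where
  "non_essentially_infinite G scale R \<longleftrightarrow>
     (\<forall>C \<in> ram_support G R. \<forall>i \<in> idx R C. finite_dim_nichols (arrow_submodule G scale R C i))"

text \<open>\<open>R\<close> is an RSR of central quantum linear type, i.e. its Nichols algebra
  \<open>\<BB>(G, r, \<rho>, u)\<close>, which is \<open>nichols_algebra (arrow_module G scale R)\<close>, is a central
  quantum linear space over \<open>G\<close>.\<close>

definition central_quantum_linear ::
  "'g monoid \<Rightarrow> (complex \<Rightarrow> 'v::ab_group_add \<Rightarrow> 'v) \<Rightarrow> ('g, 'v, 'i, 'j, 't) rsr \<Rightarrow> bool" where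
  "central_quantum_linear G scale R \<longleftrightarrow>
     is_rsr G scale R \<and> quantum_symmetric G scale R \<and> non_essentially_infinite G scale R \<and>
     (\<forall>C \<in> ram_support G R. C \<subseteq> center G)"

end

theory Submission
  imports Defs "Jordan_Normal_Form.Spectral_Radius"
begin

text \<open>Let \<open>C \<in> \<K>\<^sub>r(G)\<close> be central, \<open>C = {x}\<close>. The centre of an irreducible finite Weyl group lies in
  \<open>{1, -1}\<close>, so \<open>x\<^sup>2 = 1\<close>, and by Schur's lemma \<open>x\<close> acts on each \<open>X\<^sub>C\<^sup>(\<^sup>i\<^sup>)\<close> as \<open>1\<close> or \<open>-1\<close>. If it acted as
  \<open>1\<close>, the braiding of \<open>M\<^sub>C\<^sup>(\<^sup>i\<^sup>)\<close> would be the flip, and the powers of a basis vector would be linearly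
  independent in the Nichols algebra; hence \<open>x = -1\<close> and all characters are odd. In \<open>W(E\<^sub>6)\<close> there is no
  \<open>-1\<close>, since the Cartan matrix is singular modulo \<open>3\<close>.

  The number of odd irreducible characters equals the number of pairs \<open>{K, -K}\<close> of distinct conjugacy classes
  \<open>K \<noteq> -K\<close>: both are the dimension of the space of odd class functions. These pairs are counted without
  enumerating the group: a list of words containing the empty word represents every class up to sign provided that,
  for each listed \<open>w\<close> and each reflection \<open>t\<close>, the product \<open>t w\<close> is conjugate to a listed element up to
  sign; and it suffices to treat one \<open>t\<close> in each orbit of a group of elements commuting with \<open>w\<close> up to sign.
  That the pairs are distinct is seen from traces of powers and from the number of roots
  that are fixed or negated.\<close>

section \<open>Representations of finite groups\<close>

text \<open>The group W(E8) has 696729600 elements, so nothing is enumerated: every computation in a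
  Weyl group is done with permutations of at most 240 numbered roots, and the results of searches
  enter as certificates that rewriting can check. Working up to sign is exactly what the count of
  odd characters asks for, and it halves the data. The totals agree with the known class numbers: 6
  = 2 * 3 for G2, 25 = 2 * 9 + 7 for F4, 60 = 2 * 30 for E7 and 112 = 2 * 45 + 22 for E8, the last
  summand counting the classes equal to their own negatives.

  On the side of representations the delicate direction is that odd characters span the odd class
  functions. It comes from a Hermitian form on the functions on the group: for a class function
  orthogonal to all odd characters, a nonzero image of the associated operator would contain an
  irreducible subspace on which the operator vanishes while its adjoint is a scalar, and either
  value of that scalar makes the form degenerate. A transfer of representations is also required,
  since the spaces of an RSR lie in an arbitrary type whereas \<open>irr_chars\<close> refers to
  sequences.\<close>

lemma sum_swap3:
  "(\<Sum>b\<in>B. \<Sum>c\<in>C. \<Sum>d\<in>D. f b c d) = (\<Sum>d\<in>D. \<Sum>c\<in>C. \<Sum>b\<in>B. f b c d)"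
proof -
  have "(\<Sum>b\<in>B. \<Sum>c\<in>C. \<Sum>d\<in>D. f b c d) = (\<Sum>b\<in>B. \<Sum>d\<in>D. \<Sum>c\<in>C. f b c d)"
    by (intro sum.cong[OF refl] sum.swap)
  also have "\<dots> = (\<Sum>d\<in>D. \<Sum>b\<in>B. \<Sum>c\<in>C. f b c d)" by (rule sum.swap)
  also have "\<dots> = (\<Sum>d\<in>D. \<Sum>c\<in>C. \<Sum>b\<in>B. f b c d)"
    by (intro sum.cong[OF refl] sum.swap)
  finally show ?thesis .
qed

locale fin_group = Group.group H for H :: "'g monoid" (structure) +
  assumes finite_carrier: "finite (carrier H)"

text \<open>The ambient space is a parameter because three are used: the space of the RSR, the
  sequences in which \<open>irr_chars\<close> is defined, and the functions on the group, which
  carry the regular representation.\<close>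

locale fin_group_vs = fin_group H + vs: vector_space scale
  for H :: "'g monoid" (structure) and scale :: "complex \<Rightarrow> 'v::ab_group_add \<Rightarrow> 'v"
begin

lemma rep_sum:
  assumes "is_basis scale E B" "x \<in> E"
  shows "(\<Sum>b\<in>B. scale (vs.representation B x b) b) = x"
  using assms unfolding is_basis_def by (intro vs.sum_representation_eq) auto

lemma basis_mem: "is_basis scale E B \<Longrightarrow> b \<in> B \<Longrightarrow> b \<in> E"
  unfolding is_basis_def using vs.span_base by blast

lemma basis_subspace: "is_basis scale E B \<Longrightarrow> vs.subspace E"
  unfolding is_basis_def using vs.subspace_span by blast

lemma rep_basis: "is_basis scale E B \<Longrightarrow> b \<in> B \<Longrightarrow> vs.representation B b = (\<lambda>c. of_bool (c = b))"
  unfolding is_basis_def by (auto simp: vs.representation_basis)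

lemma rep_add: "is_basis scale E B \<Longrightarrow> x \<in> E \<Longrightarrow> y \<in> E \<Longrightarrow>
    vs.representation B (x + y) b = vs.representation B x b + vs.representation B y b"
  unfolding is_basis_def by (auto simp: vs.representation_add)

lemma rep_scale: "is_basis scale E B \<Longrightarrow> x \<in> E \<Longrightarrow>
    vs.representation B (scale a x) b = a * vs.representation B x b"
  unfolding is_basis_def by (auto simp: vs.representation_scale)

lemma rep_sum_comm: "is_basis scale E B \<Longrightarrow> (\<And>i. i \<in> I \<Longrightarrow> v i \<in> E) \<Longrightarrow>
    vs.representation B (sum v I) b = (\<Sum>i\<in>I. vs.representation B (v i) b)"
  unfolding is_basis_def by (auto simp: vs.representation_sum)

lemma basis_nonempty: "is_basis scale E B \<Longrightarrow> E \<noteq> {0} \<Longrightarrow> B \<noteq> {}"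
  unfolding is_basis_def by auto

text \<open>Linearity is demanded on the subspace only, because \<open>right_rep\<close> leaves the
  action off the representation space unspecified.\<close>

definition lin_on :: "'v set \<Rightarrow> ('v \<Rightarrow> 'v) \<Rightarrow> bool" where
  "lin_on E T \<longleftrightarrow> (\<forall>x\<in>E. \<forall>y\<in>E. T (x + y) = T x + T y) \<and> (\<forall>c. \<forall>x\<in>E. T (scale c x) = scale c (T x))"

lemma lin_onD:
  assumes "lin_on E T"
  shows "x \<in> E \<Longrightarrow> y \<in> E \<Longrightarrow> T (x + y) = T x + T y" "x \<in> E \<Longrightarrow> T (scale c x) = scale c (T x)"
  using assms unfolding lin_on_def by auto

lemma lin_on_0: "lin_on E T \<Longrightarrow> vs.subspace E \<Longrightarrow> T 0 = 0"
  using lin_onD(2)[of E T 0 0] vs.subspace_0 by force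

lemma lin_on_sum:
  assumes "lin_on E T" "vs.subspace E" "\<And>i. i \<in> I \<Longrightarrow> v i \<in> E"
  shows "T (sum v I) = (\<Sum>i\<in>I. T (v i))"
  using assms(3)
proof (induction I rule: infinite_finite_induct)
  case (insert i I)
  have "sum v I \<in> E" using insert.prems assms(2) by (intro vs.subspace_sum) auto
  then show ?case using insert by (simp add: lin_onD(1)[OF assms(1)])
qed (auto simp: lin_on_0[OF assms(1,2)])

lemma rep_lin:
  assumes B: "is_basis scale E B" and T: "lin_on E T" and F: "is_basis scale F C"
    and TE: "\<And>y. y \<in> E \<Longrightarrow> T y \<in> F" and x: "x \<in> E"
  shows "vs.representation C (T x) c = (\<Sum>b\<in>B. vs.representation B x b * vs.representation C (T b) c)"
proof -
  have sE: "vs.subspace E" and sF: "vs.subspace F" using B F by (auto intro: basis_subspace)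
  have "T x = T (\<Sum>b\<in>B. scale (vs.representation B x b) b)" using rep_sum[OF B x] by simp
  also have "\<dots> = (\<Sum>b\<in>B. scale (vs.representation B x b) (T b))"
    using basis_mem[OF B] sE
    by (subst lin_on_sum[OF T sE]) (auto intro!: vs.subspace_scale sum.cong simp: lin_onD(2)[OF T])
  finally show ?thesis
    using basis_mem[OF B] TE sF
    by (simp add: rep_sum_comm[OF F] rep_scale[OF F] vs.subspace_scale)
qed

lemma right_repD:
  assumes "right_rep scale H E act"
  shows "vs.subspace E" "h \<in> carrier H \<Longrightarrow> lin_on E (\<lambda>x. act x h)"
    "x \<in> E \<Longrightarrow> h \<in> carrier H \<Longrightarrow> act x h \<in> E" "x \<in> E \<Longrightarrow> act x \<one> = x"
    "x \<in> E \<Longrightarrow> g \<in> carrier H \<Longrightarrow> h \<in> carrier H \<Longrightarrow> act x (g \<otimes> h) = act (act x g) h"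
  using assms unfolding right_rep_def lin_on_def by auto

lemma act_sum:
  assumes "right_rep scale H E act" "h \<in> carrier H" "\<And>i. i \<in> I \<Longrightarrow> v i \<in> E"
  shows "act (sum v I) h = (\<Sum>i\<in>I. act (v i) h)"
  using lin_on_sum[OF right_repD(2,1)[OF assms(1)]] assms by auto

text \<open>Over the complex numbers the matrix of \<open>T\<close> has an eigenvector, and the
  eigenspace inside \<open>E\<close> is invariant and nonzero, hence everything.\<close>

lemma schur_scalar:
  assumes irr: "irreducible_rep scale H E act" and B: "is_basis scale E B"
    and T: "lin_on E T" and TE: "\<And>x. x \<in> E \<Longrightarrow> T x \<in> E"
    and comm: "\<And>x h. x \<in> E \<Longrightarrow> h \<in> carrier H \<Longrightarrow> T (act x h) = act (T x) h"
  shows "\<exists>a. \<forall>x\<in>E. T x = scale a x"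
proof -
  have rr: "right_rep scale H E act" and E0: "E \<noteq> {0}"
    and irr': "\<And>W. vs.subspace W \<Longrightarrow> W \<subseteq> E \<Longrightarrow> (\<forall>w\<in>W. \<forall>h\<in>carrier H. act w h \<in> W) \<Longrightarrow> W = {0} \<or> W = E"
    using irr unfolding irreducible_rep_def by auto
  note sE = right_repD(1)[OF rr]
  define n where "n = card B"
  have finB: "finite B" using B unfolding is_basis_def by auto
  then obtain e where e: "bij_betw e {0..<n} B" unfolding n_def using ex_bij_betw_nat_finite by blast
  have eB: "i < n \<Longrightarrow> e i \<in> B" for i using e by (auto simp: bij_betw_def)
  have n0: "n > 0" using basis_nonempty[OF B E0] finB unfolding n_def by (simp add: card_gt_0_iff)
  \<comment> \<open>Column \<open>i\<close> holds the coordinates of \<open>T (e i)\<close>, so an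
    eigenvector of \<open>M\<close> lists the coordinates of an eigenvector of
    \<open>T\<close>.\<close>
  define M where "M = mat n n (\<lambda>(j,i). vs.representation B (T (e i)) (e j))"
  have M: "M \<in> carrier_mat n n" unfolding M_def by simp
  obtain a v where v: "v \<in> carrier_vec n" "v \<noteq> 0\<^sub>v n" "M *\<^sub>v v = a \<cdot>\<^sub>v v"
    using spectrum_non_empty[OF M n0] M unfolding spectrum_def eigenvalue_def eigenvector_def by auto
  define x where "x = (\<Sum>i<n. scale (v $ i) (e i))"
  have xE: "x \<in> E" unfolding x_def using eB basis_mem[OF B] sE
    by (intro vs.subspace_sum) (auto intro: vs.subspace_scale)
  have repx: "vs.representation B x (e j) = v $ j" if j: "j < n" for j
  proof -
    have "vs.representation B x (e j) = (\<Sum>i<n. v $ i * of_bool (e j = e i))"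
      unfolding x_def using eB basis_mem[OF B] sE
      by (subst rep_sum_comm[OF B])
        (auto intro!: sum.cong vs.subspace_scale simp: rep_scale[OF B] rep_basis[OF B])
    also have "\<dots> = (\<Sum>i<n. if i = j then v $ i else 0)"
      using e j by (intro sum.cong) (auto simp: bij_betw_def inj_on_def)
    finally show ?thesis using j by simp
  qed
  have repTx: "vs.representation B (T x) (e j) = a * v $ j" if j: "j < n" for j
  proof -
    have "vs.representation B (T x) (e j) = (\<Sum>b\<in>B. vs.representation B x b * vs.representation B (T b) (e j))"
      by (rule rep_lin[OF B T B TE xE])
    also have "\<dots> = (\<Sum>i\<in>{0..<n}. vs.representation B x (e i) * vs.representation B (T (e i)) (e j))"
      by (rule sum.reindex_bij_betw[OF e, symmetric])
    also have "\<dots> = (M *\<^sub>v v) $ j"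
      using j v(1) by (auto simp: M_def scalar_prod_def repx intro!: sum.cong)
    finally show ?thesis using v j by simp
  qed
  have "T x = (\<Sum>b\<in>B. scale (vs.representation B (T x) b) b)" using rep_sum[OF B TE[OF xE]] by simp
  also have "\<dots> = (\<Sum>b\<in>B. scale (a * vs.representation B x b) b)"
  proof (rule sum.cong[OF refl])
    fix b assume "b \<in> B"
    then obtain j where "j < n" "b = e j" using e by (auto simp: bij_betw_def)
    then show "scale (vs.representation B (T x) b) b = scale (a * vs.representation B x b) b"
      using repx repTx by simp
  qed
  also have "\<dots> = scale a x" using rep_sum[OF B xE] by (metis (no_types, lifting) sum.cong vs.scale_scale vs.scale_sum_right)
  finally have Tx: "T x = scale a x" .
  have x0: "x \<noteq> 0"
  proof
    assume "x = 0"
    then have "v $ j = 0" if "j < n" for j using repx[OF that] B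
      by (simp add: vs.representation_zero)
    then show False using v by auto
  qed
  define W where "W = {y \<in> E. T y = scale a y}"
  have "vs.subspace W"
    unfolding vs.subspace_def W_def
    using sE lin_on_0[OF T sE] lin_onD[OF T]
    by (auto simp: vs.subspace_0 vs.subspace_add vs.subspace_scale vs.scale_right_distrib vs.scale_left_commute)
  moreover have "\<forall>w\<in>W. \<forall>h\<in>carrier H. act w h \<in> W"
    unfolding W_def using comm right_repD(3)[OF rr] lin_onD(2)[OF right_repD(2)[OF rr]] by auto
  ultimately have "W = {0} \<or> W = E" using irr'[of W] unfolding W_def by auto
  then have "W = E" using x0 xE Tx unfolding W_def by auto
  then show ?thesis unfolding W_def by auto
qed

text \<open>Kernel and image are invariant subspaces of irreducible representations, so each of them
  is trivial or everything.\<close>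

lemma schur_hom:
  assumes irrE: "irreducible_rep scale H E act" and irrF: "irreducible_rep scale H F act'"
    and T: "lin_on E T" and TE: "\<And>x. x \<in> E \<Longrightarrow> T x \<in> F"
    and comm: "\<And>x h. x \<in> E \<Longrightarrow> h \<in> carrier H \<Longrightarrow> T (act x h) = act' (T x) h"
  shows "(\<forall>x\<in>E. T x = 0) \<or> (inj_on T E \<and> T ` E = F)"
proof -
  have rr: "right_rep scale H E act" and rr': "right_rep scale H F act'"
    and irr: "\<And>W. vs.subspace W \<Longrightarrow> W \<subseteq> E \<Longrightarrow> (\<forall>w\<in>W. \<forall>h\<in>carrier H. act w h \<in> W) \<Longrightarrow> W = {0} \<or> W = E"
    and irr': "\<And>W. vs.subspace W \<Longrightarrow> W \<subseteq> F \<Longrightarrow> (\<forall>w\<in>W. \<forall>h\<in>carrier H. act' w h \<in> W) \<Longrightarrow> W = {0} \<or> W = F"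
    using irrE irrF unfolding irreducible_rep_def by auto
  note sE = right_repD(1)[OF rr] and sF = right_repD(1)[OF rr']
  have T0: "T 0 = 0" by (rule lin_on_0[OF T sE])
  define K where "K = {x \<in> E. T x = 0}"
  have "vs.subspace K"
    unfolding vs.subspace_def K_def
    using sE T0 lin_onD[OF T] by (auto simp: vs.subspace_0 vs.subspace_add vs.subspace_scale)
  moreover have "\<forall>w\<in>K. \<forall>h\<in>carrier H. act w h \<in> K"
    unfolding K_def using comm right_repD(3)[OF rr] lin_on_0[OF right_repD(2)[OF rr'] sF] by auto
  ultimately have K: "K = {0} \<or> K = E" using irr[of K] unfolding K_def by auto
  have im: "vs.subspace (T ` E)"
    unfolding vs.subspace_def
  proof (intro conjI ballI allI)
    show "0 \<in> T ` E" using T0 vs.subspace_0[OF sE] by force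
    show "x + y \<in> T ` E" if "x \<in> T ` E" "y \<in> T ` E" for x y
      using that lin_onD(1)[OF T] vs.subspace_add[OF sE] by (auto intro!: image_eqI[where x="_ + _"] simp flip: lin_onD(1)[OF T])
    show "scale c x \<in> T ` E" if "x \<in> T ` E" for x c
      using that vs.subspace_scale[OF sE] by (auto simp flip: lin_onD(2)[OF T])
  qed
  moreover have "\<forall>w\<in>T ` E. \<forall>h\<in>carrier H. act' w h \<in> T ` E"
    using comm right_repD(3)[OF rr] by (auto simp flip: comm)
  ultimately have I: "T ` E = {0} \<or> T ` E = F" using irr'[of "T ` E"] TE by auto
  show ?thesis
  proof (cases "\<forall>x\<in>E. T x = 0")
    case False
    then have "K \<noteq> E" unfolding K_def by auto
    with K have K0: "K = {0}" by auto
    have "inj_on T E"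
    proof (rule inj_onI)
      fix x y assume xy: "x \<in> E" "y \<in> E" "T x = T y"
      \<comment> \<open>The difference is spelled as a sum with a multiple, the only two operations
        that \<open>lin_on\<close> covers.\<close>
      have "T (x + scale (-1) y) = T x + scale (-1) (T y)"
        using xy sE by (simp add: lin_onD[OF T] vs.subspace_scale del: vs.scale_minus_left)
      then have "x + scale (-1) y \<in> K" unfolding K_def using xy sE
        by (auto simp: vs.subspace_diff)
      then show "x = y" using K0 by simp
    qed
    moreover have "T ` E \<noteq> {0}" using False by auto
    ultimately show ?thesis using I by auto
  qed auto
qed

end

section \<open>Matrix coefficients and orthogonality of characters\<close>

context fin_group_vs
begin

text \<open>Row \<open>b\<close> holds the coordinates of the image of \<open>b\<close>. For a right
  action this convention makes the matrices multiply in the same order as the group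
  elements.\<close>

definition mcoef :: "'v set \<Rightarrow> ('v \<Rightarrow> 'g \<Rightarrow> 'v) \<Rightarrow> 'g \<Rightarrow> 'v \<Rightarrow> 'v \<Rightarrow> complex" where
  "mcoef B act h b c = vs.representation B (act b h) c"

lemma rep_character_eq: "h \<in> carrier H \<Longrightarrow> rep_character scale H B act h = (\<Sum>b\<in>B. mcoef B act h b b)"
  unfolding rep_character_def mcoef_def by simp

lemma rep_act:
  assumes "right_rep scale H E act" "is_basis scale E B" "h \<in> carrier H" "x \<in> E"
  shows "vs.representation B (act x h) c = (\<Sum>b\<in>B. vs.representation B x b * mcoef B act h b c)"
  unfolding mcoef_def
  using rep_lin[OF assms(2) right_repD(2)[OF assms(1,3)] assms(2)] right_repD(3)[OF assms(1) _ assms(3)] assms(4)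
  by auto

lemma mcoef_mult:
  assumes "right_rep scale H E act" "is_basis scale E B" "g \<in> carrier H" "h \<in> carrier H" "b \<in> B"
  shows "mcoef B act (g \<otimes> h) b c = (\<Sum>d\<in>B. mcoef B act g b d * mcoef B act h d c)"
  using rep_act[OF assms(1,2,4), of "act b g"] basis_mem[OF assms(2,5)] right_repD(3,5)[OF assms(1)] assms(3,4)
  by (simp add: mcoef_def)

lemma mcoef_one:
  assumes "right_rep scale H E act" "is_basis scale E B" "b \<in> B"
  shows "mcoef B act \<one> b c = of_bool (c = b)"
  using rep_basis[OF assms(2,3)] right_repD(4)[OF assms(1) basis_mem[OF assms(2,3)]]
  by (simp add: mcoef_def)

lemma character_mult_commute:
  assumes "right_rep scale H E act" "is_basis scale E B" "g \<in> carrier H" "h \<in> carrier H"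
  shows "rep_character scale H B act (g \<otimes> h) = rep_character scale H B act (h \<otimes> g)"
proof -
  have "(\<Sum>b\<in>B. \<Sum>d\<in>B. mcoef B act g b d * mcoef B act h d b)
      = (\<Sum>d\<in>B. \<Sum>b\<in>B. mcoef B act h d b * mcoef B act g b d)"
    by (subst sum.swap) (simp add: mult.commute)
  then show ?thesis
    using assms by (simp add: rep_character_eq mcoef_mult)
qed

lemma character_one:
  assumes "right_rep scale H E act" "is_basis scale E B"
  shows "rep_character scale H B act \<one> = of_nat (card B)"
  using assms by (simp add: rep_character_eq mcoef_one)

lemma character_conj:
  assumes "right_rep scale H E act" "is_basis scale E B" "g \<in> carrier H" "h \<in> carrier H"
  shows "rep_character scale H B act (g \<otimes> h \<otimes> inv g) = rep_character scale H B act h"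
proof -
  have "rep_character scale H B act (g \<otimes> h \<otimes> inv g) = rep_character scale H B act (inv g \<otimes> (g \<otimes> h))"
    using assms by (intro character_mult_commute) auto
  also have "inv g \<otimes> (g \<otimes> h) = h" using assms(3,4) by (simp add: m_assoc[symmetric])
  finally show ?thesis .
qed

text \<open>The trace is unchanged under conjugation by \<open>T\<close>. The lemma lets unequal
  characters stand for non-isomorphic representations in the orthogonality relations.\<close>

lemma character_iso:
  assumes rr: "right_rep scale H E act" and rr': "right_rep scale H F act'"
    and B: "is_basis scale E B" and C: "is_basis scale F C"
    and T: "lin_on E T" and inj: "inj_on T E" and im: "T ` E = F"
    and comm: "\<And>x h. x \<in> E \<Longrightarrow> h \<in> carrier H \<Longrightarrow> T (act x h) = act' (T x) h"
  shows "rep_character scale H B act = rep_character scale H C act'"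
proof
  fix h
  show "rep_character scale H B act h = rep_character scale H C act' h"
  proof (cases "h \<in> carrier H")
    case h: True
    have fin: "finite B" "finite C" using B C unfolding is_basis_def by auto
    define S where "S = inv_into E T"
    have TS: "x \<in> F \<Longrightarrow> T (S x) = x" and SE: "x \<in> F \<Longrightarrow> S x \<in> E" for x
      unfolding S_def using im by (auto intro: f_inv_into_f inv_into_into)
    have ST: "x \<in> E \<Longrightarrow> S (T x) = x" for x unfolding S_def using inj by simp
    have TF: "x \<in> E \<Longrightarrow> T x \<in> F" for x using im by auto
    have S: "lin_on F S"
      unfolding lin_on_def
    proof (intro conjI ballI allI)
      show "S (x + y) = S x + S y" if "x \<in> F" "y \<in> F" for x y
        using that ST[of "S x + S y"] SE vs.subspace_add[OF right_repD(1)[OF rr]] TS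
        by (simp add: lin_onD(1)[OF T])
      show "S (scale c x) = scale c (S x)" if "x \<in> F" for x c
        using that ST[of "scale c (S x)"] SE vs.subspace_scale[OF right_repD(1)[OF rr]] TS
        by (simp add: lin_onD(2)[OF T])
    qed
    let ?B = "vs.representation B" and ?C = "vs.representation C"
    have act': "act' c h = T (act (S c) h)" if "c \<in> F" for c
      using comm[OF SE[OF that] h] TS[OF that] by simp
    have "(\<Sum>c\<in>C. ?C (act' c h) c) = (\<Sum>c\<in>C. \<Sum>b\<in>B. ?B (act (S c) h) b * ?C (T b) c)"
    proof (rule sum.cong[OF refl])
      fix c assume "c \<in> C"
      then have cF: "c \<in> F" using basis_mem[OF C] by auto
      show "?C (act' c h) c = (\<Sum>b\<in>B. ?B (act (S c) h) b * ?C (T b) c)"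
        using rep_lin[OF B T C TF right_repD(3)[OF rr SE[OF cF] h]] act'[OF cF] by simp
    qed
    also have "\<dots> = (\<Sum>c\<in>C. \<Sum>b\<in>B. \<Sum>d\<in>B. ?B (S c) d * mcoef B act h d b * ?C (T b) c)"
      using rep_act[OF rr B h] SE basis_mem[OF C] by (simp add: sum_distrib_right)
    also have "\<dots> = (\<Sum>d\<in>B. \<Sum>b\<in>B. \<Sum>c\<in>C. ?B (S c) d * mcoef B act h d b * ?C (T b) c)"
      by (rule sum_swap3)
    also have "\<dots> = (\<Sum>d\<in>B. \<Sum>b\<in>B. mcoef B act h d b * (\<Sum>c\<in>C. ?C (T b) c * ?B (S c) d))"
      by (simp add: sum_distrib_left mult_ac)
    also have "\<dots> = (\<Sum>d\<in>B. \<Sum>b\<in>B. mcoef B act h d b * of_bool (d = b))"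
    proof (intro sum.cong refl)
      fix d b assume db: "d \<in> B" "b \<in> B"
      \<comment> \<open>The inner sum is a matrix entry of \<open>S\<close> after \<open>T\<close>,
        that is, of the identity.\<close>
      have "(\<Sum>c\<in>C. ?C (T b) c * ?B (S c) d) = ?B (S (T b)) d"
        using rep_lin[OF C S B SE TF[OF basis_mem[OF B db(2)]], of d] by simp
      then show "mcoef B act h d b * (\<Sum>c\<in>C. ?C (T b) c * ?B (S c) d) = mcoef B act h d b * of_bool (d = b)"
        using ST[OF basis_mem[OF B db(2)]] rep_basis[OF B db(2)] by simp
    qed
    also have "\<dots> = (\<Sum>d\<in>B. mcoef B act h d d)"
      using fin by (intro sum.cong) (auto simp: of_bool_def if_distrib sum.delta cong: if_cong)
    finally show ?thesis using h by (simp add: rep_character_eq mcoef_def)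
  qed (simp add: rep_character_def)
qed

text \<open>The group average of the rank-one map that takes \<open>x\<close> to its coordinate at
  \<open>b\<close> times \<open>c\<close>. It intertwines the two actions, and its entries are the
  sums of products of matrix coefficients occurring in a pairing of characters.\<close>

definition avg :: "('v \<Rightarrow> 'g \<Rightarrow> 'v) \<Rightarrow> ('v \<Rightarrow> 'g \<Rightarrow> 'v) \<Rightarrow> 'v set \<Rightarrow> 'v \<Rightarrow> 'v \<Rightarrow> 'v \<Rightarrow> 'v" where
  "avg act act' B b c x =
     (\<Sum>h\<in>carrier H. act' (scale (vs.representation B (act x h) b) c) (inv h))"

lemma
  assumes rr: "right_rep scale H E act" and rr': "right_rep scale H F act'"
    and B: "is_basis scale E B" and c: "c \<in> F"
  shows avg_lin: "lin_on E (avg act act' B b c)"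
    and avg_in: "x \<in> E \<Longrightarrow> avg act act' B b c x \<in> F"
    and avg_act: "x \<in> E \<Longrightarrow> g \<in> carrier H \<Longrightarrow> avg act act' B b c (act x g) = act' (avg act act' B b c x) g"
proof -
  note sE = right_repD(1)[OF rr] and sF = right_repD(1)[OF rr']
  have scF: "scale a c \<in> F" for a using c sF by (rule vs.subspace_scale[rotated])
  show "lin_on E (avg act act' B b c)"
    unfolding lin_on_def avg_def
  proof (intro conjI ballI allI)
    fix x y assume xy: "x \<in> E" "y \<in> E"
    show "(\<Sum>h\<in>carrier H. act' (scale (vs.representation B (act (x + y) h) b) c) (inv h)) =
      (\<Sum>h\<in>carrier H. act' (scale (vs.representation B (act x h) b) c) (inv h)) +
      (\<Sum>h\<in>carrier H. act' (scale (vs.representation B (act y h) b) c) (inv h))"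
      unfolding sum.distrib[symmetric]
    proof (rule sum.cong[OF refl])
      fix h assume h: "h \<in> carrier H"
      show "act' (scale (vs.representation B (act (x + y) h) b) c) (inv h) =
         act' (scale (vs.representation B (act x h) b) c) (inv h) +
         act' (scale (vs.representation B (act y h) b) c) (inv h)"
        using xy h scF right_repD(3)[OF rr]
        by (simp add: lin_onD(1)[OF right_repD(2)[OF rr]] rep_add[OF B] vs.scale_left_distrib
            lin_onD(1)[OF right_repD(2)[OF rr']])
    qed
  next
    fix a x assume x: "x \<in> E"
    show "(\<Sum>h\<in>carrier H. act' (scale (vs.representation B (act (scale a x) h) b) c) (inv h)) =
      scale a (\<Sum>h\<in>carrier H. act' (scale (vs.representation B (act x h) b) c) (inv h))"
      unfolding vs.scale_sum_right
    proof (rule sum.cong[OF refl])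
      fix h assume h: "h \<in> carrier H"
      show "act' (scale (vs.representation B (act (scale a x) h) b) c) (inv h) =
         scale a (act' (scale (vs.representation B (act x h) b) c) (inv h))"
        using x h scF right_repD(3)[OF rr]
        by (simp add: lin_onD(2)[OF right_repD(2)[OF rr]] rep_scale[OF B]
            lin_onD(2)[OF right_repD(2)[OF rr'], symmetric])
    qed
  qed
  show "avg act act' B b c x \<in> F" for x
    unfolding avg_def using scF sF by (intro vs.subspace_sum) (auto intro: right_repD(3)[OF rr'])
  show "avg act act' B b c (act x g) = act' (avg act act' B b c x) g" if x: "x \<in> E" and g: "g \<in> carrier H" for x
  proof -
    \<comment> \<open>The substitution absorbs \<open>g\<close> into the summation variable; it
      reappears on the outside because the second action is applied at the inverse.\<close>
    have bij: "bij_betw (\<lambda>h. inv g \<otimes> h) (carrier H) (carrier H)"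
      using g by (intro bij_betw_byWitness[where f'="\<lambda>h. g \<otimes> h"]) (auto simp: m_assoc[symmetric])
    have "avg act act' B b c (act x g)
      = (\<Sum>k\<in>carrier H. act' (scale (vs.representation B (act (act x g) (inv g \<otimes> k)) b) c) (inv (inv g \<otimes> k)))"
      unfolding avg_def by (rule sum.reindex_bij_betw[OF bij, symmetric])
    also have "\<dots> = (\<Sum>k\<in>carrier H. act' (act' (scale (vs.representation B (act x k) b) c) (inv k)) g)"
    proof (rule sum.cong[OF refl])
      fix k assume k: "k \<in> carrier H"
      have "act (act x g) (inv g \<otimes> k) = act x k"
        using x g k by (simp add: right_repD(5)[OF rr, symmetric] m_assoc[symmetric])
      moreover have "inv (inv g \<otimes> k) = inv k \<otimes> g" using g k by (simp add: inv_mult_group)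
      ultimately show "act' (scale (vs.representation B (act (act x g) (inv g \<otimes> k)) b) c) (inv (inv g \<otimes> k))
        = act' (act' (scale (vs.representation B (act x k) b) c) (inv k)) g"
        using right_repD(5)[OF rr' scF inv_closed[OF k] g] by simp
    qed
    also have "\<dots> = act' (avg act act' B b c x) g"
      unfolding avg_def
      by (subst act_sum[OF rr' g]) (auto intro: right_repD(3)[OF rr'] scF)
    finally show ?thesis .
  qed
qed

lemma avg_coef:
  assumes rr: "right_rep scale H E act" and rr': "right_rep scale H F act'"
    and B: "is_basis scale E B" and C: "is_basis scale F C" and c: "c \<in> C" 
  shows "vs.representation C (avg act act' B b0 c b) d
     = (\<Sum>h\<in>carrier H. mcoef B act h b b0 * mcoef C act' (inv h) c d)"
proof -
  have cF: "c \<in> F" by (rule basis_mem[OF C c])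
  have scF: "scale a c \<in> F" for a using cF right_repD(1)[OF rr'] by (rule vs.subspace_scale[rotated])
  show ?thesis
    unfolding avg_def
    using scF cF right_repD(3)[OF rr'] right_repD(1)[OF rr']
    by (subst rep_sum_comm[OF C])
      (auto intro!: sum.cong vs.subspace_scale simp: lin_onD(2)[OF right_repD(2)[OF rr']] rep_scale[OF C] mcoef_def)
qed

text \<open>Inverting the argument in place of complex conjugation keeps the pairing bilinear and
  lets the sums from \<open>avg_coef\<close> appear directly.\<close>

definition pairing :: "('g \<Rightarrow> complex) \<Rightarrow> ('g \<Rightarrow> complex) \<Rightarrow> complex" where
  "pairing f f' = (\<Sum>h\<in>carrier H. f h * f' (inv h))"

lemma pairing_character:
  "pairing (rep_character scale H B act) (rep_character scale H C act')
    = (\<Sum>b\<in>B. \<Sum>c\<in>C. \<Sum>h\<in>carrier H. mcoef B act h b b * mcoef C act' (inv h) c c)"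
proof -
  have "pairing (rep_character scale H B act) (rep_character scale H C act')
    = (\<Sum>h\<in>carrier H. \<Sum>b\<in>B. \<Sum>c\<in>C. mcoef B act h b b * mcoef C act' (inv h) c c)"
    unfolding pairing_def by (simp add: rep_character_eq sum_product)
  also have "\<dots> = (\<Sum>b\<in>B. \<Sum>h\<in>carrier H. \<Sum>c\<in>C. mcoef B act h b b * mcoef C act' (inv h) c c)"
    by (rule sum.swap)
  also have "\<dots> = (\<Sum>b\<in>B. \<Sum>c\<in>C. \<Sum>h\<in>carrier H. mcoef B act h b b * mcoef C act' (inv h) c c)"
    by (intro sum.cong[OF refl] sum.swap)
  finally show ?thesis .
qed

text \<open>An averaged rank-one map is zero or an isomorphism by Schur's lemma, and an isomorphism
  would identify the characters. Its coordinate at \<open>c\<close>, evaluated on \<open>b\<close>,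
  is precisely the term of the pairing indexed by \<open>b\<close> and \<open>c\<close>.\<close>

lemma character_orthogonal:
  assumes irrE: "irreducible_rep scale H E act" and irrF: "irreducible_rep scale H F act'"
    and B: "is_basis scale E B" and C: "is_basis scale F C"
    and ne: "rep_character scale H B act \<noteq> rep_character scale H C act'"
  shows "pairing (rep_character scale H B act) (rep_character scale H C act') = 0"
proof -
  have rr: "right_rep scale H E act" and rr': "right_rep scale H F act'"
    using irrE irrF unfolding irreducible_rep_def by auto
  have "(\<Sum>h\<in>carrier H. mcoef B act h b b * mcoef C act' (inv h) c c) = 0" if "b \<in> B" "c \<in> C" for b c
  proof -
    note av = avg_lin[OF rr rr' B basis_mem[OF C \<open>c \<in> C\<close>], of b] avg_in[OF rr rr' B basis_mem[OF C \<open>c \<in> C\<close>], of _ b]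
      avg_act[OF rr rr' B basis_mem[OF C \<open>c \<in> C\<close>], of _ _ b]
    have "(\<forall>x\<in>E. avg act act' B b c x = 0) \<or>
        (inj_on (avg act act' B b c) E \<and> avg act act' B b c ` E = F)"
      by (rule schur_hom[OF irrE irrF av(1)]) (fact av(2), fact av(3))
    then show ?thesis
    proof (elim disjE conjE)
      assume 1: "\<forall>x\<in>E. avg act act' B b c x = 0"
      have "avg act act' B b c b = 0" using 1 basis_mem[OF B \<open>b \<in> B\<close>] by auto
      then show ?thesis using avg_coef[OF rr rr' B C \<open>c \<in> C\<close>, of b b c] by (simp add: vs.representation_zero)
    next
      assume 2: "inj_on (avg act act' B b c) E" "avg act act' B b c ` E = F"
      have "rep_character scale H B act = rep_character scale H C act'"
        by (rule character_iso[OF rr rr' B C av(1) 2]) (fact av(3))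
      with ne show ?thesis by contradiction
    qed
  qed
  then show ?thesis unfolding pairing_character by simp
qed

text \<open>Here the averaged rank-one map is a scalar. Its trace is the scalar times the degree,
  but also the order of the group if \<open>b = c\<close> and zero otherwise; this determines every
  term of the pairing.\<close>

lemma character_norm:
  assumes irr: "irreducible_rep scale H E act" and B: "is_basis scale E B"
  shows "pairing (rep_character scale H B act) (rep_character scale H B act) = of_nat (card (carrier H))"
proof -
  have rr: "right_rep scale H E act" and E0: "E \<noteq> {0}"
    using irr unfolding irreducible_rep_def by auto
  have finB: "finite B" using B unfolding is_basis_def by auto
  have cB: "card B > 0" using basis_nonempty[OF B E0] finB by (simp add: card_gt_0_iff)
  have key: "(\<Sum>h\<in>carrier H. mcoef B act h b b * mcoef B act (inv h) c c)
     = of_bool (b = c) * of_nat (card (carrier H)) / of_nat (card B)" if b: "b \<in> B" and c: "c \<in> B" for b c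
  proof -
    note av = avg_lin[OF rr rr B basis_mem[OF B c], of b] avg_in[OF rr rr B basis_mem[OF B c], of _ b]
      avg_act[OF rr rr B basis_mem[OF B c], of _ _ b]
    have "\<exists>a. \<forall>x\<in>E. avg act act B b c x = scale a x"
      by (rule schur_scalar[OF irr B av(1)]) (fact av(2), fact av(3))
    then obtain a where a: "\<And>x. x \<in> E \<Longrightarrow> avg act act B b c x = scale a x" by auto
    have co: "vs.representation B (avg act act B b c x) d = a * of_bool (d = x)" if "x \<in> B" for x d
      using a[OF basis_mem[OF B that]] rep_scale[OF B basis_mem[OF B that]] rep_basis[OF B that] by simp
    have "(\<Sum>x\<in>B. vs.representation B (avg act act B b c x) x) = of_nat (card B) * a"
      using co by simp
    moreover have "(\<Sum>x\<in>B. vs.representation B (avg act act B b c x) x)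
       = (\<Sum>x\<in>B. \<Sum>h\<in>carrier H. mcoef B act h x b * mcoef B act (inv h) c x)"
      using avg_coef[OF rr rr B B c] by simp
    moreover have "\<dots> = (\<Sum>h\<in>carrier H. \<Sum>x\<in>B. mcoef B act (inv h) c x * mcoef B act h x b)"
      by (subst sum.swap) (simp add: mult.commute)
    moreover have "\<dots> = (\<Sum>h\<in>carrier H. of_bool (b = c))"
      using c by (intro sum.cong) (auto simp: mcoef_mult[OF rr B, symmetric] mcoef_one[OF rr B])
    ultimately have "of_nat (card B) * a = of_nat (card (carrier H)) * of_bool (b = c)"
      by simp
    then have "a = of_bool (b = c) * of_nat (card (carrier H)) / of_nat (card B)" using cB by (simp add: field_simps)
    moreover have "(\<Sum>h\<in>carrier H. mcoef B act h b b * mcoef B act (inv h) c c) = a * of_bool (c = b)"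
      using avg_coef[OF rr rr B B c, of b b c] co[OF b, of c] by simp
    ultimately show ?thesis by (auto simp: of_bool_def)
  qed
  have "pairing (rep_character scale H B act) (rep_character scale H B act)
    = (\<Sum>b\<in>B. \<Sum>c\<in>B. if b = c then of_nat (card (carrier H)) / of_nat (card B) else 0)"
    unfolding pairing_character using key by (intro sum.cong) auto
  also have "\<dots> = (\<Sum>b\<in>B. of_nat (card (carrier H)) / of_nat (card B))"
    using finB by (intro sum.cong) auto
  finally show ?thesis using cB by simp
qed

text \<open>Schur's lemma turns \<open>z\<close> into a scalar, and its square is 1.\<close>

lemma central_scalar:
  assumes irr: "irreducible_rep scale H E act" and B: "is_basis scale E B"
    and z: "z \<in> center H" and zz: "z \<otimes> z = \<one>"
  shows "(\<forall>x\<in>E. act x z = x) \<or> (\<forall>x\<in>E. act x z = scale (-1) x)"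
proof -
  have rr: "right_rep scale H E act" and E0: "E \<noteq> {0}"
    using irr unfolding irreducible_rep_def by auto
  have zH: "z \<in> carrier H" and zc: "h \<in> carrier H \<Longrightarrow> z \<otimes> h = h \<otimes> z" for h using z unfolding center_def by auto
  have "\<exists>a. \<forall>x\<in>E. act x z = scale a x"
  proof (rule schur_scalar[OF irr B right_repD(2)[OF rr zH]])
    show "act x z \<in> E" if "x \<in> E" for x using right_repD(3)[OF rr that zH] .
    show "act (act x h) z = act (act x z) h" if "x \<in> E" "h \<in> carrier H" for x h
      using that zH zc by (simp add: right_repD(5)[OF rr, symmetric])
  qed
  then obtain a where a: "\<And>x. x \<in> E \<Longrightarrow> act x z = scale a x" by auto
  obtain x where x: "x \<in> E" "x \<noteq> 0" using E0 vs.subspace_0[OF right_repD(1)[OF rr]] by auto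
  have "act (act x z) z = x"
    using right_repD(5)[OF rr x(1) zH zH] right_repD(4)[OF rr x(1)] zz by simp
  then have "scale (a * a) x = scale 1 x"
    using a x vs.subspace_scale[OF right_repD(1)[OF rr] x(1)] by simp
  then have "a * a = 1" using x(2) vs.scale_right_imp_eq by blast
  then have "a = 1 \<or> a = -1" by (simp add: square_eq_1_iff)
  then show ?thesis using a by auto
qed

text \<open>The value at \<open>z\<close> is plus or minus the degree, a nonzero number, so the
  character alone reveals the sign by which \<open>z\<close> acts.\<close>

lemma odd_character_scalar:
  assumes irr: "irreducible_rep scale H E act" and B: "is_basis scale E B"
    and z: "z \<in> center H" and zz: "z \<otimes> z = \<one>"
  shows "rep_character scale H B act z = - rep_character scale H B act \<one> \<longleftrightarrow> (\<forall>x\<in>E. act x z = scale (-1) x)"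
proof -
  have rr: "right_rep scale H E act" and E0: "E \<noteq> {0}"
    using irr unfolding irreducible_rep_def by auto
  have zH: "z \<in> carrier H" using z unfolding center_def by auto
  have finB: "finite B" using B unfolding is_basis_def by auto
  have cB: "card B > 0" using basis_nonempty[OF B E0] finB by (simp add: card_gt_0_iff)
  have 1: "rep_character scale H B act z = of_nat (card B)" if "\<forall>x\<in>E. act x z = x"
    using that basis_mem[OF B] zH by (simp add: rep_character_eq mcoef_def rep_basis[OF B])
  have 2: "rep_character scale H B act z = - of_nat (card B)" if "\<forall>x\<in>E. act x z = scale (-1) x"
    using that basis_mem[OF B] zH
    by (simp add: rep_character_eq mcoef_def rep_scale[OF B] rep_basis[OF B] del: vs.scale_minus_left)
  have "of_nat (card B) \<noteq> (- of_nat (card B) :: complex)" using cB by (simp add: complex_eq_iff)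
  then show ?thesis using central_scalar[OF assms] 1 2 character_one[OF rr B] by metis
qed

lemma odd_character_mult:
  assumes irr: "irreducible_rep scale H E act" and B: "is_basis scale E B"
    and z: "z \<in> center H" and zz: "z \<otimes> z = \<one>"
    and o: "rep_character scale H B act z = - rep_character scale H B act \<one>" and h: "h \<in> carrier H"
  shows "rep_character scale H B act (z \<otimes> h) = - rep_character scale H B act h"
proof -
  have rr: "right_rep scale H E act" using irr unfolding irreducible_rep_def by auto
  have zH: "z \<in> carrier H" using z unfolding center_def by auto
  have "act b (z \<otimes> h) = scale (-1) (act b h)" if "b \<in> B" for b
    using o odd_character_scalar[OF irr B z zz] basis_mem[OF B that] right_repD(5)[OF rr _ zH h]
    by (simp add: lin_onD(2)[OF right_repD(2)[OF rr h]] del: vs.scale_minus_left)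
  then show ?thesis
    using h zH basis_mem[OF B] right_repD(3)[OF rr _ h]
    by (simp add: rep_character_eq mcoef_def rep_scale[OF B] sum_negf del: vs.scale_minus_left)
qed

end

section \<open>Irreducible subrepresentations, central operators, and transfer to sequences\<close>

context fin_group_vs
begin

lemma subspace_has_basis:
  assumes "vs.subspace W" "W \<subseteq> vs.span S" "finite S"
  obtains B where "is_basis scale W B"
proof -
  obtain B where B: "B \<subseteq> W" "vs.independent B" "W \<subseteq> vs.span B"
    using vs.maximal_independent_subset[of W] by blast
  have "finite B" using vs.independent_span_bound[OF assms(3) B(2)] B(1) assms(2) by blast
  moreover have "vs.span B = W" using B assms(1) vs.span_minimal[of B W] by blast
  ultimately show ?thesis using that B(2) unfolding is_basis_def by blast
qed

text \<open>A nonzero invariant subspace of \<open>K\<close> with a basis of least cardinality is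
  irreducible. The finite set \<open>S\<close> guarantees that finite bases exist.\<close>

lemma irreducible_subrep:
  assumes rr: "right_rep scale H E act" and K: "vs.subspace K" "K \<subseteq> E" "K \<noteq> {0}"
    and Kinv: "\<And>w h. w \<in> K \<Longrightarrow> h \<in> carrier H \<Longrightarrow> act w h \<in> K"
    and S: "E \<subseteq> vs.span S" "finite S"
  obtains W B where "W \<subseteq> K" "irreducible_rep scale H W act" "is_basis scale W B"
proof -
  define P where "P n W B \<longleftrightarrow> W \<subseteq> K \<and> W \<noteq> {0} \<and> (\<forall>w\<in>W. \<forall>h\<in>carrier H. act w h \<in> W)
      \<and> is_basis scale W B \<and> card B = n" for n W B
  obtain BK where "is_basis scale K BK" using subspace_has_basis[OF K(1) _ S(2)] K(2) S(1) by blast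
  then have "P (card BK) K BK" unfolding P_def using K Kinv by auto
  then have "\<exists>n. \<exists>W B. P n W B" by blast
  from exists_least_iff[THEN iffD1, OF this]
  obtain n W B where P: "P n W B" and least: "\<And>m W' B'. m < n \<Longrightarrow> \<not> P m W' B'" by blast
  have W: "W \<subseteq> K" "W \<noteq> {0}" "\<And>w h. w \<in> W \<Longrightarrow> h \<in> carrier H \<Longrightarrow> act w h \<in> W"
    and B: "is_basis scale W B" and n: "card B = n" using P unfolding P_def by auto
  have WE: "W \<subseteq> E" using W(1) K(2) by auto
  have fB: "finite B" and spB: "vs.span B = W" using B unfolding is_basis_def by auto
  have "right_rep scale H W act"
    using rr WE W(3) basis_subspace[OF B] unfolding right_rep_def by blast
  moreover have "W' = {0} \<or> W' = W"
    if W': "vs.subspace W'" "W' \<subseteq> W" "\<forall>w\<in>W'. \<forall>h\<in>carrier H. act w h \<in> W'" for W'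
  proof (rule ccontr)
    assume *: "\<not> (W' = {0} \<or> W' = W)"
    obtain B' where B': "is_basis scale W' B'"
      using subspace_has_basis[OF W'(1) _ fB] W'(2) spB by blast
    have iB': "vs.independent B'" and fB': "finite B'" and spB': "vs.span B' = W'"
      using B' unfolding is_basis_def by auto
    have "P (card B') W' B'" unfolding P_def using * W' B' W(1) by auto
    then have ge: "card B' \<ge> n" using least by (meson not_less)
    obtain w where w: "w \<in> W" "w \<notin> W'" using * W'(2) by auto
    \<comment> \<open>One more vector of \<open>W\<close> fits next to a basis of the proper
      subspace \<open>W'\<close>, which makes the latter too small for the minimal choice.\<close>
    have "vs.independent (insert w B')" using w(2) iB' spB' by (intro vs.independent_insertI) auto
    moreover have "insert w B' \<subseteq> vs.span B" using w(1) W'(2) spB spB' vs.span_superset[of B'] by blast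
    ultimately have "card (insert w B') \<le> card B" using vs.independent_span_bound[OF fB] by blast
    moreover have "w \<notin> B'" using w(2) spB' vs.span_superset[of B'] by blast
    ultimately show False using ge n fB' by simp
  qed
  ultimately have "irreducible_rep scale H W act" unfolding irreducible_rep_def using W(2) by blast
  then show ?thesis using that W(1) B by blast
qed

text \<open>The action of the group algebra element with coefficients \<open>f\<close>, which is
  central when \<open>f\<close> is a class function.\<close>

definition class_op :: "('v \<Rightarrow> 'g \<Rightarrow> 'v) \<Rightarrow> ('g \<Rightarrow> complex) \<Rightarrow> 'v \<Rightarrow> 'v" where
  "class_op act f x = (\<Sum>h\<in>carrier H. scale (f h) (act x h))"

lemma
  assumes rr: "right_rep scale H E act"
  shows class_op_lin: "lin_on E (class_op act f)"
    and class_op_in: "x \<in> E \<Longrightarrow> class_op act f x \<in> E"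
proof -
  show "lin_on E (class_op act f)"
    unfolding lin_on_def
  proof (intro conjI ballI allI)
    show "class_op act f (x + y) = class_op act f x + class_op act f y" if "x \<in> E" "y \<in> E" for x y
      unfolding class_op_def sum.distrib[symmetric] using that
      by (intro sum.cong) (auto simp: lin_onD(1)[OF right_repD(2)[OF rr]] vs.scale_right_distrib)
    show "class_op act f (scale c x) = scale c (class_op act f x)" if "x \<in> E" for c x
      unfolding class_op_def vs.scale_sum_right using that
      by (intro sum.cong) (auto simp: lin_onD(2)[OF right_repD(2)[OF rr]] mult.commute)
  qed
  show "class_op act f x \<in> E" if "x \<in> E"
    unfolding class_op_def using right_repD(1,3)[OF rr] that
    by (intro vs.subspace_sum) (auto intro: vs.subspace_scale)
qed

lemma class_op_comm:
  assumes rr: "right_rep scale H E act" and x: "x \<in> E" and k: "k \<in> carrier H"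
    and f: "\<And>g h. g \<in> carrier H \<Longrightarrow> h \<in> carrier H \<Longrightarrow> f (g \<otimes> h \<otimes> inv g) = f h"
  shows "class_op act f (act x k) = act (class_op act f x) k"
proof -
  have bij: "bij_betw (\<lambda>h. inv k \<otimes> h \<otimes> k) (carrier H) (carrier H)"
    using k by (intro bij_betw_byWitness[where f'="\<lambda>h. k \<otimes> h \<otimes> inv k"])
      (auto simp: m_assoc[symmetric], (simp add: m_assoc)+)
  have "class_op act f (act x k)
      = (\<Sum>h\<in>carrier H. scale (f (inv k \<otimes> h \<otimes> k)) (act (act x k) (inv k \<otimes> h \<otimes> k)))"
    unfolding class_op_def by (rule sum.reindex_bij_betw[OF bij, symmetric])
  also have "\<dots> = (\<Sum>h\<in>carrier H. act (scale (f h) (act x h)) k)"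
  proof (rule sum.cong[OF refl])
    fix h assume h: "h \<in> carrier H"
    have "f (inv k \<otimes> h \<otimes> k) = f h" using f[of "inv k" h] h k by simp
    moreover have "act (act x k) (inv k \<otimes> h \<otimes> k) = act (act x h) k"
      using x h k by (simp add: right_repD(5)[OF rr, symmetric] m_assoc[symmetric])
    ultimately show "scale (f (inv k \<otimes> h \<otimes> k)) (act (act x k) (inv k \<otimes> h \<otimes> k))
        = act (scale (f h) (act x h)) k"
      using right_repD(3)[OF rr x h] by (simp add: lin_onD(2)[OF right_repD(2)[OF rr k]])
  qed
  also have "\<dots> = act (class_op act f x) k"
    unfolding class_op_def
    using right_repD(3)[OF rr x] right_repD(1)[OF rr]
    by (subst act_sum[OF rr k]) (auto intro: vs.subspace_scale)
  finally show ?thesis .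
qed

text \<open>Both sides of the second equation are the trace of the operator: once as a scalar on a
  space of dimension \<open>card B\<close>, once summed over the group.\<close>

lemma class_op_irreducible:
  assumes irr: "irreducible_rep scale H E act" and B: "is_basis scale E B"
    and f: "\<And>g h. g \<in> carrier H \<Longrightarrow> h \<in> carrier H \<Longrightarrow> f (g \<otimes> h \<otimes> inv g) = f h"
  shows "\<exists>a. (\<forall>x\<in>E. class_op act f x = scale a x) \<and>
    a * of_nat (card B) = (\<Sum>h\<in>carrier H. f h * rep_character scale H B act h)"
proof -
  have rr: "right_rep scale H E act" using irr unfolding irreducible_rep_def by auto
  have "\<exists>a. \<forall>x\<in>E. class_op act f x = scale a x"
    by (rule schur_scalar[OF irr B class_op_lin[OF rr]])
      (auto intro: class_op_in[OF rr] class_op_comm[OF rr _ _ f])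
  then obtain a where a: "\<And>x. x \<in> E \<Longrightarrow> class_op act f x = scale a x" by auto
  have "a * of_nat (card B) = (\<Sum>b\<in>B. vs.representation B (class_op act f b) b)"
    using a basis_mem[OF B] by (simp add: rep_scale[OF B] rep_basis[OF B])
  also have "\<dots> = (\<Sum>b\<in>B. \<Sum>h\<in>carrier H. f h * mcoef B act h b b)"
    unfolding class_op_def
  proof (rule sum.cong[OF refl])
    fix b assume "b \<in> B"
    then have "b \<in> E" by (rule basis_mem[OF B])
    then show "vs.representation B (\<Sum>h\<in>carrier H. scale (f h) (act b h)) b
        = (\<Sum>h\<in>carrier H. f h * mcoef B act h b b)"
      using right_repD(1,3)[OF rr]
      by (subst rep_sum_comm[OF B]) (auto intro!: sum.cong vs.subspace_scale simp: rep_scale[OF B] mcoef_def)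
  qed
  also have "\<dots> = (\<Sum>h\<in>carrier H. f h * rep_character scale H B act h)"
    by (subst sum.swap) (simp add: rep_character_eq sum_distrib_left)
  finally show ?thesis using a by blast
qed

text \<open>If \<open>z\<close> acts trivially, replacing \<open>h\<close> by \<open>z h\<close> in
  the sum changes its sign. If \<open>z\<close> acts as -1, the character is odd and the
  orthogonality assumption kills the scalar.\<close>

lemma class_op_zero:
  assumes irr: "irreducible_rep scale H E act" and B: "is_basis scale E B"
    and z: "z \<in> center H" "z \<otimes> z = \<one>"
    and f: "\<And>g h. g \<in> carrier H \<Longrightarrow> h \<in> carrier H \<Longrightarrow> f (g \<otimes> h \<otimes> inv g) = f h"
    and fo: "\<And>h. h \<in> carrier H \<Longrightarrow> f (z \<otimes> h) = - f h"
    and orth: "rep_character scale H B act z = - rep_character scale H B act \<one> \<Longrightarrow>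
       (\<Sum>h\<in>carrier H. f h * rep_character scale H B act h) = 0"
    and x: "x \<in> E"
  shows "class_op act f x = 0"
proof -
  have rr: "right_rep scale H E act" and E0: "E \<noteq> {0}"
    using irr unfolding irreducible_rep_def by auto
  have cB: "card B > 0" using basis_nonempty[OF B E0] B by (simp add: card_gt_0_iff is_basis_def)
  have zH: "z \<in> carrier H" using z(1) unfolding center_def by auto
  obtain a where a: "\<And>x. x \<in> E \<Longrightarrow> class_op act f x = scale a x"
    and tr: "a * of_nat (card B) = (\<Sum>h\<in>carrier H. f h * rep_character scale H B act h)"
    using class_op_irreducible[OF irr B, of f] f by blast
  show ?thesis
  proof (cases "\<forall>x\<in>E. act x z = x")
    case True
    have bij: "bij_betw (\<lambda>h. z \<otimes> h) (carrier H) (carrier H)"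
      using zH by (intro bij_betw_byWitness[where f'="\<lambda>h. inv z \<otimes> h"]) (auto simp: m_assoc[symmetric])
    have "class_op act f x = (\<Sum>h\<in>carrier H. scale (f (z \<otimes> h)) (act x (z \<otimes> h)))"
      unfolding class_op_def by (rule sum.reindex_bij_betw[OF bij, symmetric])
    also have "\<dots> = - class_op act f x"
      unfolding class_op_def sum_negf[symmetric]
      using fo True x zH by (intro sum.cong) (auto simp: right_repD(5)[OF rr])
    finally have "class_op act f x = - class_op act f x" .
    then have "scale (1 + 1) (class_op act f x) = 0"
      by (simp only: vs.scale_left_distrib vs.scale_one) (simp add: eq_neg_iff_add_eq_0)
    then show ?thesis by simp
  next
    case False
    then have "rep_character scale H B act z = - rep_character scale H B act \<one>"
      using central_scalar[OF irr B z] odd_character_scalar[OF irr B z] by blast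
    then have "a = 0" using orth tr cB by auto
    then show ?thesis using a[OF x] by simp
  qed
qed

text \<open>An RSR may live in any complex vector space, while \<open>irr_chars\<close> admits only
  spaces of sequences; coordinates along an enumerated basis carry one into the other.\<close>

lemma irr_chars_transfer:
  assumes irr: "irreducible_rep scale H E act" and B: "is_basis scale E B"
  shows "rep_character scale H B act \<in> irr_chars H"
proof -
  define sc :: "complex \<Rightarrow> (nat \<Rightarrow> complex) \<Rightarrow> nat \<Rightarrow> complex" where "sc = (\<lambda>c v n. c * v n)"
  interpret F: fin_group_vs H sc
    by unfold_locales (auto simp: sc_def fun_eq_iff algebra_simps)
  have rr: "right_rep scale H E act" and E0: "E \<noteq> {0}"
    and irr': "\<And>W. vs.subspace W \<Longrightarrow> W \<subseteq> E \<Longrightarrow> (\<forall>w\<in>W. \<forall>h\<in>carrier H. act w h \<in> W) \<Longrightarrow> W = {0} \<or> W = E"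
    using irr unfolding irreducible_rep_def by auto
  note sE = right_repD(1)[OF rr]
  have fB: "finite B" and iB: "vs.independent B" using B unfolding is_basis_def by auto
  define n where "n = card B"
  obtain e where e: "bij_betw e {..<n} B"
    using ex_bij_betw_nat_finite[OF fB] unfolding n_def atLeast0LessThan by blast
  have eB: "k < n \<Longrightarrow> e k \<in> B" for k using e by (auto simp: bij_betw_def)
  have eE: "k < n \<Longrightarrow> e k \<in> E" for k using basis_mem[OF B eB] .
  \<comment> \<open>\<open>\<phi>\<close> takes coordinates and \<open>\<psi>\<close> forms the
    corresponding combination; they are mutually inverse between \<open>E\<close> and the sequences
    that vanish from \<open>n\<close> on.\<close>
  define \<phi> where "\<phi> x = (\<lambda>k. if k < n then vs.representation B x (e k) else 0)" for x
  define \<psi> where "\<psi> f = (\<Sum>k<n. scale (f k) (e k))" for f :: "nat \<Rightarrow> complex"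
  define E' where "E' = {f :: nat \<Rightarrow> complex. \<forall>k\<ge>n. f k = 0}"
  define \<delta> where "\<delta> k = (\<lambda>j. of_bool (j = k) :: complex)" for k :: nat
  define act' where "act' f h = \<phi> (act (\<psi> f) h)" for f h
  have \<phi>E: "\<phi> x \<in> E'" for x unfolding \<phi>_def E'_def by auto
  have \<psi>E: "\<psi> f \<in> E" for f
    unfolding \<psi>_def using eE sE by (intro vs.subspace_sum) (auto intro: vs.subspace_scale)
  have \<psi>\<phi>: "\<psi> (\<phi> x) = x" if "x \<in> E" for x
  proof -
    have "\<psi> (\<phi> x) = (\<Sum>k<n. scale (vs.representation B x (e k)) (e k))" unfolding \<psi>_def \<phi>_def by simp
    also have "\<dots> = (\<Sum>b\<in>B. scale (vs.representation B x b) b)" by (rule sum.reindex_bij_betw[OF e])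
    finally show ?thesis using rep_sum[OF B that] by simp
  qed
  have \<phi>\<psi>: "\<phi> (\<psi> f) = f" if "f \<in> E'" for f
  proof
    fix j
    show "\<phi> (\<psi> f) j = f j"
    proof (cases "j < n")
      case True
      have "\<phi> (\<psi> f) j = (\<Sum>k<n. vs.representation B (scale (f k) (e k)) (e j))"
        unfolding \<psi>_def \<phi>_def using True eE sE
        by (simp, subst rep_sum_comm[OF B]) (auto intro: vs.subspace_scale)
      also have "\<dots> = (\<Sum>k<n. if k = j then f k else 0)"
        using e eE eB True by (intro sum.cong) (auto simp: rep_scale[OF B] rep_basis[OF B] bij_betw_def inj_on_def)
      finally show ?thesis using True by simp
    qed (use that in \<open>auto simp: \<phi>_def E'_def\<close>)
  qed
  have \<phi>_add: "\<phi> (x + y) = \<phi> x + \<phi> y" if "x \<in> E" "y \<in> E" for x y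
    unfolding \<phi>_def using that by (auto simp: rep_add[OF B])
  have \<phi>_scale: "\<phi> (scale c x) = sc c (\<phi> x)" if "x \<in> E" for x c
    unfolding \<phi>_def sc_def using that by (auto simp: rep_scale[OF B])
  have \<psi>_add: "\<psi> (f + g) = \<psi> f + \<psi> g" for f g
    unfolding \<psi>_def by (simp add: vs.scale_left_distrib sum.distrib)
  have \<psi>_scale: "\<psi> (sc c f) = scale c (\<psi> f)" for c f
    unfolding \<psi>_def sc_def by (simp add: vs.scale_sum_right)
  have sE': "F.vs.subspace E'" unfolding F.vs.subspace_def by (auto simp: E'_def sc_def)
  have rr': "right_rep sc H E' act'"
    unfolding right_rep_def
  proof (intro conjI ballI allI)
    show "F.vs.subspace E'" by (rule sE')
    show "act' x h \<in> E'" for x h unfolding act'_def by (rule \<phi>E)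
    show "act' (x + y) h = act' x h + act' y h" if "h \<in> carrier H" for x y h
      unfolding act'_def using that \<psi>E right_repD(3)[OF rr \<psi>E that]
      by (simp add: \<psi>_add lin_onD(1)[OF right_repD(2)[OF rr that]] \<phi>_add)
    show "act' (sc c x) h = sc c (act' x h)" if "h \<in> carrier H" for c x h
      unfolding act'_def using that \<psi>E right_repD(3)[OF rr \<psi>E that]
      by (simp add: \<psi>_scale lin_onD(2)[OF right_repD(2)[OF rr that]] \<phi>_scale)
    show "act' x \<one> = x" if "x \<in> E'" for x
      unfolding act'_def using right_repD(4)[OF rr \<psi>E] \<phi>\<psi>[OF that] by simp
    show "act' x (g \<otimes> h) = act' (act' x g) h" if "g \<in> carrier H" "h \<in> carrier H" for x g h
      unfolding act'_def using that right_repD(3,5)[OF rr \<psi>E] \<psi>\<phi> by simp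
  qed
  have fB': "finite (\<delta> ` {..<n})" by simp
  have inj\<delta>: "inj_on \<delta> A" for A
  proof (rule inj_onI)
    fix i j assume "\<delta> i = \<delta> j"
    then have "\<delta> i i = \<delta> j i" by simp
    then show "i = j" by (simp add: \<delta>_def split: if_splits)
  qed
  have sum\<delta>: "(\<Sum>k<n. sc (u k) (\<delta> k)) = (\<lambda>k. if k < n then u k else 0)" for u
  proof
    fix j
    have "(\<Sum>k<n. sc (u k) (\<delta> k)) j = (\<Sum>k<n. u k * \<delta> k j)"
      by (induction n) (auto simp: sc_def)
    also have "\<dots> = (\<Sum>k<n. if k = j then u k else 0)"
      by (intro sum.cong) (auto simp: \<delta>_def)
    finally show "(\<Sum>k<n. sc (u k) (\<delta> k)) j = (if j < n then u j else 0)" by simp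
  qed
  have B': "is_basis sc E' (\<delta> ` {..<n})"
    unfolding is_basis_def
  proof (intro conjI)
    show "F.vs.independent (\<delta> ` {..<n})"
    proof
      assume "F.vs.dependent (\<delta> ` {..<n})"
      then obtain u v where v: "v \<in> \<delta> ` {..<n}" "u v \<noteq> 0"
        and s: "(\<Sum>v\<in>\<delta> ` {..<n}. sc (u v) v) = 0"
        using F.vs.dependent_finite[OF fB'] by auto
      obtain k where k: "k < n" "v = \<delta> k" using v by auto
      have "(\<Sum>k<n. sc (u (\<delta> k)) (\<delta> k)) = 0"
        using s by (simp add: sum.reindex[OF inj\<delta>])
      then have "u (\<delta> k) = 0" using sum\<delta>[of "\<lambda>k. u (\<delta> k)"] k(1) by (metis zero_fun_apply)
      then show False using v k by simp
    qed
    show "F.vs.span (\<delta> ` {..<n}) = E'"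
    proof
      show "F.vs.span (\<delta> ` {..<n}) \<subseteq> E'"
        using sE' by (intro F.vs.span_minimal) (auto simp: E'_def \<delta>_def)
      show "E' \<subseteq> F.vs.span (\<delta> ` {..<n})"
      proof
        fix f assume "f \<in> E'"
        then have "f = (\<Sum>k<n. sc (f k) (\<delta> k))" unfolding sum\<delta> E'_def by (auto simp: fun_eq_iff)
        moreover have "(\<Sum>k<n. sc (f k) (\<delta> k)) \<in> F.vs.span (\<delta> ` {..<n})"
          by (intro F.vs.span_sum F.vs.span_scale F.vs.span_base) auto
        ultimately show "f \<in> F.vs.span (\<delta> ` {..<n})" by simp
      qed
    qed
  qed simp
  have rep': "F.vs.representation (\<delta> ` {..<n}) f (\<delta> k) = f k" if f: "f \<in> E'" and k: "k < n" for f k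
  proof -
    have "f = (\<Sum>b\<in>\<delta> ` {..<n}. sc (F.vs.representation (\<delta> ` {..<n}) f b) b)"
      using F.rep_sum[OF B' f] by simp
    also have "\<dots> = (\<Sum>k<n. sc (F.vs.representation (\<delta> ` {..<n}) f (\<delta> k)) (\<delta> k))"
      by (simp add: sum.reindex[OF inj\<delta>])
    finally show ?thesis using k unfolding sum\<delta> by (metis (lifting))
  qed
  have "irreducible_rep sc H E' act'"
    unfolding irreducible_rep_def
  proof (intro conjI allI impI rr')
    show "E' \<noteq> {0}"
    proof
      assume *: "E' = {0}"
      have "E \<subseteq> {0}"
      proof
        fix x assume x: "x \<in> E"
        have "\<phi> x = 0" using \<phi>E[of x] * by auto
        then show "x \<in> {0}" using \<psi>\<phi>[OF x] by (simp add: \<psi>_def)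
      qed
      then show False using E0 vs.subspace_0[OF sE] by auto
    qed
    fix W assume "F.vs.subspace W \<and> W \<subseteq> E' \<and> (\<forall>w\<in>W. \<forall>h\<in>carrier H. act' w h \<in> W)"
    then have W: "F.vs.subspace W" "W \<subseteq> E'" "\<And>w h. w \<in> W \<Longrightarrow> h \<in> carrier H \<Longrightarrow> act' w h \<in> W" by auto
    have "vs.subspace (\<psi> ` W)"
      unfolding vs.subspace_def
    proof (intro conjI ballI allI)
      show "0 \<in> \<psi> ` W" using F.vs.subspace_0[OF W(1)] by (intro image_eqI[of _ _ 0]) (auto simp: \<psi>_def)
      show "x + y \<in> \<psi> ` W" if "x \<in> \<psi> ` W" "y \<in> \<psi> ` W" for x y
        using that F.vs.subspace_add[OF W(1)] by (auto simp flip: \<psi>_add)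
      show "scale c x \<in> \<psi> ` W" if "x \<in> \<psi> ` W" for c x
        using that F.vs.subspace_scale[OF W(1)] by (auto simp flip: \<psi>_scale)
    qed
    moreover have "\<forall>w\<in>\<psi> ` W. \<forall>h\<in>carrier H. act w h \<in> \<psi> ` W"
    proof (intro ballI)
      fix w h assume w: "w \<in> \<psi> ` W" and h: "h \<in> carrier H"
      then obtain f where f: "f \<in> W" "w = \<psi> f" by auto
      have "act w h = \<psi> (act' f h)"
        unfolding act'_def f(2) using \<psi>\<phi>[OF right_repD(3)[OF rr \<psi>E h]] by simp
      then show "act w h \<in> \<psi> ` W" using W(3)[OF f(1) h] by auto
    qed
    ultimately have "\<psi> ` W = {0} \<or> \<psi> ` W = E" using irr'[of "\<psi> ` W"] \<psi>E by auto
    then show "W = {0} \<or> W = E'"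
    proof
      assume *: "\<psi> ` W = {0}"
      have "f = 0" if "f \<in> W" for f
      proof -
        have "\<psi> f = \<psi> 0" using * that by (auto simp: \<psi>_def)
        then have "\<phi> (\<psi> f) = \<phi> (\<psi> 0)" by simp
        then show ?thesis using \<phi>\<psi>[of f] \<phi>\<psi>[of 0] that W(2) F.vs.subspace_0[OF sE'] by auto
      qed
      then show ?thesis using F.vs.subspace_0[OF W(1)] by auto
    next
      assume *: "\<psi> ` W = E"
      have "f \<in> W" if "f \<in> E'" for f
      proof -
        obtain g where "g \<in> W" "\<psi> f = \<psi> g" using * \<psi>E[of f] by auto
        then show ?thesis using \<phi>\<psi>[OF that] \<phi>\<psi>[of g] W(2) by auto
      qed
      then show ?thesis using W(2) by auto
    qed
  qed
  moreover have "rep_character scale H B act = rep_character sc H (\<delta> ` {..<n}) act'"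
  proof
    fix h
    show "rep_character scale H B act h = rep_character sc H (\<delta> ` {..<n}) act' h"
    proof (cases "h \<in> carrier H")
      case True
      have \<psi>\<delta>: "\<psi> (\<delta> k) = e k" if "k < n" for k
      proof -
        have "\<phi> (e k) = \<delta> k"
          unfolding \<phi>_def \<delta>_def using that e eB[OF that]
          by (auto simp: fun_eq_iff rep_basis[OF B] bij_betw_def inj_on_def)
        then show ?thesis using \<psi>\<phi>[OF eE[OF that]] by simp
      qed
      have "rep_character sc H (\<delta> ` {..<n}) act' h = (\<Sum>k<n. act' (\<delta> k) h k)"
        using True rep'[OF \<phi>E] by (simp add: rep_character_def sum.reindex[OF inj\<delta>] act'_def)
      also have "\<dots> = (\<Sum>k<n. vs.representation B (act (e k) h) (e k))"
        by (intro sum.cong) (auto simp: act'_def \<psi>\<delta> \<phi>_def)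
      also have "\<dots> = (\<Sum>b\<in>B. vs.representation B (act b h) b)" by (rule sum.reindex_bij_betw[OF e])
      finally show ?thesis using True by (simp add: rep_character_def)
    qed (simp add: rep_character_def)
  qed
  ultimately show ?thesis unfolding irr_chars_def Let_def sc_def[symmetric] using B' by blast
qed

end

section \<open>The regular representation and completeness of the odd characters\<close>

definition fscale :: "complex \<Rightarrow> ('a \<Rightarrow> complex) \<Rightarrow> 'a \<Rightarrow> complex" where
  "fscale c v = (\<lambda>g. c * v g)"

lemma sum_apply: "(\<Sum>i\<in>I. (f i :: 'a \<Rightarrow> complex)) x = (\<Sum>i\<in>I. f i x)"
  by (induction I rule: infinite_finite_induct) auto

context fin_group
begin

lemma bij_mult_right: "k \<in> carrier H \<Longrightarrow> bij_betw (\<lambda>h. h \<otimes> k) (carrier H) (carrier H)"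
  by (intro bij_betw_byWitness[where f'="\<lambda>h. h \<otimes> inv k"]) (auto simp: m_assoc)

lemma bij_inv: "bij_betw (\<lambda>h. inv h) (carrier H) (carrier H)"
  by (intro bij_betw_byWitness[where f'="\<lambda>h. inv h"]) auto

interpretation R: fin_group_vs H "fscale :: complex \<Rightarrow> ('g \<Rightarrow> complex) \<Rightarrow> 'g \<Rightarrow> complex"
  by unfold_locales (auto simp: fscale_def fun_eq_iff algebra_simps)

text \<open>The type may contain more than the carrier, so functions are forced to vanish outside
  it; this keeps the space finite-dimensional and the form definite.\<close>

definition regular :: "('g \<Rightarrow> complex) set" where
  "regular = {v. \<forall>g. g \<notin> carrier H \<longrightarrow> v g = 0}"

text \<open>Translation by the inverse, on the right of the argument, is what makes this a right
  action.\<close>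

definition shift :: "('g \<Rightarrow> complex) \<Rightarrow> 'g \<Rightarrow> 'g \<Rightarrow> complex" where
  "shift v h = (\<lambda>g. if g \<in> carrier H then v (g \<otimes> inv h) else 0)"

text \<open>The standard inner product is already invariant, since translations permute the
  group.\<close>

definition herm :: "('g \<Rightarrow> complex) \<Rightarrow> ('g \<Rightarrow> complex) \<Rightarrow> complex" where
  "herm u v = (\<Sum>g\<in>carrier H. u g * cnj (v g))"

lemma regular_rep: "right_rep fscale H regular shift"
  unfolding right_rep_def
proof (intro conjI ballI allI)
  show "R.vs.subspace regular" unfolding R.vs.subspace_def by (auto simp: regular_def fscale_def)
qed (auto simp: regular_def shift_def fscale_def fun_eq_iff m_assoc inv_mult_group)

lemma regular_span: "regular \<subseteq> R.vs.span ((\<lambda>g h. of_bool (h = g)) ` carrier H)"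
proof
  fix v assume v: "v \<in> regular"
  have "v = (\<Sum>g\<in>carrier H. fscale (v g) (\<lambda>h. of_bool (h = g)))"
  proof
    fix h
    have "(\<Sum>g\<in>carrier H. fscale (v g) (\<lambda>h. of_bool (h = g))) h = (\<Sum>g\<in>carrier H. v g * of_bool (h = g))"
      unfolding fscale_def sum_apply by simp
    also have "\<dots> = (\<Sum>g\<in>carrier H. if h = g then v g else 0)" by (intro sum.cong) auto
    also have "\<dots> = v h" using v finite_carrier by (simp add: regular_def)
    finally show "v h = (\<Sum>g\<in>carrier H. fscale (v g) (\<lambda>h. of_bool (h = g))) h" by simp
  qed
  moreover have "(\<Sum>g\<in>carrier H. fscale (v g) (\<lambda>h. of_bool (h = g))) \<in> R.vs.span ((\<lambda>g h. of_bool (h = g)) ` carrier H)"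
    by (intro R.vs.span_sum R.vs.span_scale R.vs.span_base) auto
  ultimately show "v \<in> R.vs.span ((\<lambda>g h. of_bool (h = g)) ` carrier H)" by simp
qed

lemma herm_shift:
  assumes "h \<in> carrier H"
  shows "herm (shift u h) v = herm u (shift v (inv h))"
proof -
  have "herm (shift u h) v = (\<Sum>g\<in>carrier H. shift u h (g \<otimes> h) * cnj (v (g \<otimes> h)))"
    unfolding herm_def by (rule sum.reindex_bij_betw[OF bij_mult_right[OF assms], symmetric])
  also have "\<dots> = herm u (shift v (inv h))"
    unfolding herm_def using assms by (intro sum.cong) (auto simp: shift_def m_assoc)
  finally show ?thesis .
qed

text \<open>Translations are unitary, so the adjoint inverts the group element and conjugates its
  coefficient.\<close>

lemma herm_adjoint:
  "herm (R.class_op shift f u) v = herm u (R.class_op shift (\<lambda>h. cnj (f (inv h))) v)"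
proof -
  have "herm (R.class_op shift f u) v = (\<Sum>h\<in>carrier H. f h * herm (shift u h) v)"
    unfolding herm_def R.class_op_def sum_apply sum_distrib_left sum_distrib_right
    by (subst sum.swap) (simp add: fscale_def mult_ac)
  also have "\<dots> = (\<Sum>h\<in>carrier H. f h * herm u (shift v (inv h)))"
    by (intro sum.cong) (auto simp: herm_shift)
  also have "\<dots> = (\<Sum>h\<in>carrier H. f (inv h) * herm u (shift v h))"
    using sum.reindex_bij_betw[OF bij_inv, of "\<lambda>h. f (inv h) * herm u (shift v h)"] by simp
  also have "\<dots> = herm u (R.class_op shift (\<lambda>h. cnj (f (inv h))) v)"
    unfolding herm_def R.class_op_def sum_apply sum_distrib_left cnj_sum
    by (subst sum.swap) (simp add: fscale_def mult_ac)
  finally show ?thesis .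
qed

lemma herm_zero:
  assumes "v \<in> regular" "herm v v = 0"
  shows "v = 0"
proof
  fix g
  have "complex_of_real (\<Sum>g\<in>carrier H. (cmod (v g))\<^sup>2) = 0"
    using assms(2) unfolding herm_def of_real_sum complex_norm_square by simp
  then have "(\<Sum>g\<in>carrier H. (cmod (v g))\<^sup>2) = 0" using of_real_eq_0_iff by blast
  then have "g \<in> carrier H \<Longrightarrow> v g = 0"
    using sum_nonneg_eq_0_iff[OF finite_carrier, of "\<lambda>g. (cmod (v g))\<^sup>2"] by simp
  then show "v g = 0 g" using assms(1) unfolding regular_def by auto
qed

text \<open>The operator of \<open>f\<close> on the regular representation is shown to vanish.
  Otherwise its image \<open>K\<close> contains an irreducible \<open>W\<close>; by
  \<open>class_op_zero\<close> the operator kills \<open>W\<close>, which contradicts the behaviour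
  of its adjoint on \<open>W\<close>.\<close>

theorem odd_characters_complete:
  assumes z: "z \<in> center H" "z \<otimes> z = \<one>"
    and f: "\<And>g h. g \<in> carrier H \<Longrightarrow> h \<in> carrier H \<Longrightarrow> f (g \<otimes> h \<otimes> inv g) = f h"
    and fo: "\<And>h. h \<in> carrier H \<Longrightarrow> f (z \<otimes> h) = - f h"
    and orth: "\<And>\<chi>. \<chi> \<in> odd_irr_chars H z \<Longrightarrow> (\<Sum>h\<in>carrier H. f h * \<chi> h) = 0"
    and h: "h \<in> carrier H"
  shows "f h = 0"
proof -
  let ?T = "R.class_op shift f" and ?f' = "\<lambda>h. cnj (f (inv h))"
  note rr = regular_rep
  have sR: "R.vs.subspace regular" by (rule R.right_repD(1)[OF rr])
  note Tlin = R.class_op_lin[OF rr, of f] and Tin = R.class_op_in[OF rr, of _ f]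
  have f': "?f' (g \<otimes> h \<otimes> inv g) = ?f' h" if "g \<in> carrier H" "h \<in> carrier H" for g h
    using f[of g "inv h"] that by (simp add: inv_mult_group m_assoc)
  define K where "K = ?T ` regular"
  have K: "K = {0}"
  proof (rule ccontr)
    assume K0: "K \<noteq> {0}"
    have sK: "R.vs.subspace K"
      unfolding R.vs.subspace_def K_def
    proof (intro conjI ballI allI)
      show "0 \<in> ?T ` regular"
        using R.lin_on_0[OF Tlin sR] R.vs.subspace_0[OF sR] by (intro image_eqI[of _ _ 0]) auto
      show "x + y \<in> ?T ` regular" if "x \<in> ?T ` regular" "y \<in> ?T ` regular" for x y
        using that R.vs.subspace_add[OF sR] by (auto simp flip: R.lin_onD(1)[OF Tlin])
      show "fscale c x \<in> ?T ` regular" if "x \<in> ?T ` regular" for c x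
        using that R.vs.subspace_scale[OF sR] by (auto simp flip: R.lin_onD(2)[OF Tlin])
    qed
    have KR: "K \<subseteq> regular" unfolding K_def using Tin by auto
    have Kinv: "shift w h \<in> K" if "w \<in> K" "h \<in> carrier H" for w h
      using that R.right_repD(3)[OF rr] unfolding K_def
      by (auto simp flip: R.class_op_comm[OF rr _ _ f])
    obtain W B where W: "W \<subseteq> K" "irreducible_rep fscale H W shift" and B: "is_basis fscale W B"
      using R.irreducible_subrep[OF rr sK KR K0 Kinv regular_span] finite_carrier by blast
    have "R.class_op shift f w = 0" if "w \<in> W" for w
    proof (rule R.class_op_zero[OF W(2) B z f fo _ that])
      assume "rep_character fscale H B shift z = - rep_character fscale H B shift \<one>"
      then have "rep_character fscale H B shift \<in> odd_irr_chars H z"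
        unfolding odd_irr_chars_def using R.irr_chars_transfer[OF W(2) B] by simp
      then show "(\<Sum>h\<in>carrier H. f h * rep_character fscale H B shift h) = 0" by (rule orth)
    qed
    then have T0: "?T w = 0" if "w \<in> W" for w using that by blast
    \<comment> \<open>The adjoint has a class function as its coefficients too, hence is a scalar on
      \<open>W\<close>.\<close>
    obtain \<mu> where \<mu>: "\<And>w. w \<in> W \<Longrightarrow> R.class_op shift ?f' w = fscale \<mu> w"
      using R.class_op_irreducible[OF W(2) B, of ?f'] f' by blast
    have WR: "W \<subseteq> regular" using W(1) KR by auto
    have herm_sc: "herm u (fscale c v) = cnj c * herm u v" for u c v
      unfolding herm_def fscale_def sum_distrib_left by (simp add: mult_ac)
    \<comment> \<open>If the scalar is zero, writing \<open>w\<close> as a value of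
      \<open>?T\<close> and moving \<open>?T\<close> across the form gives a zero norm. If not, the
      norm times the conjugate of \<open>\<mu>\<close> is the product of \<open>?T w = 0\<close>
      with \<open>w\<close>.\<close>
    have "w = 0" if w: "w \<in> W" for w
    proof (cases "\<mu> = 0")
      case True
      obtain u where u: "w = ?T u" using w W(1) unfolding K_def by auto
      have "herm w w = herm u (fscale \<mu> w)" unfolding u herm_adjoint using \<mu> w u by simp
      moreover have "herm u 0 = 0" by (simp add: herm_def)
      ultimately show ?thesis using True herm_zero[of w] w WR by auto
    next
      case False
      have "cnj \<mu> * herm w w = herm (?T w) w" unfolding herm_adjoint using \<mu>[OF w] herm_sc by simp
      also have "\<dots> = 0" using T0[OF w] by (simp add: herm_def)
      finally show ?thesis using False herm_zero[of w] w WR by auto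
    qed
    moreover have "W \<noteq> {0}" using W(2) unfolding irreducible_rep_def by auto
    moreover have "0 \<in> W" using R.vs.subspace_0[OF R.basis_subspace[OF B]] .
    ultimately show False by auto
  qed
  \<comment> \<open>The operator sends the indicator of the identity to \<open>f\<close>
    itself.\<close>
  define e where "e = (\<lambda>g. of_bool (g = \<one>) :: complex)"
  have "e \<in> regular" unfolding e_def regular_def by auto
  then have "?T e = 0" using K unfolding K_def by auto
  moreover have "?T e h = (\<Sum>k\<in>carrier H. if k = h then f k else 0)"
    unfolding R.class_op_def sum_apply using h
  proof (intro sum.cong refl)
    fix k assume k: "k \<in> carrier H"
    have "h \<otimes> inv k = \<one> \<longleftrightarrow> k = h" 
    proof
      assume "h \<otimes> inv k = \<one>"
      then have "h \<otimes> inv k \<otimes> k = k" using k by simp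
      then show "k = h" using h k by (simp add: m_assoc)
    qed (use h in auto)
    then show "fscale (f k) (shift e k) h = (if k = h then f k else 0)"
      using h by (simp add: fscale_def shift_def e_def)
  qed
  ultimately show ?thesis using h finite_carrier by simp
qed

end

lemma irr_chars_alt:
  "irr_chars H = {\<chi>. \<exists>E B act. irreducible_rep (fscale :: complex \<Rightarrow> (nat \<Rightarrow> complex) \<Rightarrow> nat \<Rightarrow> complex) H E act \<and>
     is_basis fscale E B \<and> \<chi> = rep_character fscale H B act}"
proof -
  have "(\<lambda>c (v :: nat \<Rightarrow> complex) n. c * v n) = fscale" by (simp add: fscale_def fun_eq_iff)
  then show ?thesis unfolding irr_chars_def by simp
qed

section \<open>The number of odd characters in terms of conjugacy classes\<close>

context fin_group
begin
interpretation R: fin_group_vs H "fscale :: complex \<Rightarrow> ('g \<Rightarrow> complex) \<Rightarrow> 'g \<Rightarrow> complex"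
  by unfold_locales (auto simp: fscale_def fun_eq_iff algebra_simps)
definition conjg :: "'g \<Rightarrow> 'g \<Rightarrow> 'g" where
  "conjg g h = g \<otimes> h \<otimes> inv g"

lemma conjg_closed [simp]: "g \<in> carrier H \<Longrightarrow> h \<in> carrier H \<Longrightarrow> conjg g h \<in> carrier H"
  unfolding conjg_def by simp

lemma conjg_conjg:
  "g \<in> carrier H \<Longrightarrow> k \<in> carrier H \<Longrightarrow> h \<in> carrier H \<Longrightarrow> conjg k (conjg g h) = conjg (k \<otimes> g) h"
  unfolding conjg_def by (simp add: inv_mult_group m_assoc)

lemma conjg_one [simp]: "h \<in> carrier H \<Longrightarrow> conjg \<one> h = h"
  unfolding conjg_def by simp

lemma conjg_inv_cancel:
  "g \<in> carrier H \<Longrightarrow> h \<in> carrier H \<Longrightarrow> conjg (inv g) (conjg g h) = h"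
  by (simp add: conjg_conjg)

lemma conjg_central:
  assumes "z \<in> center H" "k \<in> carrier H" "h \<in> carrier H"
  shows "conjg k (z \<otimes> h) = z \<otimes> conjg k h"
proof -
  have z: "z \<in> carrier H" "k \<otimes> z = z \<otimes> k" using assms unfolding center_def by auto
  then show ?thesis using assms unfolding conjg_def by (simp add: m_assoc[symmetric])
qed

text \<open>Two independent spanning families of the same space \<open>Odd\<close> are compared by
  the exchange lemma in both directions. The last alternative of \<open>cover\<close> admits the
  classes stable under \<open>z\<close>, on which an odd class function vanishes.\<close>

lemma card_odd_irr_chars:
  fixes x :: "nat \<Rightarrow> 'g"
  assumes z: "z \<in> center H" "z \<otimes> z = \<one>"
    and x: "\<And>i. i < m \<Longrightarrow> x i \<in> carrier H"
    and cover: "\<And>h. h \<in> carrier H \<Longrightarrow>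
       (\<exists>i<m. \<exists>g\<in>carrier H. h = conjg g (x i) \<or> h = z \<otimes> conjg g (x i)) \<or>
       (\<exists>g\<in>carrier H. conjg g h = z \<otimes> h)"
    and nonconj: "\<And>i j g. i < m \<Longrightarrow> j < m \<Longrightarrow> g \<in> carrier H \<Longrightarrow> x j = conjg g (x i) \<Longrightarrow> i = j"
    and nonconj': "\<And>i j g. i < m \<Longrightarrow> j < m \<Longrightarrow> g \<in> carrier H \<Longrightarrow> x j \<noteq> z \<otimes> conjg g (x i)"
  shows "card (odd_irr_chars H z) = m"
proof -
  have zH: "z \<in> carrier H" and zc: "h \<in> carrier H \<Longrightarrow> z \<otimes> h = h \<otimes> z" for h
    using z(1) unfolding center_def by auto
  define Odd where "Odd = {f :: 'g \<Rightarrow> complex. (\<forall>h. h \<notin> carrier H \<longrightarrow> f h = 0) \<and>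
     (\<forall>g\<in>carrier H. \<forall>h\<in>carrier H. f (conjg g h) = f h) \<and> (\<forall>h\<in>carrier H. f (z \<otimes> h) = - f h)}"
  have OddI: "f (conjg g h) = f h" "f (z \<otimes> h) = - f h"
    if "f \<in> Odd" "g \<in> carrier H" "h \<in> carrier H" for f g h
    using that unfolding Odd_def by blast+
  \<comment> \<open>Characters are \<open>undefined\<close> off the carrier; extension by zero
    brings them into \<open>Odd\<close> without identifying any two.\<close>
  define tr where "tr \<chi> = (\<lambda>h. if h \<in> carrier H then \<chi> h else 0)" for \<chi> :: "'g \<Rightarrow> complex"
  define X where "X = tr ` odd_irr_chars H z"
  interpret F: fin_group_vs H "fscale :: complex \<Rightarrow> (nat \<Rightarrow> complex) \<Rightarrow> nat \<Rightarrow> complex"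
    by unfold_locales (auto simp: fscale_def fun_eq_iff algebra_simps)
  have charE: "\<exists>E B act. irreducible_rep fscale H E act \<and> is_basis fscale E B \<and>
      \<chi> = rep_character (fscale :: complex \<Rightarrow> (nat \<Rightarrow> complex) \<Rightarrow> nat \<Rightarrow> complex) H B act" if "\<chi> \<in> odd_irr_chars H z" for \<chi>
    using that unfolding odd_irr_chars_def irr_chars_alt by simp
  have "inj_on tr (odd_irr_chars H z)"
  proof (rule inj_onI)
    fix \<chi> \<chi>' assume *: "\<chi> \<in> odd_irr_chars H z" "\<chi>' \<in> odd_irr_chars H z" "tr \<chi> = tr \<chi>'"
    show "\<chi> = \<chi>'"
    proof
      fix h
      show "\<chi> h = \<chi>' h"
      proof (cases "h \<in> carrier H")
        case True
        then show ?thesis using fun_cong[OF *(3), of h] by (simp add: tr_def)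
      next
        case False
        have "\<chi> h = undefined" if c: "\<chi> \<in> odd_irr_chars H z" for \<chi>
        proof -
          obtain E B act where "irreducible_rep fscale H E act \<and> is_basis fscale E B \<and>
            \<chi> = rep_character (fscale :: complex \<Rightarrow> (nat \<Rightarrow> complex) \<Rightarrow> nat \<Rightarrow> complex) H B act"
            using charE[OF c] by blast
          then show ?thesis using False by (simp add: rep_character_def)
        qed
        from this[OF *(1)] this[OF *(2)] show ?thesis by simp
      qed
    qed
  qed
  then have cardX: "card X = card (odd_irr_chars H z)" unfolding X_def by (rule card_image)
  have XO: "X \<subseteq> Odd"
  proof
    fix f assume "f \<in> X"
    then obtain \<chi> where \<chi>: "\<chi> \<in> odd_irr_chars H z" "f = tr \<chi>" unfolding X_def by auto
    obtain E B act where E: "irreducible_rep fscale H E act" "is_basis fscale E B"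
      "\<chi> = rep_character (fscale :: complex \<Rightarrow> (nat \<Rightarrow> complex) \<Rightarrow> nat \<Rightarrow> complex) H B act" using charE[OF \<chi>(1)] by blast
    have "right_rep fscale H E act" using E(1) unfolding irreducible_rep_def by auto
    note cc = F.character_conj[OF this E(2), folded conjg_def]
    have "\<chi> z = - \<chi> \<one>" using \<chi>(1) unfolding odd_irr_chars_def by auto
    note cm = F.odd_character_mult[OF E(1,2) z this[unfolded E(3)]]
    show "f \<in> Odd" unfolding Odd_def \<chi>(2) E(3) tr_def using zH by (auto simp: cc cm)
  qed
  have pair: "F.pairing f f' = (if f = f' then of_nat (card (carrier H)) else 0)" if ff: "f \<in> X" "f' \<in> X" for f f'
  proof -
    obtain \<chi> \<chi>' where \<chi>: "\<chi> \<in> odd_irr_chars H z" "f = tr \<chi>" "\<chi>' \<in> odd_irr_chars H z" "f' = tr \<chi>'"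
      using ff unfolding X_def by auto
    obtain E B act where E: "irreducible_rep fscale H E act" "is_basis fscale E B"
      "\<chi> = rep_character (fscale :: complex \<Rightarrow> (nat \<Rightarrow> complex) \<Rightarrow> nat \<Rightarrow> complex) H B act" using charE[OF \<chi>(1)] by blast
    obtain E' B' act' where E': "irreducible_rep fscale H E' act'" "is_basis fscale E' B'"
      "\<chi>' = rep_character (fscale :: complex \<Rightarrow> (nat \<Rightarrow> complex) \<Rightarrow> nat \<Rightarrow> complex) H B' act'" using charE[OF \<chi>(3)] by blast
    have p: "F.pairing f f' = F.pairing \<chi> \<chi>'"
      unfolding F.pairing_def \<chi> tr_def by (intro sum.cong) auto
    show ?thesis
    proof (cases "\<chi> = \<chi>'")
      case True
      then show ?thesis using p F.character_norm[OF E(1,2)] \<chi> E(3) by simp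
    next
      case False
      then have "f \<noteq> f'" using \<open>inj_on tr _\<close> \<chi> by (auto dest: inj_onD)
      then show ?thesis using p F.character_orthogonal[OF E(1) E'(1) E(2) E'(2)] False E(3) E'(3) by simp
    qed
  qed
  have cH: "card (carrier H) > 0" using finite_carrier by (auto simp: card_gt_0_iff)
  have pair_sum: "F.pairing (\<Sum>i\<in>I. fscale (c i) (v i)) f = (\<Sum>i\<in>I. c i * F.pairing (v i) f)"
    for I :: "('g \<Rightarrow> complex) set" and c v f
    unfolding F.pairing_def sum_apply fscale_def sum_distrib_left sum_distrib_right
    by (subst sum.swap) (simp add: mult_ac)
  have indX: "R.vs.independent X"
  proof
    assume "R.vs.dependent X"
    then obtain S u f where S: "finite S" "S \<subseteq> X" "(\<Sum>v\<in>S. fscale (u v) v) = 0" "f \<in> S" "u f \<noteq> 0"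
      unfolding R.vs.dependent_explicit by auto
    have "0 = F.pairing (\<Sum>v\<in>S. fscale (u v) v) f" unfolding S(3) by (simp add: F.pairing_def)
    also have "\<dots> = (\<Sum>v\<in>S. if v = f then u v * of_nat (card (carrier H)) else 0)"
      unfolding pair_sum using S pair[of _ f] by (intro sum.cong) (auto simp: subset_iff)
    also have "\<dots> = u f * of_nat (card (carrier H))" using S by simp
    finally show False using S(5) cH by simp
  qed
  \<comment> \<open>The signed indicator of the class of \<open>x i\<close> and of its translate by
    \<open>z\<close>.\<close>
  define \<delta> where "\<delta> i = (\<lambda>h. if \<exists>g\<in>carrier H. h = conjg g (x i) then 1
     else if \<exists>g\<in>carrier H. h = z \<otimes> conjg g (x i) then -1 else (0::complex))" for i
  have \<delta>x: "\<delta> i (x j) = of_bool (i = j)" if ij: "i < m" "j < m" for i j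
  proof (cases "i = j")
    case True
    have "\<exists>g\<in>carrier H. x j = conjg g (x i)" using True x[OF ij(2)] by (intro bexI[of _ \<one>]) auto
    then show ?thesis using True unfolding \<delta>_def by auto
  next
    case False
    then show ?thesis using nonconj[OF ij] nonconj'[OF ij] unfolding \<delta>_def by auto
  qed
  have zz: "z \<otimes> (z \<otimes> h) = h" if "h \<in> carrier H" for h using that zH z(2) by (simp add: m_assoc[symmetric])
  define cl where "cl i h \<longleftrightarrow> (\<exists>g\<in>carrier H. h = conjg g (x i))" for i h
  have cl_conj: "cl i (conjg k h) = cl i h" if i: "i < m" and k: "k \<in> carrier H" and h: "h \<in> carrier H" for i k h
  proof
    assume "cl i h"
    then obtain g where g: "g \<in> carrier H" "h = conjg g (x i)" unfolding cl_def by auto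
    then have "conjg k h = conjg (k \<otimes> g) (x i)" using conjg_conjg[OF _ k x[OF i]] by simp
    then show "cl i (conjg k h)" unfolding cl_def using k g by blast
  next
    assume "cl i (conjg k h)"
    then obtain g where g: "g \<in> carrier H" "conjg k h = conjg g (x i)" unfolding cl_def by auto
    have "h = conjg (inv k) (conjg k h)" using conjg_inv_cancel[OF k h] by simp
    also have "\<dots> = conjg (inv k \<otimes> g) (x i)" unfolding g(2) using k g x[OF i] by (simp add: conjg_conjg)
    finally show "cl i h" unfolding cl_def using k g by blast
  qed
  have \<delta>_alt: "\<delta> i h = (if cl i h then 1 else if cl i (z \<otimes> h) then -1 else 0)" if i: "i < m" and h: "h \<in> carrier H" for i h
  proof -
    have "(\<exists>g\<in>carrier H. h = z \<otimes> conjg g (x i)) = cl i (z \<otimes> h)"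
      unfolding cl_def
    proof (intro bex_cong refl)
      fix g assume g: "g \<in> carrier H"
      show "(h = z \<otimes> conjg g (x i)) = (z \<otimes> h = conjg g (x i))"
        using zz[OF h] zz[OF conjg_closed[OF g x[OF i]]] by auto
    qed
    then show ?thesis unfolding \<delta>_def cl_def by simp
  qed
  \<comment> \<open>The sign is well defined because \<open>x i\<close> is not conjugate to
    \<open>z\<close> times itself, which is the case \<open>i = j\<close> of
    \<open>nonconj'\<close>.\<close>
  have notboth: "\<not> (cl i h \<and> cl i (z \<otimes> h))" if i: "i < m" and h: "h \<in> carrier H" for i h
  proof
    assume "cl i h \<and> cl i (z \<otimes> h)"
    then obtain g where g: "g \<in> carrier H" "h = conjg g (x i)" and c2: "cl i (z \<otimes> h)" unfolding cl_def by auto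
    have "conjg (inv g) (z \<otimes> h) = z \<otimes> x i"
      using g h x[OF i] by (simp add: conjg_central[OF z(1)] conjg_inv_cancel)
    then have "cl i (z \<otimes> x i)" using cl_conj[OF i, of "inv g" "z \<otimes> h"] c2 g(1) h zH by simp
    then obtain k where k: "k \<in> carrier H" "z \<otimes> x i = conjg k (x i)" unfolding cl_def by auto
    then have "x i = z \<otimes> conjg k (x i)" using zz[OF x[OF i]] by simp
    then show False using nonconj'[OF i i k(1)] by simp
  qed
  have \<delta>O: "\<delta> i \<in> Odd" if i: "i < m" for i
    unfolding Odd_def
  proof (intro CollectI conjI ballI allI impI)
    show "\<delta> i h = 0" if "h \<notin> carrier H" for h using that zH x[OF i] unfolding \<delta>_def by auto
    show "\<delta> i (conjg g h) = \<delta> i h" if "g \<in> carrier H" "h \<in> carrier H" for g h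
      using that zH i by (simp add: \<delta>_alt cl_conj conjg_central[OF z(1), symmetric])
    show "\<delta> i (z \<otimes> h) = - \<delta> i h" if "h \<in> carrier H" for h
      using that zH i notboth[OF i that] by (auto simp: \<delta>_alt zz)
  qed
  have inj\<delta>: "inj_on \<delta> {..<m}"
  proof (rule inj_onI)
    fix i j assume ij: "i \<in> {..<m}" "j \<in> {..<m}" "\<delta> i = \<delta> j"
    then have "\<delta> i (x i) = \<delta> j (x i)" by simp
    then have "(1 :: complex) = of_bool (j = i)" using ij(1,2) by (simp only: \<delta>x lessThan_iff) simp
    then show "i = j" by (simp split: if_splits)
  qed
  \<comment> \<open>The difference of both sides is an odd class function vanishing at all
    \<open>x j\<close>, hence everywhere by \<open>cover\<close>.\<close>
  have O\<delta>: "f = (\<Sum>i<m. fscale (f (x i)) (\<delta> i))" if f: "f \<in> Odd" for f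
  proof
    fix h
    have "f h = (\<Sum>i<m. f (x i) * \<delta> i h)" if h: "h \<in> carrier H"
    proof -
      define d where "d = (\<lambda>h. f h - (\<Sum>i<m. f (x i) * \<delta> i h))"
      have dc: "d (conjg g h) = d h" if "g \<in> carrier H" "h \<in> carrier H" for g h
        unfolding d_def using OddI(1)[OF f that] OddI(1)[OF \<delta>O that] by simp
      have dz: "d (z \<otimes> h) = - d h" if "h \<in> carrier H" for h
        unfolding d_def using OddI(2)[OF f zH that] OddI(2)[OF \<delta>O zH that] by (simp add: sum_negf)
      have dx: "d (x j) = 0" if "j < m" for j
      proof -
        have "(\<Sum>i<m. f (x i) * \<delta> i (x j)) = (\<Sum>i<m. if i = j then f (x i) else 0)"
          using that by (intro sum.cong) (auto simp: \<delta>x)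
        then show ?thesis unfolding d_def using that by simp
      qed
      have "d h = 0"
        using cover[OF h]
      proof (elim disjE exE bexE conjE)
        fix i g assume "i < m" "g \<in> carrier H" "h = conjg g (x i)"
        then show ?thesis using dc x dx by simp
      next
        fix i g assume "i < m" "g \<in> carrier H" "h = z \<otimes> conjg g (x i)"
        then show ?thesis using dz[of "conjg g (x i)"] dc x dx by simp
      next
        fix g assume "g \<in> carrier H" "conjg g h = z \<otimes> h"
        then have "d h = - d h" using dc[of g h] dz[OF h] h by simp
        then show ?thesis by (simp add: eq_neg_iff_add_eq_0)
      qed
      then show ?thesis unfolding d_def by simp
    qed
    moreover have "f h = 0" "\<And>i. i < m \<Longrightarrow> \<delta> i h = 0" if "h \<notin> carrier H"
      using f \<delta>O that unfolding Odd_def by auto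
    ultimately show "f h = (\<Sum>i<m. fscale (f (x i)) (\<delta> i)) h"
      unfolding sum_apply fscale_def by (cases "h \<in> carrier H") auto
  qed
  have Osp\<delta>: "Odd \<subseteq> R.vs.span (\<delta> ` {..<m})"
  proof
    fix f assume f: "f \<in> Odd"
    have "(\<Sum>i<m. fscale (f (x i)) (\<delta> i)) \<in> R.vs.span (\<delta> ` {..<m})"
      by (intro R.vs.span_sum R.vs.span_scale R.vs.span_base) auto
    then show "f \<in> R.vs.span (\<delta> ` {..<m})" using O\<delta>[OF f] by simp
  qed
  have ind\<delta>: "R.vs.independent (\<delta> ` {..<m})"
  proof
    assume "R.vs.dependent (\<delta> ` {..<m})"
    then obtain u v where v: "v \<in> \<delta> ` {..<m}" "u v \<noteq> 0" and s: "(\<Sum>v\<in>\<delta> ` {..<m}. fscale (u v) v) = 0"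
      using R.vs.dependent_finite[of "\<delta> ` {..<m}"] by auto
    obtain j where j: "j < m" "v = \<delta> j" using v by auto
    have "0 = (\<Sum>v\<in>\<delta> ` {..<m}. fscale (u v) v) (x j)" unfolding s by simp
    also have "\<dots> = (\<Sum>i<m. u (\<delta> i) * \<delta> i (x j))"
      unfolding sum_apply by (simp add: sum.reindex[OF inj\<delta>] fscale_def)
    also have "\<dots> = (\<Sum>i<m. if i = j then u (\<delta> i) else 0)" using j by (intro sum.cong) (auto simp: \<delta>x)
    also have "\<dots> = u v" using j by simp
    finally show False using v(2) by simp
  qed
  have finX: "finite X" and "card X \<le> card (\<delta> ` {..<m})"
    using R.vs.independent_span_bound[OF _ indX, of "\<delta> ` {..<m}"] XO Osp\<delta> by auto
  then have le: "card X \<le> m" using card_image[OF inj\<delta>] by simp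
  have OspX: "Odd \<subseteq> R.vs.span X"
  proof
    fix f assume f: "f \<in> Odd"
    define N where "N = (of_nat (card (carrier H)) :: complex)"
    have N0: "N \<noteq> 0" unfolding N_def using cH by simp
    \<comment> \<open>The orthogonal projection of \<open>f\<close> to the span of the characters.
      The remainder pairs to zero with every character, so completeness annihilates it.\<close>
    define p where "p = (\<Sum>\<chi>\<in>X. fscale (F.pairing f \<chi> / N) \<chi>)"
    define d where "d = f - p"
    have pO: "p \<in> R.vs.span X" unfolding p_def
      by (intro R.vs.span_sum R.vs.span_scale R.vs.span_base)
    have pc: "p (conjg g h) = p h" if "g \<in> carrier H" "h \<in> carrier H" for g h
      unfolding p_def sum_apply fscale_def 
    proof (intro sum.cong refl)
      fix \<chi> assume "\<chi> \<in> X"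
      then have "\<chi> (conjg g h) = \<chi> h" using OddI(1)[OF _ that] XO by blast
      then show "F.pairing f \<chi> / N * \<chi> (conjg g h) = F.pairing f \<chi> / N * \<chi> h" by simp
    qed
    have pz: "p (z \<otimes> h) = - p h" if "h \<in> carrier H" for h
      unfolding p_def sum_apply fscale_def sum_negf[symmetric]
    proof (intro sum.cong refl)
      fix \<chi> assume "\<chi> \<in> X"
      then have "\<chi> (z \<otimes> h) = - \<chi> h" using OddI(2)[OF _ zH that] XO by blast
      then show "F.pairing f \<chi> / N * \<chi> (z \<otimes> h) = - (F.pairing f \<chi> / N * \<chi> h)" by simp
    qed
    have dc: "d (conjg g h) = d h" if "g \<in> carrier H" "h \<in> carrier H" for g h
      unfolding d_def using OddI(1)[OF f that] pc[OF that] by simp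
    have dz: "d (z \<otimes> h) = - d h" if "h \<in> carrier H" for h
      unfolding d_def using OddI(2)[OF f zH that] pz[OF that] by simp
    have zi: "inv z = z" using zH z(2) inv_equality by blast
    have orth: "F.pairing d \<chi> = 0" if \<chi>: "\<chi> \<in> X" for \<chi>
    proof -
      have "F.pairing d \<chi> = F.pairing f \<chi> - F.pairing p \<chi>"
        unfolding F.pairing_def d_def by (simp add: left_diff_distrib sum_subtractf)
      also have "F.pairing p \<chi> = (\<Sum>\<chi>'\<in>X. if \<chi>' = \<chi> then F.pairing f \<chi>' / N * N else 0)"
        unfolding p_def pair_sum using \<chi> by (intro sum.cong) (auto simp: pair N_def)
      also have "\<dots> = F.pairing f \<chi>" using \<chi> finX N0 by simp
      finally show ?thesis by simp
    qed
    have "d h = 0" if h: "h \<in> carrier H" for h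
    proof -
      \<comment> \<open>Completeness is stated for a sum over equal arguments, whereas
        \<open>pairing\<close> inverts one of them; hence it is applied to \<open>d\<close> composed
        with inversion.\<close>
      have "d (inv (inv h)) = 0"
      proof (rule odd_characters_complete[OF z, where f="\<lambda>h. d (inv h)"])
        show "d (inv (g \<otimes> h \<otimes> inv g)) = d (inv h)" if "g \<in> carrier H" "h \<in> carrier H" for g h
          using dc[of g "inv h"] that by (simp add: conjg_def inv_mult_group m_assoc)
        show "d (inv (z \<otimes> h)) = - d (inv h)" if "h \<in> carrier H" for h
          using dz[of "inv h"] that zH zc[of "inv h"] zi by (simp add: inv_mult_group)
        show "(\<Sum>h\<in>carrier H. d (inv h) * \<chi> h) = 0" if "\<chi> \<in> odd_irr_chars H z" for \<chi>
        proof -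
          have "(\<Sum>h\<in>carrier H. d (inv h) * \<chi> h) = (\<Sum>h\<in>carrier H. d (inv (inv h)) * \<chi> (inv h))"
            by (rule sum.reindex_bij_betw[OF bij_inv, symmetric])
          also have "\<dots> = F.pairing d (tr \<chi>)" unfolding F.pairing_def tr_def by (intro sum.cong) auto
          also have "\<dots> = 0" using that by (intro orth) (auto simp: X_def)
          finally show ?thesis .
        qed
      qed (use h in auto)
      then show ?thesis using h by simp
    qed
    moreover have "d h = 0" if "h \<notin> carrier H" for h
      using that f XO unfolding d_def p_def sum_apply fscale_def Odd_def by (auto simp: sum_apply intro!: sum.neutral)
    ultimately have "d h = 0" for h by blast
    then have "d = 0" by (simp add: fun_eq_iff)
    then show "f \<in> R.vs.span X" using pO unfolding d_def by simp
  qed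
  have "card (\<delta> ` {..<m}) \<le> card X"
    using R.vs.independent_span_bound[OF finX ind\<delta>] \<delta>O OspX by auto
  then show ?thesis using le cardX card_image[OF inj\<delta>] by simp
qed

end

section \<open>Nichols algebras of trivially braided modules\<close>

lemma tensor_carrier: "t \<in> carrier (tensor_algebra V) \<longleftrightarrow> finite {w. t w \<noteq> 0} \<and> {w. t w \<noteq> 0} \<subseteq> lists (bas V)"
  unfolding tensor_algebra_def by simp

lemma tensor_support: "t \<in> carrier (tensor_algebra V) \<Longrightarrow> t w \<noteq> 0 \<Longrightarrow> w \<in> lists (bas V)"
  unfolding tensor_carrier by blast

lemma tensor_mult: "s \<otimes>\<^bsub>tensor_algebra V\<^esub> t = (\<lambda>w. \<Sum>k\<le>length w. s (take k w) * t (drop k w))"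
  unfolding tensor_algebra_def by simp

lemma tensor_add: "s \<oplus>\<^bsub>tensor_algebra V\<^esub> t = (\<lambda>w. s w + t w)"
  unfolding tensor_algebra_def by simp

lemma tensor_zero: "\<zero>\<^bsub>tensor_algebra V\<^esub> = (\<lambda>w. 0)"
  unfolding tensor_algebra_def by simp

lemma tensor_one: "\<one>\<^bsub>tensor_algebra V\<^esub> = (\<lambda>w. of_bool (w = []))"
  unfolding tensor_algebra_def by simp

lemma tensor_mult_closed:
  assumes s: "s \<in> carrier (tensor_algebra V)" and t: "t \<in> carrier (tensor_algebra V)"
  shows "s \<otimes>\<^bsub>tensor_algebra V\<^esub> t \<in> carrier (tensor_algebra V)"
proof -
  have "\<exists>k. s (take k w) \<noteq> 0 \<and> t (drop k w) \<noteq> 0"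
    if "(\<Sum>k\<le>length w. s (take k w) * t (drop k w)) \<noteq> 0" for w
  proof (rule ccontr)
    assume "\<nexists>k. s (take k w) \<noteq> 0 \<and> t (drop k w) \<noteq> 0"
    then have "(\<Sum>k\<le>length w. s (take k w) * t (drop k w)) = 0" by (intro sum.neutral) auto
    with that show False by contradiction
  qed
  then have sub: "{w. (s \<otimes>\<^bsub>tensor_algebra V\<^esub> t) w \<noteq> 0} \<subseteq> (\<lambda>(u, v). u @ v) ` ({u. s u \<noteq> 0} \<times> {v. t v \<noteq> 0})"
  proof (intro subsetI)
    fix w assume w: "w \<in> {w. (s \<otimes>\<^bsub>tensor_algebra V\<^esub> t) w \<noteq> 0}"
    assume "\<And>w. (\<Sum>k\<le>length w. s (take k w) * t (drop k w)) \<noteq> 0 \<Longrightarrow>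
      \<exists>k. s (take k w) \<noteq> 0 \<and> t (drop k w) \<noteq> 0"
    from this[of w] obtain k where "s (take k w) \<noteq> 0" "t (drop k w) \<noteq> 0"
      using w unfolding tensor_mult by auto
    then show "w \<in> (\<lambda>(u, v). u @ v) ` ({u. s u \<noteq> 0} \<times> {v. t v \<noteq> 0})"
      by (intro image_eqI[where x="(take k w, drop k w)"]) auto
  qed
  have "finite ((\<lambda>(u, v). u @ v) ` ({u. s u \<noteq> 0} \<times> {v. t v \<noteq> 0}))"
    using s t unfolding tensor_carrier by auto
  moreover have "(\<lambda>(u, v). u @ v) ` ({u. s u \<noteq> 0} \<times> {v. t v \<noteq> 0}) \<subseteq> lists (bas V)"
  proof
    fix w assume "w \<in> (\<lambda>(u, v). u @ v) ` ({u. s u \<noteq> 0} \<times> {v. t v \<noteq> 0})"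
    then obtain u v where "w = u @ v" "s u \<noteq> 0" "t v \<noteq> 0" by auto
    then show "w \<in> lists (bas V)" using tensor_support[OF s, of u] tensor_support[OF t, of v] by simp
  qed
  ultimately show ?thesis unfolding tensor_carrier using finite_subset[OF sub] order_trans[OF sub] by simp
qed

text \<open>Both products sum over the ways of cutting a word into three consecutive pieces, indexed
  either by the second cut or by the first.\<close>

lemma tensor_mult_assoc:
  "(s \<otimes>\<^bsub>tensor_algebra V\<^esub> t) \<otimes>\<^bsub>tensor_algebra V\<^esub> r = s \<otimes>\<^bsub>tensor_algebra V\<^esub> (t \<otimes>\<^bsub>tensor_algebra V\<^esub> r)"
proof
  fix w :: "'a list"
  let ?n = "length w"
  have "((s \<otimes>\<^bsub>tensor_algebra V\<^esub> t) \<otimes>\<^bsub>tensor_algebra V\<^esub> r) w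
     = (\<Sum>k\<le>?n. \<Sum>j\<le>k. s (take j w) * t (drop j (take k w)) * r (drop k w))"
    unfolding tensor_mult by (intro sum.cong) (auto simp: sum_distrib_right min_def)
  also have "\<dots> = (\<Sum>(k, j)\<in>(SIGMA k:{..?n}. {..k}). s (take j w) * t (drop j (take k w)) * r (drop k w))"
    by (rule sum.Sigma) auto
  also have "\<dots> = (\<Sum>(j, i)\<in>(SIGMA j:{..?n}. {..?n - j}). s (take j w) * t (take i (drop j w)) * r (drop i (drop j w)))"
    by (rule sum.reindex_bij_witness[where i="\<lambda>(j, i). (j + i, j)" and j="\<lambda>(k, j). (j, k - j)"])
      (auto simp: drop_take add.commute)
  also have "\<dots> = (\<Sum>j\<le>?n. \<Sum>i\<le>?n - j. s (take j w) * t (take i (drop j w)) * r (drop i (drop j w)))"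
    by (rule sum.Sigma[symmetric]) auto
  also have "\<dots> = (s \<otimes>\<^bsub>tensor_algebra V\<^esub> (t \<otimes>\<^bsub>tensor_algebra V\<^esub> r)) w"
    unfolding tensor_mult by (intro sum.cong) (auto simp: sum_distrib_left mult.assoc)
  finally show "((s \<otimes>\<^bsub>tensor_algebra V\<^esub> t) \<otimes>\<^bsub>tensor_algebra V\<^esub> r) w
     = (s \<otimes>\<^bsub>tensor_algebra V\<^esub> (t \<otimes>\<^bsub>tensor_algebra V\<^esub> r)) w" .
qed

text \<open>Scalars are the multiples of the empty word, so ideals of this ring are closed under
  scalar multiplication.\<close>

lemma tensor_scalar_mult:
  "(\<lambda>w. c * of_bool (w = [])) \<otimes>\<^bsub>tensor_algebra V\<^esub> t = (\<lambda>w. c * t w)"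
proof
  fix w :: "'a list"
  have "(\<Sum>k\<le>length w. c * of_bool (take k w = []) * t (drop k w)) = (\<Sum>k\<le>length w. if k = 0 then c * t w else 0)"
    by (intro sum.cong) auto
  then show "((\<lambda>w. c * of_bool (w = [])) \<otimes>\<^bsub>tensor_algebra V\<^esub> t) w = c * t w"
    unfolding tensor_mult by simp
qed

lemma tensor_mult_one: "t \<otimes>\<^bsub>tensor_algebra V\<^esub> \<one>\<^bsub>tensor_algebra V\<^esub> = t"
proof
  fix w :: "'a list"
  have "(\<Sum>k\<le>length w. t (take k w) * of_bool (drop k w = [])) = (\<Sum>k\<le>length w. if k = length w then t w else 0)"
    by (intro sum.cong) auto
  then show "(t \<otimes>\<^bsub>tensor_algebra V\<^esub> \<one>\<^bsub>tensor_algebra V\<^esub>) w = t w"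
    unfolding tensor_mult tensor_one by simp
qed

lemma ring_tensor_algebra: "ring (tensor_algebra V)"
proof (rule ringI)
  have fin: "finite {w. s w + t w \<noteq> 0}" "{w. s w + t w \<noteq> 0} \<subseteq> lists (bas V)"
    if "s \<in> carrier (tensor_algebra V)" "t \<in> carrier (tensor_algebra V)" for s t
  proof -
    have "{w. s w + t w \<noteq> 0} \<subseteq> {w. s w \<noteq> 0} \<union> {w. t w \<noteq> 0}" by auto
    with that show "finite {w. s w + t w \<noteq> 0}" "{w. s w + t w \<noteq> 0} \<subseteq> lists (bas V)"
      unfolding tensor_carrier by (auto dest: finite_subset)
  qed
  show "abelian_group (tensor_algebra V)"
  proof (rule abelian_groupI)
    show "\<exists>y\<in>carrier (tensor_algebra V). y \<oplus>\<^bsub>tensor_algebra V\<^esub> x = \<zero>\<^bsub>tensor_algebra V\<^esub>"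
      if "x \<in> carrier (tensor_algebra V)" for x
      using that by (intro bexI[of _ "\<lambda>w. - x w"]) (auto simp: tensor_carrier tensor_add tensor_zero)
  qed (use fin in \<open>auto simp: tensor_carrier tensor_add tensor_zero add_ac\<close>)
  show "monoid (tensor_algebra V)"
  proof (rule monoidI)
    show "\<one>\<^bsub>tensor_algebra V\<^esub> \<in> carrier (tensor_algebra V)"
      unfolding tensor_carrier tensor_one by (auto intro: finite_subset[of _ "{[]}"])
    show "\<one>\<^bsub>tensor_algebra V\<^esub> \<otimes>\<^bsub>tensor_algebra V\<^esub> x = x" for x
      using tensor_scalar_mult[where c=1 and t=x and V=V] unfolding tensor_one by simp
  qed (simp_all add: tensor_mult_closed tensor_mult_assoc tensor_mult_one)
qed (simp_all add: tensor_mult tensor_add distrib_left distrib_right sum.distrib)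

section \<open>Skew derivatives and powers of a basis vector\<close>

lemma word_coproduct_Nil: "word_coproduct V w (u, []) = of_bool (u = w)"
proof (induction w arbitrary: u)
  case (Cons c w)
  then show ?case by (cases u) auto
qed auto

text \<open>The first letter of \<open>w\<close> goes to the left factor, which is the induction
  hypothesis, or becomes the single right letter; then \<open>triv\<close> lets it pass the rest
  without a scalar. The coefficient is the quantum integer of n + 1 at parameter 1, nonzero in
  characteristic zero.\<close>

lemma word_coproduct_replicate:
  assumes fin: "finite (bas V)" and b: "b \<in> bas V"
    and triv: "\<And>y. y \<in> bas V \<Longrightarrow> coef V (deg V b) y b = of_bool (y = b)"
    and w: "w \<in> lists (bas V)"
  shows "word_coproduct V w (replicate n b, [b]) = of_nat (Suc n) * of_bool (w = replicate (Suc n) b)"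
  using w
proof (induction w arbitrary: n rule: list.induct)
  case (Cons c w)
  have w: "w \<in> lists (bas V)" using Cons.prems by simp
  have finL: "finite {u \<in> lists (bas V). length u = n}"
    using finite_lists_length_eq[OF fin, of n] by (auto simp: lists_eq_set conj_commute elim: rev_finite_subset)
  have wc: "word_coef V (deg V b) u (replicate n b) = of_bool (u = replicate n b)"
    if u: "u \<in> lists (bas V)" "length u = n" for u
  proof -
    have "word_coef V (deg V b) u (replicate n b) = (\<Prod>k<n. of_bool (u ! k = b))"
      unfolding word_coef_def using u b triv by (auto intro!: prod.cong simp: in_lists_conv_set)
    also have "\<dots> = of_bool (\<forall>k<n. u ! k = b)" by (induction n) (auto simp: less_Suc_eq)
    also have "(\<forall>k<n. u ! k = b) = (u = replicate n b)" using u(2) by (auto simp: list_eq_iff_nth_eq)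
    finally show ?thesis .
  qed
  have "(\<Sum>u\<in>{u \<in> lists (bas V). length u = n}. word_coef V (deg V b) u (replicate n b) * word_coproduct V w (u, []))
     = (\<Sum>u\<in>{u \<in> lists (bas V). length u = n}. if u = w then of_bool (w = replicate n b) else 0)"
    by (intro sum.cong) (auto simp: wc word_coproduct_Nil)
  also have "\<dots> = of_bool (w = replicate n b)" using finL w by auto
  finally have s: "(\<Sum>u\<in>{u \<in> lists (bas V). length u = n}. word_coef V (deg V b) u (replicate n b) * word_coproduct V w (u, []))
     = of_bool (w = replicate n b)" .
  show ?case
    using s Cons.IH[OF w] by (cases n) auto
qed auto

text \<open>This is the skew derivative of \<open>t\<close> along \<open>b\<close>. Terms of the
  coproduct whose right factor lies in \<open>I\<close> vanish at a one-letter word, because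
  \<open>I\<close> starts in degree 2; in all others the left factor lies in
  \<open>I\<close>.\<close>

lemma coideal_derivative:
  assumes I: "ideal I (tensor_algebra V)" "is_coideal V I"
    and deg: "\<And>t w. t \<in> I \<Longrightarrow> t w \<noteq> 0 \<Longrightarrow> 2 \<le> length w" and t: "t \<in> I"
  shows "(\<lambda>u. coproduct V t (u, [b])) \<in> I"
proof -
  interpret I: ideal I "tensor_algebra V" by fact
  have "\<exists>(n::nat) f g. (\<forall>k<n. (f k \<in> I \<and> g k \<in> carrier (tensor_algebra V)) \<or>
            (f k \<in> carrier (tensor_algebra V) \<and> g k \<in> I)) \<and>
     coproduct V t = (\<lambda>(u, v). \<Sum>k<n. f k u * g k v)"
    using I(2) t unfolding is_coideal_def by (rule bspec)
  then obtain n :: nat and f g where fg0: "\<forall>k<n. (f k \<in> I \<and> g k \<in> carrier (tensor_algebra V)) \<or>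
            (f k \<in> carrier (tensor_algebra V) \<and> g k \<in> I)"
    and eq: "coproduct V t = (\<lambda>(u, v). \<Sum>k<n. f k u * g k v)"
    by (elim exE conjE)
  have fg: "f k \<in> I \<or> g k \<in> I" if "k < n" for k using fg0 that by blast
  have sc: "(\<lambda>w. c * s w) \<in> I" if "s \<in> I" for c s
  proof -
    have "(\<lambda>w. c * of_bool (w = [])) \<in> carrier (tensor_algebra V)"
      unfolding tensor_carrier by (auto intro: finite_subset[of _ "{[]}"])
    from I.I_l_closed[OF that this] show ?thesis by (simp only: tensor_scalar_mult)
  qed
  have "(\<lambda>u. \<Sum>k<m. f k u * g k [b]) \<in> I" if "m \<le> n" for m
    using that
  proof (induction m)
    case 0
    then show ?case using additive_subgroup.zero_closed[OF ideal.axioms(1)[OF I(1)]] by (simp add: tensor_zero)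
  next
    case (Suc m)
    have "(\<lambda>u. f m u * g m [b]) \<in> I"
    proof (cases "f m \<in> I")
      case True
      then show ?thesis using sc[of "f m" "g m [b]"] by (simp add: mult.commute)
    next
      case False
      then have "g m [b] = 0" using fg[of m] Suc.prems deg[of "g m" "[b]"] by auto
      then show ?thesis using additive_subgroup.zero_closed[OF ideal.axioms(1)[OF I(1)]] by (simp add: tensor_zero)
    qed
    moreover have "(\<lambda>u. \<Sum>k<m. f k u * g k [b]) \<in> I" using Suc by simp
    ultimately have "(\<lambda>u. \<Sum>k<m. f k u * g k [b]) \<oplus>\<^bsub>tensor_algebra V\<^esub> (\<lambda>u. f m u * g m [b]) \<in> I"
      by (intro additive_subgroup.a_closed[OF ideal.axioms(1)[OF I(1)]])
    then show ?case by (simp add: tensor_add)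
  qed
  then show ?thesis unfolding eq by auto
qed

text \<open>Differentiating along \<open>b\<close> lowers the power by one, stays in
  \<open>I\<close>, and multiplies the coefficient by a nonzero integer.\<close>

lemma coideal_replicate_zero:
  assumes fin: "finite (bas V)" and b: "b \<in> bas V"
    and triv: "\<And>y. y \<in> bas V \<Longrightarrow> coef V (deg V b) y b = of_bool (y = b)"
    and I: "ideal I (tensor_algebra V)" "is_coideal V I"
    and deg: "\<And>t w. t \<in> I \<Longrightarrow> t w \<noteq> 0 \<Longrightarrow> 2 \<le> length w" and t: "t \<in> I"
  shows "t (replicate n b) = 0"
  using t
proof (induction n arbitrary: t)
  case 0
  then show ?case using deg[of t "[]"] by fastforce
next
  case (Suc n)
  interpret I: ideal I "tensor_algebra V" by fact
  have tc: "t \<in> carrier (tensor_algebra V)" using Suc.prems I.a_subset by auto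
  have "coproduct V t (replicate n b, [b])
      = (\<Sum>w | t w \<noteq> 0. if w = replicate (Suc n) b then of_nat (Suc n) * t w else 0)"
    unfolding coproduct_def
  proof (intro sum.cong refl)
    fix w assume "w \<in> {w. t w \<noteq> 0}"
    then have "w \<in> lists (bas V)" using tensor_support[OF tc] by simp
    then show "t w * word_coproduct V w (replicate n b, [b])
        = (if w = replicate (Suc n) b then of_nat (Suc n) * t w else 0)"
      using word_coproduct_replicate[OF fin b triv] by (simp del: replicate_Suc of_nat_Suc)
  qed
  also have "\<dots> = of_nat (Suc n) * t (replicate (Suc n) b)"
    using tc unfolding tensor_carrier by (simp del: replicate_Suc of_nat_Suc)
  finally show ?case
    using Suc.IH[OF coideal_derivative[OF I deg Suc.prems, where b=b]] by (simp del: replicate_Suc of_nat_Suc)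
qed

text \<open>Every admissible ideal consists of tensors without powers of \<open>b\<close>, so high
  powers of \<open>b\<close> escape the span of any finite set of classes.\<close>

theorem nichols_infinite:
  assumes fin: "finite (bas V)" and b: "b \<in> bas V"
    and triv: "\<And>y. y \<in> bas V \<Longrightarrow> coef V (deg V b) y b = of_bool (y = b)"
  shows "\<not> finite_dim_nichols V"
proof
  assume "finite_dim_nichols V"
  then obtain F where F: "finite F" "F \<subseteq> carrier (tensor_algebra V)"
    "\<And>A. A \<in> carrier (nichols_algebra V) \<Longrightarrow>
       \<exists>c. A = nichols_ideal V +>\<^bsub>tensor_algebra V\<^esub> (\<lambda>w. \<Sum>t\<in>F. c t * t w)"
    unfolding finite_dim_nichols_def by auto
  interpret T: ring "tensor_algebra V" by (rule ring_tensor_algebra)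
  \<comment> \<open>An ideal, since both pieces of a power of \<open>b\<close> cut in two are again
    powers of \<open>b\<close>.\<close>
  define K where "K = {t \<in> carrier (tensor_algebra V). \<forall>n. t (replicate n b) = 0}"
  have K: "ideal K (tensor_algebra V)"
  proof (rule idealI)
    show "ring (tensor_algebra V)" by (rule ring_tensor_algebra)
    have "a_inv (tensor_algebra V) t = (\<lambda>w. - t w)" if "t \<in> carrier (tensor_algebra V)" for t
      using that by (intro T.minus_equality) (auto simp: tensor_add tensor_zero tensor_carrier)
    then show "subgroup K (add_monoid (tensor_algebra V))"
      using T.add.m_closed
      by (intro T.add.subgroupI) (auto simp: K_def tensor_add a_inv_def[symmetric] tensor_zero tensor_carrier intro!: exI[of _ "\<lambda>w. 0"])
    show "x \<otimes>\<^bsub>tensor_algebra V\<^esub> a \<in> K" "a \<otimes>\<^bsub>tensor_algebra V\<^esub> x \<in> K"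
      if "a \<in> K" "x \<in> carrier (tensor_algebra V)" for a x
      using that T.m_closed unfolding K_def by (auto simp: tensor_mult take_replicate drop_replicate)
  qed
  have sub: "\<Union>{I. ideal I (tensor_algebra V) \<and> is_homogeneous I \<and> is_coideal V I \<and>
           (\<forall>t\<in>I. \<forall>w. t w \<noteq> 0 \<longrightarrow> 2 \<le> length w)} \<subseteq> K"
  proof
    fix t assume "t \<in> \<Union>{I. ideal I (tensor_algebra V) \<and> is_homogeneous I \<and> is_coideal V I \<and>
           (\<forall>t\<in>I. \<forall>w. t w \<noteq> 0 \<longrightarrow> 2 \<le> length w)}"
    then obtain I where I: "ideal I (tensor_algebra V)" "is_coideal V I"
      "\<And>t w. t \<in> I \<Longrightarrow> t w \<noteq> 0 \<Longrightarrow> 2 \<le> length w" "t \<in> I" by auto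
    have "t \<in> carrier (tensor_algebra V)"
      using I(1,4) additive_subgroup.a_subset[OF ideal.axioms(1)] by blast
    then show "t \<in> K" unfolding K_def using coideal_replicate_zero[OF fin b triv I(1-4)] by auto
  qed
  have JK: "nichols_ideal V \<subseteq> K"
    unfolding nichols_ideal_def by (rule T.genideal_minimal[OF K sub])
  have J: "ideal (nichols_ideal V) (tensor_algebra V)"
    unfolding nichols_ideal_def using sub by (intro T.genideal_ideal) (auto simp: K_def)
  interpret J: ideal "nichols_ideal V" "tensor_algebra V" by (rule J)
  have "finite {w. t w \<noteq> 0}" if "t \<in> F" for t using F(2) that tensor_carrier by blast
  then have "finite (\<Union>t\<in>F. {w. t w \<noteq> 0})" using F(1) by blast
  then have "finite (length ` (\<Union>t\<in>F. {w. t w \<noteq> 0}))" by (rule finite_imageI)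
  \<comment> \<open>Longer than every word that occurs in the finite set, so the n-th power of
    \<open>b\<close> has coefficient zero in all its elements.\<close>
  then obtain n where n: "\<And>k. k \<in> length ` (\<Union>t\<in>F. {w. t w \<noteq> 0}) \<Longrightarrow> k < n"
    by (meson finite_nat_set_iff_bounded)
  have Fn: "t (replicate n b) = 0" if "t \<in> F" for t
  proof (rule ccontr)
    assume "t (replicate n b) \<noteq> 0"
    then have "replicate n b \<in> (\<Union>t\<in>F. {w. t w \<noteq> 0})" using that by auto
    then have "length (replicate n b) \<in> length ` (\<Union>t\<in>F. {w. t w \<noteq> 0})" by (rule imageI)
    then show False using n by force
  qed
  define x where "x = (\<lambda>w. of_bool (w = replicate n b) :: complex)"
  have x: "x \<in> carrier (tensor_algebra V)"
    unfolding tensor_carrier x_def using b by (auto intro: finite_subset[of _ "{replicate n b}"])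
  have "nichols_ideal V +>\<^bsub>tensor_algebra V\<^esub> x \<in> carrier (nichols_algebra V)"
    unfolding nichols_algebra_def FactRing_def using x by (auto simp: A_RCOSETS_def' )
  then obtain c where c: "nichols_ideal V +>\<^bsub>tensor_algebra V\<^esub> x
     = nichols_ideal V +>\<^bsub>tensor_algebra V\<^esub> (\<lambda>w. \<Sum>t\<in>F. c t * t w)" using F(3) by blast
  have "x \<in> nichols_ideal V +>\<^bsub>tensor_algebra V\<^esub> x"
    using additive_subgroup.zero_closed[OF ideal.axioms(1)[OF J]] x by (auto simp: a_r_coset_def' intro!: bexI[of _ "\<zero>\<^bsub>tensor_algebra V\<^esub>"])
  then obtain j where j: "j \<in> nichols_ideal V" "x = j \<oplus>\<^bsub>tensor_algebra V\<^esub> (\<lambda>w. \<Sum>t\<in>F. c t * t w)"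
    unfolding c by (auto simp: a_r_coset_def')
  have "x (replicate n b) = j (replicate n b) + (\<Sum>t\<in>F. c t * t (replicate n b))"
    unfolding j(2) tensor_add by simp
  also have "(\<Sum>t\<in>F. c t * t (replicate n b)) = 0" using Fn by (intro sum.neutral) auto
  also have "j (replicate n b) = 0" using j(1) JK unfolding K_def by auto
  finally show False unfolding x_def by simp
qed

section \<open>Weyl groups acting on the root lattice\<close>

lemma mat_eq_if_mult_vec_eq:
  assumes M: "M \<in> carrier_mat n n" and N: "N \<in> carrier_mat n n"
    and eq: "\<And>k. k < n \<Longrightarrow> M *\<^sub>v unit_vec n k = N *\<^sub>v unit_vec n k"
  shows "(M :: 'a::comm_ring_1 mat) = N"
proof (rule eq_matI)
  fix i j assume ij: "i < dim_row N" "j < dim_col N"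
  have "(M *\<^sub>v unit_vec n j) $ i = (N *\<^sub>v unit_vec n j) $ i" using eq[of j] ij N by simp
  then show "M $$ (i, j) = N $$ (i, j)" using ij M N by simp
qed (use M N in auto)

lemma mult_mat_smult_vec:
  fixes M :: "'a::comm_ring_1 mat"
  assumes "M \<in> carrier_mat m n" "v \<in> carrier_vec n"
  shows "M *\<^sub>v (k \<cdot>\<^sub>v v) = k \<cdot>\<^sub>v (M *\<^sub>v v)"
  using assms by (intro eq_vecI) auto

text \<open>The weights \<open>d\<close> symmetrize the matrix and so give an invariant form.
  Connectedness of the Dynkin diagram is expressed by \<open>conn\<close>: a labelling constant
  along edges is constant.\<close>

locale cartan =
  fixes A :: "int mat" and n :: nat and d :: "nat \<Rightarrow> int"
  assumes A: "A \<in> carrier_mat n n" and n0: "0 < n"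
    and diag: "\<And>i. i < n \<Longrightarrow> A $$ (i, i) = 2"
    and symm: "\<And>i j. i < n \<Longrightarrow> j < n \<Longrightarrow> d i * A $$ (i, j) = d j * A $$ (j, i)"
    and dpos: "\<And>i. i < n \<Longrightarrow> 0 < d i"
    and conn: "\<And>c :: nat \<Rightarrow> int. (\<And>i j. i < n \<Longrightarrow> j < n \<Longrightarrow> A $$ (i, j) \<noteq> 0 \<Longrightarrow> c i = c j) \<Longrightarrow>
       \<forall>i<n. c i = c 0"
begin

abbreviation "S \<equiv> simple_reflection A"
abbreviation "G \<equiv> weyl_group A"

lemma S_carrier [simp]: "S i \<in> carrier_mat n n"
  using A by (simp add: simple_reflection_def)

lemma S_dim [simp]: "dim_row (S i) = n" "dim_col (S i) = n"
  using S_carrier by (auto simp del: S_carrier)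

lemma S_index: "k < n \<Longrightarrow> j < n \<Longrightarrow> S i $$ (k, j) = of_bool (k = j) - of_bool (k = i) * A $$ (i, j)"
  using A by (simp add: simple_reflection_def)

lemma S_mult_vec:
  assumes v: "v \<in> carrier_vec n"
  shows "S i *\<^sub>v v = vec n (\<lambda>k. v $ k - of_bool (k = i) * (row A i \<bullet> v))"
proof (rule eq_vecI)
  fix k assume "k < dim_vec (vec n (\<lambda>k. v $ k - of_bool (k = i) * (row A i \<bullet> v)))"
  then have k: "k < n" by simp
  have "(S i *\<^sub>v v) $ k = (\<Sum>j<n. (of_bool (k = j) - of_bool (k = i) * A $$ (i, j)) * v $ j)"
    using k v by (simp add: scalar_prod_def S_index atLeast0LessThan)
  also have "\<dots> = (\<Sum>j<n. if j = k then v $ j else 0) - of_bool (k = i) * (\<Sum>j<n. A $$ (i, j) * v $ j)"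
    unfolding sum_distrib_left sum_subtractf[symmetric] by (intro sum.cong) (auto simp: algebra_simps)
  also have "\<dots> = v $ k - of_bool (k = i) * (row A i \<bullet> v)"
    using k v A by (auto simp: scalar_prod_def atLeast0LessThan)
  finally show "(S i *\<^sub>v v) $ k = vec n (\<lambda>k. v $ k - of_bool (k = i) * (row A i \<bullet> v)) $ k"
    using k by simp
qed simp

text \<open>Indices beyond the rank act as the identity, so words over arbitrary natural numbers are
  allowed without side conditions.\<close>

lemma S_ge: "n \<le> i \<Longrightarrow> S i = 1\<^sub>m n"
  using A by (intro eq_matI) (auto simp: simple_reflection_def)

lemma row_index' [simp]: "i < n \<Longrightarrow> j < n \<Longrightarrow> row A i $ j = A $$ (i, j)"
  using A by simp

lemma mult_closed [simp]:
  "X \<in> carrier_mat n n \<Longrightarrow> Y \<in> carrier_mat n n \<Longrightarrow> X * Y \<in> carrier_mat n n"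
  "X \<in> carrier_mat n n \<Longrightarrow> v \<in> carrier_vec n \<Longrightarrow> X *\<^sub>v v \<in> carrier_vec n"
  by auto

lemma row_minus:
  "u \<in> carrier_vec n \<Longrightarrow> v \<in> carrier_vec n \<Longrightarrow> row A i \<bullet> (u - a \<cdot>\<^sub>v v) = row A i \<bullet> u - a * (row A i \<bullet> v)"
  using A by (subst scalar_prod_minus_distrib[of _ n]) auto

lemma row_unit: "i < n \<Longrightarrow> k < n \<Longrightarrow> row A i \<bullet> unit_vec n k = A $$ (i, k)"
  using A by simp

lemma S_S [simp]: "S i * S i = 1\<^sub>m n"
proof (cases "i < n")
  case True
  show ?thesis
  proof (rule mat_eq_if_mult_vec_eq)
    fix k assume k: "k < n"
    let ?w = "vec n (\<lambda>l. unit_vec n k $ l - of_bool (l = i) * A $$ (i, k))"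
    have w: "?w = unit_vec n k - A $$ (i, k) \<cdot>\<^sub>v unit_vec n i"
      by (rule eq_vecI, use True k in auto)
    have "row A i \<bullet> ?w = A $$ (i, k) - A $$ (i, k) * 2"
      unfolding w using True k diag[OF True] by (simp add: row_minus)
    then have "S i *\<^sub>v (S i *\<^sub>v unit_vec n k) = unit_vec n k"
      using True k by (simp add: S_mult_vec row_unit) (rule eq_vecI, use True k in auto)
    then show "(S i * S i) *\<^sub>v unit_vec n k = 1\<^sub>m n *\<^sub>v unit_vec n k"
      using assoc_mult_mat_vec[OF S_carrier S_carrier, of "unit_vec n k" i i] by simp
  qed auto
qed (use S_ge[of i] in simp)

text \<open>Matrices act on columns, so the letter applied first stands on the right; this matches
  the order in which \<open>fold\<close> processes a word.\<close>

primrec wmat :: "nat list \<Rightarrow> int mat" where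
  "wmat [] = 1\<^sub>m n"
| "wmat (i # w) = wmat w * S i"

lemma wmat_carrier [simp]: "wmat w \<in> carrier_mat n n"
  by (induction w) auto

lemma wmat_dim [simp]: "dim_row (wmat w) = n" "dim_col (wmat w) = n"
  using wmat_carrier[of w] by (auto simp del: wmat_carrier)

lemma wmat_append: "wmat (u @ v) = wmat v * wmat u"
  by (induction u) (auto simp: assoc_mult_mat[of _ n n _ n _ n, symmetric])

lemma wmat_rev_left: "wmat (rev w) * wmat w = 1\<^sub>m n"
proof (induction w)
  case (Cons i w)
  have "wmat (rev (i # w)) * wmat (i # w) = S i * wmat (rev w) * (wmat w * S i)"
    by (simp add: wmat_append)
  also have "\<dots> = S i * ((wmat (rev w) * wmat w) * S i)"
    by (simp add: assoc_mult_mat[of _ n n _ n _ n])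
  also have "\<dots> = 1\<^sub>m n" unfolding Cons by simp
  finally show ?case .
qed simp

lemma wmat_rev_right: "wmat w * wmat (rev w) = 1\<^sub>m n"
  using wmat_rev_left[of "rev w"] by simp

abbreviation "GL \<equiv> units_of (ring_mat TYPE(int) n ())"

lemma GL_group: "group GL"
proof -
  interpret ring "ring_mat TYPE(int) n ()" by (rule ring_mat)
  show ?thesis by (rule units_group)
qed

lemma GL_simps: "x \<otimes>\<^bsub>GL\<^esub> y = x * y" "\<one>\<^bsub>GL\<^esub> = 1\<^sub>m n"
  by (simp_all add: units_of_def ring_mat_def)

lemma wmat_GL: "wmat w \<in> carrier GL"
  unfolding units_of_carrier Units_def ring_mat_def
  using wmat_rev_left[of w] wmat_rev_right[of w] by (auto intro!: bexI[of _ "wmat (rev w)"])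

lemma wmat_inv_GL: "inv\<^bsub>GL\<^esub> wmat w = wmat (rev w)"
  using group.inv_equality[OF GL_group _ wmat_GL wmat_GL, of "rev w" w]
  by (simp add: GL_simps wmat_rev_left)

text \<open>Simple reflections are involutions, so inverses of generators are words again and the
  generated subgroup consists of words.\<close>

lemma carrier_G: "carrier G = range wmat"
proof -
  have dA: "dim_row A = n" using A by simp
  have "generate GL (S ` {..<n}) = range wmat"
  proof
    show "generate GL (S ` {..<n}) \<subseteq> range wmat"
    proof
      fix x assume "x \<in> generate GL (S ` {..<n})"
      then show "x \<in> range wmat"
      proof (induction rule: generate.induct)
        case one
        then show ?case by (auto simp: GL_simps intro!: range_eqI[of _ _ "[]"])
      next
        case (incl h)
        then obtain i where "h = wmat [i]" by auto
        then show ?case by blast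
      next
        case (inv h)
        then obtain i where "h = wmat [i]" by auto
        then show ?case using wmat_inv_GL[of "[i]"] by (metis rangeI)
      next
        case (eng h1 h2)
        then obtain u v where "h1 = wmat u" "h2 = wmat v" by auto
        then have "h1 \<otimes>\<^bsub>GL\<^esub> h2 = wmat (v @ u)" by (simp add: GL_simps wmat_append)
        then show ?case by blast
      qed
    qed
    show "range wmat \<subseteq> generate GL (S ` {..<n})"
    proof clarify
      fix w
      show "wmat w \<in> generate GL (S ` {..<n})"
      proof (induction w)
        case Nil
        then show ?case using generate.one[of GL] by (simp add: GL_simps)
      next
        case (Cons i w)
        have "S i \<in> generate GL (S ` {..<n})"
        proof (cases "i < n")
          case False
          then show ?thesis using S_ge[of i] generate.one[of GL] by (simp add: GL_simps)
        qed (auto intro: generate.incl)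
        from generate.eng[OF Cons this] show ?case by (simp add: GL_simps)
      qed
    qed
  qed
  then show ?thesis unfolding weyl_group_def Let_def dA by simp
qed

lemma G_mult: "x \<otimes>\<^bsub>G\<^esub> y = x * y" and G_one: "\<one>\<^bsub>G\<^esub> = 1\<^sub>m n"
  using A by (simp_all add: weyl_group_def Let_def GL_simps)

lemma G_group: "group G"
proof -
  interpret GL: group GL by (rule GL_group)
  have "subgroup (generate GL (S ` {..<n})) GL"
  proof (rule GL.generate_is_subgroup)
    show "S ` {..<n} \<subseteq> carrier GL" using wmat_GL[of "[_]"] by auto
  qed
  then have "group (GL\<lparr>carrier := generate GL (S ` {..<n})\<rparr>)"
    by (rule subgroup.subgroup_is_group) (rule GL_group)
  then show ?thesis using A unfolding weyl_group_def Let_def by simp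
qed

lemma G_inv: "inv\<^bsub>G\<^esub> wmat w = wmat (rev w)"
  using group.inv_equality[OF G_group, of "wmat (rev w)" "wmat w"]
  by (simp add: G_mult G_one carrier_G wmat_rev_left)

lemma G_carrier_mat: "x \<in> carrier G \<Longrightarrow> x \<in> carrier_mat n n"
  unfolding carrier_G by auto

text \<open>Commuting with a reflection preserves the line of its root, so a central matrix is
  diagonal in the simple roots. Its entries are integral units, and commuting with the reflections
  once more equates the entries at adjacent vertices.\<close>

lemma center_G:
  assumes "x \<in> center G"
  shows "x = 1\<^sub>m n \<or> x = - 1\<^sub>m n"
proof -
  obtain w where w: "x = wmat w" using assms unfolding center_def carrier_G by auto
  have comm: "wmat w * S i = S i * wmat w" for i
    using assms unfolding center_def w carrier_G by (auto simp: G_mult dest!: spec[of _ "[i]"])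
  have comm': "wmat (rev w) * S i = S i * wmat (rev w)" for i
  proof -
    have "S i * wmat (rev w) = wmat (rev w) * wmat w * (S i * wmat (rev w))"
      by (simp add: wmat_rev_left)
    also have "\<dots> = wmat (rev w) * (wmat w * S i) * wmat (rev w)"
      by (simp add: assoc_mult_mat[of _ n n _ n _ n])
    also have "\<dots> = wmat (rev w) * S i * (wmat w * wmat (rev w))"
      unfolding comm by (simp add: assoc_mult_mat[of _ n n _ n _ n])
    finally show ?thesis by (simp add: wmat_rev_right)
  qed
  have Sd: "(\<Sum>j<n. S i $$ (k, j) * c j) = c k - of_bool (k = i) * (\<Sum>j<n. A $$ (i, j) * c j)"
    if "k < n" for i k and c :: "nat \<Rightarrow> int"
  proof -
    have "(\<Sum>j<n. S i $$ (k, j) * c j) = (\<Sum>j<n. (if j = k then c j else 0)) - of_bool (k = i) * (\<Sum>j<n. A $$ (i, j) * c j)"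
      unfolding sum_distrib_left sum_subtractf[symmetric] using that
      by (intro sum.cong) (auto simp: S_index algebra_simps)
    then show ?thesis using that by simp
  qed
  \<comment> \<open>Column \<open>i\<close> of \<open>S i\<close> is minus the unit vector, while
    its other rows are those of the identity; the two products thus give opposite values of the same
    entry.\<close>
  have off: "M $$ (k, i) = 0"
    if M: "M \<in> carrier_mat n n" and c: "\<And>i. M * S i = S i * M" and k: "k < n" "i < n" "k \<noteq> i" for M :: "int mat" and i k
  proof -
    have "(M * S i) $$ (k, i) = (\<Sum>j<n. M $$ (k, j) * S i $$ (j, i))"
      using M k by (simp add: scalar_prod_def atLeast0LessThan)
    also have "\<dots> = (\<Sum>j<n. if j = i then - M $$ (k, i) else 0)"
      using k by (intro sum.cong) (auto simp: S_index diag)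
    also have "\<dots> = - M $$ (k, i)" using k by simp
    finally have 1: "(M * S i) $$ (k, i) = - M $$ (k, i)" .
    have "(S i * M) $$ (k, i) = (\<Sum>j<n. S i $$ (k, j) * M $$ (j, i))"
      using M k by (simp add: scalar_prod_def atLeast0LessThan)
    also have "\<dots> = M $$ (k, i)" using Sd[OF k(1)] k by simp
    finally show ?thesis using 1 c[of i] by simp
  qed
  define c where "c i = wmat w $$ (i, i)" for i
  define c' where "c' i = wmat (rev w) $$ (i, i)" for i
  \<comment> \<open>The word and its reversal are inverse integral matrices, both diagonal.\<close>
  have "c i * c' i = 1" if i: "i < n" for i
  proof -
    have "1 = (wmat w * wmat (rev w)) $$ (i, i)" using i by (simp add: wmat_rev_right)
    also have "\<dots> = (\<Sum>j<n. wmat w $$ (i, j) * wmat (rev w) $$ (j, i))"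
      using i by (simp add: scalar_prod_def atLeast0LessThan)
    also have "\<dots> = (\<Sum>j<n. if j = i then c j * c' j else 0)"
      using i off[OF wmat_carrier[of w] comm] by (intro sum.cong) (auto simp: c_def c'_def)
    finally show ?thesis using i by simp
  qed
  then have c1: "c i = 1 \<or> c i = -1" if "i < n" for i
    using that by (metis zmult_eq_1_iff)
  \<comment> \<open>Entry \<open>(i, j)\<close> of the commutation relation with \<open>S i\<close>
    compares the two diagonal values through the nonzero factor \<open>A $$ (i, j)\<close>.\<close>
  have "c i = c j" if ij: "i < n" "j < n" "A $$ (i, j) \<noteq> 0" for i j
  proof (cases "i = j")
    case False
    have "(wmat w * S i) $$ (i, j) = (\<Sum>k<n. wmat w $$ (i, k) * S i $$ (k, j))"
      using ij by (simp add: scalar_prod_def atLeast0LessThan)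
    also have "\<dots> = (\<Sum>k<n. if k = i then - (c i * A $$ (i, j)) else 0)"
      using ij False off[OF wmat_carrier[of w] comm] by (intro sum.cong) (auto simp: c_def S_index)
    finally have 1: "(wmat w * S i) $$ (i, j) = - (c i * A $$ (i, j))" using ij by simp
    have "(S i * wmat w) $$ (i, j) = (\<Sum>k<n. S i $$ (i, k) * wmat w $$ (k, j))"
      using ij by (simp add: scalar_prod_def atLeast0LessThan)
    also have "\<dots> = (\<Sum>k<n. if k = j then - (A $$ (i, j) * c j) else 0)"
      using ij False off[OF wmat_carrier[of w] comm] by (intro sum.cong) (auto simp: c_def S_index)
    finally have "(S i * wmat w) $$ (i, j) = - (A $$ (i, j) * c j)" using ij by simp
    then show ?thesis using 1 comm[of i] ij(3) by simp
  qed simp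
  then have cc: "\<forall>i<n. c i = c 0" by (rule conn)
  have "wmat w = c 0 \<cdot>\<^sub>m 1\<^sub>m n"
  proof (rule eq_matI)
    fix i j assume "i < dim_row (c 0 \<cdot>\<^sub>m 1\<^sub>m n)" "j < dim_col (c 0 \<cdot>\<^sub>m 1\<^sub>m n)"
    then have ij: "i < n" "j < n" by auto
    show "wmat w $$ (i, j) = (c 0 \<cdot>\<^sub>m 1\<^sub>m n) $$ (i, j)"
    proof (cases "i = j")
      case True
      then have "wmat w $$ (i, j) = c 0" using cc ij unfolding c_def by blast
      then show ?thesis using True ij by simp
    qed (use ij off[OF wmat_carrier[of w] comm] in simp)
  qed auto
  then show ?thesis using c1[OF n0] w by (auto intro!: eq_matI)
qed

text \<open>The bilinear form on the root lattice with Gram matrix \<open>d i * A $$ (i, j)\<close>;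
  a simple root has norm \<open>2 * d i\<close>.\<close>

definition form :: "int vec \<Rightarrow> int vec \<Rightarrow> int" where
  "form u v = (\<Sum>k<n. d k * u $ k * (row A k \<bullet> v))"

lemma form_unit_left: "i < n \<Longrightarrow> form (unit_vec n i) v = d i * (row A i \<bullet> v)"
proof -
  assume i: "i < n"
  have "form (unit_vec n i) v = (\<Sum>k<n. if k = i then d k * (row A k \<bullet> v) else 0)"
    unfolding form_def using i by (intro sum.cong) auto
  then show ?thesis using i by simp
qed

lemma form_unit_right: "i < n \<Longrightarrow> u \<in> carrier_vec n \<Longrightarrow> form u (unit_vec n i) = d i * (row A i \<bullet> u)"
proof -
  assume i: "i < n" and u: "u \<in> carrier_vec n"
  have "form u (unit_vec n i) = (\<Sum>k<n. d k * u $ k * A $$ (k, i))"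
    unfolding form_def using i by (intro sum.cong) (auto simp: row_unit)
  also have "\<dots> = (\<Sum>k<n. d i * (A $$ (i, k) * u $ k))"
    using symm[of _ i] i by (intro sum.cong) (auto simp: mult_ac)
  also have "\<dots> = d i * (row A i \<bullet> u)"
    using i u A by (simp add: scalar_prod_def sum_distrib_left atLeast0LessThan)
  finally show ?thesis .
qed

lemma form_minus_left:
  "u \<in> carrier_vec n \<Longrightarrow> u' \<in> carrier_vec n \<Longrightarrow> form (u - a \<cdot>\<^sub>v u') v = form u v - a * form u' v"
  unfolding form_def by (simp add: algebra_simps sum_subtractf sum_distrib_left)

lemma form_minus_right:
  "v \<in> carrier_vec n \<Longrightarrow> v' \<in> carrier_vec n \<Longrightarrow> form u (v - a \<cdot>\<^sub>v v') = form u v - a * form u v'"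
  unfolding form_def
  by (simp add: row_minus algebra_simps sum_subtractf sum_distrib_left)

lemma S_mult_vec': "v \<in> carrier_vec n \<Longrightarrow> S i *\<^sub>v v = v - (row A i \<bullet> v) \<cdot>\<^sub>v (if i < n then unit_vec n i else 0\<^sub>v n)"
  by (rule eq_vecI) (auto simp: S_mult_vec)

lemma form_S:
  assumes u: "u \<in> carrier_vec n" and v: "v \<in> carrier_vec n"
  shows "form (S i *\<^sub>v u) (S i *\<^sub>v v) = form u v"
proof (cases "i < n")
  case True
  show ?thesis using u v True
    by (simp add: S_mult_vec' form_minus_left form_minus_right form_unit_left form_unit_right row_unit diag
        row_minus algebra_simps)
next
  case False
  then show ?thesis using u v S_ge[of i] by simp
qed

lemma form_wmat:
  assumes "u \<in> carrier_vec n" "v \<in> carrier_vec n"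
  shows "form (wmat w *\<^sub>v u) (wmat w *\<^sub>v v) = form u v"
  using assms
proof (induction w arbitrary: u v)
  case (Cons i w)
  have "S i *\<^sub>v u \<in> carrier_vec n" "S i *\<^sub>v v \<in> carrier_vec n" by (auto intro!: mult_mat_vec_carrier[of _ n n] Cons.prems)
  then show ?case using Cons.IH Cons.prems
    by (simp add: assoc_mult_mat_vec[of _ n n _ n] form_S)
qed auto

text \<open>A group element taking one simple root to another, up to sign, preserves the form and
  therefore carries the reflection along. The sign cancels, since root and coroot change
  together.\<close>

lemma reflection_transport:
  assumes ij: "i < n" "j < n" and e: "wmat w *\<^sub>v unit_vec n i = \<epsilon> \<cdot>\<^sub>v unit_vec n j" and \<epsilon>: "\<epsilon> = 1 \<or> \<epsilon> = -1"
  shows "wmat w * S i = S j * wmat w"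
proof (rule mat_eq_if_mult_vec_eq)
  fix k assume k: "k < n"
  let ?v = "unit_vec n k :: int vec"
  let ?wv = "wmat w *\<^sub>v ?v"
  have wv: "?wv \<in> carrier_vec n" by (auto intro!: mult_mat_vec_carrier[of _ n n])
  have fs: "form (c \<cdot>\<^sub>v u) v = c * form u v" if "u \<in> carrier_vec n" for c u v
    unfolding form_def using that by (simp add: sum_distrib_left mult_ac)
  have fs': "form u (c \<cdot>\<^sub>v v) = c * form u v" if "v \<in> carrier_vec n" for c u v
    unfolding form_def using that A by (simp add: sum_distrib_left mult_ac)
  \<comment> \<open>Equal norms give \<open>d i = d j\<close>, so the weights cancel when the
    coroots are compared.\<close>
  have "form (unit_vec n i) (unit_vec n i) = form (\<epsilon> \<cdot>\<^sub>v unit_vec n j) (\<epsilon> \<cdot>\<^sub>v unit_vec n j)"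
    using form_wmat[of "unit_vec n i" "unit_vec n i" w] e by simp
  then have "d i * 2 = \<epsilon> * (\<epsilon> * (d j * 2))"
    using ij by (simp add: fs fs' form_unit_left row_unit diag)
  then have dij: "d i = d j" using \<epsilon> by auto
  have "d i * (row A i \<bullet> ?v) = form (unit_vec n i) ?v" using ij by (simp add: form_unit_left)
  also have "\<dots> = form (\<epsilon> \<cdot>\<^sub>v unit_vec n j) ?wv" using form_wmat[of "unit_vec n i" ?v w] e by simp
  also have "\<dots> = \<epsilon> * (d j * (row A j \<bullet> ?wv))" using ij by (simp add: fs form_unit_left)
  finally have "d i * (row A i \<bullet> ?v) = d i * (\<epsilon> * (row A j \<bullet> ?wv))" unfolding dij by simp
  then have r: "row A i \<bullet> ?v = \<epsilon> * (row A j \<bullet> ?wv)" using dpos[OF ij(1)] by simp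
  have "(wmat w * S i) *\<^sub>v ?v = wmat w *\<^sub>v (?v - (row A i \<bullet> ?v) \<cdot>\<^sub>v unit_vec n i)"
    using ij by (simp add: assoc_mult_mat_vec[of _ n n _ n] S_mult_vec')
  also have "\<dots> = ?wv - (row A i \<bullet> ?v) \<cdot>\<^sub>v (\<epsilon> \<cdot>\<^sub>v unit_vec n j)"
    using mult_mat_smult_vec[of "wmat w" n n "unit_vec n i" "row A i \<bullet> ?v"]
    by (simp add: mult_minus_distrib_mat_vec[of _ n n] e)
  also have "\<dots> = ?wv - (row A j \<bullet> ?wv) \<cdot>\<^sub>v unit_vec n j"
    unfolding r using \<epsilon> by (auto simp: smult_smult_assoc)
  also have "\<dots> = (S j * wmat w) *\<^sub>v ?v"
    using ij wv by (simp add: assoc_mult_mat_vec[of _ n n _ n] S_mult_vec')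
  finally show "(wmat w * S i) *\<^sub>v ?v = (S j * wmat w) *\<^sub>v ?v" .
qed (auto intro!: mult_carrier_mat[of _ n n])

end

section \<open>Certificates for conjugacy classes\<close>

text \<open>Roots are numbered by \<open>0, \<dots>, 2 P - 1\<close>, the first \<open>n\<close> being the simple ones and \<open>r + P\<close> being the negative of
  \<open>r < P\<close>; \<open>s i\<close> is the permutation of the indices by the \<open>i\<close>-th simple reflection. The first letter of a
  word acts first.\<close>

definition neg_index :: "nat \<Rightarrow> nat \<Rightarrow> nat" where
  "neg_index P r = (if r < P then r + P else r - P)"

definition pos_index :: "nat \<Rightarrow> nat \<Rightarrow> nat" where
  "pos_index P r = (if r < P then r else r - P)"

text \<open>The simple roots form a basis, so their images alone decide whether an element is the
  identity.\<close>

definition acts_one :: "(nat \<Rightarrow> nat \<Rightarrow> nat) \<Rightarrow> nat \<Rightarrow> nat list \<Rightarrow> bool" where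
  "acts_one s n w \<longleftrightarrow> map (fold s w) [0..<n] = [0..<n]"

definition acts_neg :: "(nat \<Rightarrow> nat \<Rightarrow> nat) \<Rightarrow> nat \<Rightarrow> nat \<Rightarrow> nat list \<Rightarrow> bool" where
  "acts_neg s n P w \<longleftrightarrow> map (fold s w) [0..<n] = [P..<P + n]"

definition acts_pm :: "(nat \<Rightarrow> nat \<Rightarrow> nat) \<Rightarrow> nat \<Rightarrow> nat \<Rightarrow> nat list \<Rightarrow> bool" where
  "acts_pm s n P w \<longleftrightarrow> (\<lambda>l. l = [0..<n] \<or> l = [P..<P + n]) (map (fold s w) [0..<n])"

text \<open>The octal digits of a code, lowest first and without the leading digit \<open>1\<close>, are the letters of
  the word.\<close>

fun decode :: "num \<Rightarrow> nat list" where
  "decode (num.Bit0 (num.Bit0 (num.Bit0 k))) = 0 # decode k"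
| "decode (num.Bit1 (num.Bit0 (num.Bit0 k))) = 1 # decode k"
| "decode (num.Bit0 (num.Bit1 (num.Bit0 k))) = 2 # decode k"
| "decode (num.Bit1 (num.Bit1 (num.Bit0 k))) = 3 # decode k"
| "decode (num.Bit0 (num.Bit0 (num.Bit1 k))) = 4 # decode k"
| "decode (num.Bit1 (num.Bit0 (num.Bit1 k))) = 5 # decode k"
| "decode (num.Bit0 (num.Bit1 (num.Bit1 k))) = 6 # decode k"
| "decode (num.Bit1 (num.Bit1 (num.Bit1 k))) = 7 # decode k"
| "decode _ = []"

definition word :: "nat \<Rightarrow> nat list" where
  "word c = decode (num_of_nat c)"

definition centralizes :: "(nat \<Rightarrow> nat \<Rightarrow> nat) \<Rightarrow> nat \<Rightarrow> nat \<Rightarrow> nat list \<Rightarrow> nat list \<Rightarrow> bool" where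
  "centralizes s n P X c \<longleftrightarrow> acts_pm s n P (c @ X @ rev c @ rev X)"

text \<open>Indices of positive roots, with signs ignored, serve as the induction measure.\<close>

definition lowers :: "(nat \<Rightarrow> nat \<Rightarrow> nat) \<Rightarrow> nat \<Rightarrow> nat \<Rightarrow> nat list \<Rightarrow> bool" where
  "lowers s P r c \<longleftrightarrow> pos_index P (fold s c r) < r"

text \<open>Read as a matrix product, the word is the inverse of \<open>g\<close>, the inverse of
  \<open>y\<close>, \<open>g\<close>, \<open>X\<close> and the reflection in the root of
  \<open>U\<close> and \<open>j\<close>. Being 1 or -1, it says that \<open>g\<close> conjugates
  \<open>X\<close> times the reflection to \<open>y\<close> up to sign.\<close>

definition conjugates :: "(nat \<Rightarrow> nat \<Rightarrow> nat) \<Rightarrow> nat \<Rightarrow> nat \<Rightarrow> nat list \<Rightarrow> nat list \<Rightarrow> nat \<Rightarrow> nat list \<Rightarrow> nat list \<Rightarrow> bool" where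
  "conjugates s n P X U j g y \<longleftrightarrow> acts_pm s n P (rev U @ [j] @ U @ X @ g @ rev y @ rev g)"

text \<open>The list \<open>d # ds\<close> deals with the reflections \<open>t\<^sub>r, t\<^sub>r\<^sub>+\<^sub>1, \<dots>\<close> in positive roots. If \<open>d\<close> is an index into \<open>Cs\<close>, a
  list of words commuting with \<open>X\<close> up to sign, then \<open>t\<^sub>r\<close> is conjugate under \<open>Cs ! d\<close> to the reflection in an earlier
  root. Otherwise the next seed \<open>(U, j, g, k)\<close> expresses the root as \<open>U \<alpha>\<^sub>j\<close> and gives a word \<open>g\<close>
  conjugating the product of \<open>t\<^sub>r\<close> and \<open>X\<close> to \<open>Y ! k\<close>, up to sign.\<close>

primrec certs_ok :: "(nat \<Rightarrow> nat \<Rightarrow> nat) \<Rightarrow> nat \<Rightarrow> nat \<Rightarrow> nat list list \<Rightarrow> nat list \<Rightarrow> nat list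
    \<Rightarrow> nat \<Rightarrow> nat list \<Rightarrow> (nat \<times> nat \<times> nat \<times> nat) list \<Rightarrow> bool" where
  "certs_ok s n P Y X Cs r [] seeds = (P \<le> r)"
| "certs_ok s n P Y X Cs r (d # ds) seeds =
     (if d < length Cs then lowers s P r (word (Cs ! d)) \<and> certs_ok s n P Y X Cs (r + 1) ds seeds
      else (case seeds of [] \<Rightarrow> False | (U, j, g, k) # ss \<Rightarrow>
        j < n \<and> k < length Y \<and> fold s (word U) j = r \<and> conjugates s n P X (word U) j (word g) (Y ! k) \<and>
        certs_ok s n P Y X Cs (r + 1) ds ss))"

definition rep_ok :: "(nat \<Rightarrow> nat \<Rightarrow> nat) \<Rightarrow> nat \<Rightarrow> nat \<Rightarrow> nat list list
    \<Rightarrow> nat list \<times> nat list \<times> nat list \<times> (nat \<times> nat \<times> nat \<times> nat) list \<Rightarrow> bool" where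
  "rep_ok s n P Y = (\<lambda>(X, Cs, ds, seeds). list_all (\<lambda>c. centralizes s n P X (word c)) Cs \<and>
     certs_ok s n P Y X Cs 0 ds seeds)"

text \<open>When \<open>rs\<close> lists the images of the simple roots, this is a trace read off
  from root coordinates.\<close>

primrec diag_sum :: "(nat \<Rightarrow> int list) \<Rightarrow> nat \<Rightarrow> nat list \<Rightarrow> int" where
  "diag_sum rt a [] = 0"
| "diag_sum rt a (r # rs) = rt r ! a + diag_sum rt (a + 1) rs"

text \<open>Started with the simple roots, the list contains the traces of the first
  \<open>p\<close> powers of \<open>w\<close>; \<open>L\<close> holds the columns of the current
  power as root indices.\<close>

primrec traces :: "(nat \<Rightarrow> nat \<Rightarrow> nat) \<Rightarrow> (nat \<Rightarrow> int list) \<Rightarrow> nat list \<Rightarrow> nat \<Rightarrow> nat list \<Rightarrow> int list" where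
  "traces s rt w 0 L = []"
| "traces s rt w (Suc p) L = (\<lambda>L'. diag_sum rt 0 L' # traces s rt w p L') (map (fold s w) L)"

text \<open>The list begins with the first power, so this is the effect of replacing an element by
  its negative.\<close>

fun neg_odd :: "int list \<Rightarrow> int list" where
  "neg_odd (x # y # xs) = - x # y # neg_odd xs"
| "neg_odd [x] = [- x]"
| "neg_odd [] = []"

text \<open>Traces cannot always separate classes, hence the added numbers of roots in
  \<open>Ls\<close> that are fixed and negated. Passing to the negative element exchanges these two
  numbers.\<close>

definition word_inv :: "(nat \<Rightarrow> nat \<Rightarrow> nat) \<Rightarrow> (nat \<Rightarrow> int list) \<Rightarrow> nat \<Rightarrow> nat \<Rightarrow> nat \<Rightarrow> nat list \<Rightarrow> nat list
    \<Rightarrow> int list \<times> nat \<times> nat" where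
  "word_inv s rt n P p Ls w = (traces s rt w p [0..<n],
     length (filter (\<lambda>r. fold s w r = r) Ls), length (filter (\<lambda>r. fold s w r = neg_index P r) Ls))"

definition neg_inv :: "int list \<times> nat \<times> nat \<Rightarrow> int list \<times> nat \<times> nat" where
  "neg_inv = (\<lambda>(l, a, b). (neg_odd l, b, a))"

definition pm_eq :: "int mat \<Rightarrow> int mat \<Rightarrow> bool" where
  "pm_eq M N \<longleftrightarrow> M = N \<or> M = - N"

lemma uminus_uminus_mat [simp]: "- (- (M :: int mat)) = M"
  by (intro eq_matI) auto

lemma pm_eq_sym: "pm_eq M N \<Longrightarrow> pm_eq N M"
  unfolding pm_eq_def by auto

lemma pm_eq_trans: "pm_eq M N \<Longrightarrow> pm_eq N K \<Longrightarrow> pm_eq M K"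
  unfolding pm_eq_def by auto

lemma pm_eq_mult_left: "M \<in> carrier_mat n n \<Longrightarrow> N \<in> carrier_mat n n \<Longrightarrow> K \<in> carrier_mat n n \<Longrightarrow>
    pm_eq M N \<Longrightarrow> pm_eq (K * M) (K * N)"
  unfolding pm_eq_def by (auto simp: uminus_mult_right_mat)

lemma pm_eq_mult_right: "M \<in> carrier_mat n n \<Longrightarrow> N \<in> carrier_mat n n \<Longrightarrow> K \<in> carrier_mat n n \<Longrightarrow>
    pm_eq M N \<Longrightarrow> pm_eq (M * K) (N * K)"
  unfolding pm_eq_def by (auto simp: uminus_mult_left_mat)

lemma mult_mat_uminus_vec:
  fixes M :: "'a::comm_ring_1 mat"
  assumes "M \<in> carrier_mat m n" "v \<in> carrier_vec n"
  shows "M *\<^sub>v (- v) = - (M *\<^sub>v v)"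
proof -
  have "- v = (-1) \<cdot>\<^sub>v v" "- (M *\<^sub>v v) = (-1) \<cdot>\<^sub>v (M *\<^sub>v v)" by (intro eq_vecI; simp)+
  then show ?thesis using mult_mat_smult_vec[OF assms, of "-1"] by simp
qed

text \<open>The link between matrices and computation: the roots carry numbers, and each reflection
  acts on the numbers by \<open>s\<close>.\<close>

locale root_table = cartan +
  fixes P :: nat and rt :: "nat \<Rightarrow> int list" and s :: "nat \<Rightarrow> nat \<Rightarrow> nat"
  assumes nP: "n \<le> P"
    and length_rt: "\<And>r. r < 2 * P \<Longrightarrow> length (rt r) = n"
    and inj_rt: "inj_on rt {..<2 * P}"
    and simple_rt: "\<And>k. k < n \<Longrightarrow> vec_of_list (rt k) = unit_vec n k"
    and neg_rt: "\<And>r. r < P \<Longrightarrow> vec_of_list (rt (r + P)) = - vec_of_list (rt r)"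
    and s_lt: "\<And>i r. r < 2 * P \<Longrightarrow> s i r < 2 * P"
    and s_rt: "\<And>i r. r < 2 * P \<Longrightarrow> S i *\<^sub>v vec_of_list (rt r) = vec_of_list (rt (s i r))"
begin

abbreviation "R r \<equiv> vec_of_list (rt r)"

lemma R_carrier [simp]: "r < 2 * P \<Longrightarrow> R r \<in> carrier_vec n"
  using length_rt[of r] by (intro carrier_vecI) simp

lemma R_inj: "r < 2 * P \<Longrightarrow> r' < 2 * P \<Longrightarrow> R r = R r' \<Longrightarrow> r = r'"
proof -
  assume r: "r < 2 * P" "r' < 2 * P" "R r = R r'"
  then have "list_of_vec (R r) = list_of_vec (R r')" by simp
  then have "rt r = rt r'" by (simp only: list_vec)
  then show "r = r'" by (rule inj_onD[OF inj_rt]) (use r in auto)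
qed

lemma fold_lt: "r < 2 * P \<Longrightarrow> fold s w r < 2 * P"
  by (induction w arbitrary: r) (auto simp: s_lt)

lemma wmat_R: "r < 2 * P \<Longrightarrow> wmat w *\<^sub>v R r = R (fold s w r)"
proof (induction w arbitrary: r)
  case (Cons i w)
  then show ?case using assoc_mult_mat_vec[of "wmat w" n n "S i" n "R r"] by (simp add: s_rt s_lt)
qed simp

lemma neg_index_lt: "r < 2 * P \<Longrightarrow> neg_index P r < 2 * P"
  unfolding neg_index_def by auto

lemma R_neg_index: "r < 2 * P \<Longrightarrow> R (neg_index P r) = - R r"
proof (cases "r < P")
  case False
  assume "r < 2 * P"
  then have "R r = - R (r - P)" using neg_rt[of "r - P"] False by simp
  then show ?thesis using False unfolding neg_index_def by simp
qed (simp add: neg_index_def neg_rt)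

text \<open>Linearity of the matrices, pulled back to indices along the injective numbering.\<close>

lemma fold_neg_index:
  assumes "r < 2 * P"
  shows "fold s w (neg_index P r) = neg_index P (fold s w r)"
proof (rule R_inj)
  have "R (fold s w (neg_index P r)) = wmat w *\<^sub>v (- R r)"
    using wmat_R[OF neg_index_lt[OF assms], of w] R_neg_index[OF assms] by simp
  also have "\<dots> = - (wmat w *\<^sub>v R r)"
    by (rule mult_mat_uminus_vec[OF wmat_carrier R_carrier[OF assms]])
  also have "\<dots> = R (neg_index P (fold s w r))"
    using wmat_R[OF assms] R_neg_index[OF fold_lt[OF assms]] by simp
  finally show "R (fold s w (neg_index P r)) = R (neg_index P (fold s w r))" .
qed (use assms fold_lt neg_index_lt in auto)

lemma map_upt_eqD: "map f [0..<k] = [a..<a + k] \<Longrightarrow> j < k \<Longrightarrow> f j = a + j"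
proof -
  assume e: "map f [0..<k] = [a..<a + k]" and j: "j < k"
  have "f j = map f [0..<k] ! j" using j by simp
  also have "\<dots> = a + j" unfolding e using j by simp
  finally show ?thesis .
qed

lemma acts_oneD: "acts_one s n w \<Longrightarrow> wmat w = 1\<^sub>m n"
proof -
  assume a: "acts_one s n w"
  show ?thesis
  proof (rule mat_eq_if_mult_vec_eq)
    fix k assume k: "k < n"
    have "fold s w k = k" using map_upt_eqD[of "fold s w" n 0 k] a k unfolding acts_one_def by simp
    then show "wmat w *\<^sub>v unit_vec n k = 1\<^sub>m n *\<^sub>v unit_vec n k"
      using wmat_R[of k w] k nP simple_rt[OF k] by simp
  qed auto
qed

lemma acts_negD: "acts_neg s n P w \<Longrightarrow> wmat w = - 1\<^sub>m n"
proof -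
  assume a: "acts_neg s n P w"
  show ?thesis
  proof (rule mat_eq_if_mult_vec_eq)
    fix k assume k: "k < n"
    have "fold s w k = k + P" using map_upt_eqD[of "fold s w" n P k] a k unfolding acts_neg_def by simp
    then show "wmat w *\<^sub>v unit_vec n k = - 1\<^sub>m n *\<^sub>v unit_vec n k"
      using wmat_R[of k w] k nP simple_rt[OF k] neg_rt[of k] by simp
  qed auto
qed

lemma acts_pmD: "acts_pm s n P w \<Longrightarrow> pm_eq (wmat w) (1\<^sub>m n)"
  using acts_oneD[of w] acts_negD[of w] unfolding acts_pm_def acts_one_def acts_neg_def pm_eq_def by blast

text \<open>An element is determined by the images of the simple roots, for which the table leaves
  finitely many choices.\<close>

lemma finite_G: "finite (carrier G)"
proof -
  have "carrier G \<subseteq> (\<lambda>l. mat_of_cols n (map R l)) ` {l. set l \<subseteq> {..<2 * P} \<and> length l = n}"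
  proof
    fix x assume "x \<in> carrier G"
    then obtain w where w: "x = wmat w" unfolding carrier_G by auto
    have "x = mat_of_cols n (map R (map (fold s w) [0..<n]))"
    proof (rule eq_matI)
      fix i j assume ij: "i < dim_row (mat_of_cols n (map R (map (fold s w) [0..<n])))"
        "j < dim_col (mat_of_cols n (map R (map (fold s w) [0..<n])))"
      then have ij: "i < n" "j < n" by auto
      have "x $$ (i, j) = (wmat w *\<^sub>v unit_vec n j) $ i" using ij w by simp
      also have "\<dots> = R (fold s w j) $ i" using wmat_R[of j w] simple_rt[OF ij(2)] ij nP by simp
      finally show "x $$ (i, j) = mat_of_cols n (map R (map (fold s w) [0..<n])) $$ (i, j)"
        using ij by (simp add: mat_of_cols_index)
    qed (use w in auto)
    then show "x \<in> (\<lambda>l. mat_of_cols n (map R l)) ` {l. set l \<subseteq> {..<2 * P} \<and> length l = n}"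
      using fold_lt nP by (intro image_eqI[where x="map (fold s w) [0..<n]"]) auto
  qed
  moreover have "finite ((\<lambda>l. mat_of_cols n (map R l)) ` {l. set l \<subseteq> {..<2 * P} \<and> length l = n})"
    by (intro finite_imageI finite_lists_length_eq) simp
  ultimately show ?thesis by (rule finite_subset)
qed

lemma wmat_cancel:
  assumes "M \<in> carrier_mat n n"
  shows "wmat w * (wmat (rev w) * M) = M" "wmat (rev w) * (wmat w * M) = M"
  using assms assoc_mult_mat[of "wmat w" n n "wmat (rev w)" n M n] assoc_mult_mat[of "wmat (rev w)" n n "wmat w" n M n]
  by (simp_all add: wmat_rev_left wmat_rev_right)

definition word_refl :: "nat list \<Rightarrow> nat \<Rightarrow> int mat" where
  "word_refl U j = wmat U * S j * wmat (rev U)"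

lemma word_refl_carrier [simp]: "word_refl U j \<in> carrier_mat n n"
  unfolding word_refl_def by simp

text \<open>Applying \<open>U\<close> and then the inverse of \<open>U'\<close> takes one simple
  root to plus or minus the other, which is the situation of
  \<open>reflection_transport\<close>.\<close>

lemma word_refl_eq:
  assumes j: "j < n" "j' < n" and e: "fold s U j = fold s U' j' \<or> fold s U j = neg_index P (fold s U' j')"
  shows "word_refl U j = word_refl U' j'"
proof -
  have jP: "j < 2 * P" "j' < 2 * P" using j nP by auto
  have "R (fold s U j) = 1 \<cdot>\<^sub>v R (fold s U' j') \<or> R (fold s U j) = (-1) \<cdot>\<^sub>v R (fold s U' j')"
    using e R_neg_index[OF fold_lt[OF jP(2)]] by auto
  then obtain \<epsilon> :: int where \<epsilon>: "\<epsilon> = 1 \<or> \<epsilon> = -1" "R (fold s U j) = \<epsilon> \<cdot>\<^sub>v R (fold s U' j')" by blast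
  have rr: "wmat (rev U') *\<^sub>v R (fold s U' j') = unit_vec n j'"
  proof -
    have "wmat (rev U') *\<^sub>v R (fold s U' j') = (wmat (rev U') * wmat U') *\<^sub>v R j'"
      using wmat_R[OF jP(2), of U'] jP assoc_mult_mat_vec[of "wmat (rev U')" n n "wmat U'" n "R j'"] by simp
    then show ?thesis using jP simple_rt[OF j(2)] by (simp add: wmat_rev_left)
  qed
  have "wmat (U @ rev U') *\<^sub>v unit_vec n j = wmat (rev U') *\<^sub>v R (fold s U j)"
    using wmat_R[OF jP(1), of U] simple_rt[OF j(1)] assoc_mult_mat_vec[of "wmat (rev U')" n n "wmat U" n "unit_vec n j"]
    by (simp add: wmat_append)
  also have "\<dots> = \<epsilon> \<cdot>\<^sub>v unit_vec n j'"
    unfolding \<epsilon>(2) using mult_mat_smult_vec[of "wmat (rev U')" n n "R (fold s U' j')" \<epsilon>] rr fold_lt[OF jP(2)] by simp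
  finally have h: "wmat (U @ rev U') * S j = S j' * wmat (U @ rev U')"
    using reflection_transport[OF j _ \<epsilon>(1)] by simp
  have "word_refl U j = wmat U' * wmat (rev U') * wmat U * S j * wmat (rev U)"
    unfolding word_refl_def by (simp add: wmat_rev_right)
  also have "\<dots> = wmat U' * (wmat (U @ rev U') * S j) * wmat (rev U)"
    by (simp add: wmat_append assoc_mult_mat[of _ n n _ n _ n])
  also have "\<dots> = wmat U' * S j' * wmat (rev U') * (wmat U * wmat (rev U))"
    unfolding h by (simp add: wmat_append assoc_mult_mat[of _ n n _ n _ n])
  also have "\<dots> = word_refl U' j'" unfolding word_refl_def by (simp add: wmat_rev_right)
  finally show ?thesis .
qed

text \<open>Conjugacy to a listed element up to sign, in the form \<open>g x = y g\<close>, which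
  contains no inverse.\<close>

definition covered :: "nat list list \<Rightarrow> int mat \<Rightarrow> bool" where
  "covered Y x \<longleftrightarrow> (\<exists>k<length Y. \<exists>g. pm_eq (wmat g * x) (wmat (Y ! k) * wmat g))"

lemma covered_pm_eq:
  assumes "x \<in> carrier_mat n n" "y \<in> carrier_mat n n" "pm_eq x y" "covered Y x"
  shows "covered Y y"
  using assms(4) pm_eq_trans[OF pm_eq_mult_left[OF assms(2,1) wmat_carrier pm_eq_sym[OF assms(3)]]]
  unfolding covered_def by blast

lemma covered_conj:
  assumes x: "x \<in> carrier_mat n n" and c: "covered Y (wmat h * x * wmat (rev h))"
  shows "covered Y x"
proof -
  obtain k g where k: "k < length Y" and g: "pm_eq (wmat g * (wmat h * x * wmat (rev h))) (wmat (Y ! k) * wmat g)"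
    using c unfolding covered_def by auto
  have "pm_eq (wmat g * (wmat h * x * wmat (rev h)) * wmat h) (wmat (Y ! k) * wmat g * wmat h)"
    using x by (intro pm_eq_mult_right[OF _ _ _ g]) auto
  moreover have "wmat g * (wmat h * x * wmat (rev h)) * wmat h = wmat (h @ g) * x * (wmat (rev h) * wmat h)"
    using x by (simp add: wmat_append assoc_mult_mat[of _ n n _ n _ n])
  ultimately have "pm_eq (wmat (h @ g) * x) (wmat (Y ! k) * wmat (h @ g))"
    using x by (simp add: wmat_rev_left wmat_append assoc_mult_mat[of _ n n _ n _ n])
  then show ?thesis unfolding covered_def using k by blast
qed

lemma certs_okD:
  assumes "certs_ok s n P Y X Cs r ds seeds" "r \<le> q" "q < P"
  shows "(\<exists>c\<in>set Cs. lowers s P q (word c)) \<or>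
    (\<exists>U j g k. j < n \<and> k < length Y \<and> fold s U j = q \<and> conjugates s n P X U j g (Y ! k))"
  using assms
proof (induction ds arbitrary: r seeds)
  case (Cons d ds)
  show ?case
  proof (cases "q = r")
    case True
    then show ?thesis using Cons.prems(1) by (cases "d < length Cs") (auto split: list.splits)
  next
    case False
    then have "r + 1 \<le> q" using Cons.prems(2) by simp
    moreover obtain ss where "certs_ok s n P Y X Cs (r + 1) ds ss"
      using Cons.prems(1) by (cases "d < length Cs") (auto split: list.splits)
    ultimately show ?thesis using Cons.IH Cons.prems(3) by blast
  qed
qed auto

text \<open>Induction on the index of the root. A word \<open>c\<close> commuting with
  \<open>X\<close> up to sign conjugates the product of \<open>X\<close> with one reflection into
  its product with the reflection in the root moved by \<open>c\<close>; if that root has smaller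
  index, the induction hypothesis applies. Seeds end the descent.\<close>

lemma rep_ok_covered:
  assumes ok: "rep_ok s n P Y (X, Cs, ds, seeds)" and j: "j < n" and q: "pos_index P (fold s U j) = q"
  shows "covered Y (wmat X * word_refl U j)"
  using j q
proof (induction q arbitrary: U j rule: less_induct)
  case (less q)
  have jP: "j < 2 * P" using less.prems(1) nP by auto
  define r where "r = fold s U j"
  have rP: "r < 2 * P" unfolding r_def by (rule fold_lt[OF jP])
  have q: "q < P" "r = q \<or> r = neg_index P q"
    using less.prems(2) rP unfolding r_def[symmetric] pos_index_def neg_index_def by auto
  have ok': "certs_ok s n P Y X Cs 0 ds seeds" using ok unfolding rep_ok_def by simp
  from certs_okD[OF ok' le0 q(1)] consider
      c where "c \<in> set Cs" "lowers s P q (word c)"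
    | U' j' g k where "j' < n" "k < length Y" "fold s U' j' = q" "conjugates s n P X U' j' g (Y ! k)"
    by blast
  then show ?case
  proof cases
    case (1 c)
    let ?c = "word c"
    have k: "pos_index P (fold s ?c q) < q" using 1(2) unfolding lowers_def .
    have lt: "fold s ?c q < 2 * P" using q(1) by (intro fold_lt) simp
    have "fold s (U @ ?c) j = fold s ?c q \<or> fold s (U @ ?c) j = neg_index P (fold s ?c q)"
      using q fold_neg_index[of q ?c] unfolding r_def by auto
    then have "pos_index P (fold s (U @ ?c) j) = pos_index P (fold s ?c q)"
      using lt unfolding pos_index_def neg_index_def by (auto split: if_splits)
    then have IH: "covered Y (wmat X * word_refl (U @ ?c) j)" using less.IH[OF k less.prems(1)] by simp
    have a: "acts_pm s n P (?c @ X @ rev ?c @ rev X)"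
      using ok 1(1) unfolding rep_ok_def by (auto simp: list_all_iff centralizes_def)
    have "pm_eq (wmat (rev X) * (wmat (rev ?c) * (wmat X * wmat ?c))) (1\<^sub>m n)"
      using acts_pmD[OF a] by (simp add: wmat_append assoc_mult_mat[of _ n n _ n _ n])
    then have "pm_eq (wmat ?c * wmat X * (wmat (rev X) * (wmat (rev ?c) * (wmat X * wmat ?c)))) (wmat ?c * wmat X * 1\<^sub>m n)"
      by (rule pm_eq_mult_left[of _ n, rotated 3]) auto
    moreover have "wmat ?c * wmat X * (wmat (rev X) * (wmat (rev ?c) * (wmat X * wmat ?c))) = wmat X * wmat ?c"
      by (simp add: wmat_cancel assoc_mult_mat[of _ n n _ n _ n])
    ultimately have cx: "pm_eq (wmat X * wmat ?c) (wmat ?c * wmat X)" by simp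
    have "wmat X * word_refl (U @ ?c) j = wmat X * wmat ?c * (word_refl U j * wmat (rev ?c))"
      unfolding word_refl_def by (simp add: wmat_append assoc_mult_mat[of _ n n _ n _ n])
    moreover have "pm_eq (wmat X * wmat ?c * (word_refl U j * wmat (rev ?c))) (wmat ?c * wmat X * (word_refl U j * wmat (rev ?c)))"
      by (rule pm_eq_mult_right[OF _ _ _ cx]) auto
    moreover have "wmat ?c * wmat X * (word_refl U j * wmat (rev ?c)) = wmat ?c * (wmat X * word_refl U j) * wmat (rev ?c)"
      by (simp add: assoc_mult_mat[of _ n n _ n _ n])
    ultimately have "covered Y (wmat ?c * (wmat X * word_refl U j) * wmat (rev ?c))"
      using IH covered_pm_eq[of "wmat X * word_refl (U @ ?c) j"] by simp
    then show ?thesis by (rule covered_conj[rotated]) simp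
  next
    case (2 U' j' g k)
    then have k: "j' < n" "k < length Y" "fold s U' j' = q"
      and a: "acts_pm s n P (rev U' @ [j'] @ U' @ X @ g @ rev (Y ! k) @ rev g)"
      unfolding conjugates_def by auto
    have req: "word_refl U j = word_refl U' j'"
      using q(2) k less.prems(1) unfolding r_def by (intro word_refl_eq) auto
    let ?y = "wmat (Y ! k)" and ?y' = "wmat (rev (Y ! k))" and ?g = "wmat g" and ?g' = "wmat (rev g)"
    have "pm_eq (?g' * (?y' * (?g * (wmat X * word_refl U' j')))) (1\<^sub>m n)"
      using acts_pmD[OF a] unfolding word_refl_def by (simp add: wmat_append assoc_mult_mat[of _ n n _ n _ n])
    then have "pm_eq (?y * ?g * (?g' * (?y' * (?g * (wmat X * word_refl U' j'))))) (?y * ?g * 1\<^sub>m n)"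
      by (rule pm_eq_mult_left[of _ n, rotated 3]) auto
    moreover have "?y * ?g * (?g' * (?y' * (?g * (wmat X * word_refl U' j')))) = ?g * (wmat X * word_refl U' j')"
      by (simp add: wmat_cancel assoc_mult_mat[of _ n n _ n _ n])
    ultimately have "pm_eq (?g * (wmat X * word_refl U' j')) (?y * ?g)" by simp
    then show ?thesis unfolding covered_def req using k(2) by blast
  qed
qed

text \<open>The conjugator found for a shorter word turns the additional simple reflection into an
  arbitrary one. This is why the certificates must treat all reflections.\<close>

lemma all_covered:
  assumes Y: "\<And>k. k < length Y \<Longrightarrow> \<exists>d. rep_ok s n P Y (Y ! k, d)" and Y0: "[] \<in> set Y"
  shows "covered Y (wmat w)"
proof (induction w)
  case Nil
  obtain k where "k < length Y" "Y ! k = []" using Y0 by (auto simp: in_set_conv_nth)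
  then show ?case unfolding covered_def pm_eq_def by (intro exI[of _ k]) (auto intro: exI[of _ "[]"])
next
  case (Cons i w)
  show ?case
  proof (cases "i < n")
    case False
    then show ?thesis using Cons S_ge[of i] by simp
  next
    case True
    obtain k g where k: "k < length Y" and g: "pm_eq (wmat g * wmat w) (wmat (Y ! k) * wmat g)"
      using Cons unfolding covered_def by auto
    obtain Cs ds seeds where "rep_ok s n P Y (Y ! k, Cs, ds, seeds)" using Y[OF k] by auto
    then have "covered Y (wmat (Y ! k) * word_refl g i)" using rep_ok_covered True by blast
    moreover have "pm_eq (wmat (Y ! k) * wmat g * (S i * wmat (rev g))) (wmat g * wmat w * (S i * wmat (rev g)))"
      by (rule pm_eq_mult_right[OF _ _ _ pm_eq_sym[OF g]]) auto
    moreover have "wmat (Y ! k) * wmat g * (S i * wmat (rev g)) = wmat (Y ! k) * word_refl g i"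
      unfolding word_refl_def by (simp add: assoc_mult_mat[of _ n n _ n _ n])
    moreover have "wmat g * wmat w * (S i * wmat (rev g)) = wmat g * wmat (i # w) * wmat (rev g)"
      by (simp add: assoc_mult_mat[of _ n n _ n _ n])
    ultimately have "covered Y (wmat g * wmat (i # w) * wmat (rev g))"
      using covered_pm_eq[of "wmat (Y ! k) * word_refl g i"] by simp
    then show ?thesis by (rule covered_conj[rotated]) simp
  qed
qed

end

section \<open>Invariants of conjugacy classes and the count for one Weyl group\<close>

context root_table
begin

definition mtr :: "int mat \<Rightarrow> int" where
  "mtr M = (\<Sum>a<n. M $$ (a, a))"

lemma mtr_comm: "M \<in> carrier_mat n n \<Longrightarrow> N \<in> carrier_mat n n \<Longrightarrow> mtr (M * N) = mtr (N * M)"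
proof -
  assume M: "M \<in> carrier_mat n n" and N: "N \<in> carrier_mat n n"
  have "mtr (M * N) = (\<Sum>a<n. \<Sum>b<n. M $$ (a, b) * N $$ (b, a))"
    unfolding mtr_def using M N by (intro sum.cong) (auto simp: scalar_prod_def atLeast0LessThan)
  also have "\<dots> = (\<Sum>b<n. \<Sum>a<n. N $$ (b, a) * M $$ (a, b))"
    by (subst sum.swap) (simp add: mult.commute)
  also have "\<dots> = mtr (N * M)"
    unfolding mtr_def using M N by (intro sum.cong) (auto simp: scalar_prod_def atLeast0LessThan)
  finally show ?thesis .
qed

lemma mtr_uminus: "M \<in> carrier_mat n n \<Longrightarrow> mtr (- M) = - mtr M"
  unfolding mtr_def by (auto simp: sum_negf[symmetric] intro!: sum.cong)

lemma mtr_conj: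
  assumes "M \<in> carrier_mat n n" "M' \<in> carrier_mat n n" "M' * wmat g = wmat g * M"
  shows "mtr M' = mtr M"
proof -
  have "M' = M' * wmat g * wmat (rev g)"
    using assms(2) by (simp add: assoc_mult_mat[of _ n n _ n _ n] wmat_rev_right)
  also have "mtr \<dots> = mtr (wmat (rev g) * (wmat g * M))"
    unfolding assms(3) using assms(1) by (intro mtr_comm) auto
  also have "\<dots> = mtr M" using assms(1) by (simp add: wmat_cancel)
  finally show ?thesis .
qed

primrec trseq :: "int mat \<Rightarrow> nat \<Rightarrow> int mat \<Rightarrow> int list" where
  "trseq M 0 N = []"
| "trseq M (Suc p) N = mtr (M * N) # trseq M p (M * N)"

lemma trseq_conj:
  assumes "M \<in> carrier_mat n n" "M' \<in> carrier_mat n n" "M' * wmat g = wmat g * M"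
    and "N \<in> carrier_mat n n" "N' \<in> carrier_mat n n" "N' * wmat g = wmat g * N"
  shows "trseq M' p N' = trseq M p N"
  using assms(4-6)
proof (induction p arbitrary: N N')
  case (Suc p)
  have e: "M' * N' * wmat g = wmat g * (M * N)"
  proof -
    have "M' * N' * wmat g = M' * wmat g * N"
      using Suc.prems assms(1,2) by (simp add: assoc_mult_mat[of _ n n _ n _ n])
    then show ?thesis unfolding assms(3) using Suc.prems assms(1) by (simp add: assoc_mult_mat[of _ n n _ n _ n])
  qed
  have "mtr (M' * N') = mtr (M * N)" using Suc.prems assms(1,2) e by (intro mtr_conj) auto
  moreover have "trseq M' p (M' * N') = trseq M p (M * N)"
    using Suc.prems assms(1,2) e by (intro Suc.IH) auto
  ultimately show ?case by simp
qed simp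

text \<open>Two powers are handled at a time, because the sign returns after two
  multiplications.\<close>

lemma trseq_uminus:
  "M \<in> carrier_mat n n \<Longrightarrow> N \<in> carrier_mat n n \<Longrightarrow> trseq (- M) p N = neg_odd (trseq M p N)"
proof (induction p arbitrary: N rule: induct_nat_012)
  case 1
  then show ?case using uminus_mult_left_mat[of M N] by (simp add: mtr_uminus)
next
  case (ge2 p)
  have "- M * N = - (M * N)" "- M * (- (M * N)) = M * (M * N)"
    using ge2.prems uminus_mult_left_mat[of M N] uminus_mult_left_mat[of M "- (M * N)"]
      uminus_mult_right_mat[of M "M * N"] by simp_all
  then show ?case using ge2.IH(1)[of "M * (M * N)"] ge2.prems by (simp add: mtr_uminus)
qed simp

lemma diag_sum_eq: "diag_sum rt k L = (\<Sum>a<length L. rt (L ! a) ! (k + a))"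
proof (induction L arbitrary: k)
  case (Cons r L)
  have "diag_sum rt k (r # L) = rt r ! k + (\<Sum>a<length L. rt (L ! a) ! (k + Suc a))"
    using Cons[of "Suc k"] by simp
  then show ?case by (simp add: sum.lessThan_Suc_shift del: sum.lessThan_Suc)
qed simp

text \<open>The columns of \<open>N\<close> are roots and \<open>L\<close> records their indices, so
  left multiplication by \<open>wmat w\<close> amounts to mapping the permutation over
  \<open>L\<close>.\<close>

lemma traces_eq:
  assumes "length L = n" "\<And>a. a < n \<Longrightarrow> L ! a < 2 * P" "N \<in> carrier_mat n n"
    and "\<And>a. a < n \<Longrightarrow> N *\<^sub>v unit_vec n a = R (L ! a)"
  shows "traces s rt w p L = trseq (wmat w) p N"
  using assms
proof (induction p arbitrary: L N)
  case (Suc p)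
  let ?L = "map (fold s w) L"
  have e: "(wmat w * N) *\<^sub>v unit_vec n a = R (?L ! a)" if "a < n" for a
    using assoc_mult_mat_vec[of "wmat w" n n N n "unit_vec n a"] Suc.prems that wmat_R by simp
  have "diag_sum rt 0 ?L = mtr (wmat w * N)"
    unfolding diag_sum_eq mtr_def
  proof (rule sum.cong)
    fix a assume "a \<in> {..<n}"
    then have a: "a < n" by simp
    have "(wmat w * N) $$ (a, a) = ((wmat w * N) *\<^sub>v unit_vec n a) $ a"
      using a Suc.prems(3) by (simp del: index_mult_mat(1) assoc_mult_mat_vec)
    then show "rt (?L ! a) ! (0 + a) = (wmat w * N) $$ (a, a)"
      unfolding e[OF a] by (simp add: vec_of_list_index)
  qed (use Suc.prems in simp)
  moreover have "traces s rt w p ?L = trseq (wmat w) p (wmat w * N)"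
    using Suc.prems e by (intro Suc.IH) (auto intro: fold_lt)
  ultimately show ?case by simp
qed simp

text \<open>The counterpart of \<open>word_inv\<close> for matrices, on which invariance under
  conjugation can be proved by linear algebra.\<close>

definition mat_inv :: "nat \<Rightarrow> nat list \<Rightarrow> int mat \<Rightarrow> int list \<times> nat \<times> nat" where
  "mat_inv p Ls M = (trseq M p (1\<^sub>m n), card {v \<in> R ` set Ls. M *\<^sub>v v = v}, card {v \<in> R ` set Ls. M *\<^sub>v v = - v})"

lemma word_inv_eq:
  assumes "distinct Ls" "set Ls \<subseteq> {..<2 * P}"
  shows "word_inv s rt n P p Ls w = mat_inv p Ls (wmat w)"
proof -
  have 1: "traces s rt w p [0..<n] = trseq (wmat w) p (1\<^sub>m n)"
    using nP by (intro traces_eq) (auto simp: simple_rt)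
  have card: "card {v \<in> R ` set Ls. wmat w *\<^sub>v v = h v} = length (filter (\<lambda>r. fold s w r = h' r) Ls)"
    if h: "\<And>r. r < 2 * P \<Longrightarrow> h (R r) = R (h' r) \<and> h' r < 2 * P" for h h'
  proof -
    have "{v \<in> R ` set Ls. wmat w *\<^sub>v v = h v} = R ` set (filter (\<lambda>r. fold s w r = h' r) Ls)"
    proof (intro equalityI subsetI)
      fix v assume "v \<in> {v \<in> R ` set Ls. wmat w *\<^sub>v v = h v}"
      then obtain r where r: "r \<in> set Ls" "v = R r" "wmat w *\<^sub>v R r = h (R r)" by auto
      have rP: "r < 2 * P" using r(1) assms(2) by auto
      have "fold s w r = h' r"
        using r(3) R_inj[OF fold_lt[OF rP]] h[OF rP] wmat_R[OF rP] by auto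
      then show "v \<in> R ` set (filter (\<lambda>r. fold s w r = h' r) Ls)" using r by auto
    next
      fix v assume "v \<in> R ` set (filter (\<lambda>r. fold s w r = h' r) Ls)"
      then obtain r where r: "r \<in> set Ls" "v = R r" "fold s w r = h' r" by auto
      have rP: "r < 2 * P" using r(1) assms(2) by auto
      show "v \<in> {v \<in> R ` set Ls. wmat w *\<^sub>v v = h v}"
        using r h[OF rP] wmat_R[OF rP] by auto
    qed
    moreover have "inj_on R (set (filter (\<lambda>r. fold s w r = h' r) Ls))"
      using assms(2) R_inj by (intro inj_onI) auto
    ultimately show ?thesis using assms(1) by (simp add: card_image distinct_card[symmetric] del: set_filter)
  qed
  show ?thesis
    unfolding word_inv_def mat_inv_def 1
    using card[of "\<lambda>v. v" "\<lambda>r. r"] card[of uminus "neg_index P"] by (simp add: R_neg_index neg_index_lt)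
qed

lemma neg_inv_mat_inv:
  assumes "M \<in> carrier_mat n n" "set Ls \<subseteq> {..<2 * P}"
  shows "neg_inv (mat_inv p Ls M) = mat_inv p Ls (- M)"
proof -
  have "(- M *\<^sub>v v = v) = (M *\<^sub>v v = - v)" "(- M *\<^sub>v v = - v) = (M *\<^sub>v v = v)"
    if "v \<in> R ` set Ls" for v
  proof -
    have v: "v \<in> carrier_vec n" using that assms(2) by auto
    have "- M *\<^sub>v v = - (M *\<^sub>v v)" using v assms(1) by simp
    moreover have "- (M *\<^sub>v v) = v \<longleftrightarrow> M *\<^sub>v v = - v" "- (M *\<^sub>v v) = - v \<longleftrightarrow> M *\<^sub>v v = v"
      by (metis uminus_uminus_vec, metis uminus_uminus_vec)
    ultimately show "(- M *\<^sub>v v = v) = (M *\<^sub>v v = - v)" "(- M *\<^sub>v v = - v) = (M *\<^sub>v v = v)" by simp_all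
  qed
  then have "{v \<in> R ` set Ls. - M *\<^sub>v v = v} = {v \<in> R ` set Ls. M *\<^sub>v v = - v}"
    "{v \<in> R ` set Ls. - M *\<^sub>v v = - v} = {v \<in> R ` set Ls. M *\<^sub>v v = v}" by auto
  then show ?thesis unfolding neg_inv_def mat_inv_def using trseq_uminus[OF assms(1), of "1\<^sub>m n"] by simp
qed

text \<open>The conjugator carries fixed vectors to fixed vectors and negated ones to negated ones.
  It must preserve the chosen set of roots, hence the stability required of
  \<open>Ls\<close>.\<close>

lemma mat_inv_conj:
  assumes M: "M \<in> carrier_mat n n" and M': "M' \<in> carrier_mat n n" and g: "M' * wmat g = wmat g * M"
    and Ls: "set Ls \<subseteq> {..<2 * P}" "\<And>i r. i < n \<Longrightarrow> r \<in> set Ls \<Longrightarrow> s i r \<in> set Ls"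
  shows "mat_inv p Ls M' = mat_inv p Ls M"
proof -
  let ?V = "R ` set Ls"
  have VC: "v \<in> carrier_vec n" if "v \<in> ?V" for v using that Ls(1) by auto
  have SV: "S i *\<^sub>v v \<in> ?V" if "v \<in> ?V" for i v
  proof (cases "i < n")
    case True
    obtain r where "r \<in> set Ls" "v = R r" using \<open>v \<in> ?V\<close> by auto
    then show ?thesis using s_rt[of r i] Ls True by auto
  qed (use that VC S_ge[of i] in auto)
  have wV: "wmat w *\<^sub>v v \<in> ?V" if "v \<in> ?V" for w v
    using that
  proof (induction w arbitrary: v)
    case (Cons i w)
    then show ?case using SV[OF Cons.prems, of i] VC[OF Cons.prems] assoc_mult_mat_vec[of "wmat w" n n "S i" n v] by simp
  qed (use VC in auto)
  have inv: "wmat (rev g) *\<^sub>v (wmat g *\<^sub>v v) = v" "wmat g *\<^sub>v (wmat (rev g) *\<^sub>v v) = v" if "v \<in> ?V" for v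
    using VC[OF that] assoc_mult_mat_vec[of "wmat (rev g)" n n "wmat g" n v]
      assoc_mult_mat_vec[of "wmat g" n n "wmat (rev g)" n v] by (simp_all add: wmat_rev_left wmat_rev_right)
  have gv: "M' *\<^sub>v (wmat g *\<^sub>v v) = wmat g *\<^sub>v (M *\<^sub>v v)" if "v \<in> ?V" for v
    using VC[OF that] M M' g assoc_mult_mat_vec[of M' n n "wmat g" n v] assoc_mult_mat_vec[of "wmat g" n n M n v] by simp
  have card: "card {v \<in> ?V. M' *\<^sub>v v = h v} = card {v \<in> ?V. M *\<^sub>v v = h v}"
    if h: "\<And>v w. v \<in> ?V \<Longrightarrow> wmat w *\<^sub>v h v = h (wmat w *\<^sub>v v)" "\<And>v. v \<in> ?V \<Longrightarrow> h v \<in> carrier_vec n" for h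
  proof -
    have "bij_betw (\<lambda>v. wmat g *\<^sub>v v) {v \<in> ?V. M *\<^sub>v v = h v} {v \<in> ?V. M' *\<^sub>v v = h v}"
    proof (rule bij_betw_byWitness[where f'="\<lambda>v. wmat (rev g) *\<^sub>v v"])
      show "(\<lambda>v. wmat g *\<^sub>v v) ` {v \<in> ?V. M *\<^sub>v v = h v} \<subseteq> {v \<in> ?V. M' *\<^sub>v v = h v}"
        using wV gv h(1) by auto
      show "(\<lambda>v. wmat (rev g) *\<^sub>v v) ` {v \<in> ?V. M' *\<^sub>v v = h v} \<subseteq> {v \<in> ?V. M *\<^sub>v v = h v}"
      proof clarsimp
        fix r assume r: "r \<in> set Ls" "M' *\<^sub>v R r = h (R r)"
        have V: "R r \<in> ?V" using r(1) by auto
        let ?v = "wmat (rev g) *\<^sub>v R r"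
        have v: "?v \<in> ?V" by (rule wV[OF V])
        have "wmat g *\<^sub>v (M *\<^sub>v ?v) = M' *\<^sub>v R r" using gv[OF v] inv(2)[OF V] by simp
        then have "wmat (rev g) *\<^sub>v (wmat g *\<^sub>v (M *\<^sub>v ?v)) = h ?v" using r(2) h(1)[OF V] by simp
        moreover have "wmat (rev g) *\<^sub>v (wmat g *\<^sub>v (M *\<^sub>v ?v)) = M *\<^sub>v ?v"
          using M VC[OF v] assoc_mult_mat_vec[of "wmat (rev g)" n n "wmat g" n "M *\<^sub>v ?v"] by (simp add: wmat_rev_left)
        ultimately show "?v \<in> ?V \<and> M *\<^sub>v ?v = h ?v" using v by simp
      qed
    qed (use inv in auto)
    then show ?thesis by (rule bij_betw_same_card[symmetric])
  qed
  have "wmat w *\<^sub>v (- v) = - (wmat w *\<^sub>v v)" if "v \<in> ?V" for v w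
    by (rule mult_mat_uminus_vec[OF wmat_carrier VC[OF that]])
  then have "card {v \<in> ?V. M' *\<^sub>v v = - v} = card {v \<in> ?V. M *\<^sub>v v = - v}"
    using VC by (intro card) auto
  moreover have "card {v \<in> ?V. M' *\<^sub>v v = v} = card {v \<in> ?V. M *\<^sub>v v = v}"
    using VC by (intro card) auto
  moreover have "trseq M' p (1\<^sub>m n) = trseq M p (1\<^sub>m n)"
    by (rule trseq_conj[OF M M' g]) auto
  ultimately show ?thesis unfolding mat_inv_def by simp
qed

lemma neg_one_center:
  assumes "acts_neg s n P zw"
  shows "center G - {\<one>\<^bsub>G\<^esub>} = {- 1\<^sub>m n}"
proof -
  have z: "- 1\<^sub>m n = wmat zw" using acts_negD[OF assms] by simp
  have "- 1\<^sub>m n \<in> center G"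
    unfolding center_def
  proof (intro CollectI conjI ballI)
    show "- 1\<^sub>m n \<in> carrier G" unfolding z carrier_G by simp
    fix x assume "x \<in> carrier G"
    then have "x \<in> carrier_mat n n" by (rule G_carrier_mat)
    then show "- 1\<^sub>m n \<otimes>\<^bsub>G\<^esub> x = x \<otimes>\<^bsub>G\<^esub> - 1\<^sub>m n"
      unfolding G_mult using uminus_mult_left_mat[of "1\<^sub>m n" x] uminus_mult_right_mat[of x "1\<^sub>m n"] by simp
  qed
  moreover have "- 1\<^sub>m n \<noteq> (1\<^sub>m n :: int mat)"
  proof
    assume "- 1\<^sub>m n = (1\<^sub>m n :: int mat)"
    then have "(- 1\<^sub>m n) $$ (0, 0) = (1\<^sub>m n :: int mat) $$ (0, 0)" by simp
    then show False using n0 by simp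
  qed
  ultimately show ?thesis using center_G unfolding G_one by auto
qed

text \<open>Distinctness of the doubled list excludes every conjugacy among the chosen
  representatives and their negatives, including that of a representative with its own negative. A
  listed word outside \<open>ks\<close> comes with an explicit conjugator to its negative.\<close>

theorem card_odd_irr_chars_G:
  assumes Y: "\<And>k. k < length Y \<Longrightarrow> \<exists>d. rep_ok s n P Y (Y ! k, d)" and Y0: "[] \<in> set Y"
    and zw: "acts_neg s n P zw"
    and ks: "set ks \<subseteq> {..<length Y}"
    and self: "\<And>k. k < length Y \<Longrightarrow> k \<notin> set ks \<Longrightarrow> \<exists>g. acts_neg s n P (rev (Y ! k) @ rev g @ (Y ! k) @ g)"
    and Ls: "distinct Ls" "set Ls \<subseteq> {..<2 * P}" "\<And>i r. i < n \<Longrightarrow> r \<in> set Ls \<Longrightarrow> s i r \<in> set Ls"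
    and dist: "distinct (map (\<lambda>k. word_inv s rt n P p Ls (Y ! k)) ks @ map (\<lambda>k. neg_inv (word_inv s rt n P p Ls (Y ! k))) ks)"
  shows "card (odd_irr_chars G (- 1\<^sub>m n)) = length ks"
proof -
  interpret G: group G by (rule G_group)
  interpret F: fin_group G by unfold_locales (rule finite_G)
  let ?z = "- 1\<^sub>m n :: int mat"
  have zc: "?z \<in> center G" using neg_one_center[OF zw] by auto
  have zm: "?z \<otimes>\<^bsub>G\<^esub> x = - x" if "x \<in> carrier_mat n n" for x
    unfolding G_mult using that uminus_mult_left_mat[of "1\<^sub>m n" x] by simp
  have cj: "F.conjg (wmat g) x = wmat g * x * wmat (rev g)" for g x
    unfolding F.conjg_def G_mult G_inv by simp
  have conj_uminus: "F.conjg (wmat h) (- x) = - F.conjg (wmat h) x" if "x \<in> carrier_mat n n" for h x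
    unfolding cj using that uminus_mult_right_mat[of "wmat h" x] uminus_mult_left_mat[of "wmat h * x" "wmat (rev h)"] by simp
  let ?x = "\<lambda>i. wmat (Y ! (ks ! i))"
  have dist': "distinct (map (\<lambda>k. mat_inv p Ls (wmat (Y ! k))) ks @ map (\<lambda>k. mat_inv p Ls (- wmat (Y ! k))) ks)"
    using dist by (simp add: word_inv_eq[OF Ls(1,2)] neg_inv_mat_inv[OF _ Ls(2)])
  have conj_eq: "(wmat g * M * wmat (rev g)) * wmat g = wmat g * M" if "M \<in> carrier_mat n n" for g M
    using that by (simp add: assoc_mult_mat[of _ n n _ n _ n] wmat_rev_left)
  show ?thesis
  proof (rule F.card_odd_irr_chars[OF zc, where x="?x"])
    show "?z \<otimes>\<^bsub>G\<^esub> ?z = \<one>\<^bsub>G\<^esub>" by (simp add: zm G_one)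
    show "?x i \<in> carrier G" for i unfolding carrier_G by simp
    show "i = j" if ij: "i < length ks" "j < length ks" "g \<in> carrier G" "?x j = F.conjg g (?x i)" for i j g
    proof -
      obtain w where w: "g = wmat w" using ij(3) unfolding carrier_G by auto
      have "mat_inv p Ls (?x j) = mat_inv p Ls (?x i)"
        using ij(4) unfolding w cj by (intro mat_inv_conj[OF _ _ _ Ls(2,3), of _ _ w]) (auto simp: conj_eq)
      then have "map (\<lambda>k. mat_inv p Ls (wmat (Y ! k))) ks ! j = map (\<lambda>k. mat_inv p Ls (wmat (Y ! k))) ks ! i"
        using ij by simp
      then show ?thesis using dist' ij(1,2) by (simp only: distinct_append nth_eq_iff_index_eq length_map)
    qed
    show "?x j \<noteq> ?z \<otimes>\<^bsub>G\<^esub> F.conjg g (?x i)" if ij: "i < length ks" "j < length ks" "g \<in> carrier G" for i j g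
    proof
      assume e: "?x j = ?z \<otimes>\<^bsub>G\<^esub> F.conjg g (?x i)"
      obtain w where w: "g = wmat w" using ij(3) unfolding carrier_G by auto
      have "- ?x j = wmat w * ?x i * wmat (rev w)" unfolding e w cj by (simp add: zm)
      then have "mat_inv p Ls (- ?x j) = mat_inv p Ls (?x i)"
        by (intro mat_inv_conj[OF _ _ _ Ls(2,3), of _ _ w]) (auto simp: conj_eq)
      then have "mat_inv p Ls (?x i) \<in> (\<lambda>k. mat_inv p Ls (- wmat (Y ! k))) ` set ks"
        using ij(2) by (auto intro!: image_eqI[of _ _ "ks ! j"])
      moreover have "mat_inv p Ls (?x i) \<in> (\<lambda>k. mat_inv p Ls (wmat (Y ! k))) ` set ks"
        using ij(1) by auto
      ultimately show False using dist' by auto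
    qed
    fix h assume "h \<in> carrier G"
    then obtain w where h: "h = wmat w" unfolding carrier_G by auto
    obtain k g where k: "k < length Y" and g: "pm_eq (wmat g * h) (wmat (Y ! k) * wmat g)"
      using all_covered[OF Y Y0, of w] unfolding covered_def h by auto
    have "pm_eq (wmat (rev g) * (wmat g * h)) (wmat (rev g) * (wmat (Y ! k) * wmat g))"
      unfolding h by (rule pm_eq_mult_left[OF _ _ _ g[unfolded h]]) auto
    then have hg: "pm_eq h (F.conjg (wmat (rev g)) (wmat (Y ! k)))"
      unfolding cj h by (simp add: wmat_cancel assoc_mult_mat[of _ n n _ n _ n])
    show "(\<exists>i<length ks. \<exists>g\<in>carrier G. h = F.conjg g (?x i) \<or> h = ?z \<otimes>\<^bsub>G\<^esub> F.conjg g (?x i)) \<or>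
       (\<exists>g\<in>carrier G. F.conjg g h = ?z \<otimes>\<^bsub>G\<^esub> h)"
    proof (cases "k \<in> set ks")
      case True
      then obtain i where i: "i < length ks" "k = ks ! i" by (auto simp: in_set_conv_nth)
      have "h = F.conjg (wmat (rev g)) (?x i) \<or> h = ?z \<otimes>\<^bsub>G\<^esub> F.conjg (wmat (rev g)) (?x i)"
        using hg unfolding pm_eq_def i(2) cj by (simp add: zm)
      then show ?thesis using i(1) unfolding carrier_G by blast
    next
      case False
      obtain g' where g'neg: "acts_neg s n P (rev (Y ! k) @ rev g' @ (Y ! k) @ g')" using self[OF k False] by auto
      let ?y = "wmat (Y ! k)" and ?y' = "wmat (rev (Y ! k))"
      have "wmat g' * (?y * (wmat (rev g') * ?y')) = ?z"
        using acts_negD[OF g'neg] by (simp add: wmat_append assoc_mult_mat[of _ n n _ n _ n])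
      then have "wmat g' * (?y * (wmat (rev g') * ?y')) * ?y = ?z * ?y" by simp
      moreover have "wmat g' * (?y * (wmat (rev g') * ?y')) * ?y = F.conjg (wmat g') ?y"
        unfolding cj by (simp add: assoc_mult_mat[of _ n n _ n _ n] wmat_rev_left)
      ultimately have g': "F.conjg (wmat g') ?y = - ?y" using zm[of ?y] unfolding G_mult by simp
      \<comment> \<open>Moves the conjugator that negates \<open>Y ! k\<close> over to
        \<open>h\<close>, which up to sign is the conjugate of \<open>Y ! k\<close> by the inverse
        of \<open>g\<close>.\<close>
      define w0 where "w0 = g @ g' @ rev g"
      have wm: "wmat w0 = wmat (rev g) * (wmat g' * wmat g)"
        unfolding w0_def by (simp add: wmat_append assoc_mult_mat[of _ n n _ n _ n])
      have wmr: "wmat (rev w0) = wmat (rev g) * (wmat (rev g') * wmat g)"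
        unfolding w0_def by (simp add: wmat_append assoc_mult_mat[of _ n n _ n _ n])
      let ?c = "F.conjg (wmat (rev g)) ?y"
      have "F.conjg (wmat w0) ?c = F.conjg (wmat (rev g)) (F.conjg (wmat g') ?y)"
        unfolding cj unfolding wm wmr by (simp add: assoc_mult_mat[of _ n n _ n _ n] wmat_cancel)
      also have "\<dots> = F.conjg (wmat (rev g)) (- ?y)" by (simp only: g')
      also have "\<dots> = - ?c" by (rule conj_uminus) simp
      finally have c: "F.conjg (wmat w0) ?c = - ?c" .
      have cc: "?c \<in> carrier_mat n n" unfolding cj by simp
      have "F.conjg (wmat w0) (- ?c) = - F.conjg (wmat w0) ?c" by (rule conj_uminus[OF cc])
      then have "F.conjg (wmat w0) h = - h" using hg c unfolding pm_eq_def by auto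
      then show ?thesis using zm[of h] unfolding h carrier_G by auto
    qed
  qed
qed

end

section \<open>Evaluation of certificates\<close>

text \<open>The facts \<open>f 0 = x\<^sub>0, f 1 = x\<^sub>1, \<dots>\<close> with arguments in numeral form; unfolded, they serve as rewrite rules
  that look up a value without traversing the list.\<close>

primrec graph_from :: "(nat \<Rightarrow> 'a) \<Rightarrow> num \<Rightarrow> 'a list \<Rightarrow> bool" where
  "graph_from f k [] = True"
| "graph_from f k (x # xs) = (f (numeral k) = x \<and> graph_from f (Num.inc k) xs)"

primrec graph :: "(nat \<Rightarrow> 'a) \<Rightarrow> 'a list \<Rightarrow> bool" where
  "graph f [] = True"
| "graph f (x # xs) = (f 0 = x \<and> graph_from f num.One xs)"

lemma graph_fromI: "(\<And>j. j < length xs \<Longrightarrow> f (numeral k + j) = xs ! j) \<Longrightarrow> graph_from f k xs"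
proof (induction xs arbitrary: k)
  case (Cons x xs)
  have "f (numeral (Num.inc k) + j) = xs ! j" if "j < length xs" for j
  proof -
    have "numeral (Num.inc k) + j = numeral k + Suc j" by (simp only: numeral_inc add_Suc_right add_Suc plus_1_eq_Suc add.assoc)
    moreover have "f (numeral k + Suc j) = (x # xs) ! Suc j" by (rule Cons.prems) (use that in simp)
    ultimately show ?thesis by (simp only: nth_Cons_Suc)
  qed
  then show ?case using Cons.IH[of "Num.inc k"] Cons.prems[of 0] by simp
qed simp

lemma graphI: "(\<And>j. j < length xs \<Longrightarrow> f j = xs ! j) \<Longrightarrow> graph f xs"
  by (cases xs) (auto intro!: graph_fromI)

text \<open>Only the images of positive roots are stored; the negative ones follow by linearity, and
  letters without a row act trivially.\<close>

definition perm_table :: "nat \<Rightarrow> nat list list \<Rightarrow> nat \<Rightarrow> nat \<Rightarrow> nat" where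
  "perm_table P tab i r = (if i < length tab then (tab ! i @ map (neg_index P) (tab ! i)) ! r else r)"

definition root_table_fun :: "int list list \<Rightarrow> nat \<Rightarrow> int list" where
  "root_table_fun rs r = (rs @ map (map uminus) rs) ! r"

lemma graph_perm_table:
  "i < length tab \<Longrightarrow> graph (perm_table P tab i) (tab ! i @ map (neg_index P) (tab ! i))"
  by (rule graphI) (simp add: perm_table_def)

lemma graph_root_table: "graph (root_table_fun rs) (rs @ map (map uminus) rs)"
  by (rule graphI) (simp add: root_table_fun_def)

lemma graph_nth: "graph ((!) xs) xs"
  by (rule graphI) simp

text \<open>Together with \<open>minus_at\<close> this evaluates a simple reflection on coordinate
  lists: the pairing with a row of the Cartan matrix is subtracted at one position.\<close>

primrec dot :: "int list \<Rightarrow> int list \<Rightarrow> int" where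
  "dot [] ys = 0"
| "dot (x # xs) ys = x * hd ys + dot xs (tl ys)"

primrec minus_at :: "nat \<Rightarrow> int \<Rightarrow> int list \<Rightarrow> int list" where
  "minus_at i c [] = []"
| "minus_at i c (x # xs) = (case i of 0 \<Rightarrow> (x - c) # xs | Suc j \<Rightarrow> x # minus_at j c xs)"

primrec all_from :: "(nat \<Rightarrow> 'a \<Rightarrow> bool) \<Rightarrow> nat \<Rightarrow> 'a list \<Rightarrow> bool" where
  "all_from Q i [] = True"
| "all_from Q i (x # xs) = (Q i x \<and> all_from Q (Suc i) xs)"

lemma all_from_iff: "all_from Q i xs \<longleftrightarrow> (\<forall>k<length xs. Q (i + k) (xs ! k))"
  by (induction xs arbitrary: i) (auto simp: less_Suc_eq_0_disj)

lemma dot_eq: "length xs = length ys \<Longrightarrow> dot xs ys = (\<Sum>j<length ys. xs ! j * ys ! j)"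
proof (induction xs arbitrary: ys)
  case (Cons x xs)
  then obtain y ys' where "ys = y # ys'" by (cases ys) auto
  then show ?case using Cons by (simp add: sum.lessThan_Suc_shift del: sum.lessThan_Suc)
qed simp

lemma length_minus_at [simp]: "length (minus_at i c xs) = length xs"
  by (induction xs arbitrary: i) (auto split: nat.split)

lemma minus_at_nth: "k < length xs \<Longrightarrow> minus_at i c xs ! k = xs ! k - of_bool (k = i) * c"
  by (induction xs arbitrary: i k) (auto split: nat.split simp: nth_Cons')

text \<open>The sign conditions keep the listed roots apart from their negatives. The last clause
  ties the permutations to the reflections.\<close>

definition table_ok :: "nat \<Rightarrow> nat \<Rightarrow> int list list \<Rightarrow> int list list \<Rightarrow> nat list list \<Rightarrow> bool" where
  "table_ok n P cmat rs tab \<longleftrightarrow> n \<le> P \<and> length cmat = n \<and> length tab = n \<and> length rs = P \<and>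
     list_all (\<lambda>v. length v = n \<and> list_all (\<lambda>x. 0 \<le> x) v \<and> list_ex (\<lambda>x. 0 < x) v) rs \<and>
     distinct rs \<and> list_all (\<lambda>row. length row = n) cmat \<and>
     take n rs = map (\<lambda>k. map (\<lambda>j. of_bool (j = k)) [0..<n]) [0..<n] \<and>
     list_all (\<lambda>row. length row = P \<and> list_all (\<lambda>q. q < 2 * P) row) tab \<and>
     all_from (\<lambda>i row. map (\<lambda>v. minus_at i (dot (cmat ! i) v) v) rs = map (root_table_fun rs) row) 0 tab"

text \<open>A positive coordinate of one list would become a negative coordinate of another.\<close>

lemma distinct_negatives:
  assumes "distinct rs" "\<And>v. v \<in> set rs \<Longrightarrow> (\<forall>x\<in>set v. (0::int) \<le> x) \<and> (\<exists>x\<in>set v. 0 < x)"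
  shows "distinct (rs @ map (map uminus) rs)"
proof -
  have "inj_on (map uminus) (set rs :: int list set)"
    by (rule inj_onI) (metis (no_types, lifting) list.inj_map_strong neg_equal_iff_equal)
  moreover have "map uminus v \<noteq> w" if vw: "v \<in> set rs" "w \<in> set rs" for v w :: "int list"
  proof
    assume "map uminus v = w"
    moreover obtain x where "x \<in> set v" "0 < x" using assms(2)[OF vw(1)] by auto
    ultimately have "- x \<in> set w" by auto
    then show False using assms(2)[OF vw(2)] \<open>0 < x\<close> by auto
  qed
  ultimately show ?thesis using assms(1) by (auto simp: distinct_map)
qed

text \<open>The test concerns positive roots and proper letters; negative roots are settled by
  linearity and further letters by \<open>S_ge\<close>.\<close>

lemma root_table_of_table_ok:
  assumes cartan: "cartan A n d" and cmat: "\<And>i j. i < n \<Longrightarrow> j < n \<Longrightarrow> A $$ (i, j) = cmat ! i ! j"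
    and ok: "table_ok n P cmat rs tab"
  shows "root_table A n d P (root_table_fun rs) (perm_table P tab)"
proof -
  interpret cartan A n d by (rule cartan)
  note ok' = ok[unfolded table_ok_def]
  have nP: "n \<le> P" and len: "length cmat = n" "length tab = n" "length rs = P"
    and rs1: "\<And>v. v \<in> set rs \<Longrightarrow> length v = n \<and> (\<forall>x\<in>set v. 0 \<le> x) \<and> (\<exists>x\<in>set v. 0 < x)"
    and dist: "distinct rs" and rowl: "\<And>i. i < n \<Longrightarrow> length (cmat ! i) = n"
    and simple: "take n rs = map (\<lambda>k. map (\<lambda>j. of_bool (j = k)) [0..<n]) [0..<n]"
    and tabs: "\<And>row. row \<in> set tab \<Longrightarrow> length row = P \<and> (\<forall>q\<in>set row. q < 2 * P)"
    using ok' by (auto simp: list_all_iff list_ex_iff)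
  have tab1: "length (tab ! i) = P" "r < P \<Longrightarrow> tab ! i ! r < 2 * P" if "i < n" for i r
    using tabs[of "tab ! i"] that len by auto
  have tab2: "\<And>i. i < n \<Longrightarrow> map (\<lambda>v. minus_at i (dot (cmat ! i) v) v) rs = map (root_table_fun rs) (tab ! i)"
    using ok' len by (simp add: all_from_iff)
  have rt1: "root_table_fun rs r = rs ! r" if "r < P" for r
    using that len unfolding root_table_fun_def by (simp add: nth_append)
  have rt2: "root_table_fun rs (r + P) = map uminus (rs ! r)" if "r < P" for r
    using that len unfolding root_table_fun_def by (simp add: nth_append)
  have rl: "length (root_table_fun rs r) = n" if "r < 2 * P" for r
  proof (cases "r < P")
    case True
    then show ?thesis using rt1[OF True] rs1 len nth_mem[of r rs] by auto
  next
    case False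
    then have "r = (r - P) + P" "r - P < P" using that by auto
    then show ?thesis using rt2[of "r - P"] rs1 len nth_mem[of "r - P" rs] by auto
  qed
  have perm_lt: "perm_table P tab i r < 2 * P" if r: "r < 2 * P" for i r
  proof (cases "i < n")
    case True
    have "(tab ! i @ map (neg_index P) (tab ! i)) ! r < 2 * P"
    proof (cases "r < P")
      case True
      then show ?thesis using tab1[OF \<open>i < n\<close>] by (simp add: nth_append)
    next
      case False
      then have "tab ! i ! (r - P) < 2 * P" using tab1(2)[OF \<open>i < n\<close>] r by simp
      then have "neg_index P (tab ! i ! (r - P)) < 2 * P" unfolding neg_index_def by (simp add: less_imp_diff_less)
      then show ?thesis using False r tab1(1)[OF \<open>i < n\<close>] by (simp add: nth_append)
    qed
    then show ?thesis unfolding perm_table_def using True len by simp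
  next
    case False
    then show ?thesis using r len unfolding perm_table_def by simp
  qed
  have neg: "vec_of_list (root_table_fun rs (r + P)) = - vec_of_list (root_table_fun rs r)" if "r < P" for r
    unfolding rt1[OF that] rt2[OF that] by (rule eq_vecI) (auto simp: vec_of_list_index)
  have neg_index_root: "vec_of_list (root_table_fun rs (neg_index P r)) = - vec_of_list (root_table_fun rs r)"
    if "r < 2 * P" for r
  proof (cases "r < P")
    case False
    then have "vec_of_list (root_table_fun rs r) = - vec_of_list (root_table_fun rs (r - P))"
      using neg[of "r - P"] that by simp
    then show ?thesis using False by (simp add: neg_index_def)
  qed (simp add: neg_index_def neg)
  have S_pos: "simple_reflection A i *\<^sub>v vec_of_list (root_table_fun rs r)
      = vec_of_list (root_table_fun rs (perm_table P tab i r))" if i: "i < n" and r: "r < P" for i r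
  proof -
    let ?v = "rs ! r"
    have lv: "length ?v = n" using rs1 r len by auto
    have "row A i \<bullet> vec_of_list ?v = dot (cmat ! i) ?v"
      using i lv rowl[OF i] cmat[OF i] A by (auto simp: dot_eq scalar_prod_def vec_of_list_index atLeast0LessThan)
    then have "simple_reflection A i *\<^sub>v vec_of_list ?v = vec_of_list (minus_at i (dot (cmat ! i) ?v) ?v)"
      using lv by (intro eq_vecI) (auto simp: S_mult_vec carrier_vecI vec_of_list_index minus_at_nth)
    also have "minus_at i (dot (cmat ! i) ?v) ?v = root_table_fun rs (tab ! i ! r)"
      using arg_cong[OF tab2[OF i], of "\<lambda>l. l ! r"] r len tab1(1)[OF i] by simp
    also have "tab ! i ! r = perm_table P tab i r"
      unfolding perm_table_def using i r len tab1(1)[OF i] by (simp add: nth_append)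
    finally show ?thesis using rt1[OF r] by simp
  qed
  show ?thesis
  proof (unfold_locales, goal_cases)
    case 1 show ?case by (rule nP)
  next
    case (2 r) then show ?case by (rule rl)
  next
    case 3
    have "inj_on ((!) (rs @ map (map uminus) rs)) {..<2 * P}"
      using distinct_negatives[OF dist] rs1 len by (intro inj_on_nth) auto
    then show ?case unfolding inj_on_def root_table_fun_def .
  next
    case (4 k)
    have "rs ! k = take n rs ! k" using 4 by simp
    also have "\<dots> = map (\<lambda>j. of_bool (j = k)) [0..<n]" unfolding simple using 4 by simp
    finally have "rs ! k = map (\<lambda>j. of_bool (j = k)) [0..<n]" .
    then show ?case using rt1[of k] 4 nP by (intro eq_vecI) (auto simp: vec_of_list_index)
  next
    case (5 r) then show ?case by (rule neg)
  next
    case (6 i r) then show ?case by (rule perm_lt)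
  next
    case (7 i r)
    show ?case
    proof (cases "i < n")
      case False
      then show ?thesis using S_ge[of i] len rl[OF 7] by (simp add: perm_table_def carrier_vecI)
    next
      case i: True
      show ?thesis
      proof (cases "r < P")
        case False
        define q where "q = r - P"
        have q: "q < P" "r = q + P" using False 7 unfolding q_def by auto
        have "simple_reflection A i *\<^sub>v vec_of_list (root_table_fun rs r)
           = - (simple_reflection A i *\<^sub>v vec_of_list (root_table_fun rs q))"
          unfolding q(2) neg[OF q(1)] using rl[of q] q(1)
          by (intro mult_mat_uminus_vec[OF S_carrier]) (simp add: carrier_vecI)
        also have "\<dots> = vec_of_list (root_table_fun rs (neg_index P (perm_table P tab i q)))"
          unfolding S_pos[OF i q(1)] using neg_index_root perm_lt q(1) by simp
        also have "neg_index P (perm_table P tab i q) = perm_table P tab i r"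
          using i len tab1(1)[OF i] q unfolding perm_table_def by (simp add: nth_append)
        finally show ?thesis .
      qed (rule S_pos[OF i])
    qed
  qed
qed

text \<open>These variants name an argument that occurs repeatedly, so that it is evaluated only once.\<close>

definition pm_list :: "nat \<Rightarrow> nat \<Rightarrow> nat list \<Rightarrow> bool" where
  "pm_list n P l \<longleftrightarrow> l = [0..<n] \<or> l = [P..<P + n]"

definition index_less :: "nat \<Rightarrow> nat \<Rightarrow> nat \<Rightarrow> bool" where
  "index_less P r q \<longleftrightarrow> (if q < P then q < r else q < r + P)"

definition traces_step :: "(nat \<Rightarrow> nat \<Rightarrow> nat) \<Rightarrow> (nat \<Rightarrow> int list) \<Rightarrow> nat list \<Rightarrow> nat \<Rightarrow> nat list \<Rightarrow> int list" where
  "traces_step s rt w p L = diag_sum rt 0 L # traces s rt w p L"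

definition eq_neg :: "nat \<Rightarrow> nat \<Rightarrow> nat \<Rightarrow> bool" where
  "eq_neg P r q \<longleftrightarrow> (if r < P then q = r + P else q + P = r)"

definition seed_step :: "(nat \<Rightarrow> nat \<Rightarrow> nat) \<Rightarrow> nat \<Rightarrow> nat \<Rightarrow> nat list list \<Rightarrow> nat list \<Rightarrow> nat list
    \<Rightarrow> nat \<Rightarrow> nat list \<Rightarrow> (nat \<times> nat \<times> nat \<times> nat) list \<Rightarrow> bool" where
  "seed_step s n P Y X Cs r ds seeds = (case seeds of [] \<Rightarrow> False | (U, j, g, k) # ss \<Rightarrow>
        j < n \<and> k < length Y \<and> fold s (word U) j = r \<and> conjugates s n P X (word U) j (word g) (Y ! k) \<and>
        certs_ok s n P Y X Cs (r + 1) ds ss)"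

lemma certs_ok_eval:
  "certs_ok s n P Y X Cs r [] seeds = (P \<le> r)"
  "certs_ok s n P Y X Cs r (d # ds) seeds =
     (if d < length Cs then lowers s P r (word (Cs ! d)) \<and> certs_ok s n P Y X Cs (r + 1) ds seeds
      else seed_step s n P Y X Cs r ds seeds)"
  "seed_step s n P Y X Cs r ds ((U, j, g, k) # ss) =
     (j < n \<and> k < length Y \<and> fold s (word U) j = r \<and> conjugates s n P X (word U) j (word g) (Y ! k) \<and>
        certs_ok s n P Y X Cs (r + 1) ds ss)"
  "lowers s P r c = index_less P r (fold s c r)"
  by (auto simp: seed_step_def lowers_def index_less_def pos_index_def)

text \<open>Decoding is fused with the action: three binary digits are consumed and one reflection
  is applied, so codes never have to be expanded into lists.\<close>

lemma decode_eval:
  "fold s (word 1) r = r" "foldr s (word 1) r = r"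
  "fold s (word (numeral k)) r = fold s (decode k) r" "foldr s (word (numeral k)) r = foldr s (decode k) r"
  "fold s (decode num.One) r = r" "foldr s (decode num.One) r = r"
  "fold s (decode (num.Bit0 (num.Bit0 (num.Bit0 k)))) r = fold s (decode k) (s 0 r)"
  "fold s (decode (num.Bit1 (num.Bit0 (num.Bit0 k)))) r = fold s (decode k) (s 1 r)"
  "fold s (decode (num.Bit0 (num.Bit1 (num.Bit0 k)))) r = fold s (decode k) (s 2 r)"
  "fold s (decode (num.Bit1 (num.Bit1 (num.Bit0 k)))) r = fold s (decode k) (s 3 r)"
  "fold s (decode (num.Bit0 (num.Bit0 (num.Bit1 k)))) r = fold s (decode k) (s 4 r)"
  "fold s (decode (num.Bit1 (num.Bit0 (num.Bit1 k)))) r = fold s (decode k) (s 5 r)"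
  "fold s (decode (num.Bit0 (num.Bit1 (num.Bit1 k)))) r = fold s (decode k) (s 6 r)"
  "fold s (decode (num.Bit1 (num.Bit1 (num.Bit1 k)))) r = fold s (decode k) (s 7 r)"
  "foldr s (decode (num.Bit0 (num.Bit0 (num.Bit0 k)))) r = s 0 (foldr s (decode k) r)"
  "foldr s (decode (num.Bit1 (num.Bit0 (num.Bit0 k)))) r = s 1 (foldr s (decode k) r)"
  "foldr s (decode (num.Bit0 (num.Bit1 (num.Bit0 k)))) r = s 2 (foldr s (decode k) r)"
  "foldr s (decode (num.Bit1 (num.Bit1 (num.Bit0 k)))) r = s 3 (foldr s (decode k) r)"
  "foldr s (decode (num.Bit0 (num.Bit0 (num.Bit1 k)))) r = s 4 (foldr s (decode k) r)"
  "foldr s (decode (num.Bit1 (num.Bit0 (num.Bit1 k)))) r = s 5 (foldr s (decode k) r)"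
  "foldr s (decode (num.Bit0 (num.Bit1 (num.Bit1 k)))) r = s 6 (foldr s (decode k) r)"
  "foldr s (decode (num.Bit1 (num.Bit1 (num.Bit1 k)))) r = s 7 (foldr s (decode k) r)"
  by (simp_all add: word_def num_of_nat_numeral_eq)

lemma acts_pm_eval: "acts_pm s n P w = pm_list n P (map (fold s w) [0..<n])"
  by (simp add: acts_pm_def pm_list_def)

lemma rep_ok_eval:
  "rep_ok s n P Y (X, Cs, ds, seeds) = (list_all (\<lambda>c. centralizes s n P X (word c)) Cs \<and> certs_ok s n P Y X Cs 0 ds seeds)"
  by (simp add: rep_ok_def)

lemma traces_eval: "traces s rt w (Suc p) L = traces_step s rt w p (map (fold s w) L)"
  by (simp add: traces_step_def)

lemma word_inv_eval: "word_inv s rt n P p Ls w = (traces s rt w p [0..<n],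
     length (filter (\<lambda>r. fold s w r = r) Ls), length (filter (\<lambda>r. eq_neg P r (fold s w r)) Ls))"
proof -
  have "(q = neg_index P r) = eq_neg P r q" for q r by (auto simp: neg_index_def eq_neg_def)
  then show ?thesis by (simp add: word_inv_def)
qed

lemma fold_eval:
  "fold s [] r = r" "fold s (i # w) r = fold s w (s i r)" "fold s (u @ v) r = fold s v (fold s u r)"
  "fold s (rev w) r = foldr s w r"
  "foldr s [] r = r" "foldr s (i # w) r = s i (foldr s w r)"
  by (simp_all add: foldr_conv_fold)

lemma nth_eval:
  "(x # xs) ! 0 = x" "(x # xs) ! 1 = xs ! 0" "(x # xs) ! numeral k = xs ! pred_numeral k"
  by (simp_all add: numeral_eq_Suc)

lemma length_eval: "length [] = 0" "length (x # xs) = length xs + 1" by simp_all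

lemma filter_eval: "filter Q [] = []" "filter Q (x # xs) = (if Q x then x # filter Q xs else filter Q xs)" by simp_all

lemma all_from_eval: "all_from Q i [] = True" "all_from Q i (x # xs) = (Q i x \<and> all_from Q (i + 1) xs)" by simp_all

text \<open>With these congruence rules the simplifier rewrites only the argument that drives the recursion, not the literal
  data passed along.\<close>

lemma weak_congs:
  "r = r' \<Longrightarrow> fold s w r = fold s w r'"
  "r = r' \<Longrightarrow> foldr s w r = foldr s w r'"
  "xs = ys \<Longrightarrow> map f xs = map f ys"
  "r = r' \<Longrightarrow> certs_ok s n P Y X Cs r ds seeds = certs_ok s n P Y X Cs r' ds seeds"
  "r = r' \<Longrightarrow> seed_step s n P Y X Cs r ds seeds = seed_step s n P Y X Cs r' ds seeds"
  "c = c' \<Longrightarrow> lowers s P r c = lowers s P r c'"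
  "n = n' \<Longrightarrow> centralizes s n P X c = centralizes s n' P X c"
  "y = y' \<Longrightarrow> conjugates s n P X U j g y = conjugates s n P X U j g y'"
  "n = n' \<Longrightarrow> acts_pm s n P w = acts_pm s n' P w"
  "n = n' \<Longrightarrow> acts_neg s n P w = acts_neg s n' P w"
  "n = n' \<Longrightarrow> rep_ok s n P Y d = rep_ok s n' P Y d"
  "xs = xs \<Longrightarrow> list_all Q xs = list_all Q xs"
  "L = L' \<Longrightarrow> traces s rt w p L = traces s rt w p L'"
  "L = L' \<Longrightarrow> traces_step s rt w p L = traces_step s rt w p L'"
  "w = w' \<Longrightarrow> word_inv s rt n P p Ls w = word_inv s rt n P p Ls w'"
  "a = a' \<Longrightarrow> diag_sum rt a L = diag_sum rt a' L"
  "xs = ys \<Longrightarrow> filter Q xs = filter Q ys"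
  by simp_all

text \<open>The word is a commutator; its value -1 says that \<open>g\<close> conjugates
  \<open>y\<close> to its negative.\<close>

definition self_conj :: "(nat \<Rightarrow> nat \<Rightarrow> nat) \<Rightarrow> nat \<Rightarrow> nat \<Rightarrow> nat \<Rightarrow> nat list \<Rightarrow> bool" where
  "self_conj s n P g y \<longleftrightarrow> acts_neg s n P (rev y @ rev (word g) @ y @ word g)"

fun self_conj_pair :: "(nat \<Rightarrow> nat \<Rightarrow> nat) \<Rightarrow> nat \<Rightarrow> nat \<Rightarrow> nat list list \<Rightarrow> nat \<times> nat \<Rightarrow> bool" where
  "self_conj_pair s n P Y (k, g) = self_conj s n P g (Y ! k)"

lemma self_conj_cong: "y = y' \<Longrightarrow> self_conj s n P g y = self_conj s n P g y'"
  by simp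

text \<open>One pass through the edges in the given order, so they are listed outward from the
  start. Begun at vertex 0, it certifies that the diagram is connected.\<close>

primrec reach :: "(nat \<times> nat) list \<Rightarrow> nat list \<Rightarrow> nat list" where
  "reach [] V = V"
| "reach (e # es) V = reach es (if list_ex ((=) (fst e)) V then snd e # V else V)"

lemma reach_const:
  assumes "\<And>i j. (i, j) \<in> set es \<Longrightarrow> c i = c j" "\<And>v. v \<in> set V \<Longrightarrow> c v = a" "v \<in> set (reach es V)"
  shows "c v = a"
  using assms
proof (induction es arbitrary: V)
  case (Cons e es)
  show ?case
  proof (rule Cons.IH[OF _ _ Cons.prems(3)[unfolded reach.simps]])
    show "c i = c j" if "(i, j) \<in> set es" for i j using Cons.prems(1) that by simp
    fix v assume v: "v \<in> set (if list_ex ((=) (fst e)) V then snd e # V else V)"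
    show "c v = a"
    proof (cases "v \<in> set V")
      case False
      then have "v = snd e" "fst e \<in> set V" using v by (auto simp: list_ex_iff split: if_splits)
      then show ?thesis using Cons.prems(1)[of "fst e" "snd e"] Cons.prems(2)[of "fst e"] by simp
    qed (use Cons.prems(2) in simp)
  qed
qed simp

definition cartan_ok :: "nat \<Rightarrow> int list list \<Rightarrow> int list \<Rightarrow> (nat \<times> nat) list \<Rightarrow> bool" where
  "cartan_ok n cm ds es \<longleftrightarrow> 0 < n \<and>
     list_all (\<lambda>i. 0 < ds ! i \<and> cm ! i ! i = 2 \<and> list_all (\<lambda>j. ds ! i * cm ! i ! j = ds ! j * cm ! j ! i) [0..<n] \<and>
       list_ex ((=) i) (reach es [0])) [0..<n] \<and>
     list_all (\<lambda>(i, j). i < n \<and> j < n \<and> cm ! i ! j \<noteq> 0) es"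

lemma cartan_of_cartan_ok:
  assumes A: "A \<in> carrier_mat n n" and cm: "\<And>i j. i < n \<Longrightarrow> j < n \<Longrightarrow> A $$ (i, j) = cm ! i ! j"
    and ok: "cartan_ok n cm ds es"
  shows "cartan A n (\<lambda>i. ds ! i)"
proof -
  have ok1: "0 < n" "\<And>i. i < n \<Longrightarrow> 0 < ds ! i" "\<And>i. i < n \<Longrightarrow> cm ! i ! i = 2"
    "\<And>i j. i < n \<Longrightarrow> j < n \<Longrightarrow> ds ! i * cm ! i ! j = ds ! j * cm ! j ! i"
    "\<And>i. i < n \<Longrightarrow> i \<in> set (reach es [0])"
    "\<And>i j. (i, j) \<in> set es \<Longrightarrow> i < n \<and> j < n \<and> cm ! i ! j \<noteq> 0"
    using ok unfolding cartan_ok_def list_all_iff list_ex_iff by auto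
  show ?thesis
  proof
    show "A $$ (i, i) = 2" if "i < n" for i using ok1(3) cm that by simp
    show "ds ! i * A $$ (i, j) = ds ! j * A $$ (j, i)" if "i < n" "j < n" for i j
      using ok1(4) cm that by simp
    fix c :: "nat \<Rightarrow> int" assume c: "\<And>i j. i < n \<Longrightarrow> j < n \<Longrightarrow> A $$ (i, j) \<noteq> 0 \<Longrightarrow> c i = c j"
    show "\<forall>i<n. c i = c 0"
    proof (intro allI impI)
      fix i assume "i < n"
      show "c i = c 0"
      proof (rule reach_const[OF _ _ ok1(5)[OF \<open>i < n\<close>]])
        show "c i = c j" if "(i, j) \<in> set es" for i j using ok1(6)[OF that] c[of i j] cm by simp
      qed simp
    qed
  qed (use A ok1 in auto)
qed

text \<open>The premise is meant for a defining equation: the function keeps the name of its table,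
  and the literal table supplies the values. The next two lemmas follow the same pattern.\<close>

lemma perm_table_graphs:
  "tab = tab' \<Longrightarrow> all_from (\<lambda>i row. graph (perm_table P tab i) (row @ map (neg_index P) row)) 0 tab'"
  by (auto simp: all_from_iff intro: graph_perm_table)

lemma root_table_graph: "rs = rs' \<Longrightarrow> graph (root_table_fun rs) (rs' @ map (map uminus) rs')"
  using graph_root_table by simp

lemma nth_graph: "xs = xs' \<Longrightarrow> graph ((!) xs) xs'"
  using graph_nth by simp

fun row_ok :: "nat \<Rightarrow> int list \<Rightarrow> (nat \<Rightarrow> int list) \<Rightarrow> int list list \<Rightarrow> nat list \<Rightarrow> bool" where
  "row_ok i c f [] [] = True"
| "row_ok i c f (v # vs) (q # qs) = (minus_at i (dot c v) v = f q \<and> row_ok i c f vs qs)"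
| "row_ok i c f vs qs = False"

lemma row_ok_iff: "row_ok i c f vs qs \<longleftrightarrow> map (\<lambda>v. minus_at i (dot c v) v) vs = map f qs"
  by (induction i c f vs qs rule: row_ok.induct) auto

lemma row_ok_cong: "i = i' \<Longrightarrow> c = c' \<Longrightarrow> row_ok i c f vs qs = row_ok i' c' f vs qs"
  by simp

text \<open>Separates the shape of the tables from the reflection formulas, so that the latter can
  be checked with a restricted set of rules.\<close>

lemma table_okI:
  assumes "rs = rs'" "tab = tab'"
    and "n \<le> P \<and> length cmat = n \<and> length tab' = n \<and> length rs' = P \<and>
     list_all (\<lambda>v. length v = n \<and> list_all (\<lambda>x. 0 \<le> x) v \<and> list_ex (\<lambda>x. 0 < x) v) rs' \<and>
     distinct rs' \<and> list_all (\<lambda>row. length row = n) cmat \<and>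
     take n rs' = map (\<lambda>k. map (\<lambda>j. of_bool (j = k)) [0..<n]) [0..<n] \<and>
     list_all (\<lambda>row. length row = P \<and> list_all (\<lambda>q. q < 2 * P) row) tab'"
    and "all_from (\<lambda>i row. row_ok i (cmat ! i) (root_table_fun rs) rs' row) 0 tab'"
  shows "table_ok n P cmat rs tab"
  using assms unfolding table_ok_def row_ok_iff by simp

lemma minus_at_eval:
  "minus_at i c [] = []" "minus_at 0 c (x # xs) = (x - c) # xs" "minus_at 1 c (x # xs) = x # minus_at 0 c xs"
  "minus_at (numeral k) c (x # xs) = x # minus_at (pred_numeral k) c xs"
  by (simp_all add: numeral_eq_Suc)

lemma nat_one: "nat 1 = 1" by simp

text \<open>Closed sets of rules for \<open>simp only\<close>, by which the large evaluations are
  carried out as ordinary rewriting proofs.\<close>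

lemmas nat_eval = rel_simps arith_simps numeral_One num.inject num.distinct simp_thms if_True if_False
  zero_neq_numeral numeral_neq_zero zero_neq_one one_neq_zero one_eq_numeral_iff numeral_eq_one_iff
  zero_less_numeral zero_less_one one_less_numeral_iff not_numeral_less_zero not_numeral_less_one less_irrefl not_one_less_zero
  one_add_one one_plus_numeral numeral_plus_one add_0 add_0_right
  pred_numeral_simps BitM.simps

lemmas eval_rules = fold_eval list.map decode_eval certs_ok_eval centralizes_def conjugates_def index_less_def
  acts_pm_eval acts_neg_def rep_ok_eval list.inject list.distinct list.pred_inject nth_eval length_eval nat_eval

lemmas inv_rules = Num.inc.simps sub_num_simps dbl_simps dbl_inc_simps dbl_dec_simps word_inv_eval traces.simps(1) traces_eval traces_step_def diag_sum.simps filter_eval eq_neg_def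
  fold_eval list.map nth_eval length_eval nat_eval
  add_neg_numeral_special minus_minus minus_zero list.inject list.distinct prod.inject

lemmas table_unfold = all_from_eval append.simps list.map neg_index_def nat_eval diff_nat_numeral nat_numeral nat_one nat_0
  minus_zero graph.simps graph_from.simps Num.inc.simps

lemmas table_rules = all_from_eval row_ok.simps dot.simps minus_at_eval list.sel list.inject nth_eval nat_eval
  mult_zero_left mult_zero_right mult_1 mult_1_right diff_0_right diff_0 minus_zero minus_minus diff_numeral_special
  add_neg_numeral_special mult_minus1 mult_minus1_right
  sub_num_simps dbl_simps dbl_inc_simps dbl_dec_simps Num.inc.simps

section \<open>Central quantum linear spaces\<close>

lemma central_conj_class:
  assumes "group G" "x \<in> carrier G" "conj_class G x \<subseteq> center G"
  shows "x \<in> center G" "conj_class G x = {x}"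
proof -
  interpret group G by (rule assms(1))
  have "x \<in> conj_class G x" unfolding conj_class_def using assms(2) by (intro image_eqI[of _ _ "\<one>\<^bsub>G\<^esub>"]) auto
  then show x: "x \<in> center G" using assms(3) by blast
  have "g \<otimes>\<^bsub>G\<^esub> x \<otimes>\<^bsub>G\<^esub> inv\<^bsub>G\<^esub> g = x" if "g \<in> carrier G" for g
  proof -
    have "g \<otimes>\<^bsub>G\<^esub> x = x \<otimes>\<^bsub>G\<^esub> g" using x that unfolding center_def by auto
    then show ?thesis using that assms(2) by (simp add: m_assoc)
  qed
  then show "conj_class G x = {x}" unfolding conj_class_def by auto
qed

lemma (in group) coset_carrier: "g \<in> carrier G \<Longrightarrow> carrier G #> g = carrier G"
  by (rule coset_join2) (auto simp: subgroup_self)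

text \<open>For central \<open>x\<close> the centralizer is the whole group, there is a single
  coset, and the element \<open>x\<close> acts on the arrow submodule through the right action of
  its inverse, which is \<open>x\<close>. If this were trivial, \<open>nichols_infinite\<close>
  would contradict finite dimension.\<close>

lemma central_quantum_linear_action:
  assumes G: "group G" and inv2: "\<And>x. x \<in> center G \<Longrightarrow> x \<otimes>\<^bsub>G\<^esub> x = \<one>\<^bsub>G\<^esub>"
    and R: "central_quantum_linear G scale R" and C: "C \<in> ram_support G R"
  obtains x where "x \<in> center G" "C = {x}" "centralizer_group G (pt R C) = G" "idx R C \<noteq> {}"
    "\<And>i. i \<in> idx R C \<Longrightarrow> irreducible_rep scale G (spc R C i) (ract R C i)"
    "\<And>i. i \<in> idx R C \<Longrightarrow> is_basis scale (spc R C i) (bvec R C i ` bidx R C i)"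
    "\<And>i. i \<in> idx R C \<Longrightarrow> \<not> (\<forall>v\<in>spc R C i. ract R C i v x = v)"
proof -
  interpret group G by (rule G)
  have rsr: "is_rsr G scale R" and nei: "non_essentially_infinite G scale R" and sub: "C \<subseteq> center G"
    using R C unfolding central_quantum_linear_def by blast+
  interpret V: vector_space scale using rsr unfolding is_rsr_def by blast
  have "C \<in> conj_classes G" using C unfolding ram_support_def by simp
  then obtain x where x: "x \<in> carrier G" and Cc: "C = conj_class G x" unfolding conj_classes_def by auto
  have xc: "x \<in> center G" and Cx: "C = {x}" using central_conj_class[OF is_group x] sub Cc by auto
  have xx: "x \<otimes>\<^bsub>G\<^esub> x = \<one>\<^bsub>G\<^esub>" by (rule inv2[OF xc])
  have invx: "inv\<^bsub>G\<^esub> x = x" by (rule inv_equality[OF xx x x])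
  have comm: "x \<otimes>\<^bsub>G\<^esub> g = g \<otimes>\<^bsub>G\<^esub> x" if "g \<in> carrier G" for g using xc that unfolding center_def by blast
  have pt: "pt R C = x" using rsr \<open>C \<in> conj_classes G\<close> Cx unfolding is_rsr_def by blast
  have cent: "centralizer G x = carrier G" unfolding centralizer_def using comm by auto
  then have centG: "centralizer_group G x = G" unfolding centralizer_group_def by simp
  note RC = conjunct2[OF conjunct2[OF rsr[unfolded is_rsr_def]], THEN bspec[OF _ C], unfolded pt centG cent]
  have idx0: "idx R C \<noteq> {}"
    and irr: "\<And>i. i \<in> idx R C \<Longrightarrow> irreducible_rep scale G (spc R C i) (ract R C i)"
    and inj: "\<And>i. i \<in> idx R C \<Longrightarrow> inj_on (bvec R C i) (bidx R C i)"
    and bas: "\<And>i. i \<in> idx R C \<Longrightarrow> is_basis scale (spc R C i) (bvec R C i ` bidx R C i)"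
    and crep: "\<And>\<theta>. \<theta> \<in> cidx R C \<Longrightarrow> crep R C \<theta> \<in> carrier G"
    and coset: "\<exists>!\<theta>. \<theta> \<in> cidx R C \<and> \<one>\<^bsub>G\<^esub> \<in> carrier G #>\<^bsub>G\<^esub> crep R C \<theta>"
    using RC by simp_all
  \<comment> \<open>The whole group is its own only coset, so the unique index whose coset contains
    the identity is the only index.\<close>
  have "\<exists>!\<theta>. \<theta> \<in> cidx R C"
    using coset coset_carrier[OF crep] by (simp cong: conj_cong)
  then obtain \<theta> where \<theta>: "\<theta> \<in> cidx R C" and \<theta>u: "\<And>\<theta>'. \<theta>' \<in> cidx R C \<Longrightarrow> \<theta>' = \<theta>"
    by blast
  have g: "crep R C \<theta> \<in> carrier G" by (rule crep[OF \<theta>])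
  have "inv\<^bsub>G\<^esub> crep R C \<theta> \<otimes>\<^bsub>G\<^esub> x \<otimes>\<^bsub>G\<^esub> crep R C \<theta> = x"
    using g x comm[OF g] inv_solve_left[of x "crep R C \<theta>" "x \<otimes>\<^bsub>G\<^esub> crep R C \<theta>"] by (simp add: m_assoc)
  then have theta: "rsr_theta G R C x = \<theta>"
    unfolding rsr_theta_def pt by (intro the_equality conjI \<theta>) (simp, blast intro: \<theta>u)
  \<comment> \<open>Since \<open>x\<close> commutes with the coset representative, it is itself the
    factor on the left, and cancellation makes it unique.\<close>
  have zeta: "rsr_zeta G R C \<theta> x = x"
    unfolding rsr_zeta_def pt cent
  proof (rule the_equality)
    show "x \<in> carrier G \<and> (\<exists>\<theta>'\<in>cidx R C. crep R C \<theta> \<otimes>\<^bsub>G\<^esub> x = x \<otimes>\<^bsub>G\<^esub> crep R C \<theta>')"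
      using x by (intro conjI bexI[OF _ \<theta>] comm[OF g, symmetric])
    fix \<zeta> assume "\<zeta> \<in> carrier G \<and> (\<exists>\<theta>'\<in>cidx R C. crep R C \<theta> \<otimes>\<^bsub>G\<^esub> x = \<zeta> \<otimes>\<^bsub>G\<^esub> crep R C \<theta>')"
    then have "\<zeta> \<in> carrier G" "x \<otimes>\<^bsub>G\<^esub> crep R C \<theta> = \<zeta> \<otimes>\<^bsub>G\<^esub> crep R C \<theta>" using comm[OF g] by (auto dest!: \<theta>u)
    then show "\<zeta> = x" using g x by simp
  qed
  have nontriv: "\<not> (\<forall>v\<in>spc R C i. ract R C i v x = v)" if i: "i \<in> idx R C" for i
  proof
    let ?B = "bvec R C i ` bidx R C i" and ?M = "arrow_submodule G scale R C i"
    assume triv: "\<forall>v\<in>spc R C i. ract R C i v x = v"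
    have fin: "finite (bidx R C i)" and ind: "V.independent ?B" and span: "V.span ?B = spc R C i"
      using bas[OF i] finite_imageD[OF _ inj[OF i]] unfolding is_basis_def by auto
    have "bidx R C i \<noteq> {}" using span irr[OF i] unfolding irreducible_rep_def by auto
    then obtain j where j: "j \<in> bidx R C i" by blast
    have basM: "bas ?M = (\<lambda>j. (x, i, j)) ` bidx R C i" unfolding arrow_submodule_def Cx by auto
    have "\<not> finite_dim_nichols ?M"
    proof (rule nichols_infinite)
      show "finite (bas ?M)" unfolding basM using fin by simp
      show "(x, i, j) \<in> bas ?M" unfolding basM using j by simp
      fix y assume "y \<in> bas ?M"
      then obtain k where k: "y = (x, i, k)" "k \<in> bidx R C i" unfolding basM by auto
      have "bvec R C i k \<in> spc R C i" using V.span_base[of "bvec R C i k" ?B] k(2) unfolding span by blast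
      then have act: "ract R C i (bvec R C i k) x = bvec R C i k" using triv by blast
      have "coef ?M x (x, i, k) (x, i, j) = V.representation ?B (bvec R C i k) (bvec R C i j)"
        unfolding arrow_submodule_def arrow_module_def using x
        by (simp add: Let_def invx xx theta zeta act Cc[symmetric])
      \<comment> \<open>A basis vector has indicator coordinates; injectivity of \<open>bvec\<close>
        turns equal vectors into equal indices.\<close>
      also have "\<dots> = of_bool (k = j)"
        using V.representation_basis[OF ind, of "bvec R C i k"] k(2) j inj_on_eq_iff[OF inj[OF i]] by auto
      finally show "coef ?M (deg ?M (x, i, j)) y (x, i, j) = of_bool (y = (x, i, j))"
        unfolding k(1) by (simp add: arrow_submodule_def arrow_module_def)
    qed
    then show False using nei C i unfolding non_essentially_infinite_def by blast
  qed
  show ?thesis by (rule that[OF xc Cx _ idx0 irr bas nontriv]) (simp_all add: pt centG)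
qed

text \<open>Of the two scalars allowed by \<open>central_scalar\<close> only -1 remains. The index
  set is nonempty, so \<open>x\<close> cannot be the identity, which always acts trivially.\<close>

lemma central_quantum_linear_support:
  assumes G: "fin_group G" and inv2: "\<And>x. x \<in> center G \<Longrightarrow> x \<otimes>\<^bsub>G\<^esub> x = \<one>\<^bsub>G\<^esub>"
    and R: "central_quantum_linear G scale R" and C: "C \<in> ram_support G R"
  obtains x where "x \<in> center G" "x \<noteq> \<one>\<^bsub>G\<^esub>" "C = {x}"
    "\<And>i. i \<in> idx R C \<Longrightarrow> rsr_character G scale R C i \<in> odd_irr_chars G x"
proof (rule central_quantum_linear_action[OF fin_group.axioms(1)[OF G] inv2 R C])
  fix x assume xc: "x \<in> center G" and Cx: "C = {x}" and centG: "centralizer_group G (pt R C) = G"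
    and idx0: "idx R C \<noteq> {}"
    and irr: "\<And>i. i \<in> idx R C \<Longrightarrow> irreducible_rep scale G (spc R C i) (ract R C i)"
    and bas: "\<And>i. i \<in> idx R C \<Longrightarrow> is_basis scale (spc R C i) (bvec R C i ` bidx R C i)"
    and nontriv: "\<And>i. i \<in> idx R C \<Longrightarrow> \<not> (\<forall>v\<in>spc R C i. ract R C i v x = v)"
  interpret fin_group G by (rule G)
  interpret V: vector_space scale using R unfolding central_quantum_linear_def is_rsr_def by blast
  interpret fin_group_vs G scale by unfold_locales
  have xx: "x \<otimes>\<^bsub>G\<^esub> x = \<one>\<^bsub>G\<^esub>" by (rule inv2[OF xc])
  obtain i where i: "i \<in> idx R C" using idx0 by blast
  show ?thesis
  proof (rule that[OF xc _ Cx])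
    show "x \<noteq> \<one>\<^bsub>G\<^esub>"
      using nontriv[OF i] irr[OF i] unfolding irreducible_rep_def right_rep_def by auto
    fix i assume i: "i \<in> idx R C"
    have "\<forall>v\<in>spc R C i. ract R C i v x = scale (- 1) v"
      using central_scalar[OF irr[OF i] bas[OF i] xc xx] nontriv[OF i] by blast
    then show "rsr_character G scale R C i \<in> odd_irr_chars G x"
      unfolding rsr_character_def centG odd_irr_chars_def
      using irr_chars_transfer[OF irr[OF i] bas[OF i]] odd_character_scalar[OF irr[OF i] bas[OF i] xc xx] by blast
  qed
qed

section \<open>The centre, and the root lattice modulo an integer\<close>

context cartan
begin

lemma center_square: "x \<in> center G \<Longrightarrow> x \<otimes>\<^bsub>G\<^esub> x = \<one>\<^bsub>G\<^esub>"
  using center_G[of x] unfolding G_mult G_one by (auto simp: uminus_mult_left_mat[symmetric])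

text \<open>Each simple reflection changes \<open>u\<close> by a multiple of \<open>m\<close> and
  preserves the divisibility hypothesis, so the whole group fixes \<open>u\<close> modulo
  \<open>m\<close>.\<close>

lemma wmat_congruent:
  assumes "u \<in> carrier_vec n" "\<And>i. i < n \<Longrightarrow> m dvd row A i \<bullet> u" "k < n"
  shows "m dvd (wmat w *\<^sub>v u) $ k - u $ k"
  using assms
proof (induction w arbitrary: u)
  case (Cons i w)
  let ?u = "S i *\<^sub>v u"
  have e: "?u = vec n (\<lambda>k. u $ k - of_bool (k = i) * (row A i \<bullet> u))" by (rule S_mult_vec[OF Cons.prems(1)])
  have "m dvd row A j \<bullet> ?u" if j: "j < n" for j
  proof (cases "i < n")
    case True
    have "row A j \<bullet> ?u = (\<Sum>k<n. A $$ (j, k) * u $ k - (if k = i then A $$ (j, i) * (row A i \<bullet> u) else 0))"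
      unfolding e using j A by (auto simp: scalar_prod_def atLeast0LessThan algebra_simps intro!: sum.cong)
    also have "\<dots> = row A j \<bullet> u - A $$ (j, i) * (row A i \<bullet> u)"
      unfolding sum_subtractf using j True A Cons.prems(1) by (simp add: scalar_prod_def atLeast0LessThan)
    finally show ?thesis using Cons.prems(2)[OF j] Cons.prems(2)[OF True] by simp
  next
    case False
    then show ?thesis using Cons.prems j by (simp add: S_ge)
  qed
  then have "m dvd (wmat w *\<^sub>v ?u) $ k - ?u $ k" using Cons.prems by (intro Cons.IH) simp_all
  moreover have "m dvd ?u $ k - u $ k" unfolding e using Cons.prems(2)[of i] Cons.prems(3) by simp
  moreover have "wmat (i # w) *\<^sub>v u = wmat w *\<^sub>v ?u"
    using Cons.prems(1) by (simp add: assoc_mult_mat_vec[of _ n n _ n])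
  ultimately show ?case using dvd_add by fastforce
qed simp

text \<open>If -1 belonged to the group, it would fix \<open>v\<close> modulo \<open>m\<close>, and
  \<open>m\<close> would divide \<open>2 * v $ k\<close>.\<close>

lemma center_trivial:
  assumes v: "v \<in> carrier_vec n" "\<And>i. i < n \<Longrightarrow> m dvd row A i \<bullet> v" and k: "k < n" "\<not> m dvd 2 * v $ k"
  shows "center G = {\<one>\<^bsub>G\<^esub>}"
proof -
  have "- 1\<^sub>m n \<notin> carrier G"
  proof
    assume "- 1\<^sub>m n \<in> carrier G"
    then obtain w where "- 1\<^sub>m n = wmat w" unfolding carrier_G by auto
    moreover have "(- 1\<^sub>m n *\<^sub>v v) $ k = - (v $ k)" using v(1) k(1) by simp
    ultimately have "m dvd - (v $ k) - v $ k" using wmat_congruent[OF v k(1), of w] by simp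
    then have "m dvd - (2 * v $ k)" by simp
    then show False using k(2) unfolding dvd_minus_iff by blast
  qed
  moreover have "\<one>\<^bsub>G\<^esub> \<in> center G"
    using G_group by (simp add: center_def group.is_monoid)
  ultimately show ?thesis using center_G unfolding G_one center_def by auto
qed

end

section \<open>From verified tables to the classification for one group\<close>

context root_table
begin

text \<open>The only nontrivial central element is -1, so every class in the support is
  \<open>{- 1\<^sub>m n}\<close>, and the support is nonempty.\<close>

lemma central_quantum_linear_type:
  assumes zw: "acts_neg s n P zw" and card: "card (odd_irr_chars G (- 1\<^sub>m n)) = N"
    and Q: "central_quantum_linear G scale Q" "ram_support G Q \<noteq> {}"
  shows "\<exists>z. center G - {\<one>\<^bsub>G\<^esub>} = {z} \<and> ram_support G Q = {{z}} \<and>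
    card (odd_irr_chars G z) = N \<and> (\<forall>i \<in> idx Q {z}. rsr_character G scale Q {z} i \<in> odd_irr_chars G z)"
proof -
  interpret G: group G by (rule G_group)
  have fin: "fin_group G" by unfold_locales (rule finite_G)
  have c: "center G - {\<one>\<^bsub>G\<^esub>} = {- 1\<^sub>m n}" by (rule neg_one_center[OF zw])
  have "C = {- 1\<^sub>m n} \<and> (\<forall>i \<in> idx Q C. rsr_character G scale Q C i \<in> odd_irr_chars G (- 1\<^sub>m n))"
    if C: "C \<in> ram_support G Q" for C
  proof (rule central_quantum_linear_support[OF fin center_square Q(1) C])
    fix x assume "x \<in> center G" "x \<noteq> \<one>\<^bsub>G\<^esub>" "C = {x}"
      and "\<And>i. i \<in> idx Q C \<Longrightarrow> rsr_character G scale Q C i \<in> odd_irr_chars G x"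
    moreover from this have "x = - 1\<^sub>m n" using c by blast
    ultimately show ?thesis by simp
  qed
  then show ?thesis using c card Q(2) by blast
qed

text \<open>The same count with its hypotheses in the form produced by evaluation: \<open>cd\<close>
  pairs words with certificates, \<open>sn\<close> names the classes equal to their negatives, and
  \<open>iv\<close> is a literal list on which distinctness is a question about numbers.\<close>

lemma card_odd_irr_chars_data:
  assumes Y: "Y = map fst cd" and cd: "list_all (rep_ok s n P Y) cd"
    and Y0: "Y ! 0 = []" and len: "length Y = m"
    and zw: "acts_neg s n P zw" and sn: "list_all (self_conj_pair s n P Y) sn"
    and ks: "list_all (\<lambda>k. k < m) ks" "list_all (\<lambda>k. k \<in> set ks \<or> k \<in> set (map fst sn)) [0..<m]"
    and Ls: "distinct Ls" "set Ls \<subseteq> {..<2 * P}" "\<And>i r. i < n \<Longrightarrow> r \<in> set Ls \<Longrightarrow> s i r \<in> set Ls"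
    and iv: "map (\<lambda>k. word_inv s rt n P p Ls (Y ! k)) ks = iv" "distinct (iv @ map neg_inv iv)"
    and m: "0 < m"
  shows "card (odd_irr_chars G (- 1\<^sub>m n)) = length ks"
proof (rule card_odd_irr_chars_G[OF _ _ zw _ _ Ls])
  show "\<exists>d. rep_ok s n P Y (Y ! k, d)" if "k < length Y" for k
  proof
    show "rep_ok s n P Y (Y ! k, snd (cd ! k))"
      using cd that unfolding Y list_all_length by simp
  qed
  show "[] \<in> set Y" using Y0 m nth_mem[of 0 Y] unfolding len by simp
  show "set ks \<subseteq> {..<length Y}" using ks(1) unfolding len list_all_iff by auto
  show "\<exists>g. acts_neg s n P (rev (Y ! k) @ rev g @ Y ! k @ g)" if "k < length Y" "k \<notin> set ks" for k
  proof -
    have "k \<in> set (map fst sn)" using ks(2) that unfolding len list_all_iff by auto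
    then obtain c where "(k, c) \<in> set sn" by auto
    then have "self_conj s n P c (Y ! k)" using sn unfolding list_all_iff by force
    then show ?thesis unfolding self_conj_def by blast
  qed
  show "distinct (map (\<lambda>k. word_inv s rt n P p Ls (Y ! k)) ks @ map (\<lambda>k. neg_inv (word_inv s rt n P p Ls (Y ! k))) ks)"
    using iv(2) unfolding iv(1)[symmetric] by (simp add: comp_def)
qed

end

section \<open>Type \<open>G\<^sub>2\<close>\<close>

definition cartan_rows_G2 :: "int list list" where
  "cartan_rows_G2 =
   [[2,-1], [-3,2]]"

text \<open>The simple roots stand first, as \<open>table_ok\<close> requires. The numbering also
  fixes the order along which \<open>lowers\<close> descends.\<close>

definition pos_roots_G2 :: "int list list" where
  "pos_roots_G2 =
   [[1,0], [0,1], [1,3], [1,1], [2,3], [1,2]]"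

text \<open>Entries from 6 on denote negative roots.\<close>

definition refl_table_G2 :: "nat list list" where
  "refl_table_G2 =
   [[6, 3, 4, 1, 2, 5], [2, 7, 0, 5, 4, 3]]"

text \<open>A digit of the third component that exceeds the positions of the second calls for the
  next seed. Code 1 is the empty word; 8 and 9 are the letters 0 and 1.\<close>

definition class_data_G2 :: "(nat list \<times> nat list \<times> nat list \<times> (nat \<times> nat \<times> nat \<times> nat) list) list" where
  "class_data_G2 =
   [([], [8, 9], [2,2,1,0,0,1], [(1, 0, 1, 1), (1, 1, 72, 1)]),
   ([0], [8], [1,1,1,0,0,1], [(1, 0, 1, 0), (1, 1, 1, 2), (9, 0, 8, 2), (72, 1, 1, 0)]),
   ([1,0], [65], [1,1,0,1,0,0], [(1, 0, 9, 1), (1, 1, 1, 1), (8, 1, 72, 1)])]"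

definition self_neg_G2 :: "(nat \<times> nat) list" where
  "self_neg_G2 =
   []"

definition odd_classes_G2 :: "nat list" where
  "odd_classes_G2 = [0,1,2]"

abbreviation "refl_G2 \<equiv> perm_table 6 refl_table_G2"

abbreviation "root_G2 \<equiv> root_table_fun pos_roots_G2"

text \<open>A constant of its own, so that certificates refer to representatives by position without
  carrying the whole list.\<close>

definition class_words_G2 :: "nat list list" where
  "class_words_G2 = map fst class_data_G2"

lemma upto_G2:
  "[0..<2] = [0, 1]"
  "[6..<8] = [6, 7]"
  by (simp_all add: upt_rec)

lemma cartan_entries_G2:
  assumes "i < 2" "j < 2"
  shows "cartan_G2 $$ (i, j) = cartan_rows_G2 ! i ! j"
proof -
  have "list_all (\<lambda>i. list_all (\<lambda>j. cartan_G2 $$ (i, j) = cartan_rows_G2 ! i ! j) [0..<2]) [0..<2]"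
    by (simp add: upto_G2 cartan_G2_def mat_of_rows_list_def cartan_rows_G2_def doubleton_eq_iff)
  then show ?thesis using assms by (simp add: list_all_iff)
qed

text \<open>The weights are half the norms: the first simple root is the long one.\<close>

lemma cartan_G2: "cartan cartan_G2 2 (\<lambda>i. [3,1] ! i)"
proof (rule cartan_of_cartan_ok[OF _ cartan_entries_G2])
  show "cartan_G2 \<in> carrier_mat 2 2" unfolding cartan_G2_def mat_of_rows_list_def
    by (intro carrier_matI) (simp_all only: dim_row_mat dim_col_mat length_eval nat_eval)
  show "cartan_ok 2 cartan_rows_G2 [3,1] [(0, 1)]"
    by (simp add: cartan_ok_def upto_G2 cartan_rows_G2_def)
qed

text \<open>One equation for each simple reflection and each root, positive or negative.\<close>

lemmas refl_eval_G2 = perm_table_graphs[OF refl_table_G2_def, where P=6, unfolded table_unfold]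

lemmas root_eval_G2 = root_table_graph[OF pos_roots_G2_def, unfolded table_unfold]

lemmas words_G2 = class_words_G2_def[unfolded class_data_G2_def list.map fst_conv]

lemmas words_eval_G2 = nth_graph[OF words_G2, unfolded table_unfold]

lemma length_words_G2: "length class_words_G2 = 3"
  by (simp only: words_G2 length_eval nat_eval)

lemma table_ok_G2: "table_ok 2 6 cartan_rows_G2 pos_roots_G2 refl_table_G2"
proof (rule table_okI[OF pos_roots_G2_def refl_table_G2_def], goal_cases)
  case 1
  show ?case by (simp add: cartan_rows_G2_def upto_G2)
next
  case 2
  show ?case
    by (simp only: table_rules cartan_rows_G2_def root_eval_G2 cong: row_ok_cong)
qed

lemma root_table_G2: "root_table cartan_G2 2 (\<lambda>i. [3,1] ! i) 6 root_G2 refl_G2"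
  by (rule root_table_of_table_ok[OF cartan_G2 cartan_entries_G2 table_ok_G2])

lemma pm_list_G2: "pm_list 2 6 l \<longleftrightarrow> l = [0, 1] \<or> l = [6, 7]"
  by (simp add: pm_list_def upto_G2)

lemma classes_ok_G2: "list_all (rep_ok refl_G2 2 6 class_words_G2) class_data_G2"
  unfolding class_data_G2_def
  by (simp only: eval_rules refl_eval_G2 words_eval_G2 length_words_G2 pm_list_G2 upto_G2 cong: if_weak_cong weak_congs)

text \<open>The element -1 makes every positive root negative, so it is the longest element; the
  word has one letter for each positive root. The same holds for the words in the other
  types.\<close>

lemma neg_one_G2: "acts_neg refl_G2 2 6 [1,0,1,0,1,0]"
  by (simp only: eval_rules refl_eval_G2 upto_G2 cong: if_weak_cong weak_congs)

text \<open>The long roots. A reflection and its negative both have trace 0, and over all roots the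
  two counts coincide as well: two roots are fixed and two negated. Restricted to long roots, the
  reflection in a long root negates two and fixes none, and its negative does the opposite.\<close>

definition inv_roots_G2 :: "nat list" where
  "inv_roots_G2 = [0,2,4,6,8,10]"

lemma invariants_G2: "map (\<lambda>k. word_inv refl_G2 root_G2 2 6 (Suc (0)) inv_roots_G2 (class_words_G2 ! k)) odd_classes_G2 =
   [([2], 6, 0), ([0], 0, 2), ([1], 0, 0)]"
  unfolding odd_classes_G2_def
  by (simp only: inv_rules inv_roots_G2_def refl_eval_G2 root_eval_G2 words_eval_G2 upto_G2 cong: if_weak_cong weak_congs)

lemma card_odd_G2: "card (odd_irr_chars (weyl_group cartan_G2) (- 1\<^sub>m 2)) = 3"
proof -
  interpret root_table "cartan_G2" 2 "\<lambda>i. [3,1] ! i" 6 root_G2 refl_G2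
    by (rule root_table_G2)
  have "card (odd_irr_chars (weyl_group cartan_G2) (- 1\<^sub>m 2)) = length odd_classes_G2"
  proof (rule card_odd_irr_chars_data[OF class_words_G2_def classes_ok_G2 _ length_words_G2 neg_one_G2
        _ _ _ _ _ _ invariants_G2])
    show "class_words_G2 ! 0 = []" by (simp only: words_eval_G2)
    show "list_all (self_conj_pair refl_G2 2 6 class_words_G2) []" by simp
    show "list_all (\<lambda>k. k < 3) odd_classes_G2" by (simp add: odd_classes_G2_def)
    show "list_all (\<lambda>k. k \<in> set odd_classes_G2 \<or> k \<in> set (map fst [])) [0..<3]"
      by (simp add: odd_classes_G2_def upt_rec)
    show "distinct inv_roots_G2" "set inv_roots_G2 \<subseteq> {..<2 * 6}" by (auto simp: inv_roots_G2_def)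
    have "list_all (\<lambda>i. list_all (\<lambda>r. refl_G2 i r \<in> set inv_roots_G2) inv_roots_G2) [0..<2]"
      by (simp add: inv_roots_G2_def upto_G2 refl_eval_G2 del: One_nat_def)
    then show "refl_G2 i r \<in> set inv_roots_G2" if "i < 2" "r \<in> set inv_roots_G2" for i r
      using that by (simp add: list_all_iff)
  qed (simp_all add: neg_inv_def)
  then show ?thesis by (simp add: odd_classes_G2_def)
qed

section \<open>Type \<open>F\<^sub>4\<close>\<close>

definition cartan_rows_F4 :: "int list list" where
  "cartan_rows_F4 =
   [[2,-1,0,0], [-1,2,-2,0], [0,-1,2,-1], [0,0,-1,2]]"

definition pos_roots_F4 :: "int list list" where
  "pos_roots_F4 =
   [[1,0,0,0], [0,1,0,0], [0,0,1,0], [0,0,0,1], [1,1,0,0], [0,1,1,0], [0,2,1,0], [0,0,1,1], [1,1,1,0],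
   [0,1,1,1], [2,2,1,0], [0,2,1,1], [1,2,1,0], [1,1,1,1], [2,2,1,1], [0,2,2,1], [1,2,1,1], [2,2,2,1],
   [1,2,2,1], [2,4,2,1], [1,3,2,1], [2,4,3,1], [2,3,2,1], [2,4,3,2]]"

definition refl_table_F4 :: "nat list list" where
  "refl_table_F4 =
   [[24, 4, 2, 3, 1, 8, 10, 7, 5, 13, 6, 14, 12, 9, 11, 17, 16, 15, 18, 19, 22, 21, 20, 23], [4, 25, 6, 3, 0,
   5, 2, 11, 12, 9, 10, 7, 8, 16, 14, 15, 13, 19, 20, 17, 18, 21, 22, 23], [0, 5, 26, 7, 8, 1, 6, 3, 4, 9, 10,
   15, 12, 13, 17, 11, 18, 14, 16, 21, 20, 19, 22, 23], [0, 1, 7, 27, 4, 9, 11, 2, 13, 5, 14, 6, 16, 8, 10,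
   15, 12, 17, 18, 19, 20, 23, 22, 21]]"

text \<open>Sixteen representatives for the 25 classes: nine pairs and seven classes equal to their
  negatives.\<close>

definition class_data_F4 :: "(nat list \<times> nat list \<times> nat list \<times> (nat \<times> nat \<times> nat \<times> nat) list) list" where
  "class_data_F4 =
   [([], [8, 9, 10, 11, 5768], [5,4,5,4,0,2,1,2,0,3,0,1,1,0,0,2,1,0,2,1,1,2,0,3], [(1, 0, 1, 1), (1, 2, 1,
   2)]),
   ([0], [8, 10, 11, 2368017], [4,4,4,4,0,1,4,1,0,2,0,2,4,0,0,1,2,0,1,3,3,1,0,2], [(1, 0, 1, 0), (1, 1, 1, 3),
   (1, 2, 1, 4), (1, 3, 90, 4), (9, 2, 65, 5), (578, 1, 65, 6)]),
   ([2], [8, 10, 593, 369171], [4,4,4,4,0,1,4,1,0,3,0,2,2,0,0,1,3,0,1,2,2,1,0,3], [(1, 0, 1, 4), (1, 1, 9, 5),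
   (1, 2, 1, 0), (1, 3, 1, 7), (9, 2, 1, 6)]),
   ([1,0], [11, 72, 65, 2429066], [4,1,4,4,1,4,2,0,1,0,1,0,1,0,0,3,0,1,3,1,2,3,1,0], [(1, 0, 9, 1), (1, 2, 1,
   8), (1, 3, 156046346, 8), (10, 1, 1, 9)]),
   ([2,0], [8, 10, 9704080474], [3,3,3,3,0,1,3,1,0,2,0,2,2,0,0,1,3,0,1,2,2,1,0,2], [(1, 0, 1, 2), (1, 1, 10,
   8), (1, 2, 1, 1), (1, 3, 1, 10), (9, 2, 1, 9), (4634, 1, 4179, 11)]),
   ([2,1], [74, 81, 33416, 46163], [4,4,4,4,1,0,0,0,0,4,4,1,0,3,2,0,1,0,0,1,0,0,2,3], [(1, 0, 8, 8), (1, 1, 9,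
   2), (1, 2, 72, 1), (1, 3, 155557968, 10), (90, 1, 665, 11), (65, 2, 72, 9)]),
   ([2,1,2,1], [9, 10, 1095569547], [3,3,3,3,0,1,0,1,1,2,2,0,0,2,2,1,0,1,1,0,0,1,2,2], [(1, 0, 8, 9), (1, 1,
   578, 1), (1, 2, 9, 2), (1, 3, 11, 11)]),
   ([3,2], [8, 90, 83, 2430602], [4,4,4,1,0,1,4,1,0,1,0,2,3,0,0,1,2,0,1,3,3,1,0,1], [(1, 0, 1, 10), (1, 1,
   1244463745, 10), (1, 2, 11, 2), (9, 2, 10, 11)]),
   ([2,1,0], [522, 648], [2,1,2,2,2,0,0,0,0,2,0,2,0,1,1,0,1,0,0,1,0,0,0,2], [(1, 0, 8, 5), (1, 2, 1, 3), (1,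
   3, 1, 12), (8, 1, 72, 4), (90, 1, 11, 13), (74, 3, 1, 14), (2953354, 3, 529, 3)]),
   ([2,1,2,1,0], [10, 4177, 4744, 1091375243], [4,4,4,4,1,0,4,0,0,3,1,1,1,2,2,0,4,0,0,1,1,0,1,3], [(1, 0, 8,
   6), (1, 1, 10, 3), (1, 2, 65, 5), (1, 3, 10, 13), (9, 2, 1, 4), (4634, 1, 1, 15)]),
   ([3,2,0], [8, 90, 83], [3,3,3,1,0,1,3,1,0,1,0,2,3,0,0,1,2,0,1,3,3,1,0,1], [(1, 0, 1, 7), (1, 1, 65, 12),
   (1, 2, 11, 4), (9, 2, 666, 13), (578, 1, 18945233, 7), (37002, 3, 275539, 5), (303642, 1, 66, 14)]),
   ([2,1,2,3,1], [9, 5203, 5770, 1109472322], [4,4,4,4,0,4,0,1,2,1,3,0,0,1,1,1,0,4,1,0,0,2,3,1], [(1, 0, 664,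
   13), (1, 1, 714, 5), (1, 2, 75, 7), (1, 3, 11, 6), (10, 1, 5768, 4), (4234, 3, 1, 15)]),
   ([3,2,1,0], [5768, 4179, 77747786961], [3,0,3,0,2,2,3,2,0,1,0,1,0,0,0,1,0,0,1,0,1,0,0,0], [(1, 0, 19444746,
   10), (1, 2, 11, 8), (9, 2, 2204289, 8)]),
   ([2,3,1,2,1,0], [267354, 333448, 1243682001], [3,3,3,0,2,2,0,3,0,0,3,0,1,0,1,0,1,0,0,1,0,0,0,0], [(1, 0,
   538, 11), (1, 1, 2204289, 8), (1, 2, 151553674, 10), (10, 3, 1, 9), (65, 2, 38536, 10)]),
   ([1,2,3,2,1,2,1,0], [90, 266379, 266378], [3,2,3,0,1,0,1,0,0,0,2,1,2,0,1,0,1,0,0,1,1,0,1,0], [(1, 0,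
   304721, 10), (1, 2, 17633418, 8)]),
   ([3,1,2,0,1,2,3,2,0,1,2,0], [66, 75, 5768], [3,2,3,2,1,0,3,0,0,1,0,1,2,0,1,0,1,0,0,1,1,0,0,1], [(1, 0,
   308307, 9), (1, 2, 5313, 11), (9, 2, 4179, 11)])]"

text \<open>Each pair consists of the position of a representative and the code of an element
  conjugating it to its negative.\<close>

definition self_neg_F4 :: "(nat \<times> nat) list" where
  "self_neg_F4 =
   [(4, 1213011137), (6, 23598280), (9, 1091376321), (11, 1109472336), (12, 19433098), (13, 1091376321), (15,
   66)]"

definition odd_classes_F4 :: "nat list" where
  "odd_classes_F4 = [0,1,2,3,5,7,8,10,14]"

abbreviation "refl_F4 \<equiv> perm_table 24 refl_table_F4"

abbreviation "root_F4 \<equiv> root_table_fun pos_roots_F4"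

definition class_words_F4 :: "nat list list" where
  "class_words_F4 = map fst class_data_F4"

lemma upto_F4:
  "[0..<4] = [0, 1, 2, 3]"
  "[24..<28] = [24, 25, 26, 27]"
  by (simp_all add: upt_rec)

lemma cartan_entries_F4:
  assumes "i < 4" "j < 4"
  shows "cartan_F4 $$ (i, j) = cartan_rows_F4 ! i ! j"
proof -
  have "list_all (\<lambda>i. list_all (\<lambda>j. cartan_F4 $$ (i, j) = cartan_rows_F4 ! i ! j) [0..<4]) [0..<4]"
    by (simp add: upto_F4 cartan_F4_def mat_of_rows_list_def cartan_rows_F4_def doubleton_eq_iff)
  then show ?thesis using assms by (simp add: list_all_iff)
qed

text \<open>In this numbering the last two simple roots are the long ones.\<close>

lemma cartan_F4: "cartan cartan_F4 4 (\<lambda>i. [1,1,2,2] ! i)"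
proof (rule cartan_of_cartan_ok[OF _ cartan_entries_F4])
  show "cartan_F4 \<in> carrier_mat 4 4" unfolding cartan_F4_def mat_of_rows_list_def
    by (intro carrier_matI) (simp_all only: dim_row_mat dim_col_mat length_eval nat_eval)
  show "cartan_ok 4 cartan_rows_F4 [1,1,2,2] [(0, 1), (1, 2), (2, 3)]"
    by (simp add: cartan_ok_def upto_F4 cartan_rows_F4_def)
qed

lemmas refl_eval_F4 = perm_table_graphs[OF refl_table_F4_def, where P=24, unfolded table_unfold]

lemmas root_eval_F4 = root_table_graph[OF pos_roots_F4_def, unfolded table_unfold]

lemmas words_F4 = class_words_F4_def[unfolded class_data_F4_def list.map fst_conv]

lemmas words_eval_F4 = nth_graph[OF words_F4, unfolded table_unfold]

lemma length_words_F4: "length class_words_F4 = 16"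
  by (simp only: words_F4 length_eval nat_eval)

lemma table_ok_F4: "table_ok 4 24 cartan_rows_F4 pos_roots_F4 refl_table_F4"
proof (rule table_okI[OF pos_roots_F4_def refl_table_F4_def], goal_cases)
  case 1
  show ?case by (simp add: cartan_rows_F4_def upto_F4)
next
  case 2
  show ?case
    by (simp only: table_rules cartan_rows_F4_def root_eval_F4 cong: row_ok_cong)
qed

lemma root_table_F4: "root_table cartan_F4 4 (\<lambda>i. [1,1,2,2] ! i) 24 root_F4 refl_F4"
  by (rule root_table_of_table_ok[OF cartan_F4 cartan_entries_F4 table_ok_F4])

lemma pm_list_F4: "pm_list 4 24 l \<longleftrightarrow> l = [0, 1, 2, 3] \<or> l = [24, 25, 26, 27]"
  by (simp add: pm_list_def upto_F4)

lemma classes_ok_F4: "list_all (rep_ok refl_F4 4 24 class_words_F4) class_data_F4"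
  unfolding class_data_F4_def
  by (simp only: eval_rules refl_eval_F4 words_eval_F4 length_words_F4 pm_list_F4 upto_F4 cong: if_weak_cong weak_congs)

lemma neg_one_F4: "acts_neg refl_F4 4 24 [3,2,1,2,0,1,2,3,2,1,2,0,1,2,3,2,1,2,0,1,2,0,1,0]"
  by (simp only: eval_rules refl_eval_F4 upto_F4 cong: if_weak_cong weak_congs)

lemma self_neg_ok_F4: "list_all (self_conj_pair refl_F4 4 24 class_words_F4) self_neg_F4"
  unfolding self_neg_F4_def
  by (simp only: self_conj_pair.simps self_conj_def eval_rules refl_eval_F4 words_eval_F4 upto_F4 cong: if_weak_cong weak_congs self_conj_cong)

text \<open>The short roots. The two classes of reflections have the same traces, and each
  reflection fixes 18 of all roots, of type B3 or C3; among the short roots, however, they fix 6 and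
  12.\<close>

definition inv_roots_F4 :: "nat list" where
  "inv_roots_F4 = [0,1,4,5,8,9,12,13,16,18,20,22,24,25,28,29,32,33,36,37,40,42,44,46]"

lemma invariants_F4: "map (\<lambda>k. word_inv refl_F4 root_F4 4 24 (Suc (Suc (Suc (0)))) inv_roots_F4 (class_words_F4 ! k)) odd_classes_F4 =
   [([4, 4, 4], 24, 0), ([2, 4, 2], 6, 2), ([2, 4, 2], 12, 0), ([1, 1, 4], 0, 0), ([2, 0, 2], 4, 0), ([1, 1,
   4], 6, 0), ([1, 1, -2], 0, 0), ([-1, 1, 2], 0, 2), ([2, -2, -4], 0, 0)]"
  unfolding odd_classes_F4_def
  by (simp only: inv_rules inv_roots_F4_def refl_eval_F4 root_eval_F4 words_eval_F4 upto_F4 cong: if_weak_cong weak_congs)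

lemma card_odd_F4: "card (odd_irr_chars (weyl_group cartan_F4) (- 1\<^sub>m 4)) = 9"
proof -
  interpret root_table "cartan_F4" 4 "\<lambda>i. [1,1,2,2] ! i" 24 root_F4 refl_F4
    by (rule root_table_F4)
  have "card (odd_irr_chars (weyl_group cartan_F4) (- 1\<^sub>m 4)) = length odd_classes_F4"
  proof (rule card_odd_irr_chars_data[OF class_words_F4_def classes_ok_F4 _ length_words_F4 neg_one_F4
        self_neg_ok_F4 _ _ _ _ _ invariants_F4])
    show "class_words_F4 ! 0 = []" by (simp only: words_eval_F4)
    show "list_all (\<lambda>k. k < 16) odd_classes_F4" by (simp add: odd_classes_F4_def)
    show "list_all (\<lambda>k. k \<in> set odd_classes_F4 \<or> k \<in> set (map fst self_neg_F4)) [0..<16]"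
      by (simp add: odd_classes_F4_def self_neg_F4_def upt_rec)
    show "distinct inv_roots_F4" "set inv_roots_F4 \<subseteq> {..<2 * 24}" by (auto simp: inv_roots_F4_def)
    have "list_all (\<lambda>i. list_all (\<lambda>r. refl_F4 i r \<in> set inv_roots_F4) inv_roots_F4) [0..<4]"
      by (simp add: inv_roots_F4_def upto_F4 refl_eval_F4 del: One_nat_def)
    then show "refl_F4 i r \<in> set inv_roots_F4" if "i < 4" "r \<in> set inv_roots_F4" for i r
      using that by (simp add: list_all_iff)
  qed (simp_all add: neg_inv_def)
  then show ?thesis by (simp add: odd_classes_F4_def)
qed

section \<open>Type \<open>E\<^sub>7\<close>\<close>

definition cartan_rows_E7 :: "int list list" where
  "cartan_rows_E7 =
   [[2,0,-1,0,0,0,0], [0,2,0,-1,0,0,0], [-1,0,2,-1,0,0,0], [0,-1,-1,2,-1,0,0], [0,0,0,-1,2,-1,0],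
   [0,0,0,0,-1,2,-1], [0,0,0,0,0,-1,2]]"

definition pos_roots_E7 :: "int list list" where
  "pos_roots_E7 =
   [[1,0,0,0,0,0,0], [0,1,0,0,0,0,0], [0,0,1,0,0,0,0], [0,0,0,1,0,0,0], [0,0,0,0,1,0,0], [0,0,0,0,0,1,0],
   [0,0,0,0,0,0,1], [1,0,1,0,0,0,0], [0,1,0,1,0,0,0], [0,0,1,1,0,0,0], [0,0,0,1,1,0,0], [0,0,0,0,1,1,0],
   [0,0,0,0,0,1,1], [1,0,1,1,0,0,0], [0,1,1,1,0,0,0], [0,1,0,1,1,0,0], [0,0,1,1,1,0,0], [0,0,0,1,1,1,0],
   [0,0,0,0,1,1,1], [1,1,1,1,0,0,0], [1,0,1,1,1,0,0], [0,1,1,1,1,0,0], [0,1,0,1,1,1,0], [0,0,1,1,1,1,0],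
   [0,0,0,1,1,1,1], [1,1,1,1,1,0,0], [1,0,1,1,1,1,0], [0,1,1,2,1,0,0], [0,1,1,1,1,1,0], [0,1,0,1,1,1,1],
   [0,0,1,1,1,1,1], [1,1,1,2,1,0,0], [1,1,1,1,1,1,0], [1,0,1,1,1,1,1], [0,1,1,2,1,1,0], [0,1,1,1,1,1,1],
   [1,1,2,2,1,0,0], [1,1,1,2,1,1,0], [1,1,1,1,1,1,1], [0,1,1,2,2,1,0], [0,1,1,2,1,1,1], [1,1,2,2,1,1,0],
   [1,1,1,2,2,1,0], [1,1,1,2,1,1,1], [0,1,1,2,2,1,1], [1,1,2,2,2,1,0], [1,1,2,2,1,1,1], [1,1,1,2,2,1,1],
   [0,1,1,2,2,2,1], [1,1,2,3,2,1,0], [1,1,2,2,2,1,1], [1,1,1,2,2,2,1], [1,2,2,3,2,1,0], [1,1,2,3,2,1,1],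
   [1,1,2,2,2,2,1], [1,2,2,3,2,1,1], [1,1,2,3,2,2,1], [1,2,2,3,2,2,1], [1,1,2,3,3,2,1], [1,2,2,3,3,2,1],
   [1,2,2,4,3,2,1], [1,2,3,4,3,2,1], [2,2,3,4,3,2,1]]"

definition refl_table_E7 :: "nat list list" where
  "refl_table_E7 =
   [[63, 1, 7, 3, 4, 5, 6, 2, 8, 13, 10, 11, 12, 9, 19, 15, 20, 17, 18, 14, 16, 25, 22, 26, 24, 21, 23, 31,
   32, 29, 33, 27, 28, 30, 37, 38, 36, 34, 35, 42, 43, 41, 39, 40, 47, 45, 46, 44, 51, 49, 50, 48, 52, 53, 54,
   55, 56, 57, 58, 59, 60, 62, 61], [0, 64, 2, 8, 4, 5, 6, 7, 3, 14, 15, 11, 12, 19, 9, 10, 21, 22, 18, 13,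
   25, 16, 17, 28, 29, 20, 32, 27, 23, 24, 35, 31, 26, 38, 34, 30, 36, 37, 33, 39, 40, 41, 42, 43, 44, 45, 46,
   47, 48, 52, 50, 51, 49, 55, 54, 53, 57, 56, 59, 58, 60, 61, 62], [7, 1, 65, 9, 4, 5, 6, 0, 14, 3, 16, 11,
   12, 13, 8, 21, 10, 23, 18, 19, 20, 15, 28, 17, 30, 25, 26, 27, 22, 35, 24, 36, 32, 33, 34, 29, 31, 41, 38,
   39, 40, 37, 45, 46, 44, 42, 43, 50, 48, 49, 47, 54, 52, 53, 51, 55, 56, 57, 58, 59, 61, 60, 62], [0, 8, 9,
   66, 10, 5, 6, 13, 1, 2, 4, 17, 12, 7, 14, 15, 16, 11, 24, 19, 20, 27, 22, 23, 18, 31, 26, 21, 34, 29, 30,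
   25, 37, 33, 28, 40, 36, 32, 43, 39, 35, 41, 42, 38, 44, 49, 46, 47, 48, 45, 53, 51, 52, 50, 56, 55, 54, 57,
   58, 60, 59, 61, 62], [0, 1, 2, 10, 67, 11, 6, 7, 15, 16, 3, 5, 18, 20, 21, 8, 9, 17, 12, 25, 13, 14, 22,
   23, 24, 19, 26, 27, 28, 29, 30, 31, 32, 33, 39, 35, 36, 42, 38, 34, 44, 45, 37, 47, 40, 41, 50, 43, 48, 49,
   46, 51, 52, 53, 54, 55, 58, 59, 56, 57, 60, 61, 62], [0, 1, 2, 3, 11, 68, 12, 7, 8, 9, 17, 4, 6, 13, 14,
   22, 23, 10, 18, 19, 26, 28, 15, 16, 24, 32, 20, 34, 21, 29, 30, 37, 25, 33, 27, 35, 41, 31, 38, 39, 40, 36,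
   42, 43, 48, 45, 46, 51, 44, 49, 54, 47, 52, 56, 50, 57, 53, 55, 58, 59, 60, 61, 62], [0, 1, 2, 3, 4, 12,
   69, 7, 8, 9, 10, 18, 5, 13, 14, 15, 16, 24, 11, 19, 20, 21, 29, 30, 17, 25, 33, 27, 35, 22, 23, 31, 38, 26,
   40, 28, 36, 43, 32, 44, 34, 46, 47, 37, 39, 50, 41, 42, 48, 53, 45, 51, 55, 49, 54, 52, 56, 57, 58, 59, 60,
   61, 62]]"

text \<open>W(E7) is the product of its centre with the rotation subgroup, so the 30 representatives
  up to sign correspond to the 30 classes of the latter, a group isomorphic to Sp(6,2).\<close>

definition class_data_E7 :: "(nat list \<times> nat list \<times> nat list \<times> (nat \<times> nat \<times> nat \<times> nat) list) list" where
  "class_data_E7 =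
   [([], [8, 10, 11, 9, 12, 13, 867, 720],
   [8,8,7,7,6,6,8,0,2,1,2,4,5,0,1,3,1,2,4,0,0,1,3,1,2,0,0,2,1,3,1,0,0,0,2,1,1,0,0,4,2,1,0,0,4,1,1,0,5,2,1,0,3,2,1,3,2,3,4,3,2,1,0],
   [(1, 0, 1, 1), (1, 1, 329355, 1), (1, 6, 1402406117, 1)]),
   ([0], [8, 9, 11, 12, 13, 14, 7523, 18591233360594613],
   [8,8,8,7,6,6,6,0,1,2,2,3,4,0,1,1,3,2,3,0,0,1,1,4,2,0,0,2,1,1,5,0,0,0,2,1,7,0,0,3,2,4,0,0,3,3,5,0,4,2,3,0,1,2,4,1,2,1,3,1,2,7,0],
   [(1, 0, 1, 0), (1, 1, 1, 2), (1, 2, 1, 3)]),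
   ([1,0], [8, 9, 12, 13, 14, 138515482, 940],
   [7,5,7,5,7,6,6,0,1,7,2,2,3,0,1,1,2,3,2,0,0,1,1,3,4,0,0,5,1,1,4,0,0,0,3,1,5,0,0,2,4,3,0,0,2,2,4,0,3,5,2,0,1,4,3,1,3,1,2,1,7,5,0],
   [(1, 0, 329355, 1), (1, 2, 1, 4), (1, 4, 1, 5), (10, 3, 66, 6), (6153894466789, 6, 6137186625291, 7)]),
   ([2,0], [9, 12, 13, 14, 66, 80, 940, 295359874401955],
   [8,8,5,8,7,6,6,4,0,4,1,1,2,4,0,0,1,2,1,0,1,0,0,2,3,0,2,8,0,0,3,5,0,3,2,0,4,2,0,1,3,2,1,3,1,1,3,1,2,7,1,2,0,3,2,0,2,0,1,0,7,4,4],
   [(1, 0, 10, 1), (1, 1, 1, 4), (1, 3, 33881, 6), (5715, 4, 612391358765279332883, 6)]),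
   ([2,1,0], [9, 117, 12, 66, 646],
   [5,5,4,5,5,5,1,3,0,3,2,1,1,3,0,0,2,1,1,0,2,0,0,1,1,0,1,5,0,0,1,4,0,1,1,0,3,1,0,2,1,1,2,1,2,2,1,2,1,5,2,1,0,4,1,0,1,0,2,0,5,3,3],
   [(1, 0, 10, 2), (1, 1, 1, 3), (1, 3, 1, 8), (1, 4, 1, 9), (1, 5, 108, 9), (5715, 4, 329355, 10),
   (188887708, 5, 769222952587, 11), (6153894466789, 6, 102905717502069277784, 12)]),
   ([4,1,0], [8, 9, 12, 14, 5731, 86644164261, 2325219333780323],
   [7,5,7,7,4,6,7,0,1,7,2,2,3,0,1,1,2,4,2,0,0,1,1,6,3,0,0,4,1,1,3,0,0,0,4,1,7,0,0,2,3,5,0,0,2,2,3,0,5,4,2,0,1,3,5,1,5,1,2,1,4,5,0],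
   [(1, 0, 6153975898853, 2), (1, 2, 1, 9), (1, 3, 11, 10), (1, 6, 1556104939304549821195060314, 5), (10, 3,
   66, 13), (329299, 4, 102905757885214964043, 7)]),
   ([3,2,1], [13, 14, 714, 595, 406172],
   [5,5,4,5,5,5,5,2,2,2,3,0,0,3,2,5,2,0,1,2,4,2,0,0,1,2,0,2,0,1,1,3,0,1,0,1,2,0,1,4,1,0,4,1,1,2,1,1,0,3,1,0,2,1,0,1,0,0,4,2,3,2,5],
   [(1, 0, 8, 8), (1, 1, 5712, 3), (1, 3, 80, 2), (1, 4, 12, 13), (1, 5, 3813797366997712, 10), (1, 6,
   210654361769358760, 10), (75, 4, 1, 14), (292026917688549, 6, 3186220017263312, 12)]),
   ([6,4,1], [8, 10, 76, 78, 5731, 6965, 1818712272],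
   [7,7,6,7,4,6,5,0,3,1,2,2,3,0,1,2,1,4,2,0,0,1,2,1,3,0,0,4,1,2,1,0,0,0,4,1,1,0,0,2,3,1,0,0,2,1,1,0,5,4,1,0,2,3,1,2,5,3,2,2,4,1,0],
   [(1, 0, 1556104939304549821195060314, 5), (1, 1, 6154366564371, 2), (1, 3, 187817259, 12)]),
   ([3,2,1,0], [117, 5712, 4179, 17106515],
   [4,3,1,4,4,4,0,3,1,2,2,0,0,1,1,4,2,0,0,1,1,1,0,0,0,1,0,2,0,0,0,1,0,0,0,0,1,0,0,4,0,0,1,0,4,1,0,1,0,2,1,0,1,2,0,1,0,0,4,1,2,2,1],
   [(1, 0, 8, 6), (1, 3, 1, 4), (1, 4, 1, 15), (1, 5, 1, 16), (75, 4, 63478744413359907715162, 17), (406172,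
   5, 10109068000, 18), (3249381, 6, 80874054368, 18), (106580514021, 6, 49304732237007593976236, 19)]),
   ([4,2,1,0], [66, 12, 14, 9, 80, 295359874401955],
   [6,6,4,6,5,6,6,0,3,0,1,1,2,0,0,1,0,6,1,0,0,0,3,0,2,0,0,6,0,2,0,4,0,0,5,0,0,4,0,1,2,0,1,2,1,0,0,1,6,5,0,4,3,2,0,2,6,3,1,1,5,0,0],
   [(1, 0, 10, 5), (1, 1, 396126235231320, 4), (1, 3, 12, 15), (1, 5, 1, 20), (1, 6,
   184841710856151694251733131, 13), (92, 5, 101, 16), (5715, 4, 132797064842419377865143542501, 12),
   (28415205, 6, 27315757916399951252893835, 10), (12091233509, 6, 1662682276351544229, 21)]),
   ([4,1,3,0], [8, 14, 716, 611, 166744265394238745],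
   [5,5,5,5,4,5,5,0,2,3,2,2,1,0,5,2,2,3,1,0,0,2,2,5,1,0,0,2,2,1,1,0,0,0,3,1,5,0,0,2,1,4,0,0,1,2,1,0,5,3,1,0,2,1,5,1,3,5,2,2,2,4,0],
   [(1, 0, 2336215992964907, 6), (1, 1, 1497482329, 4), (1, 2, 99, 15), (1, 3, 11, 5), (1, 5,
   284220972069650690524695467, 16), (1, 6, 4423097095045731821811334145752255070517570, 10), (74, 3,
   4707758945779258573118080318507941, 17), (668, 5, 38699, 18), (329299, 4, 831068144016439163225, 12),
   (28415205, 6, 187817259, 21), (1353815269, 6, 8030161726205816324249, 9), (80810710245, 6,
   18703550377632485, 22)]),
   ([5,4,2,0], [108, 66, 9, 101, 80, 188888419],
   [6,6,4,6,5,0,6,1,2,1,0,0,3,1,1,0,0,0,0,1,0,0,0,0,5,0,0,5,0,2,1,4,0,1,3,1,1,3,1,0,6,1,0,4,0,0,1,0,0,5,0,0,2,5,0,2,3,2,0,0,5,1,1],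
   [(1, 0, 4614998055002, 4), (1, 1, 1, 20), (1, 3, 93, 18), (1, 6, 14, 21), (365797, 6, 168601390, 19)]),
   ([6,4,5,1], [66, 65, 870, 821, 21125548, 102962185116961130067],
   [6,6,4,6,6,6,4,0,1,0,2,2,2,0,0,1,0,3,2,0,0,0,1,0,2,0,0,6,0,1,0,1,0,0,3,0,0,1,0,6,2,0,1,1,2,0,0,1,2,5,0,1,1,2,0,1,3,1,2,1,5,0,0],
   [(1, 0, 1942945202536017258144856741696341082, 10), (1, 1, 2336087753774867, 6), (1, 3, 11, 19), (1, 4,
   77426818945360408715, 4), (1, 5, 13, 7), (5715, 4, 32893401975651433152963280, 9), (406172, 5, 10094766859,
   22)]),
   ([3,4,2,1], [14, 4771, 5716, 28415205, 476724635424976],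
   [5,5,3,5,4,4,5,2,1,1,1,2,0,1,1,1,1,1,0,5,1,2,4,1,0,2,3,1,2,0,0,1,2,0,1,0,1,1,0,1,0,3,1,0,0,2,0,0,3,1,0,3,1,0,2,0,1,3,1,2,1,1,4],
   [(1, 0, 68, 15), (1, 1, 139249288, 6), (1, 3, 80, 5), (1, 6, 47332820627149502337099631608886554859304, 9),
   (522, 3, 83279399113888054975398069941, 17)]),
   ([1,3,4,1,3,2], [76, 5795, 14, 304723, 11990570213, 25246522585962704],
   [6,6,3,5,1,5,6,6,4,3,0,0,2,1,4,0,0,1,0,3,0,0,0,1,1,0,4,1,0,0,1,1,0,2,1,0,1,3,0,0,1,3,0,2,0,0,2,0,4,1,0,4,0,1,4,0,1,3,0,0,1,1,5],
   [(1, 0, 425868242411177382841253, 17), (1, 1, 149509609079546597, 6), (1, 6, 10, 22), (8, 2,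
   40991408431757504960267, 17)]),
   ([4,3,2,1,0], [14, 50768, 33436, 45719442961689],
   [4,4,1,3,1,4,4,4,1,3,4,2,0,1,1,1,2,2,0,1,1,1,4,2,0,1,1,2,1,0,0,1,1,0,3,0,1,1,0,2,0,1,1,0,0,1,0,0,4,2,0,1,1,0,1,0,4,1,2,1,2,2,1],
   [(1, 0, 68, 13), (1, 1, 70940702739, 8), (1, 5, 1, 23), (1, 6, 47332820636025711587294659320990315742298,
   15), (8, 2, 648, 10), (11, 4, 1, 9), (604, 5, 63985345233621624407130, 24), (28415205, 6,
   6457431800171039455579046650809016740916784858202, 16), (12091233509, 6, 39219714843632319433637, 25)]),
   ([5,3,2,1,0], [13, 5712, 4179, 17106515],
   [4,3,1,4,4,4,4,3,1,2,2,0,0,1,1,4,2,0,4,1,1,1,0,0,2,1,0,2,0,4,2,1,0,1,0,1,1,0,1,4,2,0,1,1,4,1,1,1,0,2,1,0,1,2,0,1,0,0,4,1,2,2,1],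
   [(1, 0, 411434300389466, 10), (1, 3, 108, 9), (1, 4, 13, 23), (1, 5, 1, 8), (1, 6, 1, 26), (75, 4,
   10097933974460574498270001242, 24), (101, 6, 1270706452135594628117038170, 15), (4837, 6,
   470029437372009466607706, 21), (406172, 5, 23059503850447035594488178, 19), (3249381, 6, 646466320752, 27),
   (106580514021, 6, 2472353017105360669972018, 18)]),
   ([4,5,6,2,1,0], [66, 940, 592, 814],
   [4,4,2,4,4,1,1,0,4,0,1,4,1,0,0,1,0,1,1,0,0,0,1,0,1,0,0,4,0,1,0,2,0,0,4,0,0,2,0,1,3,0,1,2,1,0,0,1,1,4,0,1,2,3,0,2,3,2,1,1,4,0,0],
   [(1, 0, 238008290703536228446318731, 10), (1, 1, 12, 21), (1, 3, 268149, 24), (1, 4, 6572, 20), (9, 3,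
   3625672, 24), (12, 5, 184841710856151694251733131, 13), (5715, 4, 160565508007938530772525797, 8), (45724,
   5, 9217143099434747254423726134914, 25), (188887708, 5, 11989526441780917157, 28), (6153894466789, 6,
   4484441790554, 14)]),
   ([4,5,2,3,0], [41245, 34476, 36311874951376],
   [3,3,3,3,2,2,3,1,0,0,0,0,0,0,3,3,1,0,1,0,0,1,0,0,0,1,0,3,1,3,1,0,0,0,0,1,1,0,3,1,0,0,0,0,1,1,3,1,0,0,1,0,3,0,0,3,0,0,0,1,0,1,0],
   [(1, 0, 50794486478938, 8), (1, 1, 4202, 23), (1, 2, 47897, 10), (1, 3, 93, 11), (1, 6, 14, 27), (74, 3,
   11625756479770321039151750236, 24), (75, 4, 9317639926134394991375341726810, 24), (5715, 4, 4837, 28),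
   (4837, 6, 159178066498382395582563010, 16), (267493, 6, 17419138, 25), (21075173, 6,
   470035949701371469305608, 20), (1262629532, 5, 1017388684193963251502, 19), (10101036261, 6,
   331417237982824931967129, 27)]),
   ([6,4,5,1,3], [8, 45926, 39157, 45736394550042],
   [4,4,4,4,4,3,3,0,2,2,1,1,1,0,4,1,1,2,1,0,0,1,1,2,1,0,0,4,2,1,1,0,0,0,2,1,3,0,0,1,1,2,0,0,1,3,2,0,1,2,1,0,3,1,1,1,2,2,1,1,1,3,0],
   [(1, 0, 135364162822607410491609094015935325762, 18), (1, 1, 9856705330572608706, 8), (1, 2,
   5295175045530789054729547547848, 16), (1, 3, 11, 12), (1, 4, 246522562, 11), (74, 3, 858, 25), (5715, 4,
   4441143916361820740444880, 20)]),
   ([5,4,2,1,0], [108, 66, 9, 101, 80],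
   [5,5,4,5,5,0,5,1,2,1,0,0,3,1,1,0,0,0,0,1,0,0,0,0,5,0,0,5,0,2,1,4,0,1,3,1,1,3,1,0,5,1,0,4,0,0,1,0,0,5,0,0,2,5,0,2,3,2,0,0,5,1,1],
   [(1, 0, 305881184122970, 9), (1, 1, 1, 11), (1, 3, 108, 23), (1, 4, 13, 9), (1, 6, 102, 17), (741, 6, 814,
   26), (5715, 4, 17052363553190131507351324021, 19), (365797, 6, 254947483402559702053557890, 18),
   (188887708, 5, 15777446256, 29), (1511101669, 6, 9596720259881546030, 26), (6153894466789, 6,
   122893479948473300809946641496, 17)]),
   ([5,6,4,2,0], [66, 870, 821, 592],
   [4,4,3,4,4,4,4,0,4,0,1,1,1,0,0,1,0,2,1,0,0,0,2,0,1,0,0,4,0,1,0,3,0,0,2,0,0,2,0,4,1,0,3,1,1,0,0,1,1,4,0,1,3,1,0,1,2,2,1,1,4,0,0],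
   [(1, 0, 1570420826, 10), (1, 1, 12, 17), (1, 3, 784, 27), (1, 4, 821, 11), (1, 5, 1952902828465423448, 9),
   (1, 6, 14, 11), (9, 3, 4768, 27), (5715, 4, 2814788170637058765486813274817222499555469194513097445, 16),
   (406172, 5, 122359293165853575320, 25), (188887708, 5, 794247378963, 26), (6153894466789, 6, 570787805274,
   22)]),
   ([6,2,1,3,4,1,3], [76, 5715, 14, 366794, 139249232, 825948222885421225189],
   [6,6,1,6,3,6,6,3,4,3,0,0,2,1,1,0,0,5,0,1,0,0,0,1,2,0,4,1,0,0,1,1,0,2,1,0,1,1,0,0,1,1,0,1,0,0,1,0,6,1,0,5,0,1,3,0,1,1,0,0,1,1,4],
   [(1, 0, 715216204151932129195771264261348833370, 21), (1, 1, 12020304538, 12), (1, 3, 14634800657900909579,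
   10), (1, 5, 10, 25), (1, 6, 10, 14), (28415205, 6, 21305872947462864, 22)]),
   ([5,4,3,2,1,0], [443984, 267493, 18367977873553763, 27221584006697655687289626],
   [4,4,0,3,0,0,4,4,0,2,3,0,1,0,0,0,2,4,1,0,0,0,0,1,1,0,0,2,0,4,1,0,0,0,1,0,0,0,0,1,4,0,0,0,2,0,0,0,1,1,0,0,0,2,0,0,1,0,1,0,1,1,0],
   [(1, 0, 9596156165627467392, 15), (1, 1, 4776, 18), (1, 6, 528, 24), (8, 2, 145521137699661153548644079184,
   16), (92, 5, 1, 20), (4837, 6, 30953666739485287909803098, 27), (365797, 6, 10321068523545222625150542106,
   23)]),
   ([6,5,4,0,2,3,1], [2190105, 2466094, 4541447325267, 10831281984776544684],
   [4,4,1,0,4,0,0,4,4,2,2,4,0,1,0,4,3,2,1,0,1,0,0,3,1,0,1,0,0,0,1,0,0,1,0,0,2,0,0,0,0,2,0,0,0,3,1,0,0,2,1,0,0,1,1,0,1,0,1,0,0,0,0],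
   [(1, 0, 185387154732598884412276888, 16), (1, 1, 56648, 27), (1, 4, 59920, 23), (8, 2,
   2654668825016940550286353279878338, 18), (9, 3, 35057, 17), (12, 5, 19958609031216501459632282, 15), (75,
   4, 6344, 26)]),
   ([5,6,1,3,4,1,3,2], [304723, 19716310, 21808757, 5741473065753],
   [4,4,0,4,1,4,4,1,4,0,1,2,2,0,1,2,4,2,1,0,1,0,2,1,2,4,2,0,0,2,1,0,2,1,0,0,0,0,3,1,0,0,2,0,1,1,0,3,1,0,1,2,0,0,1,0,0,0,1,1,0,0,4],
   [(1, 0, 145806550674665924544564937424, 27), (1, 1, 669, 19), (1, 3, 9611571681435951532, 15), (1, 5, 10,
   22), (1, 6, 280606143449475660343219976, 17), (9, 3, 22726160, 18), (83, 4, 77543896233836087066, 21),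
   (4179, 4, 5656742203464295201123, 26), (292026917688549, 6, 15777446259, 25)]),
   ([6,5,3,2,1,0], [117, 5712, 4179, 17106515],
   [4,3,1,4,4,4,0,3,1,2,2,0,0,1,1,4,2,0,0,1,1,1,0,0,0,1,0,2,0,0,0,1,0,0,0,0,1,0,0,4,0,0,1,0,4,1,0,1,0,2,1,0,1,2,0,1,0,0,4,1,2,2,1],
   [(1, 0, 49784687769690, 21), (1, 3, 940, 20), (1, 4, 4188, 24), (1, 5, 14, 16), (75, 4,
   2244191743766821953460287578, 27), (406172, 5, 1904527319058258131017340466, 25), (3249381, 6,
   96340625727112676794810081986, 25), (106580514021, 6, 19094344238375618, 28)]),
   ([4,5,6,2,3,0], [329966, 275884, 18591945002388835],
   [3,3,3,3,2,3,1,1,0,0,0,2,0,0,3,3,1,0,0,0,0,1,3,1,0,1,0,3,1,0,0,0,1,0,2,1,1,0,0,1,0,2,1,0,0,1,0,0,0,2,0,0,3,0,0,0,0,0,0,1,0,1,0],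
   [(1, 0, 2222874, 18), (1, 1, 56648, 24), (1, 2, 135525149332724885698, 16), (1, 3, 99, 21), (1, 5, 117,
   18), (74, 3, 53355722031094647739113468698716, 27), (75, 4, 74171548731094282653293798345306, 27), (604, 5,
   6147408089881111260794303660738, 23), (5715, 4, 23448475602933013931631333, 26), (1262629532, 5,
   4395076322285899198640261, 25)]),
   ([1,3,4,5,2,3,4,2,1,3,2,0], [99, 70068613765, 92, 71295609625],
   [4,4,4,4,0,3,4,1,0,0,0,1,1,0,1,0,0,0,2,3,0,2,1,3,0,1,1,0,1,1,4,0,1,4,0,1,3,0,1,0,0,1,0,0,0,1,1,0,1,0,2,1,1,0,1,1,0,1,0,1,0,1,1],
   [(1, 0, 640490756746483452698, 17), (1, 1, 2244834397210721342369154257, 17), (1, 2,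
   2244834397210721292051916590, 17), (1, 3, 70230651992, 18), (1, 6, 1004987945298240446208855665434, 26),
   (5349, 6, 17106731, 29), (34021, 6, 1178420378258514641, 26)]),
   ([2,1,3,4,5,6,3,0,2,1,3,4,5,2,1,3,4,2,1,3,0], [108, 21801165, 8912253574, 4487766038736, 2323904170074342],
   [5,5,5,4,2,0,5,4,2,1,0,0,1,3,1,0,0,0,0,1,0,0,0,0,3,0,0,1,0,1,3,1,0,2,1,3,2,1,2,0,1,1,0,1,0,0,2,0,0,1,0,0,1,2,0,1,1,1,0,0,1,1,2],
   [(1, 0, 17782992, 28), (1, 1, 165402982799000888773261681, 20), (1, 2, 248298589719173492315374274, 20),
   (1, 6, 75291806144744019592, 28)])]"

text \<open>In odd rank -1 has determinant -1, so no element is conjugate to its negative.\<close>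

definition self_neg_E7 :: "(nat \<times> nat) list" where
  "self_neg_E7 =
   []"

definition odd_classes_E7 :: "nat list" where
  "odd_classes_E7 = [0,1,2,3,4,5,6,7,8,9,10,11,12,13,14,15,16,17,18,19,20,21,22,23,24,25,26,27,28,29]"

abbreviation "refl_E7 \<equiv> perm_table 63 refl_table_E7"

abbreviation "root_E7 \<equiv> root_table_fun pos_roots_E7"

definition class_words_E7 :: "nat list list" where
  "class_words_E7 = map fst class_data_E7"

lemma upto_E7:
  "[0..<7] = [0, 1, 2, 3, 4, 5, 6]"
  "[63..<70] = [63, 64, 65, 66, 67, 68, 69]"
  by (simp_all add: upt_rec)

lemma cartan_entries_E7:
  assumes "i < 7" "j < 7"
  shows "(cartan_E 7) $$ (i, j) = cartan_rows_E7 ! i ! j"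
proof -
  have "list_all (\<lambda>i. list_all (\<lambda>j. (cartan_E 7) $$ (i, j) = cartan_rows_E7 ! i ! j) [0..<7]) [0..<7]"
    by (simp add: upto_E7 cartan_E_def cartan_rows_E7_def doubleton_eq_iff)
  then show ?thesis using assms by (simp add: list_all_iff)
qed

lemma cartan_E7: "cartan (cartan_E 7) 7 (\<lambda>i. [1,1,1,1,1,1,1] ! i)"
proof (rule cartan_of_cartan_ok[OF _ cartan_entries_E7])
  show "(cartan_E 7) \<in> carrier_mat 7 7" by (simp add: cartan_E_def)
  show "cartan_ok 7 cartan_rows_E7 [1,1,1,1,1,1,1] [(0, 2), (2, 3), (3, 1), (3, 4), (4, 5), (5, 6)]"
    by (simp add: cartan_ok_def upto_E7 cartan_rows_E7_def)
qed

lemmas refl_eval_E7 = perm_table_graphs[OF refl_table_E7_def, where P=63, unfolded table_unfold]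

lemmas root_eval_E7 = root_table_graph[OF pos_roots_E7_def, unfolded table_unfold]

lemmas words_E7 = class_words_E7_def[unfolded class_data_E7_def list.map fst_conv]

lemmas words_eval_E7 = nth_graph[OF words_E7, unfolded table_unfold]

lemma length_words_E7: "length class_words_E7 = 30"
  by (simp only: words_E7 length_eval nat_eval)

lemma table_ok_E7: "table_ok 7 63 cartan_rows_E7 pos_roots_E7 refl_table_E7"
proof (rule table_okI[OF pos_roots_E7_def refl_table_E7_def], goal_cases)
  case 1
  show ?case by (simp add: cartan_rows_E7_def upto_E7)
next
  case 2
  show ?case
    by (simp only: table_rules cartan_rows_E7_def root_eval_E7 cong: row_ok_cong)
qed

lemma root_table_E7: "root_table (cartan_E 7) 7 (\<lambda>i. [1,1,1,1,1,1,1] ! i) 63 root_E7 refl_E7"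
  by (rule root_table_of_table_ok[OF cartan_E7 cartan_entries_E7 table_ok_E7])

lemma pm_list_E7: "pm_list 7 63 l \<longleftrightarrow> l = [0, 1, 2, 3, 4, 5, 6] \<or> l = [63, 64, 65, 66, 67, 68, 69]"
  by (simp add: pm_list_def upto_E7)

lemma classes_ok_E7: "list_all (rep_ok refl_E7 7 63 class_words_E7) class_data_E7"
  unfolding class_data_E7_def
  by (simp only: eval_rules refl_eval_E7 words_eval_E7 length_words_E7 pm_list_E7 upto_E7 cong: if_weak_cong weak_congs)

lemma neg_one_E7: "acts_neg refl_E7 7 63 [6,5,4,3,2,1,3,4,5,6,0,2,3,4,5,1,3,4,2,3,0,2,1,3,4,5,6,0,2,3,4,5,1,3,4,2,3,0,2,1,3,4,5,1,3,4,2,3,0,2,1,3,4,2,3,0,2,1,3,0,2,1,0]"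
  by (simp only: eval_rules refl_eval_E7 upto_E7 cong: if_weak_cong weak_congs)

text \<open>All roots are counted. Traces alone would not do: \<open>[4,1,0]\<close> and
  \<open>[6,4,1]\<close>, both products of three commuting reflections, have equal traces of all
  powers but fix 8 and 24 roots.\<close>

definition inv_roots_E7 :: "nat list" where
  "inv_roots_E7 = [0..<126]"

lemma inv_roots_upto_E7: "inv_roots_E7 =
   [0, 1, 2, 3, 4, 5, 6, 7, 8, 9, 10, 11, 12, 13, 14, 15, 16, 17, 18, 19, 20, 21, 22, 23, 24, 25, 26, 27, 28,
   29, 30, 31, 32, 33, 34, 35, 36, 37, 38, 39, 40, 41, 42, 43, 44, 45, 46, 47, 48, 49, 50, 51, 52, 53, 54, 55,
   56, 57, 58, 59, 60, 61, 62, 63, 64, 65, 66, 67, 68, 69, 70, 71, 72, 73, 74, 75, 76, 77, 78, 79, 80, 81, 82,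
   83, 84, 85, 86, 87, 88, 89, 90, 91, 92, 93, 94, 95, 96, 97, 98, 99, 100, 101, 102, 103, 104, 105, 106, 107,
   108, 109, 110, 111, 112, 113, 114, 115, 116, 117, 118, 119, 120, 121, 122, 123, 124, 125]"
  by (simp add: inv_roots_E7_def upt_rec)

lemma invariants_E7: "map (\<lambda>k. word_inv refl_E7 root_E7 7 63 (Suc (Suc (Suc (Suc (Suc (Suc (Suc (0)))))))) inv_roots_E7 (class_words_E7 ! k)) odd_classes_E7 =
   [([7, 7, 7, 7, 7, 7, 7], 126, 0), ([5, 7, 5, 7, 5, 7, 5], 60, 2), ([3, 7, 3, 7, 3, 7, 3], 26, 4), ([4, 4,
   7, 4, 4, 7, 4], 30, 0), ([2, 4, 5, 4, 2, 7, 2], 12, 2), ([1, 7, 1, 7, 1, 7, 1], 8, 6), ([3, 3, 3, 7, 3, 3,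
   3], 14, 0), ([1, 7, 1, 7, 1, 7, 1], 24, 6), ([2, 2, 2, 2, 7, 2, 2], 6, 0), ([0, 4, 3, 4, 0, 7, 0], 2, 4),
   ([1, 3, 1, 7, 1, 3, 1], 4, 2), ([1, 1, 7, 1, 1, 7, 1], 6, 0), ([1, 3, 1, 7, 1, 3, 1], 12, 2), ([2, 4, -1,
   4, 2, 7, 2], 6, 0), ([3, -1, 3, 7, 3, -1, 3], 6, 0), ([1, 3, 1, -1, 1, 3, 1], 2, 0), ([0, 2, 0, 2, 5, 2,
   0], 0, 2), ([-2, 0, 1, 4, -2, 3, -2], 0, 2), ([1, 1, 1, 1, 1, 7, 1], 2, 0), ([1, 1, 1, 1, 1, 7, 1], 6, 0),
   ([-1, 1, 5, 1, -1, 7, -1], 0, 2), ([0, 0, 3, 4, 0, 3, 0], 2, 0), ([1, -1, 1, 7, 1, -1, 1], 4, 2), ([0, 2,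
   3, -2, 0, -1, 0], 0, 0), ([-1, 1, 2, 1, -1, -2, -1], 0, 0), ([1, -1, 1, -1, 1, -1, 1], 2, 0), ([-1, -1, 2,
   -1, 4, 2, -1], 0, 0), ([0, 0, 0, 0, 0, 0, 7], 0, 0), ([2, -2, -1, -2, 2, 7, 2], 0, 0), ([2, -2, -7, -2, 2,
   7, 2], 0, 0)]"
  unfolding odd_classes_E7_def
  by (simp only: inv_rules inv_roots_upto_E7 refl_eval_E7 root_eval_E7 words_eval_E7 upto_E7 cong: if_weak_cong weak_congs)

lemma card_odd_E7: "card (odd_irr_chars (weyl_group (cartan_E 7)) (- 1\<^sub>m 7)) = 30"
proof -
  interpret root_table "(cartan_E 7)" 7 "\<lambda>i. [1,1,1,1,1,1,1] ! i" 63 root_E7 refl_E7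
    by (rule root_table_E7)
  have "card (odd_irr_chars (weyl_group (cartan_E 7)) (- 1\<^sub>m 7)) = length odd_classes_E7"
  proof (rule card_odd_irr_chars_data[OF class_words_E7_def classes_ok_E7 _ length_words_E7 neg_one_E7
        _ _ _ _ _ _ invariants_E7])
    show "class_words_E7 ! 0 = []" by (simp only: words_eval_E7)
    show "list_all (self_conj_pair refl_E7 7 63 class_words_E7) []" by simp
    show "list_all (\<lambda>k. k < 30) odd_classes_E7" by (simp add: odd_classes_E7_def)
    show "list_all (\<lambda>k. k \<in> set odd_classes_E7 \<or> k \<in> set (map fst [])) [0..<30]"
      by (simp add: odd_classes_E7_def upt_rec)
    show "distinct inv_roots_E7" "set inv_roots_E7 \<subseteq> {..<2 * 63}" by (auto simp: inv_roots_E7_def)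
    show "refl_E7 i r \<in> set inv_roots_E7" if "r \<in> set inv_roots_E7" for i r
      using that s_lt[of r i] by (simp add: inv_roots_E7_def)
  qed (simp_all add: neg_inv_def)
  then show ?thesis by (simp add: odd_classes_E7_def)
qed

section \<open>Type \<open>E\<^sub>8\<close>\<close>

definition cartan_rows_E8 :: "int list list" where
  "cartan_rows_E8 =
   [[2,0,-1,0,0,0,0,0], [0,2,0,-1,0,0,0,0], [-1,0,2,-1,0,0,0,0], [0,-1,-1,2,-1,0,0,0], [0,0,0,-1,2,-1,0,0],
   [0,0,0,0,-1,2,-1,0], [0,0,0,0,0,-1,2,-1], [0,0,0,0,0,0,-1,2]]"

definition pos_roots_E8 :: "int list list" where
  "pos_roots_E8 =
   [[1,0,0,0,0,0,0,0], [0,1,0,0,0,0,0,0], [0,0,1,0,0,0,0,0], [0,0,0,1,0,0,0,0], [0,0,0,0,1,0,0,0],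
   [0,0,0,0,0,1,0,0], [0,0,0,0,0,0,1,0], [0,0,0,0,0,0,0,1], [1,0,1,0,0,0,0,0], [0,1,0,1,0,0,0,0],
   [0,0,1,1,0,0,0,0], [0,0,0,1,1,0,0,0], [0,0,0,0,1,1,0,0], [0,0,0,0,0,1,1,0], [0,0,0,0,0,0,1,1],
   [1,0,1,1,0,0,0,0], [0,1,1,1,0,0,0,0], [0,1,0,1,1,0,0,0], [0,0,1,1,1,0,0,0], [0,0,0,1,1,1,0,0],
   [0,0,0,0,1,1,1,0], [0,0,0,0,0,1,1,1], [1,1,1,1,0,0,0,0], [1,0,1,1,1,0,0,0], [0,1,1,1,1,0,0,0],
   [0,1,0,1,1,1,0,0], [0,0,1,1,1,1,0,0], [0,0,0,1,1,1,1,0], [0,0,0,0,1,1,1,1], [1,1,1,1,1,0,0,0],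
   [1,0,1,1,1,1,0,0], [0,1,1,2,1,0,0,0], [0,1,1,1,1,1,0,0], [0,1,0,1,1,1,1,0], [0,0,1,1,1,1,1,0],
   [0,0,0,1,1,1,1,1], [1,1,1,2,1,0,0,0], [1,1,1,1,1,1,0,0], [1,0,1,1,1,1,1,0], [0,1,1,2,1,1,0,0],
   [0,1,1,1,1,1,1,0], [0,1,0,1,1,1,1,1], [0,0,1,1,1,1,1,1], [1,1,2,2,1,0,0,0], [1,1,1,2,1,1,0,0],
   [1,1,1,1,1,1,1,0], [1,0,1,1,1,1,1,1], [0,1,1,2,2,1,0,0], [0,1,1,2,1,1,1,0], [0,1,1,1,1,1,1,1],
   [1,1,2,2,1,1,0,0], [1,1,1,2,2,1,0,0], [1,1,1,2,1,1,1,0], [1,1,1,1,1,1,1,1], [0,1,1,2,2,1,1,0],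
   [0,1,1,2,1,1,1,1], [1,1,2,2,2,1,0,0], [1,1,2,2,1,1,1,0], [1,1,1,2,2,1,1,0], [1,1,1,2,1,1,1,1],
   [0,1,1,2,2,2,1,0], [0,1,1,2,2,1,1,1], [1,1,2,3,2,1,0,0], [1,1,2,2,2,1,1,0], [1,1,2,2,1,1,1,1],
   [1,1,1,2,2,2,1,0], [1,1,1,2,2,1,1,1], [0,1,1,2,2,2,1,1], [1,2,2,3,2,1,0,0], [1,1,2,3,2,1,1,0],
   [1,1,2,2,2,2,1,0], [1,1,2,2,2,1,1,1], [1,1,1,2,2,2,1,1], [0,1,1,2,2,2,2,1], [1,2,2,3,2,1,1,0],
   [1,1,2,3,2,2,1,0], [1,1,2,3,2,1,1,1], [1,1,2,2,2,2,1,1], [1,1,1,2,2,2,2,1], [1,2,2,3,2,2,1,0],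
   [1,2,2,3,2,1,1,1], [1,1,2,3,3,2,1,0], [1,1,2,3,2,2,1,1], [1,1,2,2,2,2,2,1], [1,2,2,3,3,2,1,0],
   [1,2,2,3,2,2,1,1], [1,1,2,3,3,2,1,1], [1,1,2,3,2,2,2,1], [1,2,2,4,3,2,1,0], [1,2,2,3,3,2,1,1],
   [1,2,2,3,2,2,2,1], [1,1,2,3,3,2,2,1], [1,2,3,4,3,2,1,0], [1,2,2,4,3,2,1,1], [1,2,2,3,3,2,2,1],
   [1,1,2,3,3,3,2,1], [2,2,3,4,3,2,1,0], [1,2,3,4,3,2,1,1], [1,2,2,4,3,2,2,1], [1,2,2,3,3,3,2,1],
   [2,2,3,4,3,2,1,1], [1,2,3,4,3,2,2,1], [1,2,2,4,3,3,2,1], [2,2,3,4,3,2,2,1], [1,2,3,4,3,3,2,1],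
   [1,2,2,4,4,3,2,1], [2,2,3,4,3,3,2,1], [1,2,3,4,4,3,2,1], [2,2,3,4,4,3,2,1], [1,2,3,5,4,3,2,1],
   [2,2,3,5,4,3,2,1], [1,3,3,5,4,3,2,1], [2,3,3,5,4,3,2,1], [2,2,4,5,4,3,2,1], [2,3,4,5,4,3,2,1],
   [2,3,4,6,4,3,2,1], [2,3,4,6,5,3,2,1], [2,3,4,6,5,4,2,1], [2,3,4,6,5,4,3,1], [2,3,4,6,5,4,3,2]]"

definition refl_table_E8 :: "nat list list" where
  "refl_table_E8 =
   [[120, 1, 8, 3, 4, 5, 6, 7, 2, 9, 15, 11, 12, 13, 14, 10, 22, 17, 23, 19, 20, 21, 16, 18, 29, 25, 30, 27,
   28, 24, 26, 36, 37, 33, 38, 35, 31, 32, 34, 44, 45, 41, 46, 43, 39, 40, 42, 51, 52, 53, 50, 47, 48, 49, 58,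
   59, 56, 57, 54, 55, 65, 66, 62, 63, 64, 60, 61, 72, 68, 69, 70, 71, 67, 78, 74, 75, 76, 77, 73, 79, 80, 81,
   82, 83, 84, 85, 86, 87, 88, 89, 90, 91, 96, 93, 94, 95, 92, 100, 98, 99, 97, 103, 102, 101, 106, 105, 104,
   108, 107, 110, 109, 112, 111, 113, 114, 115, 116, 117, 118, 119], [0, 121, 2, 9, 4, 5, 6, 7, 8, 3, 16, 17,
   12, 13, 14, 22, 10, 11, 24, 25, 20, 21, 15, 29, 18, 19, 32, 33, 28, 23, 37, 31, 26, 27, 40, 41, 36, 30, 45,
   39, 34, 35, 49, 43, 44, 38, 53, 47, 48, 42, 50, 51, 52, 46, 54, 55, 56, 57, 58, 59, 60, 61, 68, 63, 64, 65,
   66, 67, 62, 74, 70, 71, 72, 73, 69, 79, 80, 77, 78, 75, 76, 84, 85, 83, 81, 82, 89, 90, 88, 86, 87, 94, 92,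
   93, 91, 99, 96, 97, 98, 95, 100, 101, 102, 103, 104, 105, 106, 107, 108, 111, 112, 109, 110, 114, 113, 115,
   116, 117, 118, 119], [8, 1, 122, 10, 4, 5, 6, 7, 0, 16, 3, 18, 12, 13, 14, 15, 9, 24, 11, 26, 20, 21, 22,
   23, 17, 32, 19, 34, 28, 29, 30, 31, 25, 40, 27, 42, 43, 37, 38, 39, 33, 49, 35, 36, 50, 45, 46, 47, 48, 41,
   44, 56, 57, 53, 54, 55, 51, 52, 63, 64, 60, 61, 62, 58, 59, 70, 71, 67, 68, 69, 65, 66, 77, 73, 74, 75, 76,
   72, 83, 79, 80, 81, 82, 78, 84, 85, 86, 87, 92, 89, 90, 91, 88, 97, 94, 95, 96, 93, 101, 99, 100, 98, 104,
   103, 102, 107, 106, 105, 108, 109, 113, 111, 114, 110, 112, 115, 116, 117, 118, 119], [0, 9, 10, 123, 11,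
   5, 6, 7, 15, 1, 2, 4, 19, 13, 14, 8, 16, 17, 18, 12, 27, 21, 22, 23, 31, 25, 26, 20, 35, 36, 30, 24, 39,
   33, 34, 28, 29, 44, 38, 32, 48, 41, 42, 43, 37, 52, 46, 47, 40, 55, 50, 51, 45, 59, 54, 49, 62, 57, 58, 53,
   60, 61, 56, 69, 64, 65, 66, 67, 68, 63, 75, 76, 72, 73, 74, 70, 71, 82, 78, 79, 80, 81, 77, 87, 88, 85, 86,
   83, 84, 93, 90, 91, 92, 89, 98, 95, 96, 97, 94, 102, 100, 101, 99, 103, 104, 105, 106, 109, 110, 107, 108,
   111, 112, 113, 115, 114, 116, 117, 118, 119], [0, 1, 2, 11, 124, 12, 6, 7, 8, 17, 18, 3, 5, 20, 14, 23, 24,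
   9, 10, 19, 13, 28, 29, 15, 16, 25, 26, 27, 21, 22, 30, 31, 32, 33, 34, 35, 36, 37, 38, 47, 40, 41, 42, 43,
   51, 45, 46, 39, 54, 49, 56, 44, 58, 53, 48, 61, 50, 63, 52, 66, 60, 55, 62, 57, 71, 65, 59, 67, 68, 69, 70,
   64, 72, 73, 74, 81, 76, 77, 78, 84, 80, 75, 86, 83, 79, 89, 82, 91, 88, 85, 94, 87, 92, 93, 90, 95, 96, 97,
   98, 99, 100, 101, 105, 103, 107, 102, 108, 104, 106, 109, 110, 111, 112, 113, 114, 116, 115, 117, 118,
   119], [0, 1, 2, 3, 12, 125, 13, 7, 8, 9, 10, 19, 4, 6, 21, 15, 16, 25, 26, 11, 20, 14, 22, 30, 32, 17, 18,
   27, 28, 37, 23, 39, 24, 33, 34, 35, 44, 29, 38, 31, 40, 41, 42, 50, 36, 45, 46, 47, 48, 49, 43, 51, 52, 53,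
   60, 55, 56, 57, 65, 59, 54, 67, 62, 70, 64, 58, 72, 61, 68, 75, 63, 77, 66, 73, 79, 69, 82, 71, 78, 74, 85,
   81, 76, 83, 84, 80, 86, 87, 88, 89, 90, 95, 92, 93, 99, 91, 96, 97, 102, 94, 100, 104, 98, 106, 101, 105,
   103, 107, 108, 109, 110, 111, 112, 113, 114, 115, 117, 116, 118, 119], [0, 1, 2, 3, 4, 13, 126, 14, 8, 9,
   10, 11, 20, 5, 7, 15, 16, 17, 18, 27, 12, 21, 22, 23, 24, 33, 34, 19, 28, 29, 38, 31, 40, 25, 26, 35, 36,
   45, 30, 48, 32, 41, 42, 43, 52, 37, 46, 54, 39, 49, 57, 58, 44, 53, 47, 55, 63, 50, 51, 59, 60, 61, 69, 56,
   64, 65, 66, 73, 74, 62, 70, 71, 78, 67, 68, 75, 76, 83, 72, 79, 80, 81, 87, 77, 84, 90, 91, 82, 88, 94, 85,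
   86, 92, 98, 89, 95, 96, 101, 93, 99, 103, 97, 102, 100, 104, 105, 106, 107, 108, 109, 110, 111, 112, 113,
   114, 115, 116, 118, 117, 119], [0, 1, 2, 3, 4, 5, 14, 127, 8, 9, 10, 11, 12, 21, 6, 15, 16, 17, 18, 19, 28,
   13, 22, 23, 24, 25, 26, 35, 20, 29, 30, 31, 32, 41, 42, 27, 36, 37, 46, 39, 49, 33, 34, 43, 44, 53, 38, 47,
   55, 40, 50, 51, 59, 45, 61, 48, 56, 64, 66, 52, 67, 54, 62, 71, 57, 72, 58, 60, 68, 76, 77, 63, 65, 73, 80,
   82, 69, 70, 78, 85, 74, 86, 75, 83, 89, 79, 81, 87, 93, 84, 90, 91, 97, 88, 94, 95, 100, 92, 98, 99, 96,
   101, 102, 103, 104, 105, 106, 107, 108, 109, 110, 111, 112, 113, 114, 115, 116, 117, 119, 118]]"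

text \<open>The 67 representatives account for the 112 classes: 45 pairs, and 22 classes equal to
  their negatives, whose conjugators are given by \<open>self_neg_E8\<close>.\<close>

definition class_data_E8 :: "(nat list \<times> nat list \<times> nat list \<times> (nat \<times> nat \<times> nat \<times> nat) list) list" where
  "class_data_E8 =
   [([], [8, 10, 11, 9, 12, 13, 14, 126, 867, 4816],
   [10,10,9,9,8,8,10,7,0,2,1,2,4,5,6,0,1,3,1,2,4,5,0,0,1,3,1,2,4,0,0,2,1,3,1,2,0,0,0,2,1,3,1,1,0,0,0,4,2,1,1,0,0,0,4,2,1,1,0,0,5,4,2,1,1,0,0,5,3,2,1,1,0,6,3,2,2,1,0,3,3,4,2,1,3,3,4,2,2,3,3,4,1,2,3,5,0,1,2,3,0,1,2,0,1,4,0,1,0,2,0,3,0,1,1,2,4,5,6,7],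
   [(1, 0, 1, 1), (1, 1, 329355, 1), (1, 6, 1349147877, 1)]),
   ([0], [8, 9, 11, 12, 13, 14, 15, 289561, 22629292719295989],
   [9,9,9,7,7,7,7,8,0,1,2,2,3,4,5,0,1,1,3,2,3,4,0,0,1,1,4,2,3,0,0,2,1,1,5,2,0,0,0,2,1,1,6,8,0,0,0,3,2,1,4,0,0,0,3,2,3,5,0,0,4,3,2,3,6,0,0,4,1,2,4,3,0,5,1,2,2,4,0,1,1,3,2,5,1,1,3,2,2,1,1,3,8,2,1,4,0,6,2,1,0,5,2,0,4,3,0,3,0,2,0,1,0,8,1,2,3,4,5,6],
   [(1, 0, 1, 0), (1, 1, 1, 2), (1, 2, 1, 3)]),
   ([1,0], [8, 9, 12, 13, 14, 15, 21074970, 8108],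
   [8,6,8,8,8,7,7,7,0,1,8,2,2,3,4,0,1,1,2,3,2,3,0,0,1,1,3,4,2,0,0,6,1,1,4,5,0,0,0,3,1,1,5,6,0,0,0,2,4,1,3,0,0,0,2,5,2,4,0,0,3,2,6,2,5,0,0,3,1,4,3,2,0,4,1,3,5,3,0,1,1,2,3,4,1,1,2,4,8,1,1,2,6,5,1,3,0,5,4,1,0,4,3,0,3,2,0,2,0,8,0,1,0,6,1,6,2,3,4,5],
   [(1, 0, 329355, 1), (1, 2, 1, 4), (1, 3, 2200770, 4), (1, 4, 1, 5), (10, 3, 66, 6), (6153894466789, 6,
   551901398551710474039756168898315, 5), (1631207087902861102, 7, 42181191318286319590084697138955, 6)]),
   ([2,0], [9, 12, 13, 14, 15, 80, 66, 40876, 295359874401955],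
   [9,9,5,9,8,7,7,7,5,0,6,1,1,2,3,5,0,0,1,2,1,2,0,1,0,0,2,3,1,0,2,9,0,0,3,4,5,0,3,2,0,0,4,5,2,0,4,1,3,0,2,1,3,0,1,4,1,3,1,4,2,1,8,1,4,2,1,2,0,3,2,1,2,3,0,2,4,2,3,0,0,1,2,3,0,0,1,3,8,0,0,1,6,4,0,2,5,4,3,0,4,3,2,3,2,1,2,1,1,8,5,0,0,5,0,8,1,2,3,4],
   [(1, 0, 10, 1), (1, 1, 1, 4), (1, 3, 33881, 6), (5715, 4, 612391387976028205195, 6)]),
   ([2,1,0], [9, 12, 13, 14, 15, 80, 8108, 66],
   [8,8,5,8,8,6,6,6,5,0,7,1,1,2,3,5,0,0,1,2,1,2,0,1,0,0,2,3,1,0,2,8,0,0,3,4,5,0,3,2,0,0,4,5,2,0,4,1,3,0,2,1,3,0,1,4,1,3,1,4,2,1,8,1,4,2,1,2,0,3,2,1,2,3,0,2,4,2,3,0,0,1,2,3,0,0,1,3,8,0,0,1,7,4,0,2,5,4,3,0,4,3,2,3,2,1,2,1,1,8,5,0,0,5,0,8,1,2,3,4],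
   [(1, 0, 10, 2), (1, 1, 1, 3), (1, 3, 1, 7), (1, 4, 1, 8), (5715, 4, 329355, 9), (188887708, 5,
   769222952587, 10), (6153894466789, 6, 9221967049727050303086475693714330955915, 9), (1631207087902861102,
   7, 7865844717627530241270986505631917224075, 7), (6585965919897605941038, 7,
   2595535823181407354532020586508215910071578965560078475, 8)]),
   ([4,1,0], [8, 9, 12, 126, 15, 5731, 86644164261, 2325219333780323],
   [8,6,8,8,5,7,8,3,0,1,8,2,2,3,3,0,1,1,2,5,2,3,0,0,1,1,7,3,2,0,0,5,1,1,3,3,0,0,0,5,1,1,3,8,0,0,0,2,3,1,6,0,0,0,2,3,2,3,0,0,6,2,5,2,3,0,0,4,1,3,6,2,0,3,1,6,3,4,0,1,1,2,4,3,1,1,2,3,5,1,1,2,6,4,1,6,0,4,3,1,0,3,5,0,6,2,0,2,0,5,0,1,0,6,1,5,2,6,3,3],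
   [(1, 0, 6153975898853, 2), (1, 2, 1, 8), (1, 3, 11, 9), (1, 6, 1, 11), (10, 3, 66, 12), (329299, 4, 66,
   13)]),
   ([3,2,1], [13, 14, 15, 714, 595, 406172, 1013],
   [7,7,5,7,7,7,6,6,3,3,3,4,0,0,1,4,3,7,3,0,1,0,3,5,3,0,0,1,2,3,0,3,0,1,1,2,4,0,1,0,1,2,2,3,0,1,2,5,1,2,0,5,1,2,1,2,3,1,1,2,0,2,4,1,2,0,2,0,3,1,0,2,0,1,1,0,2,0,1,0,2,5,0,1,3,0,2,1,4,2,1,1,3,2,1,0,7,2,1,0,2,1,0,1,0,5,0,3,7,4,4,3,7,3,3,3,5,0,1,2],
   [(1, 0, 8, 7), (1, 1, 5712, 3), (1, 3, 80, 2), (1, 4, 12, 12), (1, 5, 3291474402656976, 9), (75, 4, 1, 14),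
   (292026917688549, 6, 4721647010785327197434818556620988922577616, 9), (1198861523675293486, 7,
   197407146103335720911985614695838416, 12), (75418183382741067566, 7, 29107304792069859806011519478121168,
   14)]),
   ([3,2,1,0], [13, 14, 15, 4179, 5712, 1013, 17106515],
   [7,6,4,7,7,7,5,5,6,3,3,3,0,0,1,3,3,7,3,0,1,0,3,4,4,0,0,1,2,4,0,3,0,1,1,2,3,0,1,0,1,2,2,3,0,1,2,7,1,2,0,4,1,2,1,2,4,1,1,2,0,2,3,1,2,0,2,0,3,1,0,2,0,1,1,0,2,0,1,0,2,7,0,1,4,0,2,1,3,2,1,1,3,2,1,0,3,2,1,0,2,1,0,1,0,7,0,7,4,3,3,3,4,3,4,3,7,0,1,2],
   [(1, 0, 8, 6), (1, 3, 1, 4), (1, 4, 1, 15), (1, 5, 1, 16), (75, 4, 1, 17), (406172, 5, 10109068000, 18),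
   (106580514021, 6, 80001078916959863044557832140614414152108, 18), (27925620558964526, 7,
   2223272638285398202125813733880687901297446828, 15), (190055207144302382, 7,
   7885617908639426648261725157103564588124, 17), (58531997231463703291694, 7,
   390727841579593586341606554159223786679603187778652, 16)]),
   ([4,2,1,0], [9, 12, 126, 80, 15, 66, 295359874401955],
   [7,7,3,7,6,7,7,2,3,0,5,1,1,2,2,3,0,0,1,7,1,2,0,1,0,0,5,2,1,0,3,7,0,0,2,2,3,0,2,6,0,0,2,3,3,0,2,1,2,0,3,1,2,0,1,2,1,2,1,2,7,1,6,1,2,3,1,4,0,2,3,1,3,2,0,7,2,3,2,0,0,1,4,2,0,0,1,2,6,0,0,1,5,4,0,7,3,4,2,0,3,2,7,2,5,1,3,1,1,6,3,0,0,3,0,6,1,7,2,2],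
   [(1, 0, 10, 5), (1, 1, 396126235231320, 4), (1, 3, 12, 15), (1, 5, 1, 19), (1, 6, 1, 20), (92, 5, 101, 16),
   (5715, 4, 1, 21), (28415205, 6, 1349984997, 22), (12091233509, 6, 1662682276351544229, 23),
   (59597864609582, 7, 3079143442608145760082290006216912595549093, 19), (3155822608426798, 7,
   28400085399447332862987478684300481048873855692578884332518309, 16), (511879179586949643806510, 7,
   10777905146466895655490706828199635722981, 20)]),
   ([4,1,3,0], [8, 14, 15, 716, 611, 44197837342398],
   [6,6,6,6,6,6,6,5,0,3,4,3,3,1,1,0,6,3,3,4,1,2,0,0,3,3,6,1,2,0,0,3,3,1,1,2,0,0,0,4,1,2,2,6,0,0,0,3,1,2,5,0,0,0,1,2,3,1,0,0,6,2,4,1,2,0,0,2,3,1,6,2,0,1,1,4,2,2,0,6,2,3,2,1,3,2,2,1,3,2,1,1,5,2,1,6,0,2,1,3,0,1,4,0,6,3,0,3,0,4,0,3,0,5,3,4,3,6,1,2],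
   [(1, 0, 2336215992964907, 6), (1, 1, 1497482329, 4), (1, 2, 99, 15), (1, 3, 11, 5), (1, 4, 365762, 4), (1,
   5, 284216837973422674524097451, 16), (1, 6, 1, 22), (74, 3, 92, 17), (668, 5, 38699, 18), (329299, 4, 5314,
   21), (28415205, 6, 187817259, 23), (1353815269, 6,
   795269031550367538010842725631425465811613307652880145134455, 20), (80810710245, 6, 31119223165215461, 24),
   (59597864609582, 7, 211597125230142763422355542822485027981621692794062837, 16), (23422020931594030, 7,
   2621471002019517742056485814957929540233208549, 18), (511879179586949643806510, 7,
   737197469370881931167643696002, 22)]),
   ([5,4,2,0], [9, 15, 80, 108, 66, 101, 188888419],
   [7,7,2,7,6,3,7,7,2,0,4,3,3,5,1,2,0,0,3,3,3,1,0,2,0,0,3,6,1,0,2,6,0,0,4,1,2,0,2,5,0,0,1,2,2,0,1,3,7,0,2,2,2,0,3,1,2,2,2,1,3,1,6,2,1,2,1,1,0,6,2,1,1,7,0,5,1,1,2,0,0,3,1,2,0,0,1,6,6,0,0,3,4,1,0,3,2,1,7,0,1,4,5,2,4,3,2,3,2,6,2,0,0,2,0,6,3,3,7,1],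
   [(1, 0, 4614998055002, 4), (1, 1, 1, 19), (1, 3, 93, 18), (1, 6, 14, 23), (1, 7,
   21365849663169579342752238, 19), (365797, 6, 284220927387081669636855598, 18), (1972152110, 7,
   642414350751011970979468699997998, 23), (393849399453486, 7,
   61994513330455343896043029024455482274608497043246, 18), (4440888093334494461601582, 7,
   75043480828914911467643715473234474213658798921518, 19)]),
   ([6,4,1,0], [8, 9, 102, 5731, 6965, 12, 690591208474, 356151996819831, 308206693883132068714997],
   [9,7,9,9,3,9,4,8,0,1,9,2,5,2,2,0,1,1,2,3,2,4,0,0,1,1,4,2,2,0,0,3,1,1,2,3,0,0,0,3,1,1,8,9,0,0,0,3,2,1,6,0,0,0,2,3,5,2,0,0,4,2,3,2,6,0,0,4,1,2,4,2,0,2,1,4,3,4,0,1,1,2,7,2,1,1,3,2,3,1,1,2,6,3,1,4,0,6,2,1,0,2,3,0,4,2,0,2,0,3,0,1,0,6,1,3,2,4,2,7],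
   [(1, 0, 125068614878565546359, 5), (1, 2, 1, 20), (1, 3, 11, 22), (1, 5, 196302603, 22), (10, 3,
   3158433053672300027014212795202566934631561313395429, 20), (329299, 4,
   2798472556563500157229941621153031809358357825577979457548368203, 5)]),
   ([3,4,2,1], [14, 15, 4771, 5716, 28415205, 1113994302, 476724635424976],
   [7,7,4,7,5,6,7,5,3,2,2,2,3,0,0,2,2,2,2,2,0,1,7,2,3,6,2,0,1,3,4,2,3,0,0,1,2,3,0,2,0,1,1,2,2,0,1,2,0,1,4,2,0,1,0,1,3,0,0,1,4,1,2,0,1,4,1,1,2,0,3,1,1,0,0,2,1,1,0,4,1,2,1,0,3,1,1,0,2,1,0,0,2,1,0,4,5,1,0,3,1,0,2,0,4,2,5,3,3,2,2,2,5,2,3,2,2,4,0,1],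
   [(1, 0, 68, 15), (1, 1, 139249288, 6), (1, 3, 80, 5), (1, 6,
   3146210282172925779422698950086573982457022476523304, 20), (522, 3, 34000, 17)]),
   ([4,3,2,1,3,4,3,2,1,3,2,1], [126, 74, 99, 615, 28415205, 1113917648],
   [6,6,4,5,2,6,6,0,1,2,1,2,3,0,0,2,1,2,1,2,0,0,1,2,1,3,1,0,0,1,4,2,1,0,0,0,2,1,0,2,0,0,0,1,2,0,0,2,0,0,1,2,0,0,0,0,1,0,0,0,4,0,2,0,0,4,0,3,1,0,1,0,3,0,0,2,0,1,0,1,0,2,2,0,1,1,2,0,2,1,0,0,1,2,0,4,5,1,0,1,3,0,2,0,1,2,5,1,3,2,2,1,3,1,1,2,2,4,0,0],
   [(1, 0, 8, 21), (1, 1, 342035, 5), (1, 5, 2447052869583568, 21), (1, 6,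
   179102243620064010062716263753794035798934900836990685283095565008, 5)]),
   ([1,3,4,1,3,2], [126, 76, 5795, 15, 304723, 11990570213, 25246522585962704],
   [7,7,4,6,2,6,7,0,7,5,4,1,1,0,0,2,5,1,1,2,0,0,4,1,1,1,2,0,0,1,5,2,1,0,0,0,2,1,0,2,0,0,0,2,4,0,0,1,0,0,4,1,0,0,0,0,1,0,0,0,5,0,2,0,0,5,0,3,1,0,5,0,3,0,0,2,0,3,0,4,0,1,2,0,1,3,1,0,2,1,0,0,2,2,0,5,6,2,0,1,3,0,4,0,4,1,6,1,1,2,2,1,1,2,1,2,1,5,0,0],
   [(1, 0, 8, 17), (1, 1, 149509609079546597, 6), (1, 6, 10, 24), (8, 2, 80, 17)]),
   ([4,3,2,1,0], [14, 15, 50768, 33436, 95905187518, 45719442961689],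
   [6,6,2,5,2,6,6,4,6,2,4,6,3,0,0,2,2,2,3,3,0,1,2,2,2,6,3,0,1,2,2,3,2,0,0,1,2,2,0,5,0,1,1,2,2,0,1,3,0,1,2,2,0,1,0,1,2,0,0,1,6,1,3,0,1,2,1,1,2,0,2,1,1,0,0,6,1,1,0,2,1,3,1,0,2,1,1,0,3,1,0,0,3,1,0,6,2,1,0,2,1,0,6,0,4,3,2,3,2,3,3,3,2,2,2,2,2,6,0,1],
   [(1, 0, 68, 12), (1, 1, 70940702739, 7), (1, 5, 1, 25), (1, 6, 1, 26), (8, 2, 648, 9), (11, 4, 1, 8), (604,
   5, 77, 27), (28415205, 6, 1196890874076943077, 28), (12091233509, 6, 39219714843632319433637, 29),
   (59597864609582, 7, 93258075516396145208139826667542303780223810469, 25), (3155822608426798, 7,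
   402420013403060768986836318953824887065013928557477, 27), (511879179586949643806510, 7,
   333279969019426470836442529989722, 26)]),
   ([5,3,2,1,0], [13, 15, 5712, 4179, 17106515],
   [5,4,2,5,5,5,5,5,4,2,3,3,0,0,1,2,2,5,3,0,5,0,2,2,2,0,0,3,1,2,0,3,0,5,3,1,2,0,2,0,2,1,1,2,0,2,1,5,3,1,0,2,2,1,5,1,2,2,2,1,0,1,3,2,1,0,1,0,2,3,0,1,0,5,2,0,1,0,2,0,1,5,0,2,2,0,1,3,3,1,2,5,3,1,2,0,2,1,3,0,1,3,0,2,0,5,0,5,2,3,3,3,2,2,2,2,5,0,5,1],
   [(1, 0, 411434300389466, 9), (1, 3, 108, 8), (1, 4, 13, 25), (1, 5, 1, 7), (1, 6, 1, 30), (1, 7,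
   330916735014224347284105172832142327277235237037023970, 28), (75, 4, 101, 27), (101, 6, 110, 26), (4837, 6,
   1157825527646436583865877663322876284923879667802, 31), (406172, 5, 108, 32), (3249381, 6, 648982632238,
   33), (1972152110, 7, 41534889891630, 34), (106580514021, 6, 41109295149649642375630216034309885798166956,
   34), (6821306476334, 7, 379214499762723169685403211901192844840087590277410606, 33), (27925620558964526, 7,
   19891166667370535160262380819075019273756388323426908250, 26), (190055207144302382, 7,
   117084905611619810668251312947649322935607516017284865379, 31), (58531997231463703291694, 7,
   6362140188569834499283057986097226783114307002903360216832739, 30), (4440888093334494461601582, 7,
   17054437133207288195589087970, 28)]),
   ([1,3,4,1,3,2,0], [126, 76, 2934352, 2139747, 15],
   [5,5,2,5,2,5,5,0,5,5,3,1,1,0,0,2,2,1,1,3,0,0,2,1,1,1,5,0,0,1,2,3,1,0,0,0,2,1,0,3,0,0,0,2,2,0,0,1,0,0,2,1,0,0,0,0,1,0,0,0,5,0,2,0,0,2,0,4,1,0,2,0,2,0,0,5,0,2,0,2,0,1,4,0,1,2,1,0,3,1,0,0,3,3,0,5,2,3,0,1,2,0,3,0,5,1,2,1,1,3,2,1,1,2,1,2,1,5,0,0],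
   [(1, 0, 8, 14), (1, 1, 34000, 12), (1, 3, 76, 7), (1, 5, 12, 27), (1, 6,
   985644835608393307220842444327762205937226028368612472922, 31), (8, 2, 6352, 9), (9, 3, 587511899784, 7),
   (668, 5, 99, 35), (28415205, 6, 180831280062071525, 29), (12091233509, 6,
   251386544473008144440544705446393399906097361, 36), (59597864609582, 7,
   778891301142780155245110205805394538514852155308, 27), (23422020931594030, 7,
   393220371012332563578165392277185083228042017263747, 35), (511879179586949643806510, 7,
   208718409964296261555310533975423066, 31)]),
   ([4,5,2,3,0], [15, 41245, 34476, 36311874951376],
   [4,4,4,4,3,3,4,4,2,1,1,1,1,1,0,1,4,4,2,1,2,0,1,1,2,1,1,1,0,2,1,4,2,4,2,0,1,1,1,1,2,0,0,2,1,4,0,2,1,0,1,1,1,0,2,0,2,4,2,0,1,0,1,2,0,1,0,0,4,1,1,0,0,4,4,1,0,0,1,1,0,1,0,2,2,0,0,1,1,0,4,2,2,0,2,1,1,0,4,2,0,2,1,4,1,1,1,2,2,1,1,4,1,1,2,1,2,1,4,0],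
   [(1, 0, 54512170943578, 7), (1, 1, 4202, 25), (1, 2, 47897, 9), (1, 3, 93, 10), (1, 6, 14, 33), (1, 7, 1,
   34), (74, 3, 4261, 27), (75, 4, 4907, 27), (5715, 4, 860, 35), (4837, 6, 2139950, 28), (267493, 6,
   17419138, 29), (21075173, 6, 1136476998652194396437382256831380937991250581256, 36), (1262629532, 5,
   1115030728, 32), (1972152110, 7, 1347240540506515918954033892522580481838, 33), (10101036261, 6,
   331417237982824931967129, 33), (5172039034670, 7, 16598558358557480870998388047729338633957047641, 28),
   (393849399453486, 7, 172496719595147933425029447843658099, 29), (18689722885646126, 7,
   541914462457918446957246561770814277413657, 36), (10854579124757636910, 7,
   50897308582809242928133452372900857950458797726478508795095833, 33), (4440888093334494461601582, 7,
   4440956317547344594802478, 34)]),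
   ([5,4,2,1,0], [9, 80, 101, 15, 108, 66],
   [6,6,1,6,6,4,6,6,1,0,5,4,2,2,3,1,0,0,4,2,2,2,0,1,0,0,2,6,2,0,1,6,0,0,5,3,1,0,1,2,0,0,3,1,1,0,1,2,6,0,1,1,1,0,4,3,1,1,1,1,2,3,6,1,1,1,1,2,0,6,1,1,1,6,0,2,3,1,1,0,0,2,2,1,0,0,2,6,6,0,0,4,5,3,0,2,1,3,6,0,1,5,2,1,2,2,1,2,1,6,1,0,0,1,0,6,4,2,6,3],
   [(1, 0, 305881184122970, 8), (1, 1, 1, 10), (1, 3, 108, 25), (1, 4, 13, 8), (1, 6, 1348811127, 31), (1, 7,
   68, 36), (741, 6, 814, 30), (5715, 4, 5932, 32), (365797, 6, 285253037507826895334479662, 34), (188887708,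
   5, 1, 37), (1511101669, 6, 9596720259881546030, 30), (1972152110, 7, 360795721205045146654510, 31),
   (773992523566, 7, 22602862474378449417440101804230338866944600446, 30), (6153894466789, 6,
   106863827234476392828231531191520867416, 31), (393849399453486, 7, 1935279738337067011074584734742802222,
   34), (1631207087902861102, 7, 3497623557436763159878818495573914488523562498573017164378924693788567307,
   30), (6585965919897605941038, 7, 55830433660321337245348103590815450912533605009035, 31),
   (4440888093334494461601582, 7, 4440956317547344594802478, 36)]),
   ([6,4,2,1,0], [9, 80, 102, 6965, 532, 2925828948636953],
   [6,6,1,6,5,6,3,6,1,0,5,2,4,2,2,1,0,0,2,3,2,3,0,1,0,0,3,2,2,0,1,6,0,0,2,6,1,0,1,5,0,0,4,1,1,0,1,4,2,0,1,1,1,0,2,5,1,1,1,1,3,2,5,1,1,1,1,3,0,2,1,1,1,2,0,3,5,1,1,0,0,2,6,1,0,0,4,2,5,0,0,2,4,5,0,3,1,4,2,0,1,2,3,1,3,2,1,2,1,5,1,0,0,1,0,5,2,3,2,6],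
   [(1, 0, 10, 11), (1, 1, 1252889332329820435, 8), (1, 3, 12, 26), (1, 5, 10790489022, 31), (1, 7, 18046885,
   36), (5715, 4, 3213386441190409999912688342802968752038378329023273222542575155145564776773198565, 9),
   (5934, 7, 4649347452502895204298084695470215713460349980982787674272304277920704205240410, 28),
   (96729868078, 7, 522391083549577840003447, 38), (38290811042544111353374510, 7,
   184841710856151694251733131, 12)]),
   ([4,3,2,1,3,4,3,2,1,3,2,1,0], [126, 99, 79, 17406154, 174405840],
   [5,5,5,4,1,5,5,0,3,1,1,1,5,0,0,1,2,1,1,1,0,0,2,1,2,2,3,0,0,2,4,1,2,0,0,0,1,2,0,1,0,0,0,3,1,0,0,1,0,0,3,1,0,0,0,0,3,0,0,0,5,0,1,0,0,4,0,2,2,0,5,0,2,0,0,1,0,2,0,3,0,1,1,0,3,2,1,0,1,2,0,0,3,1,0,5,3,2,0,2,2,0,1,0,3,1,4,3,4,1,1,2,2,3,2,1,1,5,0,0],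
   [(1, 0, 8, 13), (1, 1, 329491, 9), (1, 2, 5899, 8), (1, 5, 92, 32), (1, 6,
   3213386441190409999912688342802968752038378329023273222542575155145564776773198565, 9), (12, 5, 11, 32),
   (28415205, 6, 11415287271517276011048470365671584723580876526707601437321104767351, 8), (1353815269, 6,
   18701297361164072, 39), (59597864609582, 7, 11232739551329537142419441116437616424, 32),
   (511879179586949643806510, 7, 633728750133876588454206959191982557543083965912878, 9)]),
   ([6,4,1,3,0], [8, 14, 716, 611, 690591208474],
   [5,5,5,5,5,5,5,5,0,2,3,2,2,1,1,0,5,2,2,3,1,5,0,0,2,2,5,1,2,0,0,2,2,1,1,3,0,0,0,3,1,2,5,5,0,0,0,2,1,2,4,0,0,0,1,3,2,1,0,0,5,2,3,1,4,0,0,5,2,1,5,2,0,1,1,3,3,5,0,5,2,2,3,1,2,5,2,1,2,2,1,1,4,2,1,5,0,4,1,2,0,1,3,0,5,2,0,2,0,3,0,2,0,4,2,3,2,5,1,5],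
   [(1, 0, 2096657120151740165445433719, 9), (1, 1, 4779393636505, 8), (1, 2, 99, 26), (1, 3, 11, 11), (1, 4,
   1818561882, 8), (1, 5, 265662593308675003, 34), (1, 6, 1, 9), (1, 7, 5250270092585, 31), (74, 3,
   15231083497401435802760448598514907976339910708553096459247690469, 31), (110, 7,
   2785786189723629613255686250730814266205469338454589737777348702247626083612301058, 28), (668, 5,
   8911969579, 28), (42798, 7, 2475895, 34), (329299, 4,
   374056129641515208022611485292960334612469724227201309951973318049145573, 9), (28415205, 6,
   181034365041697509, 31), (227321646, 7, 446155167152503, 40), (1353815269, 6,
   10631314627032441183625999972088421751999864149626358674295, 8), (10830522158, 7,
   2229619328935929472517329640266274747353019767, 26), (80810710245, 6, 8911969580, 39), (646485681966, 7,
   4764101853954203999873383582578637761494372886133506, 31), (59597864609582, 7,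
   447810042034971113812240721819562070489321870093949631322427692557841, 28), (23422020931594030, 7,
   92569903158712933999668114361852045252440085481863221663541, 34), (511879179586949643806510, 7,
   16830918717549588720004089431341767979, 31), (38290811042544111353374510, 7,
   4423097095045731821811334145752255070517570, 9)]),
   ([5,6,4,2,0], [9, 80, 870, 821, 66],
   [5,5,1,5,5,5,5,5,1,0,4,2,2,2,2,1,0,0,2,3,2,3,0,1,0,0,3,2,2,0,1,5,0,0,2,5,1,0,1,3,0,0,4,1,1,0,1,5,2,0,1,1,1,0,2,5,1,1,1,1,2,2,5,1,1,1,1,3,0,2,1,1,1,2,0,3,5,1,1,0,0,2,3,1,0,0,5,2,5,0,0,2,4,5,0,2,1,4,2,0,1,2,3,1,3,2,1,2,1,5,1,0,0,1,0,5,2,3,2,5],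
   [(1, 0, 1569516314, 9), (1, 1, 10790489022, 31), (1, 3, 784, 33), (1, 4, 821, 10), (1, 5,
   1252889332329820435, 8), (1, 6, 14, 10), (1, 7, 306325907488902489511901203, 30), (5715, 4,
   18701414845974179, 28), (5934, 7, 35191, 40), (406172, 5, 122359293165853575320, 29), (2926382, 7,
   328916147584598613025887180783401335, 33), (188887708, 5, 793775396627, 30), (12088813358, 7,
   1071108500227976922787, 38), (852644112174, 7, 9570635566498001171, 41), (6153894466789, 6,
   259930577438794758618494040, 39), (49231155734318, 7,
   13342424061131946171517188164517567726056773137818012762333939579255, 33), (1631207087902861102, 7,
   381647849034309593958311434222947, 40), (6585965919897605941038, 7,
   114610128730087855222909124462966029959940095953240626442368439660934515410571, 30),
   (38290811042544111353374510, 7, 1060090144861660711354819119227374975351, 31)]),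
   ([6,2,1,3,4,1,3], [76, 14, 5715, 139249232, 366794, 45834488330615, 304739],
   [7,7,2,5,3,7,7,7,4,3,4,0,0,1,1,2,2,0,0,6,0,7,2,0,0,0,2,1,0,0,3,2,0,0,1,6,2,0,1,2,0,0,2,2,2,0,3,0,1,0,2,0,1,0,0,2,0,1,0,2,7,0,2,0,2,7,0,5,0,1,4,0,5,1,0,2,2,4,1,2,0,0,2,1,0,2,0,1,2,0,1,0,2,2,0,5,3,2,1,0,3,1,2,1,2,0,3,0,0,2,3,0,0,2,0,2,0,7,1,5],
   [(1, 0, 7262746570995074071056631867535428622039581472832646985818, 31), (1, 1,
   1073578234987809809680315665107, 9), (1, 5, 10, 29), (1, 6, 10, 14), (1, 7, 78, 41), (110, 7,
   64641228818153657962091614409424810450910967208053856203816662035208, 31), (28415205, 6, 194455337, 39),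
   (145855717, 6, 229651777836652497367033789527109340517697950682325698, 31), (511879179586949643806510, 7,
   7981223068220123686242155289394061294891, 41)]),
   ([5,4,3,2,1,0], [15, 443984, 267493, 70068287724, 106479850522, 27221584006697655687289626],
   [6,6,1,5,1,1,6,6,6,1,4,5,1,2,0,1,1,1,3,6,2,0,1,1,1,1,2,2,0,1,1,3,1,6,2,0,1,1,1,2,1,0,0,1,1,1,0,2,6,0,1,1,1,0,3,0,1,1,1,0,2,0,2,1,0,1,0,0,1,4,1,0,0,6,1,2,0,0,1,1,0,2,0,1,1,0,0,6,2,0,1,3,2,0,1,2,1,0,6,1,0,4,2,1,2,2,1,2,1,2,2,2,1,1,1,1,1,1,6,0],
   [(1, 0, 9596156165627460224, 15), (1, 1, 4776, 18), (1, 6, 1, 42), (1, 7, 1, 43), (8, 2,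
   82739838807179346011363368272, 16), (92, 5, 1, 19), (4837, 6,
   249936084294835803236451527018096059936550427849770074, 44), (365797, 6,
   51684673458520994054486321059436938809979465475161034246074, 43), (1972152110, 7,
   2446909631558103709728493108448925486, 42), (773992523566, 7,
   113224920663462239201458311379343400059281430711314954236020315161876222499018, 44), (393849399453486, 7,
   982660688728381761957649432519845787738, 43), (4440888093334494461601582, 7,
   654497536882563948463723190062, 43)]),
   ([6,4,3,2,1,0], [14, 50768, 33436, 1094816995],
   [4,4,1,4,1,4,4,4,4,1,3,4,2,0,0,1,1,1,2,2,0,4,1,1,1,4,2,0,2,1,1,2,1,0,0,2,1,1,0,3,0,4,2,1,1,0,1,2,0,1,1,1,0,1,0,3,1,0,0,1,4,2,2,0,1,1,1,4,1,0,1,1,1,0,0,4,2,1,0,1,1,2,4,0,1,1,2,0,2,1,0,0,2,2,0,4,1,2,0,1,1,0,4,0,4,2,1,2,1,2,2,2,1,1,1,1,1,4,0,4],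
   [(1, 0, 5897666168681004332428256731916584686566449614303371, 20), (1, 1, 4542672746515, 16), (1, 3, 940,
   16), (1, 5, 14, 42), (1, 6, 1, 15), (1, 7, 1, 45), (8, 2, 648, 22), (11, 4, 1, 20), (110, 7, 119, 43),
   (604, 5, 28529492405761936979118176779192137854298731799095619196823414360097882, 43), (38702, 7,
   7994946910359091200391582151813546522855360371643240600970030176071318881370, 42), (28415205, 6,
   27875906357329477158532940394395722266122165837098777649923931826618271287213786202, 16), (227321646, 7,
   1196880910738831735, 46), (12091233509, 6, 25369059222981541, 47), (96729868078, 7,
   330998266687185940661622174664143085371296337846458570, 45), (59597864609582, 7,
   47748523013619394072673782782685025652697869810597, 43), (3155822608426798, 7,
   28191571769004255111287060798145245864213298477007556479374101124823130, 42), (23422020931594030, 7,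
   124921045474360800006211031387546936408489987031014909105410513285924748643, 42),
   (511879179586949643806510, 7, 750486218160838501240033674123079350684912860460, 45),
   (38290811042544111353374510, 7, 47332820636023545192225909905509242274906, 15)]),
   ([4,5,3,4,1,3,2,0], [15, 17406188, 26007760, 290488441977625, 5557537555441955690704,
   24297788882776929470133091],
   [6,6,2,3,2,1,6,6,6,4,6,4,2,6,0,5,3,4,1,3,1,0,2,1,1,1,1,1,0,1,1,1,1,1,6,0,1,1,2,1,3,0,0,2,1,2,0,1,3,0,2,1,2,0,1,0,1,2,1,0,1,0,1,2,0,1,0,0,1,2,2,0,0,6,2,2,0,0,2,2,0,1,0,2,1,0,0,6,1,0,6,1,1,0,1,1,1,0,1,1,0,4,1,2,5,1,2,1,1,1,1,1,1,2,2,2,1,1,6,0],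
   [(1, 0, 9679797596488910464, 17), (1, 1, 615140587550112809116, 15), (1, 6,
   12786194484109043249472490394972669603847477804275810411676733383377, 44), (1, 7,
   6555410713411274908894613043091644836470848679151431426769, 42), (8, 2, 18189877630299051169542236368, 16),
   (10, 3, 137169104, 18), (13, 6,
   1936910203463233596723560893848450772153090970078710340773060651460165790296061018, 43), (5349, 6,
   276183645580449179096074838645002532768152317745802169, 48), (1972152110, 7,
   1142796337234272767410141500624024720537428488260548455199102370394954768835528467153, 44), (773992523566,
   7, 170881356256765207192077600435601436626146149585, 43), (5172039034670, 7,
   642832152995210515552082521647167485341273133206430538840218, 48), (4440888093334494461601582, 7,
   654672742745414127383204700881, 42)]),
   ([5,6,3,4,2,1], [305397, 365926, 136036301175, 80046902627],
   [4,4,2,4,4,4,4,4,1,0,0,3,1,0,1,0,0,1,1,0,1,0,4,1,1,0,0,0,1,1,0,0,0,0,0,0,4,4,0,0,1,4,0,1,0,1,2,1,0,1,0,4,0,1,1,0,1,0,1,0,0,1,0,1,2,0,1,0,3,0,0,1,0,0,1,0,2,2,0,0,1,0,0,1,1,0,2,0,0,1,0,1,0,0,1,0,4,2,0,0,4,1,0,1,0,0,0,1,1,0,0,0,4,0,1,0,1,0,0,2],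
   [(1, 0, 56672, 42), (1, 1, 3851912, 18), (1, 3, 12563366608, 22), (1, 4, 18931620514285188, 23), (1, 5,
   3146210282172925779422698950086573982457022476523304, 20), (1, 6, 154684384601228934, 15), (1, 7, 993, 46),
   (522, 3, 96069329905659673950703011867757293916555833704928490098903, 44), (34387, 4,
   11465427998900427356499206692045160184313210976284626163216433293097, 43), (33436, 5,
   3005593157343753628944372839391277029975031499715134716596388336790680547, 43), (38702, 7,
   5469843734149400679640368949205384648308107829244232528889645555397328, 49), (2241180, 5,
   827964646359522162095019950574610690442544829746973665999, 48), (292026917688549, 6,
   637723893134026027690361288817400483461495, 16), (2336215341508398, 7,
   99033822340017821096199924330667819728, 46), (75418183382741067566, 7,
   164089098252779587106435664607712518107892258398612903711, 49)]),
   ([5,6,1,3,4,1,3,2], [304723, 21808757, 19716310, 21841525, 19749078],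
   [5,5,0,5,2,5,5,5,2,5,0,2,1,1,2,0,1,1,5,1,2,1,0,2,0,1,1,1,5,5,1,0,0,1,2,1,0,1,2,0,0,1,2,0,0,3,5,1,0,0,0,1,0,3,2,0,2,0,4,0,1,2,0,2,0,1,5,1,0,0,1,2,1,1,0,0,0,3,1,0,0,2,0,2,1,0,4,0,0,3,0,2,0,0,2,1,5,0,0,1,5,0,0,2,0,1,1,2,5,0,1,0,1,2,0,0,2,1,1,5],
   [(1, 0, 1501083279775932405479734560433707717446184931116836591239, 44), (1, 1, 16940887414639095507, 18),
   (1, 3, 9611571681435951532, 15), (1, 5, 10, 24), (1, 6, 1210778497218692742, 17), (1, 7,
   3112910370168422715457135561822518021585994212334607722865301256, 49), (9, 3, 22726160, 18), (83, 4,
   77543896233836087066, 23), (814, 7, 232950061995049672799348440661336676420852189181654104, 45), (4179, 4,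
   725227620219259187491276734323850516760892845144419, 48), (272174, 7,
   5573578119169173050875512226428893550400680862411545, 44), (143435566, 7,
   90653452285267205057941239220649629823913435862693, 48), (292026917688549, 6, 167554212774396624, 47),
   (2336215341508398, 7, 346767033057659986564513852147456098442992911312710256363392045237735465857983201,
   49), (1198861523675293486, 7, 24422820827497452437130436283213579, 45), (38290811042544111353374510, 7,
   6623780246639133554133292619528, 47)]),
   ([6,5,3,2,1,0], [117, 4179, 5712, 110, 17106515],
   [5,4,2,5,5,5,0,5,4,1,1,1,0,0,3,1,1,5,1,0,0,0,1,2,2,0,0,0,5,2,0,1,0,0,0,1,1,0,0,0,0,5,1,1,0,0,2,5,0,2,0,2,0,2,3,1,2,0,2,1,0,5,1,2,1,0,2,0,1,1,0,2,0,0,1,0,1,0,0,0,1,5,0,0,2,0,5,0,1,2,0,3,1,1,2,0,1,1,1,0,1,1,0,1,0,5,0,5,2,1,1,1,2,1,2,1,5,0,0,5],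
   [(1, 0, 3169021818488448, 23), (1, 3, 940, 19), (1, 4, 117, 42), (1, 5, 14, 16), (1, 7, 856, 49), (75, 4,
   15995909395700353582424337686362426255012180510637340762, 44), (814, 7, 887, 45), (38702, 7, 887, 50),
   (406172, 5, 19617544, 47), (25995054, 7, 5191861057911, 51), (106580514021, 6,
   24619607994072842914593271050810660163787575517311439288811244474, 52), (852644112174, 7,
   16286788255278705219499379744448901036, 51), (27925620558964526, 7,
   1573883660403832933912211214529476100666458019629207468, 45), (190055207144302382, 7,
   1676294024053110935215672715138303313156734307, 50), (58531997231463703291694, 7,
   173283994966522458273390282257112010936197915574241997916, 49), (38290811042544111353374510, 7,
   1382023753433511654551239031, 48)]),
   ([7,6,5,1,3,0], [8, 75, 1013, 887, 89],
   [5,5,5,4,5,5,2,2,0,1,1,1,2,5,2,0,1,1,5,1,2,2,0,0,4,1,2,1,2,0,0,1,2,1,2,1,0,0,0,1,2,1,2,5,0,0,0,5,1,2,2,0,0,0,5,1,5,2,0,0,2,3,1,5,2,0,0,2,1,1,2,3,0,2,1,1,1,2,0,1,1,5,1,2,4,1,3,1,1,3,1,3,5,1,3,2,0,3,1,2,0,3,1,0,2,5,0,5,0,1,0,1,0,5,4,1,5,2,2,2],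
   [(1, 0, 16084214466, 23), (1, 1, 42664031590169, 22), (1, 2, 69, 49), (1, 4, 843, 44), (1, 5, 15777234114,
   19), (13, 6, 117015945922, 20), (83, 4, 1010369143322, 42), (329299, 4, 23418385, 48), (406172, 5,
   36684352821484, 45), (3249381, 6, 415734097673564, 50), (21115548, 5,
   686272501413662773205758431783264809892696032290430, 16), (168924389, 6, 2828824353022658, 47),
   (106580514021, 6, 182057960085438008136187235, 44), (45736313066725, 6,
   55231964883965366627687840335023452330583181384796, 52), (27925620558964526, 7,
   715355897512350622701815196506999857858, 17), (190055207144302382, 7,
   1202407181929665815026842105768536840033, 49), (92712005951843772206, 7,
   58408150055152465262615967148084332602081, 24), (58531997231463703291694, 7,
   216205680102860897675681202902922675839424078920664329842209884, 48)]),
   ([3,4,5,3,2,1,3,4,2,1,3,2,1,0], [103, 601, 12153439824, 70115235171, 179040585323314240164043546],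
   [5,5,5,1,5,2,5,5,5,2,4,0,0,5,0,3,1,0,0,4,5,0,1,0,0,1,3,3,0,0,2,1,3,1,3,0,1,2,2,1,5,0,0,2,1,2,0,0,1,0,2,0,1,0,3,0,0,2,2,0,3,0,2,2,0,2,0,0,1,2,2,0,0,5,1,2,0,0,2,1,0,2,0,5,2,0,0,3,1,0,1,0,3,0,0,3,2,0,1,5,0,3,1,2,3,0,2,0,0,3,2,1,1,2,2,1,0,2,5,0],
   [(1, 0, 18707307786582106, 21), (1, 1, 596045910189639308723560018183449, 16), (1, 2, 4700098372290, 16),
   (1, 4, 10109682776, 18), (1, 6,
   114179712439621538441350923855444878402036391268756593254088424761828439192427760260906, 16), (1, 7,
   3245229302655683816524577487039209559837618925508355263258086791600561450, 18), (8, 2, 2201808, 19), (13,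
   6, 19516296, 47), (101, 6, 156130568, 47), (38117, 6,
   92899329605458607018279303230226755602592515424522293964977749121632085892579, 19), (1972152110, 7,
   685298589944703922105934678885434558905855977241716555687759051737471470055722, 16), (86797756206, 7,
   13273377939042510035314732290887053793583351376, 47), (341072841320238, 7,
   5902952906390855975870769385503174967697546496456648460154970, 19), (4440888093334494461601582, 7,
   40960552405483450015662064051420705538109226, 18)]),
   ([4,5,6,2,3,0], [329966, 275884, 18591945002388835, 18931620505671888],
   [4,4,4,4,2,3,1,4,1,0,0,0,2,0,0,0,4,4,1,0,0,0,0,0,1,4,1,0,1,1,0,4,1,0,0,0,0,1,0,2,1,4,1,1,0,0,0,1,0,1,2,1,0,4,0,0,1,0,0,0,0,1,2,0,4,0,1,1,4,0,0,1,2,0,0,0,0,1,0,0,4,0,0,0,1,4,1,0,0,1,0,0,1,4,1,0,0,1,0,1,3,0,0,0,0,0,0,1,1,0,0,4,0,0,1,0,1,1,0,4],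
   [(1, 0, 2222874, 18), (1, 1, 267637, 42), (1, 2, 135525149332724885698, 16), (1, 3, 99, 23), (1, 7, 1, 51),
   (74, 3, 8140367121182221087841206410579990337687607146115577870595115519580, 44), (75, 4,
   466886130568453322786989058464525589185882391544309773617754, 44), (604, 5,
   192357962070000232252439250464003035425346358095584859434827073988445455042, 43), (5715, 4,
   728490411800124021506776788848912911751763446805430335709925, 48), (38702, 7, 17419195, 46), (2139950, 7,
   199226263676783055827312158085175288372704993373747313680329487133, 49), (168601390, 7,
   156987192327484710806040996155875862393831649346088408840, 45), (1262629532, 5, 40899474964633, 47),
   (80808290094, 7, 3822259184783302775285458353475735558283417, 46), (646485681966, 7,
   195798427918836494109487940978353927569038926621972100, 49), (49231155734318, 7,
   11726344928612250593985120740131219257533813457, 45), (10854579124757636910, 7,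
   387542292658743226685236943121807030624701, 51), (38290811042544111353374510, 7,
   1150423546833997166608850139511, 44)]),
   ([7,4,5,2,3,0], [15, 41245, 34476, 36311874951376],
   [4,4,4,4,3,3,4,4,2,1,1,1,1,1,0,1,4,4,2,1,2,0,1,1,2,1,1,1,0,2,1,4,2,4,2,0,1,1,1,1,2,0,0,2,1,4,0,2,1,0,1,1,1,0,2,0,2,4,2,0,1,0,1,2,0,1,0,0,4,1,1,0,0,4,4,1,0,0,1,1,0,1,0,2,2,0,0,1,1,0,4,2,2,0,2,1,1,0,4,2,0,2,1,4,1,1,1,2,2,1,1,4,1,1,2,1,2,1,4,0],
   [(1, 0, 13646795504396977792, 16), (1, 1, 4202, 43), (1, 2, 4151065, 22), (1, 3,
   1331495584135400642459946867, 19), (1, 6, 14, 51), (1, 7, 1, 18), (74, 3,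
   51868574203477480088810530113465862622866184164649257032796, 42), (75, 4,
   351756561041662410221101847274274953215853559435648090, 42), (5715, 4, 42769, 52), (4837, 6,
   1264153799257872936436950617, 42), (267493, 6, 1488509084171228216038827984549706412839562119278317602403,
   44), (21075173, 6, 728220885081972114662104227489669020894473849095418953890477833525000, 43), (1262629532,
   5, 377794413670860675378902546465186880854446220218515446653065006, 18), (1972152110, 7, 7029831202606,
   44), (10101036261, 6, 24424930742503444524707993, 51), (5172039034670, 7,
   9972406986994667707854164165809187986910453020236895156458945610844, 16), (393849399453486, 7,
   791154327989028015525146488882713058603, 47), (18689722885646126, 7,
   367689982485764765327421362819456790162201, 19), (10854579124757636910, 7,
   20796133533156494483534145787628088089, 44), (4440888093334494461601582, 7,
   540661154950041527972980155964935828131098984105601, 52)]),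
   ([2,3,4,5,1,3,4,3,2,1,3,0], [15, 314137, 23398613, 1108166499, 5112412854480, 85771171668461458458],
   [6,6,6,1,4,1,6,6,4,5,3,5,1,2,0,2,1,1,2,1,3,0,1,3,5,1,2,3,0,4,2,1,1,1,2,0,1,1,2,1,2,0,0,2,1,6,0,1,1,0,2,1,1,0,3,0,2,2,3,0,1,0,2,2,0,1,0,0,1,2,2,0,0,6,1,2,0,0,4,1,0,2,0,2,1,0,0,2,1,0,1,3,2,0,6,2,2,0,1,1,0,2,1,4,2,1,2,2,3,2,3,1,1,2,2,1,3,1,6,0],
   [(1, 0, 4956056369402322158288, 17), (1, 1, 52727192503478649357541, 17), (1, 2, 47435, 18), (1, 6,
   400491839239943302035296774871681183236811752933522242545396828442708705, 48), (1, 7, 5797, 52), (267493,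
   6, 69, 53), (1972152110, 7, 60162022726563338491630408660143838533987301410013741436188662440161, 48),
   (42005678565166, 7, 264928006390824510489204057576228488, 53), (4440888093334494461601582, 7,
   796643034752852046825675364142, 52)]),
   ([7,4,5,0,2,1], [108, 66, 79, 101, 80, 9],
   [6,6,4,6,6,0,6,6,1,2,1,0,0,3,2,1,1,0,0,0,0,2,1,0,0,0,0,6,0,0,0,6,0,5,1,2,4,0,1,3,1,2,1,1,3,1,1,0,6,1,1,0,4,1,0,2,0,1,0,2,0,0,6,0,1,0,0,0,2,6,0,0,0,6,5,3,2,0,4,3,2,0,2,1,0,2,0,6,6,0,2,0,1,2,0,0,1,1,6,0,1,1,3,1,1,0,1,0,0,6,4,2,2,1,1,6,0,0,6,2],
   [(1, 0, 35661096724371664, 20), (1, 1, 31037256220086612740401646, 19), (1, 3, 4396, 43), (1, 4, 64864,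
   20), (1, 6, 102, 48), (1, 7, 68, 19), (741, 6, 144076660, 45), (5715, 4,
   6338338481749382456416906920433808791155320754582031417727817991371120, 18), (365797, 6,
   2103218414689151869272844782, 43), (188887708, 5, 64029550043349244372687290243043737802542, 53),
   (1511101669, 6, 2121289661771903197693403399883665547, 45), (1972152110, 7,
   124554272582687572761908429385287765478784455038512539897644549208, 17), (773992523566, 7,
   851056552707876146165, 48), (6153894466789, 6, 15847036066155428833571817099, 48), (393849399453486, 7,
   5977782792876805438042039146369650025860957586128, 18), (1631207087902861102, 7,
   131694622786658563074384251785227438668097075290, 48), (6585965919897605941038, 7,
   103001643212638418139997270167829819183527676245181039708, 17), (4440888093334494461601582, 7,
   3653160379869809990530238344824736170717323, 53)]),
   ([5,3,4,2,3,0,2,1,3,4,5,4,3,0,2,1,3,4,0,2,3,2,1,0], [871, 80, 17143069, 19502307, 12088858831],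
   [5,5,1,5,3,0,5,5,1,2,3,0,0,2,0,1,2,0,0,0,0,0,1,0,0,0,0,2,0,0,0,2,0,4,2,0,1,0,1,2,4,0,0,1,1,1,0,0,2,0,1,0,1,0,3,2,0,1,1,1,2,0,2,1,1,1,0,0,2,2,1,0,0,5,3,2,0,0,1,2,0,0,0,1,0,0,0,2,2,0,4,0,2,0,0,0,1,0,3,0,0,3,2,1,2,0,1,0,0,2,1,2,1,1,1,2,0,0,5,0],
   [(1, 0, 49069274022609, 19), (1, 1, 1519304857, 19), (1, 3, 95906312328, 19), (1, 6,
   249024936959858513073547980459577120612367138877523901, 52), (1, 7,
   1194204117425019805821495305312225269550, 53), (1972152110, 7, 3640615843511770045912571424866943966561922,
   52), (4440888093334494461601582, 7, 26482001213176183, 53)]),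
   ([6,7,3,4,2,1], [126, 4771, 5716, 119, 17406160],
   [5,5,5,5,4,5,5,0,2,1,1,1,2,0,0,1,1,1,1,1,0,0,5,1,2,5,1,0,0,2,4,1,2,0,0,0,1,2,0,1,0,0,0,1,1,0,0,1,0,0,4,1,0,0,0,0,2,0,0,0,5,0,1,0,0,5,0,3,1,0,2,0,3,0,0,1,0,2,0,5,0,1,1,0,2,3,1,0,1,2,0,0,1,1,0,5,4,1,0,2,3,0,1,0,5,1,4,2,2,1,1,1,4,1,2,1,1,5,0,0],
   [(1, 0, 928, 45), (1, 1, 9692989703841302145, 23), (1, 2, 1168544896702167377706, 23), (1, 3,
   9348342539713685708597, 20), (1, 5, 76, 46), (1, 6, 3146210282172925779422697889065272477118974629628840,
   20), (522, 3, 273616, 50), (604, 5,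
   408713956509753155397482320522112576233162593706456479565328274233463369397213046614604144, 45), (28415205,
   6, 1215421024838068850209179045379560543386231851084961598497354269392, 23), (145855717, 6,
   1596730294241598336288662385945082789, 46), (80810710245, 6,
   24361250192508289538813512882836223027971948096918132039271932105712468292694497776, 45), (59597864609582,
   7, 1010581279099378078008350833573, 45), (23422020931594030, 7, 7316001264542852531461057079651, 50),
   (511879179586949643806510, 7, 251075775646452630741379825084840744223029616, 23)]),
   ([4,5,6,3,2,1,3,4,5,4,3,2,1,3,2,1], [74, 6965, 22426268, 3249397, 21800806, 136036301175],
   [6,6,2,6,6,6,1,6,0,2,0,4,2,3,4,3,0,4,0,1,1,1,0,2,0,1,0,1,1,0,1,2,0,1,0,6,2,0,1,2,0,2,0,0,3,0,5,2,1,0,0,2,1,0,2,3,0,0,2,3,1,2,2,0,0,1,2,1,0,2,0,0,1,1,0,1,2,0,1,0,0,1,3,0,0,0,2,1,2,0,0,2,0,2,0,1,6,0,2,0,6,0,1,4,0,1,1,0,1,2,6,0,2,0,0,3,2,1,1,5],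
   [(1, 0, 304907, 47), (1, 1, 162639203, 24), (1, 3, 317619886477325999916683, 23), (1, 4, 478643527112331,
   22), (1, 5, 1201446279792186064, 21), (1, 7,
   14393967122202233147839710404508159465537047723756291605694669520, 23), (5934, 7, 1, 54), (292026917688549,
   6, 56633828595721538550730105317713171233143, 24), (2336215341508398, 7,
   3033715998101043024673919622104453775523351055314316094, 23), (9701657620150789934, 7,
   804355426198550137074199441521456584328, 54)]),
   ([6,7,5,3,0,2], [643, 943, 538, 894, 70921677813],
   [5,5,5,4,5,5,5,4,0,0,0,0,1,1,1,0,2,5,2,0,3,1,0,0,2,1,1,0,1,5,0,0,1,3,2,0,0,1,0,0,2,1,1,0,0,3,0,5,0,1,0,0,0,1,3,0,2,0,0,0,5,1,0,2,0,0,0,1,5,0,2,1,0,1,3,0,0,1,0,5,1,5,0,1,5,1,1,0,0,1,1,3,2,0,3,1,0,1,0,1,0,2,0,0,1,5,0,2,5,0,0,5,0,0,2,0,5,1,3,1],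
   [(1, 0, 4151504, 23), (1, 1, 921, 49), (1, 2, 411661021919434, 22), (1, 4, 86, 51), (1, 5,
   18931620507221293, 23), (1, 6, 8706323271836, 22), (75, 4, 2352328, 46), (4179, 4,
   2756170124342926874286819977322779923826065147714797339419678307, 49), (406172, 5,
   363054435522388094174892, 46), (28415205, 6,
   22045014585891563061620514990188420757900301117363243290142840456, 49), (1262629532, 5,
   70671548125661664521424385464051508470804727618698594148508, 23), (80810710245, 6, 8971573457, 54),
   (106580514021, 6, 1289571281264332956, 49), (656336327909, 6, 382098060667885868686204760175007093577937,
   51), (27925620558964526, 7, 12884189722031928616893611169330659285592073586665723521, 23),
   (1198861523675293486, 7, 3575012029069492963727708, 54), (10854579124757636910, 7,
   299071243490938172821930236637567185, 49), (58531997231463703291694, 7,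
   2907223012897286777424533585751782538376221410559955632343364700, 49)]),
   ([6,7,2,3,4,1,3,1], [126, 76, 5795, 304723, 119, 139249232, 307994],
   [7,7,3,7,2,7,7,0,6,5,3,1,1,0,0,2,5,1,1,2,0,0,3,1,1,1,2,0,0,1,5,2,1,0,0,0,2,1,0,2,0,0,0,2,3,0,0,1,0,0,3,1,0,0,0,0,1,0,0,0,7,0,2,0,0,7,0,4,1,0,6,0,4,0,0,2,0,4,0,3,0,1,2,0,1,3,1,0,2,1,0,0,2,2,0,7,5,2,0,1,4,0,3,0,3,1,5,1,1,2,2,1,1,2,1,2,1,7,0,0],
   [(1, 0, 35976, 50), (1, 1, 74786873388938712173209, 23), (1, 3, 620351169870690210851, 23), (1, 5,
   659554446763505520301716877409144567835764674456620380826528, 49), (1, 6, 1009, 24), (28415205, 6,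
   247408427, 54), (145855717, 6, 816325571896435072388477779939343732273947827437677978306, 49),
   (59597864609582, 7, 168821791868624330594895861, 50), (511879179586949643806510, 7,
   3502992366851655155104112, 54)]),
   ([6,5,4,3,2,1,0], [3851856, 2139950, 9404404671259527084, 14315928629834954009],
   [4,4,0,4,0,0,0,4,4,0,3,4,0,0,1,0,0,0,2,4,0,1,4,0,0,0,2,1,1,0,0,3,0,0,1,1,0,0,0,2,0,4,1,0,0,0,0,2,1,0,0,0,0,0,1,4,0,0,0,0,1,2,2,0,0,0,0,2,0,1,0,0,0,1,0,1,3,0,0,0,0,1,4,0,0,0,2,1,1,0,0,1,1,3,0,1,0,3,1,0,0,1,1,0,1,1,0,1,0,1,1,1,0,0,0,0,0,0,0,4],
   [(1, 0, 48264, 28), (1, 1, 303477, 33), (1, 3, 940, 25), (1, 7, 1, 55), (8, 2, 1088153982192332826192, 34),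
   (11, 4, 6965, 26), (92, 5, 814, 30), (522, 3, 5524729818760, 31), (38702, 7, 4983, 56), (2926382, 7,
   9014500808, 57), (96729868078, 7, 994063736527183513975, 58), (38290811042544111353374510, 7,
   21441790286112832199913753400968282, 27)]),
   ([7,5,4,3,2,1,0], [15, 443984, 267493, 70068287724, 106479850522, 27221584006697655687289626],
   [6,6,1,5,1,1,6,6,6,1,4,5,1,2,0,1,1,1,3,6,2,0,1,1,1,1,2,2,0,1,1,3,1,6,2,0,1,1,1,2,1,0,0,1,1,1,0,2,6,0,1,1,1,0,3,0,1,1,1,0,2,0,2,1,0,1,0,0,1,4,1,0,0,6,1,2,0,0,1,1,0,2,0,1,1,0,0,6,2,0,1,3,2,0,1,2,1,0,6,1,0,4,2,1,2,2,1,2,1,2,2,2,1,1,1,1,1,1,6,0],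
   [(1, 0, 1168540599592881796160, 26), (1, 1, 4776, 34), (1, 6, 15, 55), (1, 7, 1, 25), (8, 2,
   23886507632346063090159126562482950989437589629361243388090300435, 28), (92, 5, 68, 36), (4837, 6,
   5823731366825, 57), (365797, 6, 1, 59), (1972152110, 7,
   101739431516924014851027140336901512338816371721407169626, 27), (773992523566, 7,
   17735123593690854668609858035938304878482499646093239060925541892821357772811872278489060824013534451914,
   33), (393849399453486, 7, 982660688706825497163951585305035978842, 25), (4440888093334494461601582, 7,
   82916256902687783229257197343028668138586, 60)]),
   ([7,5,6,1,3,4,0], [8, 310078, 406447, 21165430503767395],
   [4,4,4,2,4,3,4,3,0,3,4,1,2,2,1,0,2,1,1,2,1,2,0,0,1,2,4,1,1,0,0,1,2,1,1,1,0,0,0,2,1,1,1,4,0,0,0,1,1,1,2,0,0,0,1,2,4,4,0,0,2,1,4,1,2,0,0,2,2,1,4,1,0,1,1,4,1,2,0,2,1,1,2,1,1,2,1,1,1,1,1,1,4,2,1,1,0,2,1,1,0,1,2,0,2,1,0,1,0,1,0,1,0,4,2,2,1,2,1,1],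
   [(1, 0, 19604930137669956242805998289, 33), (1, 1, 5830364539074, 34), (1, 2, 140449297, 55), (1, 4, 108,
   31), (1, 6, 16517800291959685029787343703942457023949238118523757427717997762, 28), (10, 3, 272883, 56),
   (668, 5, 309594, 57), (329299, 4, 419540995734733672044457950560743464837119004267505439020843, 27),
   (21115548, 5, 9932414532957095818493341706836532059669916961901798101138649577570978611353, 33), (21075173,
   6, 654139366244671823119744862748076651868796602521060831804332768404116614344582047197963, 33),
   (188887708, 5, 3090773968591032371832248041575933038345430121270018, 25), (1353815269, 6,
   1922838885492489645931942335974969654556419551329573246205667593769029330287339356313, 30), (12091233509,
   6, 1790783261407622737746580956661825082533337885301116983117124077268729588482, 30), (45736313066725, 6,
   46178183153809643941326852127590064445252769919412834799870788406800174154733691, 58),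
   (92712005951843772206, 7, 916922123744570521410501530549388237730221834393, 29)]),
   ([7,6,4,3,2,1,0], [126, 50768, 33436, 119, 45719442961689],
   [5,5,1,4,1,5,5,0,5,1,4,5,2,0,0,1,1,1,2,2,0,0,1,1,1,5,2,0,0,1,1,2,1,0,0,0,1,1,0,4,0,0,0,1,1,0,0,2,0,0,1,1,0,0,0,0,1,0,0,0,5,0,2,0,0,1,0,3,1,0,1,0,1,0,0,5,0,1,0,1,0,2,3,0,1,1,2,0,2,1,0,0,2,2,0,5,1,2,0,1,1,0,5,0,5,2,1,2,1,2,2,2,1,1,1,1,1,5,0,0],
   [(1, 0, 928, 38), (1, 1, 4457628630594625, 30), (1, 5, 126, 55), (1, 6, 15, 26), (8, 2, 42002152152360,
   31), (11, 4, 18046885, 36), (604, 5, 19414947, 57), (28415205, 6,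
   2989492030208993575281387427929845687195530240964564310385460314, 33), (12091233509, 6, 1, 61),
   (59597864609582, 7, 24848576957709454560576524211110140508313549764920410, 60), (3155822608426798, 7,
   758654962939861128173161254039081601565565466714, 58), (23422020931594030, 7,
   19006147392684440605566219287489618955261364099086843235, 58), (511879179586949643806510, 7,
   65079528124511150553113480496218, 29)]),
   ([4,5,6,7,1,3,2], [2504055, 2727852, 5191721135486, 5715352611609],
   [4,4,4,0,4,4,1,1,0,2,4,1,4,4,1,0,0,1,0,3,1,0,4,1,0,1,0,2,0,1,4,0,0,1,0,0,4,1,2,0,0,0,0,0,4,1,0,1,0,0,0,1,2,0,1,0,1,0,1,0,1,0,4,1,0,1,1,0,1,2,1,0,1,0,1,2,0,0,1,3,0,1,0,0,1,0,0,0,3,0,0,0,2,0,0,0,4,0,0,0,0,0,0,0,0,1,0,0,1,0,4,0,1,0,0,0,1,1,1,0],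
   [(1, 0, 17231733, 55), (1, 1, 25123024, 33), (1, 2, 108736540875549012063679288970, 33), (1, 4, 268112,
   40), (1, 5, 64809, 28), (10, 3,
   1921872822480357904867079350504209058214202350786071634285290455791233979728717031048, 28), (12, 5, 76,
   38), (13, 6, 4942221322892381851118, 26), (522, 3, 1113943968, 56), (4252, 5, 641005917712, 57), (34387, 4,
   165624008, 57), (275100, 5, 6105123320241698030473322818770366387508299765550, 55), (188887708, 5,
   2644356316934810, 59), (292026917688549, 6, 44491072248348262853658069004718173604083303975446448504949515,
   33), (9701657620150789934, 7, 1111738845312270134607921165008, 62)]),
   ([2,3,4,5,6,0,2,3,4,5,2,1,3,4,2,3,1], [12, 353668235619097, 331255466453786, 686176431822667789614,
   1277579907810094198366548835, 75235251029332301029],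
   [6,5,5,6,6,2,1,6,6,6,3,0,0,2,3,3,2,0,0,6,0,6,1,0,0,6,6,6,0,0,4,4,1,4,2,6,1,1,2,1,1,1,2,1,1,1,2,0,1,1,1,0,1,3,0,1,0,1,0,6,1,0,1,0,2,4,0,1,1,1,2,0,4,1,1,2,2,2,3,1,1,0,2,2,0,1,0,2,1,0,1,0,1,1,0,2,1,1,1,1,2,1,1,2,1,0,2,0,0,1,2,1,1,2,1,1,0,1,1,6],
   [(1, 0, 1168396441632058962785271661298, 34), (1, 3, 10114051452620159115, 33), (1, 4, 180831004067109529,
   29), (1, 7,
   124985207627353309692295711008763694042303836843231019415032830604494901849047322448267817773848, 33), (8,
   2, 46435, 39), (9, 3, 70940715801, 30), (92, 5, 8836457189, 32), (110, 7, 639045398386, 62), (604, 5,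
   5463883232964961741593, 31), (668, 5, 293472333345880, 26), (741, 6,
   8080153602271751565108981434727884137320644732019789708814420471592, 31), (5934, 7,
   223848730436660552476319303747225605694189305415453011685999128873381874192, 30), (17606446, 7,
   7597521839897, 61), (38290811042544111353374510, 7, 9028522264276102761418633845355809499928, 29)]),
   ([7,5,6,4,0,2,1], [66, 9, 6575, 6974, 80],
   [5,5,4,5,5,5,5,5,0,1,0,3,2,2,2,0,0,1,0,2,3,2,0,0,0,1,0,3,2,0,0,5,0,1,0,2,4,0,0,2,0,1,0,0,2,0,0,5,3,0,0,4,3,0,3,2,0,0,3,2,2,2,5,0,0,2,2,2,1,3,0,0,2,2,1,5,3,0,2,1,1,3,2,0,1,1,2,2,5,1,1,3,0,2,1,2,0,0,3,1,0,0,2,0,0,2,0,0,0,5,4,1,1,0,0,5,3,2,3,2],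
   [(1, 0, 413513720955823271553874478065682118272763790632688508551239538980783192, 28), (1, 1,
   2450607259911219916095209624, 30), (1, 3, 2352216, 55), (1, 4, 155294364, 31), (1, 5, 3373989, 36), (1, 6,
   102, 36), (1, 7, 79509965758, 31), (5715, 4, 622874244331037714162232286445562319731124787133946571855656,
   27), (406172, 5, 40683169926992264472548727631202435316407979875949765022263908669730731176871000, 33),
   (188887708, 5, 938473760695136695129567674133148137054388753614783085140653516679283539244, 60),
   (12091233509, 6, 429324828248043009752010785122050687640086483552900849403555, 58), (6153894466789, 6,
   3800815019364152348120337394892151362914164535558670094571143, 29), (1631207087902861102, 7,
   291445807207773628994391443056318664, 63), (6585965919897605941038, 7,
   4013179124084475799312218250367937613764844, 35)]),
   ([7,5,6,0,2,1,3], [943, 5712, 4179, 894, 4484370459637],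
   [5,4,1,5,5,5,5,4,4,1,2,2,0,0,0,1,1,5,2,0,3,0,1,1,1,0,0,2,0,1,0,2,0,3,2,0,1,0,1,0,1,0,0,1,0,1,0,5,2,0,0,1,1,0,3,0,1,1,1,0,5,0,2,1,0,1,0,0,1,2,1,0,0,0,1,2,0,0,0,1,0,5,0,0,1,0,0,0,2,0,0,3,2,0,1,0,1,0,2,0,0,2,0,1,0,5,0,5,1,2,2,2,1,1,1,1,5,0,3,0],
   [(1, 0, 40144, 40), (1, 3, 2426705, 31), (1, 4, 247419016, 55), (1, 5, 64856, 30), (1, 6,
   35378281170270665057514613868412512908569740007187170, 28), (75, 4, 17317793, 56), (406172, 5,
   16915328738954981390423347816622605608433310446954882640, 33), (28415205, 6, 10088475411, 62),
   (106580514021, 6, 1248898072173590058964756108775943566286973032700336625873, 58), (27925620558964526, 7,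
   4023836832704356664058538083239177292308215917061698, 29), (190055207144302382, 7,
   30220106550278533840088010648810667068014745, 41), (58531997231463703291694, 7,
   15353939712788094870726849773889984298, 63)]),
   ([7,6,1,3,4,1,3,2,0], [126, 76, 2934352, 2139747, 119],
   [5,5,2,5,2,5,5,0,5,5,3,1,1,0,0,2,2,1,1,3,0,0,2,1,1,1,5,0,0,1,2,3,1,0,0,0,2,1,0,3,0,0,0,2,2,0,0,1,0,0,2,1,0,0,0,0,1,0,0,0,5,0,2,0,0,2,0,4,1,0,2,0,2,0,0,5,0,2,0,2,0,1,4,0,1,2,1,0,3,1,0,0,3,3,0,5,2,3,0,1,2,0,3,0,5,1,2,1,1,3,2,1,1,2,1,2,1,5,0,0],
   [(1, 0, 4784, 41), (1, 1, 267683, 38), (1, 3, 40876, 30), (1, 5, 1012, 56), (1, 6,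
   123205604472178361218110657836756562774824632998905952346, 31), (8, 2, 21596349400269520, 31), (9, 3,
   557203578824328, 30), (668, 5, 3334881, 58), (28415205, 6, 158812947, 62), (12091233509, 6,
   106739382628090311676137192708361373596045920803776107970645880428753, 30), (59597864609582, 7,
   4319368310941695075635247994365596727648977, 58), (23422020931594030, 7, 11, 64),
   (511879179586949643806510, 7, 750923355556512903198867699802, 41)]),
   ([7,4,5,6,2,3,0], [2639742, 2207079, 4622168207276, 9693067656261004058],
   [4,4,4,4,4,3,4,2,1,0,0,0,4,0,0,0,4,4,1,2,0,0,0,0,1,4,1,0,1,1,1,4,1,0,0,0,0,1,0,4,4,0,0,1,0,0,0,1,0,1,3,1,0,1,0,0,1,0,0,0,2,1,2,0,0,0,0,1,4,0,1,1,1,0,0,0,0,1,0,4,1,1,0,0,1,4,1,0,0,1,0,0,2,4,0,0,0,1,0,1,1,0,0,0,0,0,0,1,1,0,0,4,0,0,1,0,1,1,0,0],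
   [(1, 0, 142338842, 33), (1, 1, 17133429, 55), (1, 2, 882133691162, 34), (1, 3,
   19604858079289759328757203099, 30), (1, 4, 86, 40), (1, 6, 14, 34), (12, 5, 4936581103769, 30), (74, 3,
   17461109, 56), (75, 4, 17420185, 56), (604, 5, 3400904, 57), (5715, 4, 1108466960, 58), (45724, 5,
   3320464010057058181878505917999950557297201631632651949622913, 55), (38117, 6, 9997016410, 57),
   (1262629532, 5, 4129718930408931003521325150542628322356189031182469, 33), (80810710245, 6, 42005958937945,
   62), (646485681966, 7, 17927435424814565855344513153629117463864863843626260100, 30), (49231155734318, 7,
   172218456466666563, 61), (10854579124757636910, 7, 540187193060844561271241411117760172339333, 58)]),
   ([7,1,3,4,5,2,3,4,0,2,3,0,2], [4261, 41319, 19502307, 148733459458795727, 1248135381],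
   [5,5,1,3,2,1,5,5,0,2,2,1,0,0,1,4,2,1,1,0,0,0,3,1,1,0,0,2,0,1,0,2,0,3,0,1,2,0,0,0,0,1,0,2,0,0,0,0,2,0,0,0,5,0,2,2,0,0,1,3,0,1,2,0,0,0,1,0,2,2,0,0,0,5,2,0,1,0,1,0,1,0,0,0,0,0,0,4,2,0,3,1,0,1,1,0,0,0,2,0,0,2,5,1,0,1,0,0,0,2,1,2,1,0,0,2,1,0,5,1],
   [(1, 0, 67732997368476869621438154371749570553165972333452943166468187011445, 31), (1, 1, 47258, 34), (1,
   6, 22129432, 58), (1, 7, 5475, 35), (2200805, 6, 8865008547, 60), (1972152110, 7,
   27981091304582569059539912968388562906944300615772688573140394243707949328, 30), (3155822608426798, 7,
   929314046045747525729727085908, 37), (4440888093334494461601582, 7, 313793924092483897238216, 64)]),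
   ([2,1,3,4,5,6,0,2,3,4,5,4,3,2,1,3,4,0,2,1,3], [4812, 1171665539, 11166706458, 1500954535149394128,
   636245109530],
   [5,5,5,4,5,3,1,5,1,0,1,0,0,1,5,3,1,0,0,4,0,2,3,0,0,0,2,1,0,0,1,0,2,0,3,5,0,3,1,1,2,0,2,1,1,1,1,0,1,2,1,0,1,3,0,1,0,1,0,1,2,0,1,0,1,1,0,2,0,1,2,0,5,2,0,1,1,2,1,1,0,0,1,2,0,1,0,1,0,0,1,0,2,0,0,2,1,2,0,2,1,2,1,1,2,0,1,0,0,2,1,0,0,1,2,1,0,2,1,5],
   [(1, 0, 201079912218872534, 35), (1, 1, 308193190355976048463543724345209621743839740388522312, 36), (1, 2,
   30815320, 35), (1, 4, 13104574360267633932646052039253130664295176529786665312, 36), (1, 7, 17419193, 60),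
   (14, 7, 188902170, 60), (5934, 7, 18692004623002979, 60), (1166845742, 7, 1, 65),
   (38290811042544111353374510, 7, 35955143386920, 37)]),
   ([3,4,5,6,7,3,4,5,6,2,1,3,4,5,3,4,2,1,3,2,1], [95, 6965, 2926438, 193768949],
   [4,4,2,4,4,4,1,3,3,0,0,0,2,3,0,0,3,2,2,0,1,0,3,2,2,1,1,1,0,2,1,0,1,1,1,0,0,1,1,0,1,0,0,2,0,1,0,2,1,0,3,2,1,0,2,0,2,1,2,0,1,0,0,2,0,1,0,0,3,2,1,0,0,1,2,1,0,0,1,1,0,1,0,1,1,0,0,0,2,0,1,2,2,0,2,1,4,0,0,1,0,2,0,2,1,1,1,1,1,0,0,2,4,2,3,0,2,1,1,0],
   [(1, 0, 647042651912, 62), (1, 1, 1818974417, 41), (1, 3, 86725982524097799077, 40), (1, 4,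
   330902088151757, 40), (1, 5, 457957, 39), (292026917688549, 6, 9716415544067866793160801395480252766651,
   41), (75418183382741067566, 7, 1, 66)]),
   ([7,6,5,4,3,2,1,0], [33211984, 17119607, 7999934059875758781721, 4815055191684877867509,
   80783221002762061083043053484],
   [5,5,0,5,0,0,0,0,5,0,2,5,0,0,0,0,0,0,4,5,0,0,5,0,0,0,3,5,0,0,0,2,0,0,3,1,0,0,0,2,0,0,1,0,0,0,0,4,2,0,0,0,0,0,3,1,0,0,0,0,3,1,2,0,0,0,0,1,0,2,0,0,0,1,0,3,1,0,0,0,0,3,1,0,0,0,1,1,2,0,0,1,2,1,0,1,0,1,1,0,0,1,1,0,1,1,0,1,0,1,1,1,0,0,0,0,0,0,0,0],
   [(1, 0, 17231733, 46), (1, 1, 19422702, 51), (1, 3, 8108, 42), (8, 2, 2463160, 44), (11, 4, 481781, 43),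
   (92, 5, 445934, 45), (522, 3, 2201016, 48), (741, 6, 2214844, 49)]),
   ([7,6,4,5,3,4,1,3,2,0], [1113996087, 1665095888, 1376230969713988634, 1189840658371504958,
   1277579845437475632226344876, 1477711607821772838839048400],
   [6,6,1,6,1,1,6,1,6,3,6,4,0,4,6,6,2,6,0,0,0,0,1,0,0,0,2,0,6,0,1,0,4,0,2,0,0,1,1,5,3,0,0,1,1,1,0,0,3,0,1,0,1,0,0,0,1,1,0,0,3,0,1,1,1,1,0,0,1,1,1,0,0,0,2,1,0,0,0,2,0,1,0,0,3,0,0,0,5,0,0,0,2,0,0,0,1,0,0,0,0,0,0,0,2,0,1,0,0,0,0,0,0,1,1,1,0,1,1,0],
   [(1, 0, 46085933872217201447265760803817569937852792573408345, 49), (1, 1, 1858031772, 46), (1, 3,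
   2327105140701336, 42), (1, 6, 1598274310513630406184061299371583700480934725534476302061705208529, 44), (8,
   2, 317648, 44), (10, 3, 8778837712, 51), (14, 7,
   6555410713411274908894613043091644836470848679151431426769, 42), (66, 3, 2152656, 49), (75, 4, 21163892,
   51), (814, 7, 9, 50)]),
   ([7,6,2,3,4,5,0,2,3,4,3,1], [86344985369, 81122215607, 5933579660032127878764, 5557536711017062123198,
   1581628080025981341347958655516450774779954758102299929],
   [5,5,5,1,5,0,5,0,5,5,5,2,4,3,5,5,0,5,1,2,0,1,0,1,0,5,1,3,0,0,1,0,0,0,1,1,0,0,1,0,0,0,1,1,0,0,1,0,2,0,1,0,4,0,0,1,0,1,0,1,0,0,1,1,1,0,0,0,0,1,2,1,0,0,0,4,1,1,0,0,0,2,1,1,0,0,1,1,0,0,0,1,0,0,0,1,0,0,0,0,0,1,0,1,1,0,1,0,0,1,1,0,0,1,0,1,0,0,0,0],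
   [(1, 0, 10113230394062983540581841233, 42), (1, 1, 143461145, 51), (1, 2, 80125634315, 46), (1, 4,
   26814593334738248268717732073841218673336406450463796119674698190931217304, 44), (1, 6,
   4086370975228841988015058681856772168483000181814915123274882752961189356143582334151448, 43), (8, 2,
   66503438663592334029255466458100539568094164976265960000904083998134804841132229774224, 45), (9, 3,
   156347161, 51), (10, 3, 137248241, 46), (14, 7, 964867084611061810573571588076011301535909724967378925936,
   42), (66, 3, 30927170, 43), (75, 4, 342809, 44), (604, 5, 1249032392, 45)]),
   ([4,5,6,7,3,4,5,2,3,4,1,3,2,0], [4562921865132, 6826367829639, 18591682432352172, 18450495892539015,
   29970254919154818153928912, 311909157584628929147548],
   [6,6,3,4,6,0,0,6,6,5,6,6,3,0,1,6,4,0,2,2,6,1,3,0,0,0,6,2,0,1,0,0,0,0,0,0,1,1,0,0,0,2,0,1,1,1,1,0,0,5,1,0,1,1,0,3,0,1,0,1,0,0,0,0,1,0,0,0,1,0,0,0,0,0,2,0,1,0,0,4,1,0,1,0,0,1,0,1,0,0,1,0,0,0,0,0,1,0,0,0,1,0,0,1,0,0,1,0,0,0,0,0,1,0,1,1,0,0,0,0],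
   [(1, 0, 322951966019030647878082331407331894182752586266067605196176921719841489, 49), (1, 1,
   371639424688712971345166056736454037957987277856453722, 44), (1, 4, 8778836688, 51), (1, 7,
   26729532879403359043031439406420705277705004784919249, 48), (8, 2, 137285328, 51), (10, 3,
   9332633664562059087912937770303926651175286119535786677381542508379452674052908782658568632473, 49), (11,
   4, 1409639334431311160460346347373167864611776016837850069963279445821859181657, 45), (66, 3, 1126878928,
   50), (101, 6, 305360, 52), (668, 5, 2669463722552207585213347, 42)]),
   ([3,2,1,3,4,5,6,7,4,5,4,3,2,1,3,4,3,2,1,0], [1857158499, 20940227651671102, 18367977987107829,
   4819667792870909978414, 1453748970044309411405116259, 1727418819539121746794553575],
   [6,6,1,5,4,0,6,0,2,3,3,3,3,6,0,1,5,0,0,6,0,0,2,0,1,0,0,0,0,4,0,1,3,0,0,0,1,1,0,2,1,0,0,1,1,1,0,0,2,1,1,0,1,1,0,0,1,1,0,0,0,0,0,1,1,0,0,0,1,1,2,1,0,0,1,2,0,0,0,1,1,0,0,1,1,1,0,0,0,0,1,0,2,0,0,0,1,1,0,0,1,1,0,1,2,0,1,0,0,0,0,1,1,1,1,1,0,0,0,0],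
   [(1, 0, 4467191920268936, 46), (1, 1,
   28413949722722070396973071640885058606499040029916240819885963537914650, 43), (1, 6,
   137264351828151718508141412209297266312, 46), (13, 6, 4847728069344286519449, 43), (92, 5,
   1346430851610394005906778606, 43)]),
   ([3,4,5,6,7,2,3,4,5,6,1,3,4,5,2,1,3,4,1,3,2,0], [108, 101, 103286472327672322256, 76553077922837921123,
   1499853298593051267, 95990611109955281125, 5323658502262515774889253624016],
   [7,7,7,5,7,0,7,3,7,3,4,0,0,1,2,5,2,0,0,0,0,1,6,0,0,0,0,6,0,0,0,2,0,3,4,7,4,0,2,1,3,3,2,4,1,2,2,0,3,3,1,0,2,2,0,2,0,2,0,2,0,0,2,0,2,0,0,0,2,2,0,0,0,3,2,1,2,0,2,1,2,0,1,2,0,1,0,2,3,0,2,0,2,2,0,0,2,2,2,0,2,2,1,2,1,0,1,0,0,2,2,3,2,2,2,2,0,0,2,2],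
   [(1, 0, 92930794496567876967101783639489673581090938967772673962280436554554307125969, 45), (1, 1,
   5142657223943346949164683221269582825914511719432902596016282, 48), (1, 2,
   1255531548814293662325495275555479823280021102525177575577, 48), (1, 4,
   257924909522148763081781611222475847294756401495428998243576840003379170804876497, 43), (1, 6,
   9445782987878452759102569755057816492871031047377, 48), (8, 2, 11979938000, 52), (5934, 7, 3850960, 53)]),
   ([5,3,4,2,3,0,2,1,3,4,5,6,7,5,4,3,2,1,3,4,5,6,0,2,3,4,3,2,1,0], [1094816995, 1498518554,
   75236448561437801827, 106601095265136757749, 1742188163396153497837738814],
   [5,5,4,5,5,5,5,4,5,0,0,5,3,4,3,0,4,0,0,0,5,2,3,0,0,2,2,0,2,0,1,0,1,3,3,0,0,1,1,0,1,2,2,0,0,1,1,0,0,1,1,0,0,1,0,0,0,1,0,0,2,0,0,0,1,2,0,2,0,0,1,0,2,2,0,2,0,1,2,1,0,0,2,1,2,1,0,2,0,4,1,0,0,0,2,2,0,0,0,2,0,0,2,0,1,0,1,2,1,0,0,0,0,0,1,0,0,2,2,2],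
   [(1, 0, 805828434140641506366684689593107085326014488554309600463, 45), (1, 1, 29625495254175095041045785,
   51), (1, 3, 1448636640326013060, 47), (1, 4, 497033332985800330219997392056748, 51), (1, 5,
   1011509734044982535616949956742, 45), (1, 6, 41374783335898242582702771833017885606509440819910858, 45),
   (8, 2, 6623779631635174761068309630288, 47), (11, 4, 35556667749840299450246780582265979715615541, 45),
   (101, 6, 3056784485343086949490228379769366725334886, 51)]),
   ([2,3,4,5,6,7,2,3,4,5,6,1,3,4,5,2,3,4,0,2,3,1], [87, 96060005034916309785, 85785809002668326243,
   1340188379854849619, 6590555223569691494014, 4825274624869709806947,
   1870653030955687844054093637536794222],
   [7,7,7,7,7,1,3,1,0,2,0,7,7,4,0,2,0,2,0,7,5,0,7,2,0,3,0,3,0,4,5,1,0,3,2,0,1,6,6,1,1,0,0,0,1,1,0,1,1,0,0,1,1,0,1,0,0,1,1,0,1,0,2,4,0,1,0,0,1,2,3,0,0,1,1,2,0,0,1,1,0,2,0,0,1,0,0,2,1,0,1,2,1,0,1,2,1,0,1,1,0,0,1,1,0,1,1,0,1,2,2,1,1,0,0,1,1,1,1,0],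
   [(1, 0, 3703186906768384055928456, 51), (1, 1, 71535280281, 49), (1, 2,
   1714476098575030494281953740764525645689402457, 46), (1, 3, 4130558774527610, 51), (1, 4,
   482485851961590715266210970551376292001431136342201219920298892024016, 49), (11, 4, 12442129617, 50), (12,
   5, 23532598562834059, 47), (92, 5, 563365889658, 49), (522, 3, 1348814472, 54)]),
   ([3,4,5,6,2,3,4,5,1,3,4,2,3,0,2,1,3,4,5,6,7,5,3,1], [307884, 305357, 1501029976934516387,
   82208287871816008832637509844],
   [4,4,4,1,4,4,2,4,0,2,3,0,0,1,4,3,0,0,0,1,0,1,1,0,0,0,0,2,0,0,3,0,0,1,0,2,1,0,3,1,0,1,0,0,1,3,2,0,1,0,1,0,1,3,0,1,0,3,0,1,0,0,2,0,2,1,0,0,0,2,0,0,1,2,0,1,2,0,3,1,0,0,1,0,0,1,0,2,1,0,1,0,0,1,0,2,2,0,1,0,2,0,1,2,1,0,1,0,0,2,2,0,1,0,0,1,0,0,2,2],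
   [(1, 0, 79243894579496499251942651924661579213075399990362, 48), (1, 1,
   10511882107682973414240128989309511547453430276510159913680, 49), (1, 2,
   5386886306784241096275718262459452751912751155080496713373200, 48), (1, 4,
   3722346559316039718133821037285594332690008069281552, 49), (1, 5,
   353400713463257173166956869737231194947195558472641755990837765551276752, 48), (1, 7,
   792884607729832809370101660287787659057641480912, 48), (14, 7,
   908692104039923453519125127608355668697925452496, 49)]),
   ([7,5,6,2,3,4,5,1,3,4,2,3,0,2,1,3,4,5,6,7,6,5,4,3,0,2,1,3,4,5,6,0,2,3,4,5,3,2,1,3,4,3,2,0], [126,
   4538875392695, 1358193391590008961997832558331381606, 79510475802,
   359620500360263738564837639547678159095406, 5170496336135948900656728257838,
   98888816919734663750068087226081845676],
   [7,5,2,4,7,7,7,0,1,7,1,6,7,0,0,7,3,1,3,6,0,0,1,1,2,4,7,0,0,1,3,1,1,0,0,0,1,4,0,7,0,0,0,1,3,0,0,1,0,0,1,2,0,0,0,0,1,0,0,0,2,0,1,0,0,2,0,2,1,0,2,0,2,0,0,2,0,1,0,5,0,5,2,0,1,1,1,0,2,1,0,0,1,1,0,2,1,1,0,2,1,0,4,0,4,2,3,1,2,2,2,1,2,1,1,1,1,2,0,0],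
   [(1, 0, 22806189797504008743945419408496848, 50), (1, 4, 1662544013762172587342048673363359842605582987,
   52), (1, 5, 1450168150148609938795337635496079550, 50), (1, 6,
   26088645256100241189345079053937049970036870, 52), (9, 3, 59601523600469879267842785732930, 50), (12, 5,
   24487959831673553850267863427819255552569260, 50), (66, 3,
   1809917582812582246527055637758128865811953302429494041, 52), (668, 5,
   2040235730107750120761161547788764798, 52), (45724, 5, 54771922371400696363377, 50)]),
   ([5,4,3,0,2,1,3,4,5,6,7,6,5,4,2,3,0,2,1,3,4,5,6,2,3,4,5,4,3,0,2,1,3,4,3,0,2,1,3,2], [4812, 1094895294,
   1348798895, 33208301934752611, 79549998910, 1196961565281872666],
   [6,4,4,1,3,3,5,3,1,0,3,0,0,1,1,1,1,0,0,5,0,1,1,0,0,0,1,1,0,0,2,0,2,0,1,3,0,2,1,2,1,0,1,1,2,2,1,0,1,1,1,0,1,2,0,1,0,1,0,2,2,0,1,0,1,2,0,2,0,1,1,0,2,1,0,1,1,2,2,2,0,0,1,1,0,2,0,1,0,0,1,0,1,0,0,1,1,1,0,2,2,1,2,1,1,0,1,0,0,1,3,0,0,1,1,1,0,2,1,1],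
   [(1, 0, 1632508910326208714, 53)]),
   ([3,4,5,6,7,1,3,4,5,6,0,2,3,4,5,1,3,4,2,3,0,2,1,3,4,5,6,7,6,4,5,3,4,2,3,0,2,1,3,4,5,6,2,3,0,2,1,3,4,5,0,2,1,3,4,2,1,3,0,2],
   [4774, 444335, 71611930832, 1248957694, 22380036890589313489656016],
   [5,5,4,5,2,5,2,3,0,1,1,1,1,0,0,1,0,0,0,1,0,1,4,0,0,1,1,1,0,0,1,3,0,0,0,1,2,2,0,1,0,1,0,0,1,0,1,3,0,0,2,2,2,0,0,1,0,0,0,1,1,0,1,0,1,1,0,1,2,0,0,0,1,0,0,1,1,1,0,2,0,0,1,0,0,1,1,1,3,0,0,0,0,1,0,1,2,1,0,0,1,0,1,0,1,0,1,0,0,1,1,0,2,0,0,1,0,1,0,1],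
   [(1, 0, 93484553304830579612351158481, 54), (1, 1, 904281731894248706235617038415231558105, 54), (1, 3,
   4121708247542377730485132903827670744540069, 54), (1, 5, 100030741932017838919294675629340205557, 54)])]"

definition self_neg_E8 :: "(nat \<times> nat) list" where
  "self_neg_E8 =
   [(11, 486136725344445373887880870366216911351505527058571), (13,
   23137533110505114143988461948841376813201744), (21, 918200857780210709446246945711022464275381068482), (22,
   241528678760539338348927825476015698262740136587725012), (26,
   248903630020760380043032013717481732922902303125906231), (32,
   8396073883666860937616490342192753191159939090846309628259), (34,
   2332698626897438594574584395981232632753333571764328843501229787633539159612640750), (38,
   131944646535542974763106476820571978048485544789167562387275641493966843179768991070), (39,
   6993358157928226716492540734287885238551644863044490704025950462364), (40,
   15713464498061774345262690964990701340909685512019341292444728094), (46,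
   7073110366595636417332325324695689195409824825007748395920887226871), (47,
   563965299916778642822057560055179901360814024233673980537099817671918932715009463894170618176209), (50,
   308265272632143175020876533742304434343471070324689400096036664281716624280939275), (51,
   230587494577498767844701385020652350486168601485219031), (54, 3502560555732784705590876470325793148749000),
   (56, 29887199587723477308648929075779291308874213323600163026355728), (57,
   32743155765184533927505759162433114647436597111866311296252827543587131564824337), (59,
   31242993665230820967619107054009620273031913519434686), (61,
   32618290650756565342663756640671856734295438122936659), (62,
   1708456627449181131258052762329297495155587870976816590611678417), (64, 1264916790808906491614733027), (66,
   4788)]"

definition odd_classes_E8 :: "nat list" where
  "odd_classes_E8 = [0,1,2,3,4,5,6,7,8,9,10,12,14,15,16,17,18,19,20,23,24,25,27,28,29,30,31,33,35,36,37,41,42,43,44,45,48,49,52,53,55,58,60,63,65]"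

abbreviation "refl_E8 \<equiv> perm_table 120 refl_table_E8"

abbreviation "root_E8 \<equiv> root_table_fun pos_roots_E8"

definition class_words_E8 :: "nat list list" where
  "class_words_E8 = map fst class_data_E8"

lemma upto_E8:
  "[0..<8] = [0, 1, 2, 3, 4, 5, 6, 7]"
  "[120..<128] = [120, 121, 122, 123, 124, 125, 126, 127]"
  by (simp_all add: upt_rec)

lemma cartan_entries_E8:
  assumes "i < 8" "j < 8"
  shows "(cartan_E 8) $$ (i, j) = cartan_rows_E8 ! i ! j"
proof -
  have "list_all (\<lambda>i. list_all (\<lambda>j. (cartan_E 8) $$ (i, j) = cartan_rows_E8 ! i ! j) [0..<8]) [0..<8]"
    by (simp add: upto_E8 cartan_E_def cartan_rows_E8_def doubleton_eq_iff)
  then show ?thesis using assms by (simp add: list_all_iff)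
qed

lemma cartan_E8: "cartan (cartan_E 8) 8 (\<lambda>i. [1,1,1,1,1,1,1,1] ! i)"
proof (rule cartan_of_cartan_ok[OF _ cartan_entries_E8])
  show "(cartan_E 8) \<in> carrier_mat 8 8" by (simp add: cartan_E_def)
  show "cartan_ok 8 cartan_rows_E8 [1,1,1,1,1,1,1,1] [(0, 2), (2, 3), (3, 1), (3, 4), (4, 5), (5, 6), (6, 7)]"
    by (simp add: cartan_ok_def upto_E8 cartan_rows_E8_def)
qed

lemmas refl_eval_E8 = perm_table_graphs[OF refl_table_E8_def, where P=120, unfolded table_unfold]

lemmas root_eval_E8 = root_table_graph[OF pos_roots_E8_def, unfolded table_unfold]

lemmas words_E8 = class_words_E8_def[unfolded class_data_E8_def list.map fst_conv]

lemmas words_eval_E8 = nth_graph[OF words_E8, unfolded table_unfold]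

lemma length_words_E8: "length class_words_E8 = 67"
  by (simp only: words_E8 length_eval nat_eval)

lemma table_ok_E8: "table_ok 8 120 cartan_rows_E8 pos_roots_E8 refl_table_E8"
proof (rule table_okI[OF pos_roots_E8_def refl_table_E8_def], goal_cases)
  case 1
  show ?case by (simp add: cartan_rows_E8_def upto_E8)
next
  case 2
  show ?case
    by (simp only: table_rules cartan_rows_E8_def root_eval_E8 cong: row_ok_cong)
qed

lemma root_table_E8: "root_table (cartan_E 8) 8 (\<lambda>i. [1,1,1,1,1,1,1,1] ! i) 120 root_E8 refl_E8"
  by (rule root_table_of_table_ok[OF cartan_E8 cartan_entries_E8 table_ok_E8])

lemma pm_list_E8: "pm_list 8 120 l \<longleftrightarrow> l = [0, 1, 2, 3, 4, 5, 6, 7] \<or> l = [120, 121, 122, 123, 124, 125, 126, 127]"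
  by (simp add: pm_list_def upto_E8)

lemma classes_ok_E8: "list_all (rep_ok refl_E8 8 120 class_words_E8) class_data_E8"
  unfolding class_data_E8_def
  by (simp only: eval_rules refl_eval_E8 words_eval_E8 length_words_E8 pm_list_E8 upto_E8 cong: if_weak_cong weak_congs)

lemma neg_one_E8: "acts_neg refl_E8 8 120 [7,6,5,4,3,2,1,3,4,5,6,0,2,3,4,5,1,3,4,2,3,0,2,1,3,4,5,6,7,6,5,4,3,2,1,3,4,5,6,0,2,3,4,5,1,3,4,2,3,0,2,1,3,4,5,6,7,6,5,4,3,2,1,3,4,5,6,0,2,3,4,5,1,3,4,2,3,0,2,1,3,4,5,6,0,2,3,4,5,1,3,4,2,3,0,2,1,3,4,5,1,3,4,2,3,0,2,1,3,4,2,3,0,2,1,3,0,2,1,0]"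
  by (simp only: eval_rules refl_eval_E8 upto_E8 cong: if_weak_cong weak_congs)

lemma self_neg_ok_E8: "list_all (self_conj_pair refl_E8 8 120 class_words_E8) self_neg_E8"
  unfolding self_neg_E8_def
  by (simp only: self_conj_pair.simps self_conj_def eval_rules refl_eval_E8 words_eval_E8 upto_E8 cong: if_weak_cong weak_congs self_conj_cong)

text \<open>The traces of the first seven powers already separate the 45 representatives and their
  negatives, so both root counts are left at zero.\<close>

definition inv_roots_E8 :: "nat list" where
  "inv_roots_E8 = []"

lemma invariants_E8: "map (\<lambda>k. word_inv refl_E8 root_E8 8 120 (Suc (Suc (Suc (Suc (Suc (Suc (Suc (0)))))))) inv_roots_E8 (class_words_E8 ! k)) odd_classes_E8 =
   [([8, 8, 8, 8, 8, 8, 8], 0, 0), ([6, 8, 6, 8, 6, 8, 6], 0, 0), ([4, 8, 4, 8, 4, 8, 4], 0, 0), ([5, 5, 8, 5,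
   5, 8, 5], 0, 0), ([3, 5, 6, 5, 3, 8, 3], 0, 0), ([2, 8, 2, 8, 2, 8, 2], 0, 0), ([4, 4, 4, 8, 4, 4, 4], 0,
   0), ([3, 3, 3, 3, 8, 3, 3], 0, 0), ([1, 5, 4, 5, 1, 8, 1], 0, 0), ([2, 4, 2, 8, 2, 4, 2], 0, 0), ([2, 2, 8,
   2, 2, 8, 2], 0, 0), ([3, 5, 0, 5, 3, 8, 3], 0, 0), ([4, 0, 4, 8, 4, 0, 4], 0, 0), ([2, 4, 2, 0, 2, 4, 2],
   0, 0), ([1, 3, 1, 3, 6, 3, 1], 0, 0), ([3, 1, 0, 5, 3, 4, 3], 0, 0), ([2, 2, 2, 2, 2, 8, 2], 0, 0), ([0, 2,
   6, 2, 0, 8, 0], 0, 0), ([-1, 5, 2, 5, -1, 8, -1], 0, 0), ([1, 1, 4, 5, 1, 4, 1], 0, 0), ([2, 0, 2, 8, 2, 0,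
   2], 0, 0), ([1, 3, 4, -1, 1, 0, 1], 0, 0), ([2, 2, -1, 2, 2, -1, 2], 0, 0), ([1, 3, 1, 3, -4, 3, 1], 0, 0),
   ([2, 0, 2, 0, 2, 0, 2], 0, 0), ([0, 0, 3, 0, 5, 3, 0], 0, 0), ([-1, 1, 2, 5, -1, 4, -1], 0, 0), ([1, 1, 1,
   1, 1, 1, 8], 0, 0), ([3, -1, 0, -1, 3, 8, 3], 0, 0), ([-2, 2, 4, 2, -2, 8, -2], 0, 0), ([-1, -1, 8, -1, -1,
   8, -1], 0, 0), ([1, -3, 4, 5, 1, 0, 1], 0, 0), ([0, 2, 3, 2, 0, -1, 0], 0, 0), ([-1, 3, 2, -1, -1, 0, -1],
   0, 0), ([-1, 1, -1, 1, -1, 1, 6], 0, 0), ([-1, 1, 2, -3, -1, 4, -1], 0, 0), ([-2, 0, 1, 0, 3, 3, -2], 0,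
   0), ([-1, -1, -1, 3, 4, -1, -1], 0, 0), ([1, -1, -2, -1, 1, 8, 1], 0, 0), ([3, -1, -6, -1, 3, 8, 3], 0, 0),
   ([-1, 1, 2, 1, 4, -2, -1], 0, 0), ([1, -1, 1, -1, 1, -1, 1], 0, 0), ([2, 0, -4, -4, 2, 0, 2], 0, 0), ([2,
   -2, 2, -2, -8, -2, 2], 0, 0), ([4, -4, -8, -4, 4, 8, 4], 0, 0)]"
  unfolding odd_classes_E8_def
  by (simp only: inv_rules inv_roots_E8_def refl_eval_E8 root_eval_E8 words_eval_E8 upto_E8 cong: if_weak_cong weak_congs)

lemma card_odd_E8: "card (odd_irr_chars (weyl_group (cartan_E 8)) (- 1\<^sub>m 8)) = 45"
proof -
  interpret root_table "(cartan_E 8)" 8 "\<lambda>i. [1,1,1,1,1,1,1,1] ! i" 120 root_E8 refl_E8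
    by (rule root_table_E8)
  have "card (odd_irr_chars (weyl_group (cartan_E 8)) (- 1\<^sub>m 8)) = length odd_classes_E8"
  proof (rule card_odd_irr_chars_data[OF class_words_E8_def classes_ok_E8 _ length_words_E8 neg_one_E8
        self_neg_ok_E8 _ _ _ _ _ invariants_E8])
    show "class_words_E8 ! 0 = []" by (simp only: words_eval_E8)
    show "list_all (\<lambda>k. k < 67) odd_classes_E8" by (simp add: odd_classes_E8_def)
    show "list_all (\<lambda>k. k \<in> set odd_classes_E8 \<or> k \<in> set (map fst self_neg_E8)) [0..<67]"
      by (simp add: odd_classes_E8_def self_neg_E8_def upt_rec)
    show "distinct inv_roots_E8" "set inv_roots_E8 \<subseteq> {..<2 * 120}" by (auto simp: inv_roots_E8_def)
    show "refl_E8 i r \<in> set inv_roots_E8" if "r \<in> set inv_roots_E8" for i r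
      using that by (simp add: inv_roots_E8_def)
  qed (simp_all add: neg_inv_def)
  then show ?thesis by (simp add: odd_classes_E8_def)
qed

section \<open>Type \<open>E\<^sub>6\<close>\<close>

definition cartan_rows_E6 :: "int list list" where
  "cartan_rows_E6 =
   [[2,0,-1,0,0,0], [0,2,0,-1,0,0], [-1,0,2,-1,0,0], [0,-1,-1,2,-1,0], [0,0,0,-1,2,-1], [0,0,0,0,-1,2]]"

lemma upto_E6: "[0..<6] = [0, 1, 2, 3, 4, 5]"
  by (simp add: upt_rec)

lemma cartan_entries_E6:
  assumes "i < 6" "j < 6"
  shows "(cartan_E 6) $$ (i, j) = cartan_rows_E6 ! i ! j"
proof -
  have "list_all (\<lambda>i. list_all (\<lambda>j. (cartan_E 6) $$ (i, j) = cartan_rows_E6 ! i ! j) [0..<6]) [0..<6]"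
    by (simp add: upto_E6 cartan_E_def cartan_rows_E6_def doubleton_eq_iff)
  then show ?thesis using assms by (simp add: list_all_iff)
qed

lemma cartan_E6: "cartan (cartan_E 6) 6 (\<lambda>i. [1,1,1,1,1,1] ! i)"
proof (rule cartan_of_cartan_ok[OF _ cartan_entries_E6])
  show "(cartan_E 6) \<in> carrier_mat 6 6" by (simp add: cartan_E_def)
  show "cartan_ok 6 cartan_rows_E6 [1,1,1,1,1,1] [(0, 2), (2, 3), (3, 1), (3, 4), (4, 5)]"
    by (simp add: cartan_ok_def upto_E6 cartan_rows_E6_def)
qed

text \<open>The vector spans the kernel of the Cartan matrix modulo \<open>3\<close>: modulo \<open>3\<close> it is fixed by the Weyl
  group, whereas \<open>-1\<close> moves it.\<close>

lemma center_E6: "center (weyl_group (cartan_E 6)) = {\<one>\<^bsub>weyl_group (cartan_E 6)\<^esub>}"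
proof -
  define l :: "int list" where "l = [1, 0, - 1, 0, 1, - 1]"
  interpret cartan "cartan_E 6" 6 "\<lambda>i. [1,1,1,1,1,1] ! i" by (rule cartan_E6)
  show ?thesis
  proof (rule center_trivial[of "vec_of_list l" 3 0])
    fix i :: nat assume i: "i < 6"
    have "length l = 6" by (simp add: l_def)
    then have "row (cartan_E 6) i \<bullet> vec_of_list l = (\<Sum>j<6. cartan_rows_E6 ! i ! j * l ! j)"
      using i A by (auto simp: scalar_prod_def vec_of_list_index cartan_entries_E6 atLeast0LessThan intro!: sum.cong)
    also have "\<dots> = (\<Sum>j\<leftarrow>[0..<6]. cartan_rows_E6 ! i ! j * l ! j)"
      by (simp only: interv_sum_list_conv_sum_set_nat set_upt atLeast0LessThan)
    also have "3 dvd \<dots>"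
    proof -
      have "list_all (\<lambda>i. 3 dvd (\<Sum>j\<leftarrow>[0..<6]. cartan_rows_E6 ! i ! j * l ! j)) [0..<6]"
        by (simp add: upto_E6 cartan_rows_E6_def l_def)
      then show ?thesis using i unfolding list_all_iff by auto
    qed
    finally show "3 dvd row (cartan_E 6) i \<bullet> vec_of_list l" .
  qed (auto simp: l_def vec_of_list_index intro!: carrier_vecI)
qed

text \<open>A class in the support would consist of the identity, which acts trivially on every
  representation, against \<open>central_quantum_linear_action\<close>.\<close>

lemma no_central_quantum_linear_E6:
  assumes "central_quantum_linear (weyl_group (cartan_E 6)) scale R"
  shows "ram_support (weyl_group (cartan_E 6)) R = {}"
proof -
  interpret cartan "cartan_E 6" 6 "\<lambda>i. [1,1,1,1,1,1] ! i" by (rule cartan_E6)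
  have "False" if C: "C \<in> ram_support G R" for C
  proof (rule central_quantum_linear_action[OF G_group center_square assms C])
    fix x assume "x \<in> center G" and "idx R C \<noteq> {}"
      and irr: "\<And>i. i \<in> idx R C \<Longrightarrow> irreducible_rep scale G (spc R C i) (ract R C i)"
      and "\<And>i. i \<in> idx R C \<Longrightarrow> \<not> (\<forall>v\<in>spc R C i. ract R C i v x = v)"
    moreover have "x = \<one>\<^bsub>G\<^esub>" using \<open>x \<in> center G\<close> unfolding center_E6 by simp
    ultimately show False unfolding irreducible_rep_def right_rep_def by blast
  qed
  then show ?thesis by blast
qed

section \<open>The classification\<close>

theorem theorem2:
  fixes G :: "int mat monoid"
    and scale :: "complex \<Rightarrow> 'v::ab_group_add \<Rightarrow> 'v"
    and R :: "(int mat, 'v, 'i, 'j, 't) rsr"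
  assumes "G \<in> {weyl_group (cartan_E 6), weyl_group (cartan_E 7), weyl_group (cartan_E 8),
                weyl_group cartan_F4, weyl_group cartan_G2}"
    and "central_quantum_linear G scale R"
    and "ram_support G R \<noteq> {}"
  shows
    "(G = weyl_group (cartan_E 7) \<and>
       (\<exists>z. center G - {\<one>\<^bsub>G\<^esub>} = {z} \<and> ram_support G R = {{z}} \<and>
          card (odd_irr_chars G z) = 30 \<and>
          (\<forall>i \<in> idx R {z}. rsr_character G scale R {z} i \<in> odd_irr_chars G z))) \<or>
     (G = weyl_group (cartan_E 8) \<and>
       (\<exists>z. center G - {\<one>\<^bsub>G\<^esub>} = {z} \<and> ram_support G R = {{z}} \<and>
          card (odd_irr_chars G z) = 45 \<and>
          (\<forall>i \<in> idx R {z}. rsr_character G scale R {z} i \<in> odd_irr_chars G z))) \<or>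
     (G = weyl_group cartan_F4 \<and>
       (\<exists>z. center G - {\<one>\<^bsub>G\<^esub>} = {z} \<and> ram_support G R = {{z}} \<and>
          card (odd_irr_chars G z) = 9 \<and>
          (\<forall>i \<in> idx R {z}. rsr_character G scale R {z} i \<in> odd_irr_chars G z))) \<or>
     (G = weyl_group cartan_G2 \<and>
       (\<exists>z. center G - {\<one>\<^bsub>G\<^esub>} = {z} \<and> ram_support G R = {{z}} \<and>
          card (odd_irr_chars G z) = 3 \<and>
          (\<forall>i \<in> idx R {z}. rsr_character G scale R {z} i \<in> odd_irr_chars G z)))"
proof -
  note cql_types = root_table.central_quantum_linear_type[OF root_table_E7 neg_one_E7 card_odd_E7, of scale R]
    root_table.central_quantum_linear_type[OF root_table_E8 neg_one_E8 card_odd_E8, of scale R]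
    root_table.central_quantum_linear_type[OF root_table_F4 neg_one_F4 card_odd_F4, of scale R]
    root_table.central_quantum_linear_type[OF root_table_G2 neg_one_G2 card_odd_G2, of scale R]
  show ?thesis
    using assms(1)
  proof (elim insertE emptyE)
    assume "G = weyl_group (cartan_E 6)"
    then show ?thesis using no_central_quantum_linear_E6 assms(2,3) by blast
  qed (use assms(2,3) cql_types in simp_all)
qed

end
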